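(* Let $\mathbf u_0^\epsilon,\mathbf v_0^\epsilon\in\mathbb H^1_\Delta$. Let $\mathbf u^\epsilon$ and $\mathbf v^\epsilon$ be the global strong solutions of the $\epsilon$-LLBE associated with the initial data $\mathbf u_0^\epsilon$ and $\mathbf v_0^\epsilon$, respectively, as conferred by the existence theorem recalled in the context. Then $$\|\mathbf u^\epsilon-\mathbf v^\epsilon\|_{L^\infty_T(\mathbb H^1)}\le C\,\|\mathbf u_0^\epsilon-\mathbf v_0^\epsilon\|_{\mathbb H^1_\Delta},$$ where the constant $C$ may depend on $\epsilon$ and $T$. This implies uniqueness of the solution $\mathbf u^\epsilon$.
   Context: Domain: $d\in\{1,2,3\}$ and $\mathscr D\subset\mathbb R^d$ is a bounded polytopal domain (a bounded interval if $d=1$, a polygon, possibly non-convex, if $d=2$, a convex polyhedron if $d=3$). If $\mathscr D$ is non-convex ($d=2$), it has exactly one re-entrant corner, of angle $\omega\in(\pi,2\pi)$, and $\alpha_0:=\pi/\omega\in(\tfrac12,1)$. An exponent $\alpha$ is admissible if $\tfrac12<\alpha<\alpha_0$ when $\mathscr D$ is non-convex, and $\alpha=1$ when $\mathscr D$ is convex. Spaces: $\mathbb L^p,\mathbb H^s$ are the Lebesgue and (fractional) Sobolev spaces of $\mathbb R^3$-valued functions on $\mathscr D$. $\mathbb H^1_\Delta:=\{\mathbf v\in\mathbb H^1:\Delta\mathbf v\in\mathbb L^2\}$ with norm $\|\mathbf v\|_{\mathbb H^1}+\|\Delta\mathbf v\|_{\mathbb L^2}$. $L^q_T(X)=L^q(0,T;X)$,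 $W^{1,q}_T(X)=W^{1,q}(0,T;X)$, $H^1_T=W^{1,2}_T$. $\langle\mathbf u\times\nabla\mathbf v,\nabla\mathbf w\rangle_{\mathbb L^2}=\sum_{j=1}^d\int_{\mathscr D}(\mathbf u\times\partial_j\mathbf v)\cdot\partial_j\mathbf w\,dx$. $\epsilon$-LLBE (regularised Landau--Lifshitz--Bloch equation): with $T>0$ given and arbitrarily large, $\epsilon\in(0,1)$, constants $\kappa_1,\kappa_2,\mu>0$ and a real constant $\gamma$ (of either sign): $\partial_t\mathbf u^\epsilon-\epsilon\Delta\partial_t\mathbf u^\epsilon=\kappa_1\Delta\mathbf u^\epsilon+\gamma\,\mathbf u^\epsilon\times\Delta\mathbf u^\epsilon-\kappa_2(1+\mu|\mathbf u^\epsilon|^2)\mathbf u^\epsilon$ in $(0,T)\times\mathscr D$, $\mathbf u^\epsilon(0)=\mathbf u_0^\epsilon$, $\partial\mathbf u^\epsilon/\partial\boldsymbol\nu=0$ on $\partial\mathscr D$. Weak solution on $[0,T]$: for admissible $\alpha$, $\mathbf u^\epsilon\in H^1_T(\mathbb H^1)\cap L^2_T(\mathbb H^{1+\alpha})$ such that for all $t\in(0,T)$ and $\mathbf v\in\mathbb H^1$ $$\langle\mathbf u^\epsilon(t),\mathbf v\rangle_{\mathbb L^2}+\epsilon\langle\nabla\mathbf u^\epsilon(t),\nabla\mathbf v\rangle_{\mathbb L^2}+\kappa_1\!\int_0^t\!\langle\nabla\mathbf u^\epsilon,\nabla\mathbf v\rangle_{\mathbb L^2}ds+\gamma\!\int_0^t\!\langle\mathbf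 u^\epsilon\times\nabla\mathbf u^\epsilon,\nabla\mathbf v\rangle_{\mathbb L^2}ds+\kappa_2\!\int_0^t\!\langle(1+\mu|\mathbf u^\epsilon|^2)\mathbf u^\epsilon,\mathbf v\rangle_{\mathbb L^2}ds=\langle\mathbf u_0^\epsilon,\mathbf v\rangle_{\mathbb L^2}+\epsilon\langle\nabla\mathbf u_0^\epsilon,\nabla\mathbf v\rangle_{\mathbb L^2}.$$ Strong solution: a weak solution with $\mathbf u^\epsilon\in W^{1,\infty}_T(\mathbb H^1)\cap H^1_T(\mathbb H^1_\Delta)$. "Global" means existing for any given positive time $T$. Existence theorem referred to: let $\mathcal S_n$ be the span of the first $n$ elements of an orthonormal basis of $\mathbb L^2$ of eigenfunctions of the negative Neumann Laplacian. If $\mathbf u_0^\epsilon\to\mathbf u_0$ in $\mathbb H^1_\Delta$ as $\epsilon\to0^+$ and there are $\mathbf u_{0,n}^\epsilon\in\mathcal S_n$ with $\mathbf u_{0,n}^\epsilon\to\mathbf u_0^\epsilon$ in $\mathbb H^1_\Delta$ as $n\to\infty$, uniformly in $\epsilon\in(0,1)$, then there exists a global strong solution $\mathbf u^\epsilon$ of the $\epsilon$-LLBE (a limit of Faedo--Galerkin approximations with values in $\mathcal S_n$ and initial data $\mathbf u_{0,n}^\epsilon$), and for any admissible $\alpha$ there is a constant $c$ independent of $\epsilon$ such that, with $\beta=\min\{2,d\}$, the quantities $\|\mathbf u^\epsilon\|_{L^\infty_T(\mathbb H^1)}$, $\|\mathbf u^\epsilon\|_{L^2_T(\mathbb H^{1+\alpha})}$,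 $\sqrt\epsilon\|\mathbf u^\epsilon\|_{L^\infty_T(\mathbb H^{1+\alpha})}$, $\sqrt\epsilon\|\mathbf u^\epsilon\|_{L^\infty_T(\mathbb H^1_\Delta)}$, $\epsilon^{(\beta+1)/2}\|\partial_t\mathbf u^\epsilon\|_{L^\infty_T(\mathbb H^1)}$, $\epsilon^{(\beta+2)/2}\|\partial_t\mathbf u^\epsilon\|_{L^\infty_T(\mathbb H^{1+\alpha})}$ and $\epsilon^{(\beta+2)/2}\|\partial_t\mathbf u^\epsilon\|_{L^\infty_T(\mathbb H^1_\Delta)}$ are all at most $c$. *)

theory Defs
  imports "HOL-Analysis.Analysis" "HOL-Analysis.Cross3" "HOL-Probability.Essential_Supremum"
begin

text \<open>
  Near \<open>p\<close> the set \<open>D\<close> is an open plane sector with vertex \<open>p\<close> and opening angle \<open>\<omega>\<close>.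
  A boundary point with \<open>\<omega> = pi\<close> lies in the relative interior of an edge; a boundary point
  with \<open>\<omega> > pi\<close> is a re-entrant corner.
\<close>

definition sector_at :: "'a::euclidean_space set \<Rightarrow> 'a \<Rightarrow> real \<Rightarrow> bool" where
  "sector_at D p \<omega> \<longleftrightarrow> 0 < \<omega> \<and> \<omega> < 2 * pi \<and>
     (\<exists>r>0. \<exists>e f. norm e = 1 \<and> norm f = 1 \<and> e \<bullet> f = 0 \<and>
        D \<inter> ball p r =
          {p + \<rho> *\<^sub>R (cos \<theta> *\<^sub>R e + sin \<theta> *\<^sub>R f) | \<rho> \<theta>. 0 < \<rho> \<and> \<rho> < r \<and> 0 < \<theta> \<and> \<theta> < \<omega>})"

text \<open>
  By compactness of the boundary only finitely many boundary points of such a set have an angle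
  different from \<open>pi\<close>, so the boundary consists of finitely many line segments. Slits are
  excluded because the angles are smaller than \<open>2 * pi\<close>.
\<close>

definition polygonal :: "'a::euclidean_space set \<Rightarrow> bool" where
  "polygonal D \<longleftrightarrow> DIM('a) = 2 \<and> open D \<and> connected D \<and> bounded D \<and> D \<noteq> {} \<and>
     (\<forall>p \<in> frontier D. \<exists>\<omega>. sector_at D p \<omega>)"

definition reentrant_corner :: "'a::euclidean_space set \<Rightarrow> 'a \<Rightarrow> real \<Rightarrow> bool" where
  "reentrant_corner D p \<omega> \<longleftrightarrow> p \<in> frontier D \<and> sector_at D p \<omega> \<and> pi < \<omega>"

text \<open>
  In dimension one the first alternative is a bounded open interval, in dimension two it is a
  convex polygon.
\<close>

definition polytopal_domain :: "'a::euclidean_space set \<Rightarrow> bool" where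
  "polytopal_domain D \<longleftrightarrow> DIM('a) \<in> {1, 2, 3} \<and>
     ((\<exists>P. polytope P \<and> D = interior P \<and> D \<noteq> {}) \<or>
      (polygonal D \<and> \<not> convex D \<and> (\<exists>!p. \<exists>\<omega>. reentrant_corner D p \<omega>)))"

definition admissible :: "'a::euclidean_space set \<Rightarrow> real \<Rightarrow> bool" where
  "admissible D \<alpha> \<longleftrightarrow>
     (if convex D then \<alpha> = 1
      else 1/2 < \<alpha> \<and> (\<exists>p \<omega>. reentrant_corner D p \<omega> \<and> \<alpha> < pi / \<omega>))"

definition pdiff :: "'a::euclidean_space \<Rightarrow> ('a \<Rightarrow> real) \<Rightarrow> 'a \<Rightarrow> real" where
  "pdiff b f x = frechet_derivative f (at x) b"

fun Ck :: "nat \<Rightarrow> ('a::euclidean_space \<Rightarrow> real) \<Rightarrow> bool" where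
  "Ck 0 f \<longleftrightarrow> continuous_on UNIV f"
| "Ck (Suc k) f \<longleftrightarrow> f differentiable_on UNIV \<and> (\<forall>b\<in>Basis. Ck k (pdiff b f))"

definition test_functions :: "'a::euclidean_space set \<Rightarrow> ('a \<Rightarrow> real) set" where
  "test_functions S = {\<phi>. (\<forall>k. Ck k \<phi>) \<and>
     compact (closure {x. \<phi> x \<noteq> 0}) \<and> closure {x. \<phi> x \<noteq> 0} \<subseteq> S}"

text \<open>
  A function space is represented by its extended norm \<open>N\<close>: the elements of the space are the
  functions \<open>f\<close> with \<open>N f < \<infinity>\<close>. All these norms are invariant under modification of \<open>f\<close> on a
  null set of \<open>D\<close>.
\<close>

definition esqrt :: "ennreal \<Rightarrow> ennreal" where
  "esqrt x = (if x = \<infinity> then \<infinity> else ennreal (sqrt (enn2real x)))"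

definition L2 :: "'a::euclidean_space set \<Rightarrow> ('a \<Rightarrow> 'b::euclidean_space) \<Rightarrow> ennreal" where
  "L2 D f = (if f \<in> borel_measurable (lebesgue_on D)
             then esqrt (\<integral>\<^sup>+x. ennreal ((norm (f x))\<^sup>2) \<partial>lebesgue_on D) else \<infinity>)"

definition weak_pdiff ::
  "'a::euclidean_space set \<Rightarrow> 'a \<Rightarrow> ('a \<Rightarrow> 'b::euclidean_space) \<Rightarrow> ('a \<Rightarrow> 'b) \<Rightarrow> bool" where
  "weak_pdiff D b f g \<longleftrightarrow> L2 D f < \<infinity> \<and> L2 D g < \<infinity> \<and>
     (\<forall>\<phi>\<in>test_functions D.
        (\<integral>x. pdiff b \<phi> x *\<^sub>R f x \<partial>lebesgue_on D) = - (\<integral>x. \<phi> x *\<^sub>R g x \<partial>lebesgue_on D))"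

definition wpd :: "'a::euclidean_space set \<Rightarrow> 'a \<Rightarrow> ('a \<Rightarrow> 'b::euclidean_space) \<Rightarrow> 'a \<Rightarrow> 'b" where
  "wpd D b f = (SOME g. weak_pdiff D b f g)"

definition weak_laplacian ::
  "'a::euclidean_space set \<Rightarrow> ('a \<Rightarrow> 'b::euclidean_space) \<Rightarrow> ('a \<Rightarrow> 'b) \<Rightarrow> bool" where
  "weak_laplacian D f g \<longleftrightarrow> L2 D f < \<infinity> \<and> L2 D g < \<infinity> \<and>
     (\<forall>\<phi>\<in>test_functions D.
        (\<integral>x. (\<Sum>b\<in>Basis. pdiff b (pdiff b \<phi>) x) *\<^sub>R f x \<partial>lebesgue_on D)
          = (\<integral>x. \<phi> x *\<^sub>R g x \<partial>lebesgue_on D))"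

definition wlap :: "'a::euclidean_space set \<Rightarrow> ('a \<Rightarrow> 'b::euclidean_space) \<Rightarrow> 'a \<Rightarrow> 'b" where
  "wlap D f = (SOME g. weak_laplacian D f g)"

definition H1 :: "'a::euclidean_space set \<Rightarrow> ('a \<Rightarrow> 'b::euclidean_space) \<Rightarrow> ennreal" where
  "H1 D f = (if \<forall>b\<in>Basis. \<exists>g. weak_pdiff D b f g
             then esqrt ((L2 D f)\<^sup>2 + (\<Sum>b\<in>Basis. (L2 D (wpd D b f))\<^sup>2)) else \<infinity>)"

definition H1Lap :: "'a::euclidean_space set \<Rightarrow> ('a \<Rightarrow> 'b::euclidean_space) \<Rightarrow> ennreal" where
  "H1Lap D f = (if \<exists>g. weak_laplacian D f g then H1 D f + L2 D (wlap D f) else \<infinity>)"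

text \<open>Sobolev--Slobodeckij norms of order \<open>s\<close> in the interval \<open>(0,1]\<close>, and of order \<open>1 + s\<close>.\<close>

definition Hfrac :: "'a::euclidean_space set \<Rightarrow> real \<Rightarrow> ('a \<Rightarrow> 'b::euclidean_space) \<Rightarrow> ennreal" where
  "Hfrac D s f = (if s = 1 then H1 D f else
     esqrt ((L2 D f)\<^sup>2 +
       (\<integral>\<^sup>+x. (\<integral>\<^sup>+y. ennreal ((norm (f x - f y))\<^sup>2 / norm (x - y) powr (real DIM('a) + 2 * s))
          \<partial>lebesgue_on D) \<partial>lebesgue_on D)))"

definition H1plus :: "'a::euclidean_space set \<Rightarrow> real \<Rightarrow> ('a \<Rightarrow> 'b::euclidean_space) \<Rightarrow> ennreal" where
  "H1plus D s f = (if H1 D f < \<infinity>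
     then esqrt ((L2 D f)\<^sup>2 + (\<Sum>b\<in>Basis. (Hfrac D s (wpd D b f))\<^sup>2)) else \<infinity>)"

abbreviation time :: "real \<Rightarrow> real measure" where
  "time T \<equiv> lebesgue_on {0<..<T}"

definition simple_in ::
  "real \<Rightarrow> (('a \<Rightarrow> 'b) \<Rightarrow> ennreal) \<Rightarrow> (real \<Rightarrow> 'a \<Rightarrow> 'b) \<Rightarrow> bool" where
  "simple_in T N s \<longleftrightarrow> simple_function (time T) s \<and> (\<forall>t\<in>{0<..<T}. N (s t) < \<infinity>)"

definition simple_integral_in :: "real \<Rightarrow> (real \<Rightarrow> 'a \<Rightarrow> 'b::real_vector) \<Rightarrow> 'a \<Rightarrow> 'b" where
  "simple_integral_in T s =
     (\<lambda>x. \<Sum>y\<in>s ` {0<..<T}. measure (time T) {t\<in>{0<..<T}. s t = y} *\<^sub>R y x)"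

definition strongly_measurable ::
  "real \<Rightarrow> (('a \<Rightarrow> 'b::real_vector) \<Rightarrow> ennreal) \<Rightarrow> (real \<Rightarrow> 'a \<Rightarrow> 'b) \<Rightarrow> bool" where
  "strongly_measurable T N u \<longleftrightarrow>
     (\<exists>s. (\<forall>n. simple_in T N (s n)) \<and>
          (AE t in time T. (\<lambda>n::nat. N (\<lambda>x. s n t x - u t x)) \<longlonglongrightarrow> 0))"

definition has_bochner_integral_in ::
  "real \<Rightarrow> (('a \<Rightarrow> 'b::real_vector) \<Rightarrow> ennreal) \<Rightarrow> (real \<Rightarrow> 'a \<Rightarrow> 'b) \<Rightarrow> ('a \<Rightarrow> 'b) \<Rightarrow> bool" where
  "has_bochner_integral_in T N u y \<longleftrightarrow> strongly_measurable T N u \<and>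
     (\<exists>s. (\<forall>n. simple_in T N (s n)) \<and>
          (\<lambda>n::nat. \<integral>\<^sup>+t. N (\<lambda>x. s n t x - u t x) \<partial>time T) \<longlonglongrightarrow> 0 \<and>
          (\<lambda>n. N (\<lambda>x. simple_integral_in T (s n) x - y x)) \<longlonglongrightarrow> 0)"

definition L2T ::
  "real \<Rightarrow> (('a \<Rightarrow> 'b::real_vector) \<Rightarrow> ennreal) \<Rightarrow> (real \<Rightarrow> 'a \<Rightarrow> 'b) \<Rightarrow> ennreal" where
  "L2T T N u = (if strongly_measurable T N u then esqrt (\<integral>\<^sup>+t. (N (u t))\<^sup>2 \<partial>time T) else \<infinity>)"

definition LinfT ::
  "real \<Rightarrow> (('a \<Rightarrow> 'b::real_vector) \<Rightarrow> ennreal) \<Rightarrow> (real \<Rightarrow> 'a \<Rightarrow> 'b) \<Rightarrow> ennreal" where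
  "LinfT T N u = (if strongly_measurable T N u then esssup (time T) (\<lambda>t. N (u t)) else \<infinity>)"

definition weak_tderiv ::
  "real \<Rightarrow> (('a \<Rightarrow> 'b::real_vector) \<Rightarrow> ennreal) \<Rightarrow> (real \<Rightarrow> 'a \<Rightarrow> 'b) \<Rightarrow> (real \<Rightarrow> 'a \<Rightarrow> 'b) \<Rightarrow> bool" where
  "weak_tderiv T N u g \<longleftrightarrow>
     (\<forall>\<phi>\<in>test_functions {0<..<T}. \<exists>y.
        has_bochner_integral_in T N (\<lambda>t x. pdiff 1 \<phi> t *\<^sub>R u t x) y \<and>
        has_bochner_integral_in T N (\<lambda>t x. \<phi> t *\<^sub>R g t x) (\<lambda>x. - y x))"

definition in_H1T ::
  "real \<Rightarrow> (('a \<Rightarrow> 'b::real_vector) \<Rightarrow> ennreal) \<Rightarrow> (real \<Rightarrow> 'a \<Rightarrow> 'b) \<Rightarrow> bool" where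
  "in_H1T T N u \<longleftrightarrow> L2T T N u < \<infinity> \<and> (\<exists>g. L2T T N g < \<infinity> \<and> weak_tderiv T N u g)"

definition in_W1infT ::
  "real \<Rightarrow> (('a \<Rightarrow> 'b::real_vector) \<Rightarrow> ennreal) \<Rightarrow> (real \<Rightarrow> 'a \<Rightarrow> 'b) \<Rightarrow> bool" where
  "in_W1infT T N u \<longleftrightarrow> LinfT T N u < \<infinity> \<and> (\<exists>g. LinfT T N g < \<infinity> \<and> weak_tderiv T N u g)"

definition inner_L2 ::
  "'a::euclidean_space set \<Rightarrow> ('a \<Rightarrow> 'b::euclidean_space) \<Rightarrow> ('a \<Rightarrow> 'b) \<Rightarrow> real" where
  "inner_L2 D f g = (\<integral>x. f x \<bullet> g x \<partial>lebesgue_on D)"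

definition inner_grad ::
  "'a::euclidean_space set \<Rightarrow> ('a \<Rightarrow> 'b::euclidean_space) \<Rightarrow> ('a \<Rightarrow> 'b) \<Rightarrow> real" where
  "inner_grad D f g = (\<Sum>b\<in>Basis. inner_L2 D (wpd D b f) (wpd D b g))"

definition inner_cross_grad ::
  "'a::euclidean_space set \<Rightarrow> ('a \<Rightarrow> real^3) \<Rightarrow> ('a \<Rightarrow> real^3) \<Rightarrow> ('a \<Rightarrow> real^3) \<Rightarrow> real" where
  "inner_cross_grad D f g h =
     (\<Sum>b\<in>Basis. inner_L2 D (\<lambda>x. cross3 (f x) (wpd D b g x)) (wpd D b h))"

text \<open>
  The weak formulation is imposed at every time \<open>t\<close>; together with \<open>u t \<in> H1\<close> for every \<open>t\<close>,
  this selects the continuous representative of \<open>u\<close> with respect to time. The initial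
  condition and the homogeneous Neumann condition enter only through the weak formulation.
\<close>

definition weak_solution ::
  "'a::euclidean_space set \<Rightarrow> real \<Rightarrow> real \<Rightarrow> real \<Rightarrow> real \<Rightarrow> real \<Rightarrow> real \<Rightarrow> real \<Rightarrow>
   ('a \<Rightarrow> real^3) \<Rightarrow> (real \<Rightarrow> 'a \<Rightarrow> real^3) \<Rightarrow> bool" where
  "weak_solution D \<alpha> \<kappa>\<^sub>1 \<kappa>\<^sub>2 \<mu> \<gamma> \<epsilon> T u0 u \<longleftrightarrow>
     in_H1T T (H1 D) u \<and> L2T T (H1plus D \<alpha>) u < \<infinity> \<and>
     (\<forall>t\<in>{0<..<T}. H1 D (u t) < \<infinity> \<and>
       (\<forall>v. H1 D v < \<infinity> \<longrightarrow>
          inner_L2 D (u t) v + \<epsilon> * inner_grad D (u t) v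
          + \<kappa>\<^sub>1 * (\<integral>s. inner_grad D (u s) v \<partial>time t)
          + \<gamma> * (\<integral>s. inner_cross_grad D (u s) (u s) v \<partial>time t)
          + \<kappa>\<^sub>2 * (\<integral>s. inner_L2 D (\<lambda>x. (1 + \<mu> * (norm (u s x))\<^sup>2) *\<^sub>R u s x) v \<partial>time t)
          = inner_L2 D u0 v + \<epsilon> * inner_grad D u0 v))"

definition strong_solution ::
  "'a::euclidean_space set \<Rightarrow> real \<Rightarrow> real \<Rightarrow> real \<Rightarrow> real \<Rightarrow> real \<Rightarrow> real \<Rightarrow> real \<Rightarrow>
   ('a \<Rightarrow> real^3) \<Rightarrow> (real \<Rightarrow> 'a \<Rightarrow> real^3) \<Rightarrow> bool" where
  "strong_solution D \<alpha> \<kappa>\<^sub>1 \<kappa>\<^sub>2 \<mu> \<gamma> \<epsilon> T u0 u \<longleftrightarrow>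
     weak_solution D \<alpha> \<kappa>\<^sub>1 \<kappa>\<^sub>2 \<mu> \<gamma> \<epsilon> T u0 u \<and> in_W1infT T (H1 D) u \<and> in_H1T T (H1Lap D) u"

text \<open>
  \<open>c\<close> is the common constant of the a priori estimates that accompany the existence of strong
  solutions; \<open>u'\<close> is the time derivative of \<open>u\<close>, unique up to null sets.
\<close>

definition solution_bounds ::
  "'a::euclidean_space set \<Rightarrow> real \<Rightarrow> real \<Rightarrow> real \<Rightarrow> real \<Rightarrow> (real \<Rightarrow> 'a \<Rightarrow> real^3) \<Rightarrow> bool" where
  "solution_bounds D \<alpha> \<epsilon> T c u \<longleftrightarrow>
     (let \<beta> = real (min 2 DIM('a)) in
        LinfT T (H1 D) u \<le> ennreal c \<and>
        L2T T (H1plus D \<alpha>) u \<le> ennreal c \<and>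
        ennreal (sqrt \<epsilon>) * LinfT T (H1plus D \<alpha>) u \<le> ennreal c \<and>
        ennreal (sqrt \<epsilon>) * LinfT T (H1Lap D) u \<le> ennreal c \<and>
        (\<exists>u'. weak_tderiv T (H1 D) u u' \<and>
           ennreal (\<epsilon> powr ((\<beta> + 1) / 2)) * LinfT T (H1 D) u' \<le> ennreal c \<and>
           ennreal (\<epsilon> powr ((\<beta> + 2) / 2)) * LinfT T (H1plus D \<alpha>) u' \<le> ennreal c \<and>
           ennreal (\<epsilon> powr ((\<beta> + 2) / 2)) * LinfT T (H1Lap D) u' \<le> ennreal c))"

end

theory Submission
  imports Defs "HOL-Probability.Probability_Measure"
begin

text \<open>
  Write \<open>w = u - v\<close> and test the difference of the two weak formulations at time \<open>t\<close> with the
  function \<open>w t\<close>; no time derivative is involved. The three time integrands are locally Lipschitz: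
  the differences are bounded by
  \<open>C (1 + N(u s)^2 + N(v s)^2) |w s| |w t|\<close>, where \<open>|.|\<close> is the norm of \<open>H1\<close> and \<open>N\<close> that of
  \<open>H1plus\<close>. Dividing by \<open>|w t|\<close> leaves an integral inequality for \<open>|w t|\<close> whose kernel is
  integrable, since \<open>u\<close> and \<open>v\<close> are square integrable in time with values in \<open>H1plus\<close>, and
  Gronwall's inequality applies.

  The Lipschitz bounds rest on two embeddings: functions in \<open>H1\<close> and in the fractional space of
  order \<open>\<alpha>\<close> are in \<open>L^4\<close>, and functions with gradient in \<open>L^4\<close> are bounded because the dimension
  is at most three. The domain is a finite union of bounded convex open sets, so it suffices to prove
  them on such a set \<open>E\<close>. There a function is compared with its averages over the contracted
  copies \<open>x + l (E - x)\<close> of \<open>E\<close>, after its Slobodeckij seminorm has been bounded by the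
  gradient through \<open>g (x + h) - g x = \<integral> \<nabla>g (x + t h) h dt\<close>, which follows from the definition of weak
  derivatives by duality.
\<close>

section \<open>Test functions and the fundamental lemma of the calculus of variations\<close>

text \<open>The regularisation makes the test with \<open>w t\<close> close: \<open>inner_L2\<close>
  plus \<epsilon> times \<open>inner_grad\<close> dominates min 1 \<epsilon> times the squared H1
  norm at each single time, hence the dependence of the constant on \<epsilon>. The price is that
  the test function is frozen at time t while the integrands run over s, so no time integral has a
  sign and the diffusion term is estimated like the other two. The cross product decides which
  embeddings are needed: its difference is f x grad w + w x grad g with w known only in H1, so f
  must be bounded, and w and grad g must be in L^4. Order s embeds into L^4 as soon as d <= 4 s;
  this covers \<alpha> > 1/2 in a non-convex polygon, and s = 3/4, an order that the gradient
  controls, for all d <= 3. Convexity of the pieces keeps segments and contracted copies inside; a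
  re-entrant corner is a union of two half-discs. In time the kernel is merely integrable and the
  norm of \<open>w t\<close> is known to be bounded almost everywhere, so the Gronwall argument
  proceeds by levels of the primitive of the kernel.\<close>

definition flat :: "real \<Rightarrow> real" where
  "flat x = (if 0 < x then exp (- 1 / x) else 0)"

lemma poly_exp_inverse_tendsto_0:
  "((\<lambda>x::real. poly p (1 / x) * exp (- 1 / x)) \<longlongrightarrow> 0) (at_right 0)"
proof -
  have 1: "((\<lambda>z. coeff p i * (z ^ i / exp z)) \<longlongrightarrow> 0) at_top" for i
    using tendsto_mult_right_zero[OF tendsto_power_div_exp_0[of i]] by blast
  have "((\<lambda>z. \<Sum>i\<le>degree p. coeff p i * (z ^ i / exp z)) \<longlongrightarrow> (\<Sum>i\<le>degree p. 0)) at_top"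
    by (intro tendsto_sum 1)
  then have "((\<lambda>z. poly p z * exp (- z)) \<longlongrightarrow> 0) at_top"
    by (simp add: poly_altdef sum_distrib_right exp_minus divide_inverse mult.assoc)
  from filterlim_compose[OF this filterlim_inverse_at_top_right]
  show ?thesis by (simp add: field_simps)
qed

text \<open>The existential provides a whole sequence of successive derivatives, the form that the
  induction in \<open>Ck_ridge\<close> consumes.\<close>

lemma flat_derivatives:
  "\<exists>F. F 0 = flat \<and> (\<forall>n x. (F n has_real_derivative F (Suc n) x) (at x))"
proof -
  \<comment> \<open>For x > 0 the n-th derivative is q_n(1/x) exp(-1/x); differentiating once more
    replaces the polynomial p by z^2 (p - p').\<close>
  define q :: "nat \<Rightarrow> real poly" where "q n = ((\<lambda>p. [:0, 0, 1:] * (p - pderiv p)) ^^ n) 1" for n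
  define F where "F n x = (if 0 < x then poly (q n) (1 / x) * exp (- 1 / x) else 0)" for n and x :: real
  have qS: "q (Suc n) = [:0, 0, 1:] * (q n - pderiv (q n))" for n
    by (simp add: q_def)
  have "(F n has_real_derivative F (Suc n) x) (at x)" for n x
  proof -
    consider "x > 0" | "x < 0" | "x = 0" by linarith
    then show ?thesis
    proof cases
      case 1
      have "((\<lambda>x. poly (q n) (1 / x) * exp (- 1 / x)) has_real_derivative F (Suc n) x) (at x)"
        using 1 unfolding F_def qS
        by (auto intro!: derivative_eq_intros simp: field_simps power2_eq_square)
      then show ?thesis
        by (rule has_field_derivative_transform_within_open[of _ _ _ "{0<..}"])
          (use 1 in \<open>auto simp: F_def\<close>)
    next
      case 2
      have "((\<lambda>x. 0) has_real_derivative F (Suc n) x) (at x)"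
        using 2 by (simp add: F_def)
      then show ?thesis
        by (rule has_field_derivative_transform_within_open[of _ _ _ "{..<0}"])
          (use 2 in \<open>auto simp: F_def\<close>)
    next
      case 3
      \<comment> \<open>Dividing by y only multiplies the polynomial in 1/y by one more factor z, so
        the decay lemma applies again.\<close>
      have R: "((\<lambda>y. F n y / y) \<longlongrightarrow> 0) (at_right 0)"
      proof -
        have "((\<lambda>x. poly ([:0, 1:] * q n) (1 / x) * exp (- 1 / x)) \<longlongrightarrow> 0) (at_right (0::real))"
          by (rule poly_exp_inverse_tendsto_0)
        then show ?thesis
          by (rule Lim_transform_eventually)
            (auto simp: eventually_at_filter F_def field_simps)
      qed
      have L: "((\<lambda>y. F n y / y) \<longlongrightarrow> 0) (at_left 0)"
        by (rule tendsto_eventually) (auto simp: eventually_at_filter F_def)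
      have "((\<lambda>y. F n y / y) \<longlongrightarrow> 0) (at 0)"
        using L R by (simp add: filterlim_at_split)
      then show ?thesis
        using 3 by (simp add: has_field_derivative_iff F_def)
    qed
  qed
  moreover have "F 0 = flat"
    by (auto simp: F_def q_def flat_def)
  ultimately show ?thesis by blast
qed

lemma flat_nonneg: "0 \<le> flat x" and flat_le_1: "flat x \<le> 1"
  by (auto simp: flat_def)

text \<open>Rescaling turns \<open>flat\<close> into an approximation of the Heaviside function. The
  value 0 at the jump is the reason why products of such factors converge to indicators of open
  boxes.\<close>

lemma flat_scale_tendsto: "(\<lambda>n. flat (real n * x)) \<longlonglongrightarrow> (if 0 < x then 1 else 0)"
proof (cases "0 < x")
  case True
  have "(\<lambda>n. exp (- (1 / x) * (1 / real n))) \<longlonglongrightarrow> exp (- (1 / x) * 0)"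
    by (intro tendsto_intros lim_1_over_n)
  moreover have "eventually (\<lambda>n. exp (- (1 / x) * (1 / real n)) = flat (real n * x)) sequentially"
    using eventually_gt_at_top[of 0] by eventually_elim (use True in \<open>auto simp: flat_def field_simps\<close>)
  ultimately show ?thesis
    using True by (auto intro: Lim_transform_eventually)
next
  case False
  then have "flat (real n * x) = 0" for n
    by (auto simp: flat_def zero_less_mult_iff)
  then show ?thesis using False by simp
qed

section \<open>Calculus of \<open>Ck\<close> functions and stability of test functions\<close>

lemma pdiff_eq:
  assumes "(f has_derivative f') (at x)"
  shows "pdiff b f x = f' b"
  using frechet_derivative_at[OF assms] by (simp add: pdiff_def)

lemma Ck_continuous: "Ck k f \<Longrightarrow> continuous_on UNIV f"
  by (cases k) (auto intro: differentiable_imp_continuous_on)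

lemma Ck_SucD: "Ck (Suc k) f \<Longrightarrow> Ck k f"
proof (induction k arbitrary: f)
  case 0
  then show ?case using Ck_continuous by fastforce
next
  case (Suc k)
  then show ?case by (metis Ck.simps(2))
qed

lemma Ck_differentiable: "Ck (Suc k) f \<Longrightarrow> f differentiable (at x)"
  by (simp add: differentiable_on_def)

lemma Ck_const: "Ck k (\<lambda>x. c)"
proof (induction k arbitrary: c)
  case (Suc k)
  have "pdiff b (\<lambda>x. c) = (\<lambda>x. 0)" for b :: 'a
    by (rule ext) (rule pdiff_eq[OF has_derivative_const])
  then show ?case using Suc by simp
qed simp

lemma Ck_add: "Ck k f \<Longrightarrow> Ck k g \<Longrightarrow> Ck k (\<lambda>x. f x + g x)"
proof (induction k arbitrary: f g)
  case 0
  then show ?case by (auto intro: continuous_on_add)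
next
  case (Suc k)
  have D: "f differentiable (at x)" "g differentiable (at x)" for x
    using Suc.prems by (auto intro: Ck_differentiable)
  have "pdiff b (\<lambda>x. f x + g x) = (\<lambda>x. pdiff b f x + pdiff b g x)" for b
  proof
    fix x
    show "pdiff b (\<lambda>x. f x + g x) x = pdiff b f x + pdiff b g x"
      using pdiff_eq[OF has_derivative_add[OF D(1)[unfolded frechet_derivative_works] D(2)[unfolded frechet_derivative_works]], of b x]
      by (simp add: pdiff_def)
  qed
  then show ?case
    using Suc by (auto simp: differentiable_on_def intro!: differentiable_add)
qed

lemma Ck_mult: "Ck k f \<Longrightarrow> Ck k g \<Longrightarrow> Ck k (\<lambda>x. f x * g x)"
proof (induction k arbitrary: f g)
  case 0
  then show ?case by (auto intro: continuous_on_mult)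
next
  case (Suc k)
  have D: "f differentiable (at x)" "g differentiable (at x)" for x
    using Suc.prems by (auto intro: Ck_differentiable)
  have "pdiff b (\<lambda>x. f x * g x) = (\<lambda>x. f x * pdiff b g x + pdiff b f x * g x)" for b
  proof
    fix x
    show "pdiff b (\<lambda>x. f x * g x) x = f x * pdiff b g x + pdiff b f x * g x"
      using pdiff_eq[OF has_derivative_mult[OF D(1)[unfolded frechet_derivative_works] D(2)[unfolded frechet_derivative_works]], of b x]
      by (simp add: pdiff_def)
  qed
  moreover have "Ck k f" "Ck k g" using Suc.prems Ck_SucD by blast+
  ultimately show ?case
    using Suc by (auto simp: differentiable_on_def intro!: differentiable_mult Ck_add)
qed

lemma Ck_prod: "finite I \<Longrightarrow> (\<And>i. i \<in> I \<Longrightarrow> Ck k (f i)) \<Longrightarrow> Ck k (\<lambda>x. \<Prod>i\<in>I. f i x)"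
  by (induction I rule: finite_induct) (auto intro: Ck_const Ck_mult)

text \<open>Partial derivatives of a ridge function are ridge functions of the next derivative,
  scaled by a coordinate of a; the factor c and the index n are in the statement so that the
  induction closes.\<close>

lemma Ck_ridge:
  assumes F: "\<And>n x. (F n has_real_derivative F (Suc n) x) (at x)"
  shows "Ck k (\<lambda>x. c * F n (x \<bullet> a + d))"
proof (induction k arbitrary: c n)
  case 0
  have "isCont (F n) x" for x using F DERIV_isCont by blast
  then have "continuous_on UNIV (F n)" by (simp add: continuous_at_imp_continuous_on)
  then have "continuous_on UNIV (\<lambda>x. F n (x \<bullet> a + d))"
    by (rule continuous_on_compose2) (auto intro!: continuous_intros)
  then show ?case by (auto intro!: continuous_intros)
next
  case (Suc k)
  have D: "((\<lambda>x. c * F n (x \<bullet> a + d)) has_derivative (\<lambda>h. c * (F (Suc n) (x \<bullet> a + d) * (h \<bullet> a)))) (at x)" for x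
    by (auto intro!: derivative_eq_intros DERIV_compose_FDERIV[OF F])
  have "pdiff b (\<lambda>x. c * F n (x \<bullet> a + d)) = (\<lambda>x. (c * (b \<bullet> a)) * F (Suc n) (x \<bullet> a + d))" for b
    by (rule ext) (simp add: pdiff_eq[OF D])
  moreover have "(\<lambda>x. c * F n (x \<bullet> a + d)) differentiable_on UNIV"
    using D unfolding differentiable_on_def differentiable_def by blast
  ultimately show ?case
    using Suc by simp
qed

lemma Ck_translate: "Ck k f \<Longrightarrow> Ck k (\<lambda>x. f (x + h))"
proof (induction k arbitrary: f)
  case 0
  then show ?case by (auto intro!: continuous_on_compose2[of UNIV f] continuous_intros)
next
  case (Suc k)
  have D: "f differentiable (at x)" for x
    using Suc.prems by (rule Ck_differentiable)
  have D': "((\<lambda>x. f (x + h)) has_derivative frechet_derivative f (at (x + h))) (at x)" for x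
  proof -
    have "((\<lambda>x. x + h) has_derivative (\<lambda>y. y)) (at x)"
      by (auto intro!: derivative_eq_intros)
    from has_derivative_compose[OF this, of f, OF D[unfolded frechet_derivative_works]]
    show ?thesis by simp
  qed
  have "pdiff b (\<lambda>x. f (x + h)) = (\<lambda>x. pdiff b f (x + h))" for b
    by (rule ext) (simp add: pdiff_eq[OF D'] pdiff_def[of b f])
  then show ?case
    using Suc D' by (auto simp: differentiable_on_def differentiable_def)
qed

lemma pdiff_translate:
  assumes "Ck (Suc 0) f"
  shows "pdiff b (\<lambda>x. f (x + h)) x = pdiff b f (x + h)"
proof -
  have "((\<lambda>x. x + h) has_derivative (\<lambda>y. y)) (at x)"
    by (auto intro!: derivative_eq_intros)
  from has_derivative_compose[OF this, of f, OF Ck_differentiable[OF assms, unfolded frechet_derivative_works]]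
  show ?thesis by (simp add: pdiff_eq pdiff_def[of b f])
qed

lemma Ck_has_derivative:
  assumes "Ck (Suc 0) f"
  shows "(f has_derivative (\<lambda>h. \<Sum>b\<in>Basis. (h \<bullet> b) * pdiff b f x)) (at x)"
proof -
  have D: "(f has_derivative frechet_derivative f (at x)) (at x)"
    using Ck_differentiable[OF assms] by (simp add: frechet_derivative_works)
  then interpret bounded_linear "frechet_derivative f (at x)"
    by (rule has_derivative_bounded_linear)
  have "frechet_derivative f (at x) h = (\<Sum>b\<in>Basis. (h \<bullet> b) * pdiff b f x)" for h
  proof -
    have "frechet_derivative f (at x) (\<Sum>b\<in>Basis. (h \<bullet> b) *\<^sub>R b) = (\<Sum>b\<in>Basis. (h \<bullet> b) * pdiff b f x)"
      unfolding pdiff_def sum scale by simp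
    then show ?thesis by (simp add: euclidean_representation)
  qed
  then have "frechet_derivative f (at x) = (\<lambda>h. \<Sum>b\<in>Basis. (h \<bullet> b) * pdiff b f x)"
    by (rule ext)
  with D show ?thesis by simp
qed

lemma test_functionD:
  assumes "\<phi> \<in> test_functions S"
  shows test_Ck: "Ck k \<phi>" and test_compact: "compact (closure {x. \<phi> x \<noteq> 0})"
    and test_support: "closure {x. \<phi> x \<noteq> 0} \<subseteq> S"
  using assms by (auto simp: test_functions_def)

lemma test_functions_mono: "S \<subseteq> S' \<Longrightarrow> test_functions S \<subseteq> test_functions S'"
  by (auto simp: test_functions_def)

text \<open>Off the closed support the function vanishes on an open set, so its derivative vanishes
  there too: differentiation does not enlarge the support.\<close>

lemma test_pdiff:
  assumes "\<phi> \<in> test_functions S" "b \<in> Basis"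
  shows "pdiff b \<phi> \<in> test_functions S"
proof -
  have "Ck k (pdiff b \<phi>)" for k
    using test_Ck[OF assms(1), of "Suc k"] assms(2) by simp
  moreover have sub: "closure {x. pdiff b \<phi> x \<noteq> 0} \<subseteq> closure {x. \<phi> x \<noteq> 0}"
  proof (rule closure_minimal)
    show "{x. pdiff b \<phi> x \<noteq> 0} \<subseteq> closure {x. \<phi> x \<noteq> 0}"
    proof (rule ccontr)
      assume "\<not> ?thesis"
      then obtain x where x: "pdiff b \<phi> x \<noteq> 0" "x \<in> - closure {x. \<phi> x \<noteq> 0}" by blast
      have "((\<lambda>x. 0) has_derivative (\<lambda>h. 0)) (at x)" by simp
      then have "(\<phi> has_derivative (\<lambda>h. 0)) (at x)"
        by (rule has_derivative_transform_within_open[of _ _ _ _ "- closure {x. \<phi> x \<noteq> 0}"])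
          (use x closure_subset[of "{x. \<phi> x \<noteq> 0}"] in auto)
      then show False using x pdiff_eq by metis
    qed
  qed simp
  moreover have "compact (closure {x. pdiff b \<phi> x \<noteq> 0})"
    using compact_Int_closed[OF test_compact[OF assms(1)] closed_closure, of "{x. pdiff b \<phi> x \<noteq> 0}"]
    unfolding inf.absorb2[OF sub] .
  ultimately show ?thesis
    using test_support[OF assms(1)] unfolding test_functions_def by blast
qed

lemma test_bounded:
  assumes "\<phi> \<in> test_functions S"
  obtains B where "B > 0" "\<And>x. \<bar>\<phi> x\<bar> \<le> B"
proof -
  have "compact (\<phi> ` closure {x. \<phi> x \<noteq> 0})"
    by (rule compact_continuous_image)
      (use test_Ck[OF assms, of 0] test_compact[OF assms] continuous_on_subset in auto)
  then obtain B where B: "\<And>y. y \<in> \<phi> ` closure {x. \<phi> x \<noteq> 0} \<Longrightarrow> norm y \<le> B" "B > 0"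
    using bounded_pos compact_imp_bounded by metis
  have "\<bar>\<phi> x\<bar> \<le> B" for x
    using B closure_subset[of "{x. \<phi> x \<noteq> 0}"] by (cases "\<phi> x = 0") auto
  then show ?thesis using that B by blast
qed

lemma test_borel [measurable_dest]: "\<phi> \<in> test_functions S \<Longrightarrow> \<phi> \<in> borel_measurable borel"
  by (rule borel_measurable_continuous_onI[OF Ck_continuous[OF test_Ck[of _ _ 0]]])

lemma closure_image_translate: "closure {x::'a::euclidean_space. f (x + h) \<noteq> (0::real)} = (\<lambda>y. y - h) ` closure {x. f x \<noteq> 0}"
proof -
  have "{x. f (x + h) \<noteq> 0} = (\<lambda>y. (- h) + y) ` {x. f x \<noteq> 0}"
    by (auto intro!: image_eqI[of _ _ "_ + h"])
  then show ?thesis by (simp only: closure_translation) (auto simp: image_iff algebra_simps)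
qed

lemma test_translate:
  assumes "\<phi> \<in> test_functions S" "\<And>x. x \<in> S \<Longrightarrow> x - h \<in> S'"
  shows "(\<lambda>x. \<phi> (x + h)) \<in> test_functions S'"
proof -
  have "compact ((\<lambda>y. y - h) ` closure {x. \<phi> x \<noteq> 0})"
    using compact_translation_subtract[OF test_compact[OF assms(1)]] .
  moreover have "(\<lambda>y. y - h) ` closure {x. \<phi> x \<noteq> 0} \<subseteq> S'"
    using test_support[OF assms(1)] assms(2) by auto
  ultimately show ?thesis
    using Ck_translate[OF test_Ck[OF assms(1)]]
    unfolding test_functions_def mem_Collect_eq closure_image_translate by blast
qed

section \<open>Smooth approximations of the indicators of boxes, and the fundamental lemma\<close>

definition box_bump :: "'a::euclidean_space \<Rightarrow> 'a \<Rightarrow> nat \<Rightarrow> 'a \<Rightarrow> real" where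
  "box_bump l u n x = (\<Prod>b\<in>Basis. flat (real n * (x \<bullet> b - l \<bullet> b)) * flat (real n * (u \<bullet> b - x \<bullet> b)))"

lemma box_bump_bounds: "0 \<le> box_bump l u n x" "box_bump l u n x \<le> 1"
  unfolding box_bump_def
  by (intro prod_nonneg prod_le_1 conjI mult_nonneg_nonneg mult_le_one flat_nonneg flat_le_1)+

lemma box_bump_tendsto: "(\<lambda>n. box_bump l u n x) \<longlonglongrightarrow> indicator (box l u) x"
proof -
  have "(\<lambda>n. box_bump l u n x) \<longlonglongrightarrow>
      (\<Prod>b\<in>Basis. (if 0 < x \<bullet> b - l \<bullet> b then 1 else 0) * (if 0 < u \<bullet> b - x \<bullet> b then 1 else 0))"
    unfolding box_bump_def by (intro tendsto_prod tendsto_mult flat_scale_tendsto)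
  moreover have "(\<Prod>b\<in>Basis. (if 0 < x \<bullet> b - l \<bullet> b then 1 else 0) * (if 0 < u \<bullet> b - x \<bullet> b then 1 else 0))
      = (indicator (box l u) x :: real)"
  proof (cases "x \<in> box l u")
    case True
    then show ?thesis by (auto simp: mem_box)
  next
    case False
    then obtain b where "b \<in> Basis" "\<not> (l \<bullet> b < x \<bullet> b \<and> x \<bullet> b < u \<bullet> b)" by (auto simp: mem_box)
    then show ?thesis using False by (auto simp: prod_zero_iff intro!: bexI[of _ b])
  qed
  ultimately show ?thesis by simp
qed

lemma box_bump_support: "{x. box_bump l u n x \<noteq> 0} \<subseteq> box l u"
proof
  fix x assume "x \<in> {x. box_bump l u n x \<noteq> 0}"
  then have "flat (real n * (x \<bullet> b - l \<bullet> b)) \<noteq> 0" "flat (real n * (u \<bullet> b - x \<bullet> b)) \<noteq> 0" if "b \<in> Basis" for b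
    using that by (auto simp: box_bump_def)
  then have "l \<bullet> b < x \<bullet> b \<and> x \<bullet> b < u \<bullet> b" if "b \<in> Basis" for b
    using that by (force simp: flat_def zero_less_mult_iff split: if_splits)
  then show "x \<in> box l u" by (auto simp: mem_box)
qed

lemma box_bump_test:
  assumes "cbox l u \<subseteq> S"
  shows "box_bump l u n \<in> test_functions S"
proof -
  obtain F where F: "F 0 = flat" "\<And>n x. (F n has_real_derivative F (Suc n) x) (at x)"
    using flat_derivatives by blast
  have 1: "Ck k (\<lambda>x. flat (real n * (x \<bullet> b - l \<bullet> b)))" for k b
    using Ck_ridge[of F k 1 0 "real n *\<^sub>R b" "- (real n * (l \<bullet> b))"]
    by (simp add: F right_diff_distrib)
  have 2: "Ck k (\<lambda>x. flat (real n * (u \<bullet> b - x \<bullet> b)))" for k b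
    using Ck_ridge[of F k 1 0 "- (real n *\<^sub>R b)" "(real n * (u \<bullet> b))"]
    by (simp add: F right_diff_distrib)
  have "Ck k (box_bump l u n)" for k
    unfolding box_bump_def[abs_def] by (intro Ck_prod Ck_mult 1 2) auto
  moreover have "closure {x. box_bump l u n x \<noteq> 0} \<subseteq> cbox l u"
    using box_bump_support box_subset_cbox by (intro closure_minimal) blast+
  moreover from this have "compact (closure {x. box_bump l u n x \<noteq> 0})"
    using compact_Int_closed[OF compact_cbox closed_closure, of l u "{x. box_bump l u n x \<noteq> 0}"]
    by (simp only: inf.absorb2)
  ultimately show ?thesis
    using assms unfolding test_functions_def by blast
qed

lemma test_mult:
  assumes "\<phi> \<in> test_functions S" "\<And>k. Ck k \<psi>"
  shows "(\<lambda>x. \<phi> x * \<psi> x) \<in> test_functions S"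
proof -
  have sub: "closure {x. \<phi> x * \<psi> x \<noteq> 0} \<subseteq> closure {x. \<phi> x \<noteq> 0}"
    by (rule closure_mono) auto
  then have "closure {x. \<phi> x * \<psi> x \<noteq> 0} \<subseteq> S"
    using test_support[OF assms(1)] by blast
  moreover have "compact (closure {x. \<phi> x * \<psi> x \<noteq> 0})"
    using compact_Int_closed[OF test_compact[OF assms(1)] closed_closure, of "{x. \<phi> x * \<psi> x \<noteq> 0}"]
    unfolding inf.absorb2[OF sub] .
  moreover have "Ck k (\<lambda>x. \<phi> x * \<psi> x)" for k
    using assms test_Ck by (intro Ck_mult)
  ultimately show ?thesis unfolding test_functions_def by blast
qed

lemma box_bump_borel [measurable]: "box_bump l u n \<in> borel_measurable borel"
  using test_borel[OF box_bump_test[OF order_refl]] .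

text \<open>The first bump keeps the support of the product inside S, so the second box may be
  arbitrary; both converge to indicators under the majorant |f|. Arbitrary boxes are what the
  uniqueness of measures in \<open>AE_zero_on_box\<close> asks for.\<close>

lemma integral_box_Int_eq_0:
  fixes f :: "'a::euclidean_space \<Rightarrow> real"
  assumes f: "integrable lborel f"
    and 0: "\<And>\<phi>. \<phi> \<in> test_functions S \<Longrightarrow> (\<integral>x. \<phi> x * f x \<partial>lborel) = 0"
    and sub: "cbox l0 u0 \<subseteq> S"
  shows "(\<integral>x. indicator (box l0 u0) x * indicator (box l u) x * f x \<partial>lborel) = 0"
proof -
  note [measurable] = borel_measurable_integrable[OF f]
  have "(\<lambda>n. \<integral>x. box_bump l0 u0 n x * box_bump l u n x * f x \<partial>lborel) \<longlonglongrightarrow>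
      (\<integral>x. indicator (box l0 u0) x * indicator (box l u) x * f x \<partial>lborel)"
  proof (rule integral_dominated_convergence[where w = "\<lambda>x. \<bar>f x\<bar>"])
    show "AE x in lborel. (\<lambda>n. box_bump l0 u0 n x * box_bump l u n x * f x)
        \<longlonglongrightarrow> indicator (box l0 u0) x * indicator (box l u) x * f x"
      by (intro AE_I2 tendsto_intros box_bump_tendsto)
    show "AE x in lborel. norm (box_bump l0 u0 n x * box_bump l u n x * f x) \<le> \<bar>f x\<bar>" for n
    proof (intro AE_I2)
      fix x
      have "box_bump l0 u0 n x * box_bump l u n x \<le> 1" "0 \<le> box_bump l0 u0 n x * box_bump l u n x"
        by (intro mult_le_one mult_nonneg_nonneg box_bump_bounds)+
      then show "norm (box_bump l0 u0 n x * box_bump l u n x * f x) \<le> \<bar>f x\<bar>"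
        by (simp add: abs_mult mult_left_le_one_le)
    qed
  qed (use f in auto)
  moreover have "(\<lambda>x. box_bump l0 u0 n x * box_bump l u n x) \<in> test_functions S" for n
    by (intro test_mult box_bump_test sub test_Ck[OF box_bump_test[OF order_refl]])
  ultimately show ?thesis
    using 0 by (simp add: LIMSEQ_const_iff)
qed

text \<open>The positive and negative parts of f, cut off to the box, are densities of two measures
  with equal finite values on all open boxes. These boxes are stable under intersection and generate
  the Borel sets, so the two parts agree almost everywhere; since at most one of them is non-zero at
  each point, both vanish.\<close>

lemma AE_zero_on_box:
  fixes f :: "'a::euclidean_space \<Rightarrow> real"
  assumes f: "integrable lborel f"
    and 0: "\<And>\<phi>. \<phi> \<in> test_functions S \<Longrightarrow> (\<integral>x. \<phi> x * f x \<partial>lborel) = 0"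
    and sub: "cbox l0 u0 \<subseteq> S"
  shows "AE x in lborel. x \<in> box l0 u0 \<longrightarrow> f x = 0"
proof -
  note [measurable] = borel_measurable_integrable[OF f]
  define p where "p x = ennreal (f x) * indicator (box l0 u0) x" for x
  define m where "m x = ennreal (- f x) * indicator (box l0 u0) x" for x
  have [measurable]: "p \<in> borel_measurable borel" "m \<in> borel_measurable borel"
    by (auto simp: p_def[abs_def] m_def[abs_def])
  have eq: "emeasure (density lborel p) (box l u) = emeasure (density lborel m) (box l u)"
    and fin: "emeasure (density lborel p) (box l u) \<noteq> \<infinity>" for l u
  proof -
    define h where "h x = indicator (box l0 u0) x * indicator (box l u) x * f x" for x
    have h: "integrable lborel h"
      unfolding h_def by (rule Bochner_Integration.integrable_bound[OF f]) (auto simp: indicator_def)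
    then have fin: "(\<integral>\<^sup>+x. ennreal (h x) \<partial>lborel) \<noteq> \<infinity>" "(\<integral>\<^sup>+x. ennreal (- h x) \<partial>lborel) \<noteq> \<infinity>"
      by (auto simp: real_integrable_def)
    moreover have "integral\<^sup>L lborel h = 0"
      using integral_box_Int_eq_0[OF f 0 sub] unfolding h_def by simp
    ultimately have "(\<integral>\<^sup>+x. ennreal (h x) \<partial>lborel) = (\<integral>\<^sup>+x. ennreal (- h x) \<partial>lborel)"
      using real_lebesgue_integral_def[OF h] ennreal_enn2real by (metis eq_iff_diff_eq_0 infinity_ennreal_def less_top)
    moreover have "p x * indicator (box l u) x = ennreal (h x)"
      "m x * indicator (box l u) x = ennreal (- h x)" for x
      by (auto simp: p_def m_def h_def indicator_def)
    ultimately show "emeasure (density lborel p) (box l u) = emeasure (density lborel m) (box l u)"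
      "emeasure (density lborel p) (box l u) \<noteq> \<infinity>"
      using fin by (simp_all add: emeasure_density)
  qed
  have "density lborel p = density lborel m"
  proof (rule measure_eqI_generator_eq)
    let ?E = "range (\<lambda>(a, b). box a b::'a set)"
    show "Int_stable ?E"
      by (auto simp: Int_stable_def box_Int_box)
    show "?E \<subseteq> Pow UNIV" "sets (density lborel p) = sigma_sets UNIV ?E"
      "sets (density lborel m) = sigma_sets UNIV ?E"
      by (simp_all add: borel_eq_box)
    let ?A = "\<lambda>n::nat. box (- (real n *\<^sub>R One)) (real n *\<^sub>R One) :: 'a set"
    show "range ?A \<subseteq> ?E" "(\<Union>i. ?A i) = UNIV"
      unfolding UN_box_eq_UNIV by auto
  qed (use eq fin in auto)
  then have "AE x in lborel. p x = m x"
    by (intro sigma_finite_measure.density_unique[OF sigma_finite_lborel]) auto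
  then show ?thesis
  proof eventually_elim
    case (elim x)
    then show ?case
      by (cases "f x \<ge> 0") (auto simp: p_def m_def indicator_def ennreal_neg)
  qed
qed

text \<open>Open boxes whose closures lie in S cover S, and by Lindelof countably many suffice, so
  the exceptional sets unite to a null set.\<close>

lemma fundamental_lemma_real:
  fixes f :: "'a::euclidean_space \<Rightarrow> real"
  assumes f: "integrable lborel f" and "open S"
    and 0: "\<And>\<phi>. \<phi> \<in> test_functions S \<Longrightarrow> (\<integral>x. \<phi> x * f x \<partial>lborel) = 0"
  shows "AE x in lborel. x \<in> S \<longrightarrow> f x = 0"
proof -
  define \<F> where "\<F> = {box l u |l u. cbox l u \<subseteq> S}"
  have "\<exists>l u. x \<in> box l u \<and> cbox l u \<subseteq> S" if "x \<in> S" for x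
    using open_contains_cbox[OF \<open>open S\<close> that] by metis
  then have "\<Union>\<F> = S"
    unfolding \<F>_def by (auto dest: subsetD[OF box_subset_cbox]) blast
  moreover obtain \<F>' where "\<F>' \<subseteq> \<F>" "countable \<F>'" "\<Union>\<F>' = \<Union>\<F>"
    using Lindelof[of \<F>] by (auto simp: \<F>_def)
  moreover have "AE x in lborel. \<forall>X\<in>\<F>'. x \<in> X \<longrightarrow> f x = 0"
    using \<open>\<F>' \<subseteq> \<F>\<close> AE_zero_on_box[OF f 0]
    by (subst AE_ball_countable[OF \<open>countable \<F>'\<close>]) (auto simp: \<F>_def)
  ultimately show ?thesis
    by (auto elim!: eventually_mono)
qed

lemma fundamental_lemma:
  fixes f :: "'a::euclidean_space \<Rightarrow> 'b::euclidean_space"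
  assumes f: "integrable lborel f" and "open S"
    and 0: "\<And>\<phi>. \<phi> \<in> test_functions S \<Longrightarrow> (\<integral>x. \<phi> x *\<^sub>R f x \<partial>lborel) = 0"
  shows "AE x in lborel. x \<in> S \<longrightarrow> f x = 0"
proof -
  note [measurable] = borel_measurable_integrable[OF f]
  have "AE x in lborel. x \<in> S \<longrightarrow> f x \<bullet> b = 0" if "b \<in> Basis" for b
  proof (rule fundamental_lemma_real)
    fix \<phi> assume \<phi>: "\<phi> \<in> test_functions S"
    note [measurable] = test_borel[OF \<phi>]
    obtain B where B: "\<And>x. \<bar>\<phi> x\<bar> \<le> B" using test_bounded[OF \<phi>] by blast
    have "integrable lborel (\<lambda>x. \<phi> x *\<^sub>R f x)"
      by (rule Bochner_Integration.integrable_bound[OF integrable_scaleR_right[OF f, of B]])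
        (auto intro!: mult_right_mono AE_I2 order_trans[OF B])
    then have "(\<integral>x. (\<phi> x *\<^sub>R f x) \<bullet> b \<partial>lborel) = (\<integral>x. \<phi> x *\<^sub>R f x \<partial>lborel) \<bullet> b"
      by (rule integral_inner_left)
    then show "(\<integral>x. \<phi> x * (f x \<bullet> b) \<partial>lborel) = 0"
      using 0[OF \<phi>] by simp
  qed (use f \<open>open S\<close> in auto)
  then have "AE x in lborel. \<forall>b\<in>Basis. x \<in> S \<longrightarrow> f x \<bullet> b = 0"
    by (subst AE_ball_countable) (auto simp: countable_finite)
  then show ?thesis
    by eventually_elim (use euclidean_eq_iff[of _ 0] in auto)
qed

section \<open>Difference quotients of weakly differentiable functions\<close>

lemma nn_integral_lborel_shift:
  fixes f :: "'a::euclidean_space \<Rightarrow> ennreal"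
  assumes [measurable]: "f \<in> borel_measurable borel"
  shows "(\<integral>\<^sup>+x. f (x + c) \<partial>lborel) = (\<integral>\<^sup>+x. f x \<partial>lborel)"
proof -
  have "(\<integral>\<^sup>+x. f x \<partial>distr lborel borel ((+) c)) = (\<integral>\<^sup>+x. f (c + x) \<partial>lborel)"
    by (subst nn_integral_distr) auto
  then show ?thesis by (simp add: lborel_distr_plus add.commute)
qed

lemma integrable_lborel_shift:
  fixes f :: "'a::euclidean_space \<Rightarrow> 'b::{banach, second_countable_topology}"
  assumes "integrable lborel f"
  shows "integrable lborel (\<lambda>x. f (x + c))"
proof -
  have "integrable (distr lborel borel ((+) c)) f"
    using assms by (simp add: lborel_distr_plus)
  then show ?thesis
    by (subst (asm) integrable_distr_eq) (use assms in \<open>auto simp: add.commute\<close>)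
qed

lemma integral_lborel_shift:
  fixes f :: "'a::euclidean_space \<Rightarrow> 'b::{banach, second_countable_topology}"
  assumes [measurable]: "f \<in> borel_measurable borel"
  shows "(\<integral>x. f (x + c) \<partial>lborel) = (\<integral>x. f x \<partial>lborel)"
proof -
  have "(\<integral>x. f x \<partial>distr lborel borel ((+) c)) = (\<integral>x. f (c + x) \<partial>lborel)"
    by (subst integral_distr) auto
  then show ?thesis by (simp add: lborel_distr_plus add.commute)
qed

text \<open>A weak gradient on E of functions that are integrable on the whole space. Translations
  and Fubini can then be applied on \<open>lborel\<close>, while the test functions see only the
  values in E.\<close>

definition has_weak_grad :: "'a::euclidean_space set \<Rightarrow> ('a \<Rightarrow> 'b::euclidean_space) \<Rightarrow> ('a \<Rightarrow> 'a \<Rightarrow> 'b) \<Rightarrow> bool" where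
  "has_weak_grad E g G \<longleftrightarrow> integrable lborel g \<and> (\<forall>b\<in>Basis. integrable lborel (G b)) \<and>
     (\<forall>b\<in>Basis. \<forall>\<phi>\<in>test_functions E.
        (\<integral>x. pdiff b \<phi> x *\<^sub>R g x \<partial>lborel) = - (\<integral>x. \<phi> x *\<^sub>R G b x \<partial>lborel))"

lemma integrable_bounded_scaleR:
  fixes f :: "'a::euclidean_space \<Rightarrow> 'b::euclidean_space"
  assumes f: "integrable lborel f" and [measurable]: "\<phi> \<in> borel_measurable borel" and B: "\<And>x. \<bar>\<phi> x\<bar> \<le> B"
  shows "integrable lborel (\<lambda>x. \<phi> x *\<^sub>R f x)"
proof -
  note [measurable] = borel_measurable_integrable[OF f]
  show ?thesis
  by (rule Bochner_Integration.integrable_bound[OF integrable_scaleR_right[OF f, of B]])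
    (auto intro!: mult_right_mono AE_I2 order_trans[OF B])
qed

lemma test_scaleR_integrable:
  fixes f :: "'a::euclidean_space \<Rightarrow> 'b::euclidean_space"
  assumes "\<phi> \<in> test_functions S" "integrable lborel f"
  shows "integrable lborel (\<lambda>x. \<phi> x *\<^sub>R f x)"
  using test_bounded[OF assms(1)] integrable_bounded_scaleR[OF assms(2) test_borel[OF assms(1)]] by metis

text \<open>Justifies an exchange of integrals in \<open>weak_grad_segment\<close>: the translated
  factor is bounded by B, so integrating the norm over t in [0,1] leaves at most B times the norm of
  f x.\<close>

lemma integrable_segment:
  fixes f :: "'a::euclidean_space \<Rightarrow> 'b::euclidean_space"
  assumes f: "integrable lborel f" and [measurable]: "k \<in> borel_measurable borel" and B: "\<And>x. \<bar>k x\<bar> \<le> B"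
  shows "integrable (lborel \<Otimes>\<^sub>M lborel) (\<lambda>(x, t). indicator {0..1::real} t *\<^sub>R k (x + t *\<^sub>R h) *\<^sub>R f x)"
proof (rule lborel_pair.Fubini_integrable)
  note [measurable] = borel_measurable_integrable[OF f]
  show "(\<lambda>(x, t). indicator {0..1::real} t *\<^sub>R k (x + t *\<^sub>R h) *\<^sub>R f x) \<in> borel_measurable (lborel \<Otimes>\<^sub>M lborel)"
    by measurable
  have 0: "0 \<le> B" using B[of undefined] by linarith
  have 1: "integrable lborel (\<lambda>t. indicator {0..1::real} t *\<^sub>R k (x + t *\<^sub>R h) *\<^sub>R f x)" for x
  proof (rule Bochner_Integration.integrable_bound)
    show "integrable lborel (\<lambda>t. indicator {0..1::real} t *\<^sub>R (B * norm (f x)))"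
      by (intro integrable_scaleR_left integrable_real_indicator) auto
    show "AE t in lborel. norm (indicator {0..1::real} t *\<^sub>R k (x + t *\<^sub>R h) *\<^sub>R f x)
        \<le> norm (indicator {0..1::real} t *\<^sub>R (B * norm (f x)))"
      using B 0 by (intro AE_I2) (auto simp: indicator_def mult_right_mono)
  qed measurable
  then show "AE x in lborel. integrable lborel
      (\<lambda>t. case (x, t) of (x, t) \<Rightarrow> indicator {0..1} t *\<^sub>R k (x + t *\<^sub>R h) *\<^sub>R f x)"
    by simp
  show "integrable lborel (\<lambda>x. \<integral>t. norm (case (x, t) of (x, t) \<Rightarrow>
      indicator {0..1} t *\<^sub>R k (x + t *\<^sub>R h) *\<^sub>R f x) \<partial>lborel)"
  proof (rule Bochner_Integration.integrable_bound)
    show "integrable lborel (\<lambda>x. B * norm (f x))"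
      using f by auto
    show "AE x in lborel. norm (\<integral>t. norm (case (x, t) of (x, t) \<Rightarrow>
      indicator {0..1} t *\<^sub>R k (x + t *\<^sub>R h) *\<^sub>R f x) \<partial>lborel) \<le> norm (B * norm (f x))"
    proof (intro AE_I2)
      fix x
      have "(\<integral>t. norm (indicator {0..1} t *\<^sub>R k (x + t *\<^sub>R h) *\<^sub>R f x) \<partial>lborel)
          \<le> (\<integral>t. indicator {0..1::real} t *\<^sub>R (B * norm (f x)) \<partial>lborel)"
        using B 0
        by (intro integral_mono integrable_norm 1 integrable_scaleR_left integrable_real_indicator)
          (auto simp: indicator_def mult_right_mono)
      also have "\<dots> = B * norm (f x)" by simp
      finally show "norm (\<integral>t. norm (case (x, t) of (x, t) \<Rightarrow>
          indicator {0..1} t *\<^sub>R k (x + t *\<^sub>R h) *\<^sub>R f x) \<partial>lborel) \<le> norm (B * norm (f x))"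
        using 0 by simp
    qed
  qed measurable
qed

text \<open>The classical identity that \<open>weak_grad_segment\<close> transfers to g by
  duality.\<close>

lemma test_segment_FTC:
  fixes \<phi> :: "'a::euclidean_space \<Rightarrow> real"
  assumes "\<phi> \<in> test_functions S"
  shows "(\<integral>t. indicator {0..1::real} t *\<^sub>R (\<Sum>b\<in>Basis. (h \<bullet> b) * pdiff b \<phi> (x + t *\<^sub>R h)) \<partial>lborel) = \<phi> (x + h) - \<phi> x"
proof -
  have "((\<lambda>t. \<phi> (x + t *\<^sub>R h)) has_vector_derivative (\<Sum>b\<in>Basis. (h \<bullet> b) * pdiff b \<phi> (x + t *\<^sub>R h))) (at t within {0..1})" for t
  proof -
    have "((\<lambda>t. x + t *\<^sub>R h) has_derivative (\<lambda>s. s *\<^sub>R h)) (at t within {0..1})"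
      by (auto intro!: derivative_eq_intros)
    from has_derivative_compose[OF this Ck_has_derivative[OF test_Ck[OF assms], of "x + t *\<^sub>R h"]]
    show ?thesis
      by (simp add: has_vector_derivative_def sum_distrib_left mult.assoc)
  qed
  moreover have "continuous_on {0..1} (\<lambda>t. \<Sum>b\<in>Basis. (h \<bullet> b) * pdiff b \<phi> (x + t *\<^sub>R h))"
    by (intro continuous_intros continuous_on_compose2[OF Ck_continuous[OF test_Ck[OF test_pdiff[OF assms]]]])
      auto
  ultimately show ?thesis
    by (subst integral_FTC_Icc[where F="\<lambda>t. \<phi> (x + t *\<^sub>R h)"]) auto
qed

text \<open>Against a test function \<phi> supported where both x and x + h lie in E, the segment
  integral of H h becomes, by translation and the definition of the weak gradient, an integral of g
  against derivatives of \<phi> along -h. \<open>test_segment_FTC\<close> evaluates the inner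
  integral as \<phi> (x - h) - \<phi> x; translating back produces g (x + h) - g x, and the
  fundamental lemma removes \<phi>. The exceptional null set depends on h.\<close>

lemma weak_grad_segment:
  fixes g :: "'a::euclidean_space \<Rightarrow> 'b::euclidean_space"
  assumes E: "open E" "convex E" and G: "has_weak_grad E g G"
  defines "H \<equiv> \<lambda>h y. \<Sum>b\<in>Basis. (h \<bullet> b) *\<^sub>R G b y"
  shows "AE x in lborel. x \<in> E \<and> x + h \<in> E \<longrightarrow>
     integrable lborel (\<lambda>t. indicator {0..1::real} t *\<^sub>R H h (x + t *\<^sub>R h)) \<and>
     g (x + h) - g x = (\<integral>t. indicator {0..1::real} t *\<^sub>R H h (x + t *\<^sub>R h) \<partial>lborel)"
proof -
  have g: "integrable lborel g" and Gi: "\<And>b. b \<in> Basis \<Longrightarrow> integrable lborel (G b)"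
    and Gw: "\<And>b \<phi>. b \<in> Basis \<Longrightarrow> \<phi> \<in> test_functions E \<Longrightarrow>
        (\<integral>x. pdiff b \<phi> x *\<^sub>R g x \<partial>lborel) = - (\<integral>x. \<phi> x *\<^sub>R G b x \<partial>lborel)"
    using G by (auto simp: has_weak_grad_def)
  have Hi: "integrable lborel (H h)"
    unfolding H_def using Gi by auto
  note [measurable] = borel_measurable_integrable[OF g] borel_measurable_integrable[OF Hi]
  define U where "U = {x. x \<in> E \<and> x + h \<in> E}"
  have "U = E \<inter> (\<lambda>x. x + h) -` E" by (auto simp: U_def)
  moreover have "open ((\<lambda>x. x + h) -` E)"
    using E by (intro open_vimage) (auto intro!: continuous_intros)
  ultimately have "open U" using E by auto
  have seg: "x + t *\<^sub>R h \<in> E" if "x \<in> U" "0 \<le> t" "t \<le> 1" for x t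
  proof -
    have "(1 - t) *\<^sub>R x + t *\<^sub>R (x + h) \<in> E"
      using that E by (intro convexD_alt) (auto simp: U_def)
    then show ?thesis by (simp add: algebra_simps)
  qed
  \<comment> \<open>With t as the outer variable all inner integrals are dominated by translates of
    one and the same integral, so the bound is uniform in t; the two variables are swapped at the
    end.\<close>
  have pair: "integrable (lborel \<Otimes>\<^sub>M lborel) (\<lambda>(x, t). indicator {0..1::real} t *\<^sub>R k x *\<^sub>R H h (x + t *\<^sub>R h))"
    if "k \<in> borel_measurable borel" "\<And>x. \<bar>k x\<bar> \<le> B" for k B
  proof -
    note [measurable] = that(1)
    have "integrable (lborel \<Otimes>\<^sub>M lborel) (\<lambda>(t, x). indicator {0..1::real} t *\<^sub>R k x *\<^sub>R H h (x + t *\<^sub>R h))"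
    proof (rule lborel_pair.Fubini_integrable)
      have 1: "integrable lborel (\<lambda>x. indicator {0..1::real} t *\<^sub>R k x *\<^sub>R H h (x + t *\<^sub>R h))" for t
        using integrable_bounded_scaleR[OF integrable_lborel_shift[OF Hi] that, of "t *\<^sub>R h"]
        by (cases "t \<in> {0..1}") (auto simp: indicator_def)
      then show "AE t in lborel. integrable lborel (\<lambda>x. case (t, x) of (t, x) \<Rightarrow>
          indicator {0..1::real} t *\<^sub>R k x *\<^sub>R H h (x + t *\<^sub>R h))" by simp
      have 0: "0 \<le> B" using that(2)[of undefined] by linarith
      show "integrable lborel (\<lambda>t. \<integral>x. norm (case (t, x) of (t, x) \<Rightarrow>
          indicator {0..1::real} t *\<^sub>R k x *\<^sub>R H h (x + t *\<^sub>R h)) \<partial>lborel)"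
      proof (rule Bochner_Integration.integrable_bound)
        show "integrable lborel (\<lambda>t. indicator {0..1::real} t *\<^sub>R (B * (\<integral>x. norm (H h x) \<partial>lborel)))"
          by (intro integrable_scaleR_left integrable_real_indicator) auto
        show "AE t in lborel. norm (\<integral>x. norm (case (t, x) of (t, x) \<Rightarrow>
            indicator {0..1::real} t *\<^sub>R k x *\<^sub>R H h (x + t *\<^sub>R h)) \<partial>lborel)
          \<le> norm (indicator {0..1::real} t *\<^sub>R (B * (\<integral>x. norm (H h x) \<partial>lborel)))"
        proof (intro AE_I2)
          fix t :: real
          have "(\<integral>x. norm (indicator {0..1::real} t *\<^sub>R k x *\<^sub>R H h (x + t *\<^sub>R h)) \<partial>lborel)
             \<le> (\<integral>x. indicator {0..1::real} t *\<^sub>R (B * norm (H h (x + t *\<^sub>R h))) \<partial>lborel)"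
            using that(2) 0
            by (intro integral_mono integrable_norm 1 integrable_scaleR_right integrable_mult_right
                integrable_lborel_shift[OF integrable_norm[OF Hi]])
              (auto simp: indicator_def mult_right_mono)
          also have "\<dots> = indicator {0..1::real} t *\<^sub>R (B * (\<integral>x. norm (H h x) \<partial>lborel))"
            by (simp add: integral_lborel_shift[of "\<lambda>x. norm (H h x)"])
          finally show "norm (\<integral>x. norm (case (t, x) of (t, x) \<Rightarrow>
            indicator {0..1::real} t *\<^sub>R k x *\<^sub>R H h (x + t *\<^sub>R h)) \<partial>lborel)
          \<le> norm (indicator {0..1::real} t *\<^sub>R (B * (\<integral>x. norm (H h x) \<partial>lborel)))"
            by simp
        qed
      qed measurable
    qed measurable
    from lborel_pair.integrable_product_swap[OF this] show ?thesis
      by (simp add: case_prod_beta')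
  qed
  define F where "F x = (\<integral>t. indicator {0..1::real} t *\<^sub>R H h (x + t *\<^sub>R h) \<partial>lborel)" for x
  have pair1: "integrable (lborel \<Otimes>\<^sub>M lborel) (\<lambda>(x, t). indicator {0..1::real} t *\<^sub>R H h (x + t *\<^sub>R h))"
    using pair[of "\<lambda>_. 1" 1] by simp
  have Fi: "integrable lborel F"
    using lborel_pair.integrable_fst'[OF pair1] by (simp add: F_def[abs_def])
  have "AE x in lborel. x \<in> U \<longrightarrow> g (x + h) - g x - F x = 0"
  proof (rule fundamental_lemma)
    show "integrable lborel (\<lambda>x. g (x + h) - g x - F x)"
      using g integrable_lborel_shift[OF g] Fi by auto
    fix \<phi> assume \<phi>: "\<phi> \<in> test_functions U"
    have \<phi>E: "\<phi> \<in> test_functions E"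
      using \<phi> test_functions_mono[of U E] by (auto simp: U_def)
    note [measurable] = test_borel[OF \<phi>]
    obtain B where B: "\<And>x. \<bar>\<phi> x\<bar> \<le> B" using test_bounded[OF \<phi>] by blast
    \<comment> \<open>The derivative of \<phi> in the direction -h: translating H h back by t h
      turns \<phi> x into \<phi> (x - t h), and the sign comes from the weak integration by
      parts.\<close>
    define d where "d y = (\<Sum>b\<in>Basis. (- h \<bullet> b) * pdiff b \<phi> y)" for y
    have dB: "\<exists>B. \<forall>x. \<bar>d x\<bar> \<le> B" and [measurable]: "d \<in> borel_measurable borel"
    proof -
      have "\<forall>b\<in>Basis. \<exists>B. \<forall>x. \<bar>pdiff b \<phi> x\<bar> \<le> B"
        using test_bounded[OF test_pdiff[OF \<phi>]] by metis
      then obtain C where C: "\<And>b x. b \<in> Basis \<Longrightarrow> \<bar>pdiff b \<phi> x\<bar> \<le> C b" by metis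
      have "\<bar>d x\<bar> \<le> (\<Sum>b\<in>Basis. \<bar>- h \<bullet> b\<bar> * C b)" for x
        unfolding d_def by (intro order_trans[OF sum_abs] sum_mono) (auto simp: abs_mult C intro!: mult_left_mono)
      then show "\<exists>B. \<forall>x. \<bar>d x\<bar> \<le> B" by blast
      show "d \<in> borel_measurable borel"
        unfolding d_def using test_borel[OF test_pdiff[OF \<phi>]] by measurable
    qed
    then obtain B' where B': "\<And>x. \<bar>d x\<bar> \<le> B'" by blast
    \<comment> \<open>The support of \<phi> moves from x to x + t h, which stays in E by convexity;
      this is what admits the translate as a test function for the weak gradient on E.\<close>
    have shift_test: "(\<lambda>x. \<phi> (x + t *\<^sub>R (- h))) \<in> test_functions E" if "t \<in> {0..1}" for t
      using seg that by (intro test_translate[OF \<phi>]) auto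
    have inner: "(\<integral>x. \<phi> x *\<^sub>R H h (x + t *\<^sub>R h) \<partial>lborel) = (\<integral>x. d (x + t *\<^sub>R (- h)) *\<^sub>R g x \<partial>lborel)"
      if t: "t \<in> {0..1}" for t
    proof -
      let ?\<psi> = "\<lambda>x. \<phi> (x + t *\<^sub>R (- h))"
      have "(\<integral>x. \<phi> x *\<^sub>R H h (x + t *\<^sub>R h) \<partial>lborel) = (\<integral>x. ?\<psi> x *\<^sub>R H h x \<partial>lborel)"
        using integral_lborel_shift[of "\<lambda>x. \<phi> x *\<^sub>R H h (x + t *\<^sub>R h)" "t *\<^sub>R (- h)"] by simp
      also have "\<dots> = (\<Sum>b\<in>Basis. (h \<bullet> b) *\<^sub>R (\<integral>x. ?\<psi> x *\<^sub>R G b x \<partial>lborel))"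
      proof -
        have "(\<integral>x. ?\<psi> x *\<^sub>R H h x \<partial>lborel) = (\<integral>x. (\<Sum>b\<in>Basis. (h \<bullet> b) *\<^sub>R (?\<psi> x *\<^sub>R G b x)) \<partial>lborel)"
          by (simp add: H_def scaleR_sum_right mult.commute)
        also have "\<dots> = (\<Sum>b\<in>Basis. \<integral>x. (h \<bullet> b) *\<^sub>R (?\<psi> x *\<^sub>R G b x) \<partial>lborel)"
          by (intro Bochner_Integration.integral_sum integrable_scaleR_right
              test_scaleR_integrable[OF shift_test[OF t]] Gi)
        finally show ?thesis by (simp only: integral_scaleR_right)
      qed
      also have "\<dots> = (\<Sum>b\<in>Basis. (- h \<bullet> b) *\<^sub>R (\<integral>x. pdiff b ?\<psi> x *\<^sub>R g x \<partial>lborel))"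
        using Gw[OF _ shift_test[OF t]] by (intro sum.cong) auto
      also have "\<dots> = (\<integral>x. (\<Sum>b\<in>Basis. (- h \<bullet> b) *\<^sub>R (pdiff b ?\<psi> x *\<^sub>R g x)) \<partial>lborel)"
      proof -
        have "(\<integral>x. (\<Sum>b\<in>Basis. (- h \<bullet> b) *\<^sub>R (pdiff b ?\<psi> x *\<^sub>R g x)) \<partial>lborel)
          = (\<Sum>b\<in>Basis. \<integral>x. (- h \<bullet> b) *\<^sub>R (pdiff b ?\<psi> x *\<^sub>R g x) \<partial>lborel)"
          by (intro Bochner_Integration.integral_sum integrable_scaleR_right
              test_scaleR_integrable[OF test_pdiff[OF shift_test[OF t]]] g)
        then show ?thesis by (simp only: integral_scaleR_right)
      qed
      also have "\<dots> = (\<integral>x. d (x + t *\<^sub>R (- h)) *\<^sub>R g x \<partial>lborel)"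
        by (simp only: pdiff_translate[OF test_Ck[OF \<phi>]] d_def scaleR_sum_left scaleR_scaleR)
      finally show ?thesis .
    qed
    have "(\<integral>x. \<phi> x *\<^sub>R F x \<partial>lborel) = (\<integral>x. (\<integral>t. indicator {0..1::real} t *\<^sub>R \<phi> x *\<^sub>R H h (x + t *\<^sub>R h) \<partial>lborel) \<partial>lborel)"
      unfolding F_def by (simp add: mult.commute flip: integral_scaleR_right)
    also have "\<dots> = (\<integral>t. (\<integral>x. indicator {0..1::real} t *\<^sub>R \<phi> x *\<^sub>R H h (x + t *\<^sub>R h) \<partial>lborel) \<partial>lborel)"
      using lborel_pair.Fubini_integral[OF pair[of \<phi> B]] B by simp
    also have "\<dots> = (\<integral>t. (\<integral>x. indicator {0..1::real} t *\<^sub>R d (x + t *\<^sub>R (- h)) *\<^sub>R g x \<partial>lborel) \<partial>lborel)"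
      unfolding integral_scaleR_right
      by (rule Bochner_Integration.integral_cong[OF refl]) (use inner in \<open>auto simp: indicator_def\<close>)
    also have "\<dots> = (\<integral>x. (\<integral>t. indicator {0..1::real} t *\<^sub>R d (x + t *\<^sub>R (- h)) *\<^sub>R g x \<partial>lborel) \<partial>lborel)"
      using lborel_pair.Fubini_integral[OF integrable_segment[OF g, where k=d and B=B' and h="- h"]] B' by simp
    also have "\<dots> = (\<integral>x. (\<phi> (x + (- h)) - \<phi> x) *\<^sub>R g x \<partial>lborel)"
    proof (intro Bochner_Integration.integral_cong refl)
      fix x
      have di: "integrable lborel (\<lambda>t. indicator {0..1::real} t *\<^sub>R d (x + t *\<^sub>R (- h)))"
      proof (rule Bochner_Integration.integrable_bound)
        show "integrable lborel (\<lambda>t. indicator {0..1::real} t *\<^sub>R B')"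
          by (intro integrable_scaleR_left integrable_real_indicator) auto
      qed (use B' in \<open>auto simp: indicator_def intro!: AE_I2 order_trans[OF _ abs_ge_self]\<close>)
      have "(\<integral>t. indicator {0..1::real} t *\<^sub>R d (x + t *\<^sub>R (- h)) *\<^sub>R g x \<partial>lborel)
          = (\<integral>t. (indicator {0..1::real} t *\<^sub>R d (x + t *\<^sub>R (- h))) *\<^sub>R g x \<partial>lborel)"
        by simp
      also have "\<dots> = (\<integral>t. indicator {0..1::real} t *\<^sub>R d (x + t *\<^sub>R (- h)) \<partial>lborel) *\<^sub>R g x"
        using di by (intro integral_scaleR_left) auto
      also have "(\<integral>t. indicator {0..1::real} t *\<^sub>R d (x + t *\<^sub>R (- h)) \<partial>lborel) = \<phi> (x + (- h)) - \<phi> x"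
        using test_segment_FTC[OF \<phi>, of "- h" x] by (simp only: d_def)
      finally show "(\<integral>t. indicator {0..1::real} t *\<^sub>R d (x + t *\<^sub>R (- h)) *\<^sub>R g x \<partial>lborel)
          = (\<phi> (x + (- h)) - \<phi> x) *\<^sub>R g x" .
    qed
    also have "\<dots> = (\<integral>x. \<phi> (x + (- h)) *\<^sub>R g x \<partial>lborel) - (\<integral>x. \<phi> x *\<^sub>R g x \<partial>lborel)"
      using shift_test[of 1]
      by (simp add: scaleR_diff_left test_scaleR_integrable[OF _ g] \<phi>
          Bochner_Integration.integral_diff[OF test_scaleR_integrable[OF _ g] test_scaleR_integrable[OF \<phi> g]])
    also have "(\<integral>x. \<phi> (x + (- h)) *\<^sub>R g x \<partial>lborel) = (\<integral>x. \<phi> x *\<^sub>R g (x + h) \<partial>lborel)"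
      using integral_lborel_shift[of "\<lambda>x. \<phi> x *\<^sub>R g (x + h)" "- h"] by simp
    finally show "(\<integral>x. \<phi> x *\<^sub>R (g (x + h) - g x - F x) \<partial>lborel) = 0"
      using \<phi> g Fi integrable_lborel_shift[OF g]
      by (simp add: scaleR_diff_right test_scaleR_integrable)
  qed fact
  moreover have "AE x in lborel. integrable lborel (\<lambda>t. indicator {0..1::real} t *\<^sub>R H h (x + t *\<^sub>R h))"
    using lborel_pair.AE_integrable_fst'[OF pair1] by simp
  ultimately show ?thesis
    by eventually_elim (auto simp: U_def F_def)
qed

text \<open>Iterated Cauchy-Schwarz against the constant 1 gives Jensen's inequality for exponents
  that are powers of 2; this is why exponents below are written as 2 ^ k.\<close>

lemma nn_integral_power_le:
  fixes f :: "'a \<Rightarrow> ennreal"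
  assumes [measurable]: "f \<in> borel_measurable M" and M: "emeasure M (space M) \<le> 1"
  shows "(\<integral>\<^sup>+x. f x \<partial>M) ^ (2 ^ k) \<le> (\<integral>\<^sup>+x. f x ^ (2 ^ k) \<partial>M)"
proof (induction k)
  case (Suc k)
  have "(\<integral>\<^sup>+x. f x \<partial>M) ^ (2 ^ Suc k) = ((\<integral>\<^sup>+x. f x \<partial>M) ^ (2 ^ k))\<^sup>2"
    by (simp add: power_mult[symmetric] mult.commute)
  also have "\<dots> \<le> (\<integral>\<^sup>+x. f x ^ (2 ^ k) \<partial>M)\<^sup>2"
    using Suc by (intro power_mono) auto
  also have "\<dots> \<le> (\<integral>\<^sup>+x. (f x ^ (2 ^ k))\<^sup>2 \<partial>M) * (\<integral>\<^sup>+x. 1\<^sup>2 \<partial>M)"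
    using Cauchy_Schwarz_nn_integral[of "\<lambda>x. f x ^ (2 ^ k)" M "\<lambda>_. 1"] by simp
  also have "\<dots> \<le> (\<integral>\<^sup>+x. (f x ^ (2 ^ k))\<^sup>2 \<partial>M) * 1"
    using M by (intro mult_left_mono) auto
  finally show ?case by (simp add: power_mult[symmetric] mult.commute)
qed simp

lemma ennreal_term_le_suminf: "f n \<le> (\<Sum>n. f n :: ennreal)"
  using sum_le_suminf[OF summableI, of "{n}" f] by simp

text \<open>Dyadic shells: on R / 2^(k+1) < |x| <= R / 2^k the function is at most c k, and the ball
  of radius R / 2^k has volume proportional to (R / 2^k)^d. The products form a geometric series of
  ratio 2^(a - d) < 1.\<close>

lemma nn_integral_powr_cball_finite:
  fixes a :: real
  assumes a: "0 \<le> a" "a < DIM('a)" and R: "R > 0"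
  shows "(\<integral>\<^sup>+x. indicator (cball 0 R) x * ennreal (norm (x::'a::euclidean_space) powr (- a)) \<partial>lborel) < \<infinity>"
proof -
  let ?d = "DIM('a)"
  define c where "c k = (R / 2 ^ Suc k) powr (- a)" for k :: nat
  have le: "indicator (cball 0 R) x * ennreal (norm x powr (- a))
      \<le> (\<Sum>k. indicator (cball 0 (R / 2 ^ k)) x * ennreal (c k))" for x :: 'a
  proof (cases "x = 0 \<or> x \<notin> cball 0 R")
    \<comment> \<open>At x = 0 the left side is 0, because 0 powr (- a) is 0.\<close>
    case True
    then show ?thesis by auto
  next
    case False
    then have x: "x \<noteq> 0" "norm x \<le> R" by auto
    \<comment> \<open>The least index provides both sides of the shell: |x| <= R / 2^k comes from
      minimality.\<close>
    define k where "k = (LEAST k. R / 2 ^ Suc k < norm x)"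
    have "\<exists>k. R / 2 ^ Suc k < norm x"
    proof -
      have "(\<lambda>k. R * (1/2) ^ Suc k) \<longlonglongrightarrow> R * 0"
        by (intro tendsto_intros LIMSEQ_Suc LIMSEQ_realpow_zero) auto
      then have "eventually (\<lambda>k. R * (1/2) ^ Suc k < norm x) sequentially"
        by (rule order_tendstoD(2)) (use x(1) in simp)
      then show ?thesis
        by (auto simp: eventually_sequentially power_divide)
    qed
    then have k1: "R / 2 ^ Suc k < norm x"
      unfolding k_def by (rule LeastI_ex)
    have k2: "norm x \<le> R / 2 ^ k"
    proof (cases k)
      case (Suc j)
      then have "\<not> R / 2 ^ Suc j < norm x"
        using not_less_Least[of j "\<lambda>k. R / 2 ^ Suc k < norm x"] unfolding k_def by simp
      then show ?thesis using Suc by simp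
    qed (use x in simp)
    have "norm x powr (- a) \<le> c k"
      unfolding c_def using k1 R a by (intro powr_mono2') auto
    then have "indicator (cball 0 R) x * ennreal (norm x powr (- a)) \<le> indicator (cball 0 (R / 2 ^ k)) x * ennreal (c k)"
      using x k2 by (simp add: ennreal_leI)
    also have "\<dots> \<le> (\<Sum>k. indicator (cball 0 (R / 2 ^ k)) x * ennreal (c k))"
      by (rule ennreal_term_le_suminf)
    finally show ?thesis .
  qed
  define V where "V = unit_ball_vol (real ?d)"
  define K where "K = R powr (- a) * 2 powr a * V * R ^ ?d"
  have shell: "ennreal (c k) * emeasure lborel (cball (0::'a) (R / 2 ^ k)) = ennreal (K * (2 powr (a - ?d)) ^ k)" for k
  proof -
    have "c k * (V * (R / 2 ^ k) ^ ?d) = K * (2 powr (a - ?d)) ^ k"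
    proof -
      have "c k = R powr (- a) * (2 ^ Suc k) powr a"
        unfolding c_def using R by (simp add: powr_divide powr_minus field_simps)
      also have "(2 ^ Suc k) powr a = 2 powr a * (2 powr a) ^ k"
        by (simp add: powr_mult powr_power powr_realpow[symmetric] powr_powr mult.commute)
      finally have c: "c k = R powr (- a) * 2 powr a * (2 powr a) ^ k" by simp
      have "(R / 2 ^ k) ^ ?d = R ^ ?d / (2 ^ ?d) ^ k"
        by (simp add: power_divide power_mult[symmetric] mult.commute)
      moreover have "(2 powr (a - ?d)) ^ k = (2 powr a) ^ k / (2 ^ ?d) ^ k"
        by (simp add: powr_diff powr_realpow power_divide)
      ultimately show ?thesis by (simp add: c K_def)
    qed
    moreover have "emeasure lborel (cball (0::'a) (R / 2 ^ k)) = ennreal (V * (R / 2 ^ k) ^ ?d)"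
      using R by (simp add: emeasure_cball V_def)
    ultimately show ?thesis
      by (simp add: c_def V_def flip: ennreal_mult')
  qed
  have "(\<integral>\<^sup>+x. indicator (cball 0 R) x * ennreal (norm (x::'a) powr (- a)) \<partial>lborel)
      \<le> (\<integral>\<^sup>+x. (\<Sum>k. indicator (cball 0 (R / 2 ^ k)) x * ennreal (c k)) \<partial>(lborel::'a measure))"
    by (intro nn_integral_mono le)
  also have "\<dots> = (\<Sum>k. \<integral>\<^sup>+x. indicator (cball 0 (R / 2 ^ k)) x * ennreal (c k) \<partial>(lborel::'a measure))"
    by (intro nn_integral_suminf borel_measurable_times_ennreal borel_measurable_indicator) auto
  also have "\<dots> = (\<Sum>k. ennreal (K * (2 powr (a - ?d)) ^ k))"
  proof (rule arg_cong[of _ _ suminf], rule ext)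
    fix k
    have "(\<integral>\<^sup>+x. indicator (cball 0 (R / 2 ^ k)) x * ennreal (c k) \<partial>(lborel::'a measure))
        = emeasure lborel (cball (0::'a) (R / 2 ^ k)) * ennreal (c k)"
      by (subst nn_integral_multc) (auto intro!: borel_measurable_indicator)
    then show "(\<integral>\<^sup>+x. indicator (cball 0 (R / 2 ^ k)) x * ennreal (c k) \<partial>(lborel::'a measure))
        = ennreal (K * (2 powr (a - ?d)) ^ k)"
      using shell[of k] by (simp only: mult.commute)
  qed
  also have "\<dots> < \<infinity>"
  proof -
    have "(2::real) powr (a - ?d) < 2 powr 0" using a by (intro powr_less_mono) auto
    then have "summable (\<lambda>k. K * (2 powr (a - ?d)) ^ k)"
      by (intro summable_mult summable_geometric) simp
    moreover have "0 \<le> K" using R by (simp add: K_def V_def)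
    ultimately show ?thesis
      by (simp add: suminf_ennreal2)
  qed
  finally show ?thesis .
qed

text \<open>The segment formula is raised to the power 2^k by Jensen over t in [0,1], and the
  integrals over x and t are exchanged. By convexity x + t h remains in E, so every t contributes at
  most the same integral of the gradient over E.\<close>

lemma translation_estimate:
  fixes g :: "'a::euclidean_space \<Rightarrow> 'b::euclidean_space"
  assumes E: "open E" "convex E" and G: "has_weak_grad E g G"
  shows "(\<integral>\<^sup>+x. indicator E x * indicator E (x + h) * ennreal (norm (g (x + h) - g x) ^ (2 ^ k)) \<partial>lborel)
    \<le> ennreal (norm h ^ (2 ^ k)) * (\<integral>\<^sup>+x. indicator E x * ennreal ((\<Sum>b\<in>Basis. norm (G b x)) ^ (2 ^ k)) \<partial>lborel)"
proof -
  define \<Gamma> where "\<Gamma> x = (\<Sum>b\<in>Basis. norm (G b x))" for x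
  have g: "integrable lborel g" and Gi: "\<And>b. b \<in> Basis \<Longrightarrow> integrable lborel (G b)"
    using G by (auto simp: has_weak_grad_def)
  have [measurable]: "G b \<in> borel_measurable borel" if "b \<in> Basis" for b
    using borel_measurable_integrable[OF Gi[OF that]] by simp
  have [measurable]: "E \<in> sets borel" using E by simp
  note [measurable] = borel_measurable_integrable[OF g]
  have [measurable]: "\<Gamma> \<in> borel_measurable borel" unfolding \<Gamma>_def by measurable
  have \<Gamma>0: "0 \<le> \<Gamma> x" for x by (auto simp: \<Gamma>_def intro: sum_nonneg)
  define H where "H y = (\<Sum>b\<in>Basis. (h \<bullet> b) *\<^sub>R G b y)" for y
  have H\<Gamma>: "norm (H y) \<le> norm h * \<Gamma> y" for y
    unfolding H_def \<Gamma>_def sum_distrib_left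
    by (intro sum_norm_le) (auto simp: Basis_le_norm intro!: mult_right_mono)
  let ?p = "2 ^ k :: nat"
  let ?I = "restrict_space lborel {0..1::real}"
  have key: "indicator E x * indicator E (x + h) * ennreal (norm (g (x + h) - g x) ^ ?p)
      \<le> (\<integral>\<^sup>+t. indicator {0..1::real} t * (indicator E (x + t *\<^sub>R h) * ennreal (norm h ^ ?p) * ennreal (\<Gamma> (x + t *\<^sub>R h) ^ ?p)) \<partial>lborel)"
    if int: "x \<in> E \<and> x + h \<in> E \<longrightarrow>
     integrable lborel (\<lambda>t. indicator {0..1::real} t *\<^sub>R H (x + t *\<^sub>R h)) \<and>
     g (x + h) - g x = (\<integral>t. indicator {0..1::real} t *\<^sub>R H (x + t *\<^sub>R h) \<partial>lborel)" for x
  proof (cases "x \<in> E \<and> x + h \<in> E")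
    case True
    have seg: "x + t *\<^sub>R h \<in> E" if "t \<in> {0..1}" for t
    proof -
      have "(1 - t) *\<^sub>R x + t *\<^sub>R (x + h) \<in> E"
        using that E True by (intro convexD_alt) auto
      then show ?thesis by (simp add: algebra_simps)
    qed
    have "ennreal (norm (g (x + h) - g x)) \<le> (\<integral>\<^sup>+t. ennreal (norm (indicator {0..1::real} t *\<^sub>R H (x + t *\<^sub>R h))) \<partial>lborel)"
      using int True by (simp only:) (intro integral_norm_bound_ennreal, simp)
    also have "\<dots> \<le> (\<integral>\<^sup>+t. ennreal (norm h * \<Gamma> (x + t *\<^sub>R h)) * indicator {0..1::real} t \<partial>lborel)"
      using H\<Gamma> by (intro nn_integral_mono) (auto simp: indicator_def ennreal_leI)
    also have "\<dots> = (\<integral>\<^sup>+t. ennreal (norm h * \<Gamma> (x + t *\<^sub>R h)) \<partial>?I)"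
      by (simp add: nn_integral_restrict_space)
    finally have "ennreal (norm (g (x + h) - g x)) ^ ?p \<le> (\<integral>\<^sup>+t. ennreal (norm h * \<Gamma> (x + t *\<^sub>R h)) \<partial>?I) ^ ?p"
      by (intro power_mono) auto
    also have "\<dots> \<le> (\<integral>\<^sup>+t. ennreal (norm h * \<Gamma> (x + t *\<^sub>R h)) ^ ?p \<partial>?I)"
      by (intro nn_integral_power_le measurable_restrict_space1)
        (auto simp: emeasure_restrict_space space_restrict_space)
    also have "\<dots> = (\<integral>\<^sup>+t. indicator {0..1::real} t * (indicator E (x + t *\<^sub>R h) * ennreal (norm h ^ ?p) * ennreal (\<Gamma> (x + t *\<^sub>R h) ^ ?p)) \<partial>lborel)"
      using seg \<Gamma>0 by (subst nn_integral_restrict_space)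
        (auto simp: ennreal_power power_mult_distrib ennreal_mult indicator_def intro!: nn_integral_cong)
    finally show ?thesis using True by (simp add: ennreal_power)
  qed auto
  have "(\<integral>\<^sup>+x. indicator E x * indicator E (x + h) * ennreal (norm (g (x + h) - g x) ^ ?p) \<partial>lborel)
    \<le> (\<integral>\<^sup>+x. (\<integral>\<^sup>+t. indicator {0..1::real} t * (indicator E (x + t *\<^sub>R h) * ennreal (norm h ^ ?p) * ennreal (\<Gamma> (x + t *\<^sub>R h) ^ ?p)) \<partial>lborel) \<partial>lborel)"
    using weak_grad_segment[OF E G, of h] unfolding H_def[symmetric]
    by (intro nn_integral_mono_AE) (auto elim!: eventually_mono intro: key)
  also have "\<dots> = (\<integral>\<^sup>+t. (\<integral>\<^sup>+x. indicator {0..1::real} t * (indicator E (x + t *\<^sub>R h) * ennreal (norm h ^ ?p) * ennreal (\<Gamma> (x + t *\<^sub>R h) ^ ?p)) \<partial>lborel) \<partial>lborel)"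
    by (rule lborel_pair.Fubini') measurable
  also have "\<dots> = (\<integral>\<^sup>+t. indicator {0..1::real} t * (\<integral>\<^sup>+x. indicator E x * ennreal (norm h ^ ?p) * ennreal (\<Gamma> x ^ ?p) \<partial>lborel) \<partial>lborel)"
    by (simp add: nn_integral_cmult nn_integral_lborel_shift[of "\<lambda>x. indicator E x * ennreal (norm h ^ ?p) * ennreal (\<Gamma> x ^ ?p)"])
  also have "\<dots> = (\<integral>\<^sup>+x. indicator E x * ennreal (norm h ^ ?p) * ennreal (\<Gamma> x ^ ?p) \<partial>lborel)"
    by (subst nn_integral_multc) auto
  also have "\<dots> = ennreal (norm h ^ ?p) * (\<integral>\<^sup>+x. indicator E x * ennreal (\<Gamma> x ^ ?p) \<partial>lborel)"
    by (subst nn_integral_cmult[symmetric]) (auto simp: mult_ac)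
  finally show ?thesis unfolding \<Gamma>_def .
qed

text \<open>In the variable h = y - x the translation estimate gains |h|^(2^k), which leaves the
  kernel |h|^(-(d - 1/2)); the 1/2 in the exponent is the slack that makes it integrable near 0.
  With p = 2^k the seminorm has order 1 - 1/(2p), that is 3/4 for p = 2 and 7/8 for p = 4.\<close>

lemma slobodeckij_le_gradient:
  fixes E :: "'a::euclidean_space set"
  assumes E: "open E" "convex E" "bounded E"
  shows "\<exists>C\<ge>0. \<forall>(g :: 'a \<Rightarrow> 'b::euclidean_space) G. has_weak_grad E g G \<longrightarrow>
    (\<integral>\<^sup>+x. \<integral>\<^sup>+y. indicator E x * indicator E y *
        ennreal (norm (g x - g y) ^ (2 ^ k) / norm (x - y) powr (DIM('a) + 2 ^ k - 1/2)) \<partial>lborel \<partial>lborel)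
      \<le> ennreal C * (\<integral>\<^sup>+x. indicator E x * ennreal ((\<Sum>b\<in>Basis. norm (G b x)) ^ (2 ^ k)) \<partial>lborel)"
proof -
  let ?d = "DIM('a)" and ?p = "2 ^ k :: nat"
  obtain R where R: "R > 0" "\<And>x y. x \<in> E \<Longrightarrow> y \<in> E \<Longrightarrow> norm (x - y) \<le> R"
  proof -
    obtain r where r: "\<And>x. x \<in> E \<Longrightarrow> norm x \<le> r" "r > 0" using E(3) by (auto simp: bounded_pos)
    have "norm (x - y) \<le> r + r" if "x \<in> E" "y \<in> E" for x y
      using norm_triangle_ineq4[of x y] r(1)[OF that(1)] r(1)[OF that(2)] by linarith
    then show ?thesis using that[of "r + r"] r by auto
  qed
  define C where "C = (\<integral>\<^sup>+h. indicator (cball 0 R) h * ennreal (norm (h::'a) powr (- (?d - 1/2))) \<partial>lborel)"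
  have d1: "1 \<le> real ?d"
    by (metis DIM_ge_Suc0 One_nat_def of_nat_1 of_nat_mono)
  have "C < \<infinity>" unfolding C_def
    by (rule nn_integral_powr_cball_finite[where R=R and a="real DIM('a) - 1/2" and 'a='a]) (use R d1 in linarith)+
  then have C: "C = ennreal (enn2real C)" by (simp add: less_top)
  have [measurable]: "E \<in> sets borel" using E by simp
  have "(\<integral>\<^sup>+x. \<integral>\<^sup>+y. indicator E x * indicator E y *
        ennreal (norm (g x - g y) ^ ?p / norm (x - y) powr (?d + 2 ^ k - 1/2)) \<partial>lborel \<partial>lborel)
      \<le> C * (\<integral>\<^sup>+x. indicator E x * ennreal ((\<Sum>b\<in>Basis. norm (G b x)) ^ ?p) \<partial>lborel)"
    if G: "has_weak_grad E g G" for g :: "'a \<Rightarrow> 'b" and G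
  proof -
    have g: "integrable lborel g" using G by (auto simp: has_weak_grad_def)
    note [measurable] = borel_measurable_integrable[OF g]
    define w where "w h = ennreal (1 / norm (h::'a) powr (?d + 2 ^ k - 1/2))" for h
    have [measurable]: "w \<in> borel_measurable borel" unfolding w_def by measurable
    let ?S = "\<integral>\<^sup>+x. indicator E x * ennreal ((\<Sum>b\<in>Basis. norm (G b x)) ^ ?p) \<partial>lborel"
    have "(\<integral>\<^sup>+x. \<integral>\<^sup>+y. indicator E x * indicator E y *
        ennreal (norm (g x - g y) ^ ?p / norm (x - y) powr (?d + 2 ^ k - 1/2)) \<partial>lborel \<partial>lborel)
      = (\<integral>\<^sup>+x. \<integral>\<^sup>+h. w h * (indicator E x * indicator E (x + h) * ennreal (norm (g (x + h) - g x) ^ ?p)) \<partial>lborel \<partial>lborel)"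
    proof (rule nn_integral_cong)
      fix x :: 'a
      let ?f = "\<lambda>y. indicator E x * indicator E y *
        ennreal (norm (g x - g y) ^ ?p / norm (x - y) powr (?d + 2 ^ k - 1/2))"
      have "(\<integral>\<^sup>+y. ?f y \<partial>lborel) = (\<integral>\<^sup>+h. ?f (h + x) \<partial>lborel)"
        by (rule nn_integral_lborel_shift[symmetric]) measurable
      also have "\<dots> = (\<integral>\<^sup>+h. w h * (indicator E x * indicator E (x + h) * ennreal (norm (g (x + h) - g x) ^ ?p)) \<partial>lborel)"
        by (intro nn_integral_cong)
          (auto simp: w_def norm_minus_commute add.commute ennreal_mult[symmetric] indicator_def)
      finally show "(\<integral>\<^sup>+y. ?f y \<partial>lborel) = \<dots>" .
    qed
    also have "\<dots> = (\<integral>\<^sup>+h. \<integral>\<^sup>+x. w h * (indicator E x * indicator E (x + h) * ennreal (norm (g (x + h) - g x) ^ ?p)) \<partial>lborel \<partial>lborel)"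
      by (rule lborel_pair.Fubini') measurable
    also have "\<dots> = (\<integral>\<^sup>+h. w h * (\<integral>\<^sup>+x. indicator E x * indicator E (x + h) * ennreal (norm (g (x + h) - g x) ^ ?p) \<partial>lborel) \<partial>lborel)"
      by (intro nn_integral_cong nn_integral_cmult) measurable
    also have "\<dots> \<le> (\<integral>\<^sup>+h. indicator (cball 0 R) h * ennreal (norm (h::'a) powr (- (?d - 1/2))) * ?S \<partial>lborel)"
    proof (intro nn_integral_mono)
      fix h :: 'a
      show "w h * (\<integral>\<^sup>+x. indicator E x * indicator E (x + h) * ennreal (norm (g (x + h) - g x) ^ ?p) \<partial>lborel)
         \<le> indicator (cball 0 R) h * ennreal (norm h powr (- (?d - 1/2))) * ?S"
      proof (cases "h \<in> cball 0 R")
        case False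
        then have "x \<notin> E \<or> x + h \<notin> E" for x
          using R(2)[of "x + h" x] by auto
        then have "indicator E x * indicator E (x + h) * c = (0::ennreal)" for x c
          by (auto simp: indicator_def)
        then show ?thesis by (simp only:) simp
      next
        case True
        have "w h * (\<integral>\<^sup>+x. indicator E x * indicator E (x + h) * ennreal (norm (g (x + h) - g x) ^ ?p) \<partial>lborel)
            \<le> w h * (ennreal (norm h ^ ?p) * ?S)"
          by (intro mult_left_mono translation_estimate E G) auto
        also have "\<dots> = ennreal (norm h ^ ?p / norm h powr (?d + 2 ^ k - 1/2)) * ?S"
          by (simp add: w_def mult.assoc[symmetric] ennreal_mult[symmetric])
        also have "norm h ^ ?p / norm h powr (?d + 2 ^ k - 1/2) = norm h powr (- (?d - 1/2))"
        proof (cases "h = 0")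
          case False
          then have "norm h ^ ?p = norm h powr (2 ^ k)"
            by (subst powr_realpow[symmetric]) auto
          then have "norm h ^ ?p / norm h powr (?d + 2 ^ k - 1/2) = norm h powr (2 ^ k - (?d + 2 ^ k - 1/2))"
            by (simp only: powr_diff)
          then show ?thesis by simp
        qed simp
        finally show ?thesis using True by simp
      qed
    qed
    also have "\<dots> = C * ?S"
      unfolding C_def
      by (rule nn_integral_multc) (auto intro!: borel_measurable_times_ennreal borel_measurable_indicator)
    finally show ?thesis .
  qed
  then show ?thesis
    using C by (intro exI[of _ "enn2real C"]) auto
qed

section \<open>Sobolev embeddings on bounded convex sets\<close>

lemma ennreal_power_le_imp_le:
  fixes x y :: ennreal
  assumes "x ^ n \<le> y ^ n" "n > 0"
  shows "x \<le> y"
proof (rule ccontr)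
  assume "\<not> x \<le> y"
  then have less: "y < x" by simp
  then obtain b where b: "y = ennreal b" "0 \<le> b" by (cases y) auto
  show False
  proof (cases x)
    case (real a)
    then have "b ^ n < a ^ n"
      using less b assms(2) by (intro power_strict_mono) (auto simp: ennreal_less_iff)
    then have "y ^ n < x ^ n"
      using real b by (simp add: ennreal_power ennreal_less_iff)
    then show False using assms by simp
  next
    case top
    then have "x ^ n = top" using assms(2) by (simp add: power_eq_top_ennreal)
    then show False using assms(1) b by (simp add: ennreal_power top_unique)
  qed
qed

lemma ennreal_add_power_le: "(x + y) ^ n \<le> 2 ^ n * (x ^ n + y ^ n :: ennreal)"
proof -
  have "x + y \<le> 2 * max x y" by (simp add: mult_2 add_mono)
  then have "(x + y) ^ n \<le> 2 ^ n * max x y ^ n"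
    by (metis power_mono power_mult_distrib zero_le)
  also have "max x y ^ n \<le> x ^ n + y ^ n"
    by (auto simp: max_def add_increasing add_increasing2)
  then have "2 ^ n * max x y ^ n \<le> 2 ^ n * (x ^ n + y ^ n)"
    by (rule mult_left_mono) simp
  finally show ?thesis .
qed

lemma nn_integral_lborel_affine:
  fixes f :: "'a::euclidean_space \<Rightarrow> ennreal"
  assumes [measurable]: "f \<in> borel_measurable borel" and c: "c \<noteq> 0"
  shows "(\<integral>\<^sup>+x. f x \<partial>lborel) = ennreal (\<bar>c\<bar> ^ DIM('a)) * (\<integral>\<^sup>+x. f (t + c *\<^sub>R x) \<partial>lborel)"
  by (subst lborel_affine[OF c, of t])
    (simp add: nn_integral_density nn_integral_distr nn_integral_cmult)

text \<open>For a = d + p s this is the p-th power of the Slobodeckij seminorm of order s. The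
  measure is a parameter because the estimates are proved for the normalised measure of a convex
  set.\<close>

definition slobodeckij :: "'a::euclidean_space measure \<Rightarrow> nat \<Rightarrow> real \<Rightarrow> ('a \<Rightarrow> 'b::real_normed_vector) \<Rightarrow> ennreal" where
  "slobodeckij M p a g = (\<integral>\<^sup>+x. \<integral>\<^sup>+y. ennreal (norm (g x - g y) ^ p / norm (x - y) powr a) \<partial>M \<partial>M)"

text \<open>On pairs at distance at most r the factor |x - y|^(-a) is at least r^(-a); this is how
  averages over small copies are turned into the seminorm. For x = y both sides vanish because p >
  0.\<close>

lemma difference_le_kernel:
  assumes "norm (x - y) \<le> r" "0 \<le> a" "p > 0"
  shows "ennreal (norm (g x - g y) ^ p) \<le> ennreal (r powr a) * ennreal (norm (g x - g y) ^ p / norm (x - y) powr a)"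
proof (cases "x = y")
  case False
  then have "norm (x - y) powr a \<le> r powr a" "0 < norm (x - y) powr a"
    using assms by (auto intro: powr_mono2)
  then have "norm (g x - g y) ^ p \<le> r powr a * (norm (g x - g y) ^ p / norm (x - y) powr a)"
    by (simp add: field_simps mult_right_mono)
  then show ?thesis by (simp add: ennreal_mult[symmetric] ennreal_leI)
qed (use assms in auto)

section \<open>Averages over contracted copies of a bounded convex open set\<close>

locale convex_region =
  fixes E :: "'a::euclidean_space set"
  assumes open_E: "open E" and convex_E: "convex E" and bounded_E: "bounded E" and nonempty_E: "E \<noteq> {}"
begin

text \<open>Total mass 1 lets Jensen's inequality hold without a constant and makes integrals
  averages.\<close>

definition M where "M = uniform_measure lborel E"

text \<open>Only an upper bound for the distances in E matters; the summand 1 makes its positivity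
  immediate.\<close>

definition R where "R = diameter E + 1"

lemma R_pos: "R > 0" unfolding R_def using diameter_ge_0[OF bounded_E] by linarith

lemma R_bound: "x \<in> E \<Longrightarrow> y \<in> E \<Longrightarrow> norm (x - y) \<le> R"
  using diameter_bounded_bound[OF bounded_E, of x y] by (simp add: R_def dist_norm)

lemma E_borel [measurable]: "E \<in> sets borel" using open_E by simp

lemma emeasure_E: "emeasure lborel E \<noteq> 0" "emeasure lborel E \<noteq> \<infinity>"
proof -
  show "emeasure lborel E \<noteq> \<infinity>" using emeasure_bounded_finite[OF bounded_E] by simp
  show "emeasure lborel E \<noteq> 0"
    using open_not_negligible[OF open_E nonempty_E] open_E
    by (auto simp: negligible_iff_null_sets null_sets_completion_iff dest: null_setsI)
qed

sublocale prob_space M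
  unfolding M_def using emeasure_E by (intro prob_space_uniform_measure) auto

lemma sets_M [measurable_cong, simp]: "sets M = sets borel"
  by (simp add: M_def)

lemma space_M [simp]: "space M = UNIV"
  by (simp add: M_def)

lemma nn_integral_M:
  assumes [measurable]: "f \<in> borel_measurable borel"
  shows "(\<integral>\<^sup>+x. f x \<partial>M) = (\<integral>\<^sup>+x. indicator E x * f x \<partial>lborel) / emeasure lborel E"
  unfolding M_def by (subst nn_integral_uniform_measure) (auto simp: mult.commute)

lemma AE_M: "(AE x in M. x \<in> E)"
  unfolding M_def using emeasure_E by (intro AE_uniform_measureI) auto

lemma nn_integral_M_mono:
  assumes "\<And>x. x \<in> E \<Longrightarrow> f x \<le> g x"
  shows "(\<integral>\<^sup>+x. f x \<partial>M) \<le> (\<integral>\<^sup>+x. g x \<partial>M)"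
  using AE_M by (intro nn_integral_mono_AE) (auto elim!: eventually_mono intro: assms)

lemma contract_in_E:
  assumes "x \<in> E" "z \<in> E" "0 < l" "l \<le> 1"
  shows "x + l *\<^sub>R (z - x) \<in> E" "norm (x + l *\<^sub>R (z - x) - x) \<le> l * R"
proof -
  have "(1 - l) *\<^sub>R x + l *\<^sub>R z \<in> E"
    using assms convex_E by (intro convexD_alt) auto
  then show "x + l *\<^sub>R (z - x) \<in> E" by (simp add: algebra_simps)
  show "norm (x + l *\<^sub>R (z - x) - x) \<le> l * R"
    using assms R_bound[of z x] by (simp add: mult_left_mono)
qed

text \<open>The change of variables y = x + l (z - x) contributes the factor (1/l)^d. Convexity
  keeps the image of E inside E, and the image lies within distance l R of x.\<close>

lemma nn_integral_contract:
  assumes [measurable]: "f \<in> borel_measurable borel" and x: "x \<in> E" and l: "0 < l" "l \<le> 1"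
  shows "(\<integral>\<^sup>+z. f (x + l *\<^sub>R (z - x)) \<partial>M)
    \<le> ennreal ((1 / l) ^ DIM('a)) * (\<integral>\<^sup>+y. indicator (cball x (l * R)) y * f y \<partial>M)"
proof -
  have [measurable]: "cball x (l * R) \<in> sets borel" by simp
  define k where "k y = indicator E y * (indicator (cball x (l * R)) y * f y)" for y
  have [measurable]: "k \<in> borel_measurable borel" unfolding k_def by measurable
  have "(\<integral>\<^sup>+z. indicator E z * f (x + l *\<^sub>R (z - x)) \<partial>lborel) \<le> (\<integral>\<^sup>+z. k ((x - l *\<^sub>R x) + l *\<^sub>R z) \<partial>lborel)"
  proof (rule nn_integral_mono)
    fix z
    have eq: "(x - l *\<^sub>R x) + l *\<^sub>R z = x + l *\<^sub>R (z - x)" by (simp add: algebra_simps)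
    show "indicator E z * f (x + l *\<^sub>R (z - x)) \<le> k ((x - l *\<^sub>R x) + l *\<^sub>R z)"
      using contract_in_E[OF x _ l, of z]
      by (cases "z \<in> E") (auto simp: k_def eq dist_norm norm_minus_commute)
  qed
  also have "\<dots> = ennreal ((1 / l) ^ DIM('a)) * (\<integral>\<^sup>+y. k y \<partial>lborel)"
    using l by (subst nn_integral_lborel_affine[of k l "x - l *\<^sub>R x"])
      (auto simp: mult.assoc[symmetric] ennreal_mult[symmetric] power_divide)
  finally have "(\<integral>\<^sup>+z. indicator E z * f (x + l *\<^sub>R (z - x)) \<partial>lborel) / emeasure lborel E
      \<le> ennreal ((1 / l) ^ DIM('a)) * ((\<integral>\<^sup>+y. k y \<partial>lborel) / emeasure lborel E)"
    by (simp add: ennreal_times_divide divide_right_mono_ennreal)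
  then show ?thesis
    by (simp add: nn_integral_M k_def)
qed

lemma slobodeckij_M:
  fixes g :: "'a \<Rightarrow> 'b::euclidean_space"
  assumes [measurable]: "g \<in> borel_measurable borel"
  shows "slobodeckij M p a g = (\<integral>\<^sup>+x. \<integral>\<^sup>+y. indicator E x * indicator E y *
      ennreal (norm (g x - g y) ^ p / norm (x - y) powr a) \<partial>lborel \<partial>lborel) / emeasure lborel E / emeasure lborel E"
proof -
  have 1: "(\<integral>\<^sup>+y. ennreal (norm (g x - g y) ^ p / norm (x - y) powr a) \<partial>M)
      = (\<integral>\<^sup>+y. indicator E y * ennreal (norm (g x - g y) ^ p / norm (x - y) powr a) \<partial>lborel) / emeasure lborel E" for x
    by (rule nn_integral_M) measurable
  have "slobodeckij M p a g = (\<integral>\<^sup>+x. indicator E x * (\<integral>\<^sup>+y. ennreal (norm (g x - g y) ^ p / norm (x - y) powr a) \<partial>M) \<partial>lborel) / emeasure lborel E"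
    unfolding slobodeckij_def by (rule nn_integral_M) measurable
  also have "\<dots> = (\<integral>\<^sup>+x. (\<integral>\<^sup>+y. indicator E x * indicator E y * ennreal (norm (g x - g y) ^ p / norm (x - y) powr a) \<partial>lborel) / emeasure lborel E \<partial>lborel) / emeasure lborel E"
    unfolding 1
    by (simp add: mult.assoc ennreal_times_divide nn_integral_cmult)
  also have "\<dots> = (\<integral>\<^sup>+x. \<integral>\<^sup>+y. indicator E x * indicator E y *
      ennreal (norm (g x - g y) ^ p / norm (x - y) powr a) \<partial>lborel \<partial>lborel) / emeasure lborel E / emeasure lborel E"
    by (subst nn_integral_divide) auto
  finally show ?thesis .
qed

text \<open>
  Compare \<open>f x\<close> with its averages over the contracted copies \<open>x + l (E - x)\<close> of \<open>E\<close>, where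
  \<open>l = m powr (2 / DIM('a))\<close>.
\<close>

lemma square_le_average:
  fixes f :: "'a \<Rightarrow> real" and s :: real
  assumes [measurable]: "f \<in> borel_measurable borel" and s: "DIM('a) \<le> 4 * s"
    and x: "x \<in> E" and m: "0 < m" "m \<le> 1"
    and Q: "(\<integral>\<^sup>+y. ennreal (f y ^ 4) \<partial>M) \<le> ennreal (Q\<^sup>2)" "0 \<le> Q"
  shows "ennreal ((f x)\<^sup>2) \<le> ennreal (2 * R powr (DIM('a) + 2 * s) * m) *
      (\<integral>\<^sup>+y. ennreal (norm (f x - f y) ^ 2 / norm (x - y) powr (DIM('a) + 2 * s)) \<partial>M) + ennreal (2 * Q / m)"
proof -
  let ?d = "DIM('a)"
  define a where "a = ?d + 2 * s"
  have d: "real ?d > 0" by simp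
  \<comment> \<open>Chosen so that l^(d/2) = m: the average of f^2 over the contracted copy is then
    at most (Q^2 / l^d)^(1/2) = Q / m.\<close>
  define l where "l = m powr (2 / ?d)"
  have l: "0 < l" "l \<le> 1" using m by (auto simp: l_def powr_le_one_le intro: powr_le1)
  have ld: "l powr (?d / 2) = m" using m by (simp add: l_def powr_powr)
  have a0: "0 \<le> a" using s by (simp add: a_def)
  \<comment> \<open>The relation d <= 4 s enters here: l^(2 s) <= l^(d/2) = m because l <=
    1.\<close>
  have l2s: "l powr (2 * s) \<le> m"
    unfolding ld[symmetric] using l s by (intro powr_mono') auto
  let ?y = "\<lambda>z. x + l *\<^sub>R (z - x)"
  let ?G = "\<integral>\<^sup>+y. ennreal (norm (f x - f y) ^ 2 / norm (x - y) powr a) \<partial>M"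
  have I1: "(\<integral>\<^sup>+z. ennreal ((f x - f (?y z))\<^sup>2) \<partial>M) \<le> ennreal (R powr a * m) * ?G"
  proof -
    have "(\<integral>\<^sup>+z. ennreal ((f x - f (?y z))\<^sup>2) \<partial>M) \<le> ennreal ((1 / l) ^ ?d) *
        (\<integral>\<^sup>+y. indicator (cball x (l * R)) y * ennreal ((f x - f y)\<^sup>2) \<partial>M)"
      by (rule nn_integral_contract) (use x l in auto)
    also have "\<dots> \<le> ennreal ((1 / l) ^ ?d) *
        (\<integral>\<^sup>+y. ennreal ((l * R) powr a) * ennreal (norm (f x - f y) ^ 2 / norm (x - y) powr a) \<partial>M)"
    proof (intro mult_left_mono nn_integral_M_mono)
      fix y
      show "indicator (cball x (l * R)) y * ennreal ((f x - f y)\<^sup>2)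
         \<le> ennreal ((l * R) powr a) * ennreal (norm (f x - f y) ^ 2 / norm (x - y) powr a)"
        using difference_le_kernel[of x y "l * R" a 2 f] a0
        by (cases "y \<in> cball x (l * R)") (auto simp: dist_norm)
    qed simp
    also have "\<dots> = ennreal ((1 / l) ^ ?d * (l * R) powr a) * ?G"
      using l by (subst nn_integral_cmult) (auto simp: ennreal_mult mult.assoc)
    also have "(1 / l) ^ ?d * (l * R) powr a = R powr a * l powr (2 * s)"
    proof -
      have "(1 / l) ^ ?d = l powr (- real ?d)"
        using l by (simp add: powr_minus powr_realpow divide_inverse power_inverse)
      moreover have "l powr (- real ?d) * l powr a = l powr (2 * s)"
        by (simp add: a_def powr_add[symmetric])
      moreover have "(l * R) powr a = l powr a * R powr a"
        using l R_pos by (simp add: powr_mult)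
      ultimately show ?thesis by (metis mult.assoc mult.commute)
    qed
    also have "ennreal (R powr a * l powr (2 * s)) * ?G \<le> ennreal (R powr a * m) * ?G"
      using l2s by (intro mult_right_mono ennreal_leI mult_left_mono) auto
    finally show ?thesis .
  qed
  have I2: "(\<integral>\<^sup>+z. ennreal ((f (?y z))\<^sup>2) \<partial>M) \<le> ennreal (Q / m)"
  proof (rule ennreal_power_le_imp_le[of _ 2])
    have "(\<integral>\<^sup>+z. ennreal ((f (?y z))\<^sup>2) \<partial>M)\<^sup>2 \<le> (\<integral>\<^sup>+z. (ennreal ((f (?y z))\<^sup>2))\<^sup>2 \<partial>M)"
      using nn_integral_power_le[of "\<lambda>z. ennreal ((f (?y z))\<^sup>2)" M 1] emeasure_space_1 by simp
    also have "\<dots> = (\<integral>\<^sup>+z. ennreal (f (?y z) ^ 4) \<partial>M)"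
      by (simp add: ennreal_power flip: power_mult)
    also have "\<dots> \<le> ennreal ((1 / l) ^ ?d) * (\<integral>\<^sup>+y. indicator (cball x (l * R)) y * ennreal (f y ^ 4) \<partial>M)"
      by (rule nn_integral_contract) (use x l in auto)
    also have "\<dots> \<le> ennreal ((1 / l) ^ ?d) * (\<integral>\<^sup>+y. ennreal (f y ^ 4) \<partial>M)"
      by (intro mult_left_mono nn_integral_mono) (auto simp: indicator_def)
    also have "\<dots> \<le> ennreal ((1 / l) ^ ?d) * ennreal (Q\<^sup>2)"
      using Q by (intro mult_left_mono) auto
    also have "\<dots> = ennreal (Q / m) ^ 2"
    proof -
      have "l ^ ?d = m\<^sup>2"
      proof -
        have "l ^ ?d = l powr real ?d" using l by (simp add: powr_realpow)
        also have "\<dots> = m powr 2" using d by (simp add: l_def powr_powr)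
        finally show ?thesis using m by (simp add: powr_numeral)
      qed
      then have "(1 / l) ^ ?d * Q\<^sup>2 = (Q / m)\<^sup>2" by (simp add: power_divide)
      then show ?thesis using l m Q by (simp add: ennreal_mult[symmetric] ennreal_power)
    qed
    finally show "(\<integral>\<^sup>+z. ennreal ((f (?y z))\<^sup>2) \<partial>M)\<^sup>2 \<le> ennreal (Q / m) ^ 2" .
  qed simp
  have "ennreal ((f x)\<^sup>2) = (\<integral>\<^sup>+z. ennreal ((f x)\<^sup>2) \<partial>M)"
    by (simp add: emeasure_space_1[simplified])
  also have "\<dots> \<le> (\<integral>\<^sup>+z. 2 * ennreal ((f x - f (?y z))\<^sup>2) + 2 * ennreal ((f (?y z))\<^sup>2) \<partial>M)"
  proof (rule nn_integral_mono)
    fix z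
    \<comment> \<open>The right side minus the left side is the square of f x - 2 f y, with y the
      contracted point.\<close>
    have "(f x)\<^sup>2 \<le> 2 * (f x - f (?y z))\<^sup>2 + 2 * (f (?y z))\<^sup>2"
      using sum_squares_ge_zero[of "f x - 2 * f (?y z)" 0] by (simp add: power2_eq_square algebra_simps)
    then have "ennreal ((f x)\<^sup>2) \<le> ennreal (2 * (f x - f (?y z))\<^sup>2 + 2 * (f (?y z))\<^sup>2)"
      by (rule ennreal_leI)
    then show "ennreal ((f x)\<^sup>2) \<le> 2 * ennreal ((f x - f (?y z))\<^sup>2) + 2 * ennreal ((f (?y z))\<^sup>2)"
      by (simp add: ennreal_mult)
  qed
  also have "\<dots> = 2 * (\<integral>\<^sup>+z. ennreal ((f x - f (?y z))\<^sup>2) \<partial>M) + 2 * (\<integral>\<^sup>+z. ennreal ((f (?y z))\<^sup>2) \<partial>M)"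
    by (simp add: nn_integral_add nn_integral_cmult)
  also have "\<dots> \<le> 2 * (ennreal (R powr a * m) * ?G) + 2 * ennreal (Q / m)"
    by (intro add_mono mult_left_mono I1 I2) auto
  also have "\<dots> = ennreal (2 * R powr a * m) * ?G + ennreal (2 * Q / m)"
  proof -
    have 2: "2 * ennreal r = ennreal (2 * r)" for r
      by (subst ennreal_mult') auto
    show ?thesis by (simp only: 2 mult.assoc[symmetric] times_divide_eq_right)
  qed
  finally show ?thesis by (simp add: a_def)
qed

text \<open>The choice m = 2 B / u^2 makes B / m equal to u^2 / 2, which is absorbed on the left; it
  satisfies m <= 1 exactly if u^2 >= 2 B. Below that threshold u^4 <= 2 B u^2 is immediate.\<close>

lemma fourth_power_bound:
  fixes u A B G :: real
  assumes B: "B > 0" and G: "G \<ge> 0" "A \<ge> 0"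
    and le: "\<And>m. 0 < m \<Longrightarrow> m \<le> 1 \<Longrightarrow> u\<^sup>2 \<le> A * m * G + B / m"
  shows "u ^ 4 \<le> B * (4 * A * G + 2 * u\<^sup>2)"
proof (cases "u\<^sup>2 \<ge> 2 * B")
  have u4: "u ^ 4 = u\<^sup>2 * u\<^sup>2" by (simp flip: power_add)
  case True
  then have u: "u\<^sup>2 > 0" using B by linarith
  have "u\<^sup>2 \<le> A * (2 * B / u\<^sup>2) * G + B / (2 * B / u\<^sup>2)"
    using True u B by (intro le) (auto simp: field_simps)
  also have "\<dots> = 2 * A * B * G / u\<^sup>2 + u\<^sup>2 / 2" using B u by (simp add: field_simps)
  finally have "u\<^sup>2 / 2 \<le> 2 * A * B * G / u\<^sup>2" by simp
  then have "u\<^sup>2 * u\<^sup>2 \<le> 4 * A * B * G" using u by (simp add: pos_le_divide_eq)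
  moreover have "0 \<le> B * (2 * u\<^sup>2)" using B by simp
  moreover have "B * (4 * A * G + 2 * u\<^sup>2) = 4 * A * B * G + B * (2 * u\<^sup>2)" by (simp add: algebra_simps)
  ultimately show ?thesis unfolding u4 by linarith
next
  case False
  have u4: "u ^ 4 = u\<^sup>2 * u\<^sup>2" by (simp flip: power_add)
  from False have "u\<^sup>2 * u\<^sup>2 \<le> (2 * B) * u\<^sup>2" by (intro mult_right_mono) auto
  moreover have "0 \<le> B * (4 * A * G)" using B G by simp
  moreover have "B * (4 * A * G + 2 * u\<^sup>2) = B * (4 * A * G) + (2 * B) * u\<^sup>2" by (simp add: algebra_simps)
  ultimately show ?thesis unfolding u4 by linarith
qed

text \<open>Let Q^2 be the integral of f^4. The pointwise bound from
  \<open>square_le_average\<close> and \<open>fourth_power_bound\<close> carries a factor Q on its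
  right side; integrating it gives Q^2 <= Q (...), and Q can be cancelled. Boundedness of f makes Q
  finite.\<close>

lemma L4_bound_bounded:
  fixes f :: "'a \<Rightarrow> real" and s :: real
  assumes [measurable]: "f \<in> borel_measurable borel" and s: "DIM('a) \<le> 4 * s"
    and bounded: "\<And>x. \<bar>f x\<bar> \<le> N"
  shows "(\<integral>\<^sup>+x. ennreal (f x ^ 4) \<partial>M)
    \<le> (ennreal (16 * R powr (DIM('a) + 2 * s) + 4) * (slobodeckij M 2 (DIM('a) + 2 * s) f + (\<integral>\<^sup>+x. ennreal ((f x)\<^sup>2) \<partial>M)))\<^sup>2"
proof -
  let ?a = "DIM('a) + 2 * s"
  define G where "G x = (\<integral>\<^sup>+y. ennreal (norm (f x - f y) ^ 2 / norm (x - y) powr ?a) \<partial>M)" for x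
  have [measurable]: "G \<in> borel_measurable borel" unfolding G_def by measurable
  let ?S = "slobodeckij M 2 ?a f" and ?q = "\<integral>\<^sup>+x. ennreal ((f x)\<^sup>2) \<partial>M"
  let ?Q4 = "\<integral>\<^sup>+x. ennreal (f x ^ 4) \<partial>M"
  have S: "?S = (\<integral>\<^sup>+x. G x \<partial>M)" by (simp add: slobodeckij_def G_def)
  show ?thesis
  proof (cases "?S = \<infinity> \<or> ?Q4 = 0")
    case True
    then show ?thesis
      by (auto simp: ennreal_mult_top power_eq_top_ennreal ennreal_mult_eq_top_iff add_pos_pos)
  next
    case False
    have "?Q4 \<le> (\<integral>\<^sup>+x. ennreal (N ^ 4) \<partial>M)"
    proof (intro nn_integral_mono ennreal_leI)
      fix x
      have "\<bar>f x\<bar> ^ 4 \<le> N ^ 4" using bounded by (intro power_mono) auto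
      then show "f x ^ 4 \<le> N ^ 4" by (simp add: power_even_abs)
    qed
    also have "\<dots> < \<infinity>" by (simp add: emeasure_space_1[simplified])
    finally obtain Q4 where Q4: "?Q4 = ennreal Q4" "0 \<le> Q4" by (cases ?Q4) auto
    with False have "Q4 > 0" by (cases "Q4 = 0") auto
    define Q where "Q = sqrt Q4"
    have Q: "Q > 0" "Q\<^sup>2 = Q4" using \<open>Q4 > 0\<close> by (auto simp: Q_def)
    have le: "ennreal (f x ^ 4) \<le> ennreal Q * (ennreal (16 * R powr ?a) * G x + 4 * ennreal ((f x)\<^sup>2))"
      if x: "x \<in> E" "G x \<noteq> \<infinity>" for x
    proof -
      obtain g where g: "G x = ennreal g" "0 \<le> g" using x by (cases "G x") auto
      have "(f x)\<^sup>2 \<le> 2 * R powr ?a * m * g + 2 * Q / m" if m: "0 < m" "m \<le> 1" for m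
      proof -
        have "ennreal ((f x)\<^sup>2) \<le> ennreal (2 * R powr ?a * m) * G x + ennreal (2 * Q / m)"
          unfolding G_def using square_le_average[OF _ s x(1) m, of f Q] Q Q4 by simp
        also have "\<dots> = ennreal (2 * R powr ?a * m * g + 2 * Q / m)"
          using g m Q by (simp add: ennreal_mult[symmetric] ennreal_plus[symmetric] del: ennreal_plus)
        finally show ?thesis using g m Q by (subst (asm) ennreal_le_iff) auto
      qed
      then have "f x ^ 4 \<le> (2 * Q) * (4 * (2 * R powr ?a) * g + 2 * (f x)\<^sup>2)"
        using Q g by (intro fourth_power_bound) auto
      also have "\<dots> = Q * (16 * R powr ?a * g + 4 * (f x)\<^sup>2)" by (simp add: algebra_simps)
      finally have "ennreal (f x ^ 4) \<le> ennreal \<dots>" by (rule ennreal_leI)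
      also have "\<dots> = ennreal Q * (ennreal (16 * R powr ?a) * G x + 4 * ennreal ((f x)\<^sup>2))"
        using Q g by (simp add: ennreal_mult)
      finally show ?thesis .
    qed
    have "AE x in M. G x \<noteq> \<infinity>"
      using False S by (intro nn_integral_noteq_infinite) auto
    with AE_M have "AE x in M. ennreal (f x ^ 4) \<le> ennreal Q * (ennreal (16 * R powr ?a) * G x + 4 * ennreal ((f x)\<^sup>2))"
      by eventually_elim (rule le)
    then have "?Q4 \<le> (\<integral>\<^sup>+x. ennreal Q * (ennreal (16 * R powr ?a) * G x + 4 * ennreal ((f x)\<^sup>2)) \<partial>M)"
      by (rule nn_integral_mono_AE)
    also have "\<dots> = ennreal Q * (ennreal (16 * R powr ?a) * ?S + 4 * ?q)"
      by (simp add: S nn_integral_cmult nn_integral_add)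
    also have "\<dots> \<le> ennreal Q * (ennreal (16 * R powr ?a + 4) * (?S + ?q))"
      by (intro mult_left_mono) (auto simp: distrib_left distrib_right intro!: add_mono add_increasing add_increasing2)
    finally have "ennreal Q * ennreal Q \<le> ennreal Q * (ennreal (16 * R powr ?a + 4) * (?S + ?q))"
      using Q Q4 by (simp add: ennreal_mult[symmetric] power2_eq_square)
    then have "ennreal Q \<le> ennreal (16 * R powr ?a + 4) * (?S + ?q)"
      using Q by (subst (asm) ennreal_mult_le_mult_iff) auto
    then have "ennreal Q ^ 2 \<le> (ennreal (16 * R powr ?a + 4) * (?S + ?q))\<^sup>2"
      by (intro power_mono) auto
    then show ?thesis using Q Q4 by (simp add: ennreal_power)
  qed
qed

text \<open>Truncating the norm of g at level n increases neither the seminorm nor the L2 norm, so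
  the bounded case gives an estimate free of n; monotone convergence removes the truncation.\<close>

lemma L4_bound:
  fixes g :: "'a \<Rightarrow> 'b::euclidean_space" and s :: real
  assumes [measurable]: "g \<in> borel_measurable borel" and s: "DIM('a) \<le> 4 * s"
  shows "(\<integral>\<^sup>+x. ennreal (norm (g x) ^ 4) \<partial>M)
    \<le> (ennreal (16 * R powr (DIM('a) + 2 * s) + 4) * (slobodeckij M 2 (DIM('a) + 2 * s) g + (\<integral>\<^sup>+x. ennreal ((norm (g x))\<^sup>2) \<partial>M)))\<^sup>2"
    (is "_ \<le> ?B")
proof -
  define f where "f n x = min (norm (g x)) (real n)" for n x
  have [measurable]: "f n \<in> borel_measurable borel" for n unfolding f_def by measurable
  have le: "(\<integral>\<^sup>+x. ennreal (f n x ^ 4) \<partial>M) \<le> ?B" for n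
  proof -
    have "(\<integral>\<^sup>+x. ennreal (f n x ^ 4) \<partial>M)
      \<le> (ennreal (16 * R powr (DIM('a) + 2 * s) + 4) * (slobodeckij M 2 (DIM('a) + 2 * s) (f n) + (\<integral>\<^sup>+x. ennreal ((f n x)\<^sup>2) \<partial>M)))\<^sup>2"
      by (rule L4_bound_bounded[where N=n]) (use s in \<open>auto simp: f_def\<close>)
    also have "\<dots> \<le> ?B"
    proof (intro power_mono mult_left_mono add_mono)
      show "slobodeckij M 2 (DIM('a) + 2 * s) (f n) \<le> slobodeckij M 2 (DIM('a) + 2 * s) g"
        unfolding slobodeckij_def
      proof (intro nn_integral_mono ennreal_leI divide_right_mono power_mono)
        fix x y
        have "\<bar>norm (g x) - norm (g y)\<bar> \<le> norm (g x - g y)" by (rule norm_triangle_ineq3)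
        then show "norm (f n x - f n y) \<le> norm (g x - g y)" by (auto simp: f_def min_def)
      qed auto
      show "(\<integral>\<^sup>+x. ennreal ((f n x)\<^sup>2) \<partial>M) \<le> (\<integral>\<^sup>+x. ennreal ((norm (g x))\<^sup>2) \<partial>M)"
        by (intro nn_integral_mono ennreal_leI power_mono) (auto simp: f_def)
    qed auto
    finally show ?thesis .
  qed
  have "(\<lambda>n. \<integral>\<^sup>+x. ennreal (f n x ^ 4) \<partial>M) \<longlonglongrightarrow> (\<integral>\<^sup>+x. ennreal (norm (g x) ^ 4) \<partial>M)"
  proof (rule nn_integral_LIMSEQ)
    show "incseq (\<lambda>n x. ennreal (f n x ^ 4))"
      by (auto simp: incseq_def le_fun_def f_def intro!: ennreal_leI power_mono)
    show "(\<lambda>n. ennreal (f n x ^ 4)) \<longlonglongrightarrow> ennreal (norm (g x) ^ 4)" for x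
    proof (rule tendsto_eventually)
      obtain n0 :: nat where "norm (g x) \<le> n0" using real_arch_simple by blast
      then show "\<forall>\<^sub>F n in sequentially. ennreal (f n x ^ 4) = ennreal (norm (g x) ^ 4)"
        unfolding eventually_sequentially by (intro exI[of _ n0]) (auto simp: f_def min_def)
    qed
  qed measurable
  then show ?thesis
    by (rule LIMSEQ_le_const2) (use le in blast)
qed

end

section \<open>Pointwise bounds from a fourth-power seminorm\<close>

context convex_region
begin

text \<open>
  The averages of \<open>u\<close> over the copies of \<open>E\<close> contracted towards \<open>x\<close> by the factors \<open>1/2^k\<close>
  converge to \<open>u x\<close>, and consecutive averages differ by a geometrically small amount.
\<close>

lemma average_step:
  fixes u :: "'a \<Rightarrow> real"
  assumes [measurable]: "u \<in> borel_measurable borel" and d: "DIM('a) \<le> 3"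
    and x: "x \<in> E" and l: "0 < l" "l \<le> 1"
  shows "(\<integral>\<^sup>+z. \<integral>\<^sup>+w. ennreal \<bar>u (x + l *\<^sub>R (z - x)) - u (x + (l / 2) *\<^sub>R (w - x))\<bar> \<partial>M \<partial>M) ^ 4
    \<le> ennreal (2 ^ DIM('a) * (2 * R) powr (DIM('a) + 7 / 2) * sqrt l) * slobodeckij M 4 (DIM('a) + 7 / 2) u"
proof -
  let ?d = "DIM('a)" and ?a = "DIM('a) + 7 / 2 :: real"
  have [measurable]: "cball x r \<in> sets borel" for x :: 'a and r by simp
  have "(\<integral>\<^sup>+z. \<integral>\<^sup>+w. ennreal \<bar>u (x + l *\<^sub>R (z - x)) - u (x + (l / 2) *\<^sub>R (w - x))\<bar> \<partial>M \<partial>M) ^ 4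
     \<le> (\<integral>\<^sup>+z. (\<integral>\<^sup>+w. ennreal \<bar>u (x + l *\<^sub>R (z - x)) - u (x + (l / 2) *\<^sub>R (w - x))\<bar> \<partial>M) ^ 4 \<partial>M)"
    using nn_integral_power_le[of "\<lambda>z. \<integral>\<^sup>+w. ennreal \<bar>u (x + l *\<^sub>R (z - x)) - u (x + (l / 2) *\<^sub>R (w - x))\<bar> \<partial>M" M 2]
      emeasure_space_1 by simp
  also have "\<dots> \<le> (\<integral>\<^sup>+z. \<integral>\<^sup>+w. ennreal \<bar>u (x + l *\<^sub>R (z - x)) - u (x + (l / 2) *\<^sub>R (w - x))\<bar> ^ 4 \<partial>M \<partial>M)"
  proof (rule nn_integral_mono)
    fix z
    show "(\<integral>\<^sup>+w. ennreal \<bar>u (x + l *\<^sub>R (z - x)) - u (x + (l / 2) *\<^sub>R (w - x))\<bar> \<partial>M) ^ 4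
        \<le> (\<integral>\<^sup>+w. ennreal \<bar>u (x + l *\<^sub>R (z - x)) - u (x + (l / 2) *\<^sub>R (w - x))\<bar> ^ 4 \<partial>M)"
      using nn_integral_power_le[of "\<lambda>w. ennreal \<bar>u (x + l *\<^sub>R (z - x)) - u (x + (l / 2) *\<^sub>R (w - x))\<bar>" M 2]
        emeasure_space_1 by simp
  qed
  also have "\<dots> \<le> (\<integral>\<^sup>+z. ennreal ((2 / l) ^ ?d) *
      (\<integral>\<^sup>+y'. indicator (cball x (l / 2 * R)) y' * ennreal \<bar>u (x + l *\<^sub>R (z - x)) - u y'\<bar> ^ 4 \<partial>M) \<partial>M)"
  proof (rule nn_integral_mono)
    fix z
    show "(\<integral>\<^sup>+w. ennreal \<bar>u (x + l *\<^sub>R (z - x)) - u (x + (l / 2) *\<^sub>R (w - x))\<bar> ^ 4 \<partial>M)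
      \<le> ennreal ((2 / l) ^ ?d) * (\<integral>\<^sup>+y'. indicator (cball x (l / 2 * R)) y' * ennreal \<bar>u (x + l *\<^sub>R (z - x)) - u y'\<bar> ^ 4 \<partial>M)"
      using nn_integral_contract[of "\<lambda>y'. ennreal \<bar>u (x + l *\<^sub>R (z - x)) - u y'\<bar> ^ 4" x "l / 2"] x l by simp
  qed
  also have "\<dots> = ennreal ((2 / l) ^ ?d) * (\<integral>\<^sup>+z.
      (\<integral>\<^sup>+y'. indicator (cball x (l / 2 * R)) y' * ennreal \<bar>u (x + l *\<^sub>R (z - x)) - u y'\<bar> ^ 4 \<partial>M) \<partial>M)"
    by (rule nn_integral_cmult) measurable
  also have "\<dots> \<le> ennreal ((2 / l) ^ ?d) * (ennreal ((1 / l) ^ ?d) * (\<integral>\<^sup>+y. indicator (cball x (l * R)) y *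
      (\<integral>\<^sup>+y'. indicator (cball x (l / 2 * R)) y' * ennreal \<bar>u y - u y'\<bar> ^ 4 \<partial>M) \<partial>M))"
    by (intro mult_left_mono nn_integral_contract[of "\<lambda>y. \<integral>\<^sup>+y'. indicator (cball x (l / 2 * R)) y' * ennreal \<bar>u y - u y'\<bar> ^ 4 \<partial>M"] x l)
      auto
  also have "(\<integral>\<^sup>+y. indicator (cball x (l * R)) y *
      (\<integral>\<^sup>+y'. indicator (cball x (l / 2 * R)) y' * ennreal \<bar>u y - u y'\<bar> ^ 4 \<partial>M) \<partial>M)
    \<le> (\<integral>\<^sup>+y. \<integral>\<^sup>+y'. ennreal ((2 * l * R) powr ?a) * ennreal (norm (u y - u y') ^ 4 / norm (y - y') powr ?a) \<partial>M \<partial>M)"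
  proof (rule nn_integral_mono)
    fix y
    show "indicator (cball x (l * R)) y *
      (\<integral>\<^sup>+y'. indicator (cball x (l / 2 * R)) y' * ennreal \<bar>u y - u y'\<bar> ^ 4 \<partial>M)
    \<le> (\<integral>\<^sup>+y'. ennreal ((2 * l * R) powr ?a) * ennreal (norm (u y - u y') ^ 4 / norm (y - y') powr ?a) \<partial>M)"
    proof (cases "y \<in> cball x (l * R)")
      case True
      show ?thesis
        unfolding indicator_simps(1)[OF True] mult_1
      proof (rule nn_integral_mono)
        fix y'
        show "indicator (cball x (l / 2 * R)) y' * ennreal \<bar>u y - u y'\<bar> ^ 4
          \<le> ennreal ((2 * l * R) powr ?a) * ennreal (norm (u y - u y') ^ 4 / norm (y - y') powr ?a)"
        proof (cases "y' \<in> cball x (l / 2 * R)")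
          case y': True
          have "l / 2 * R \<le> l * R" using l R_pos by simp
          then have "norm (y - y') \<le> 2 * l * R"
            using True y' dist_triangle2[of y y' x] by (auto simp: dist_commute simp flip: dist_norm)
          from difference_le_kernel[OF this, of ?a 4 u] show ?thesis
            using y' by (simp add: ennreal_power)
        qed simp
      qed
    qed simp
  qed
  also have "\<dots> = ennreal ((2 * l * R) powr ?a) * slobodeckij M 4 ?a u"
    by (simp add: slobodeckij_def nn_integral_cmult)
  also have "ennreal ((2 / l) ^ ?d) * (ennreal ((1 / l) ^ ?d) * (ennreal ((2 * l * R) powr ?a) * slobodeckij M 4 ?a u))
      = ennreal ((2 / l) ^ ?d * (1 / l) ^ ?d * (2 * l * R) powr ?a) * slobodeckij M 4 ?a u"
    using l by (simp add: ennreal_mult mult.assoc)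
  also have "\<dots> \<le> ennreal (2 ^ ?d * (2 * R) powr ?a * sqrt l) * slobodeckij M 4 ?a u"
  proof (intro mult_right_mono ennreal_leI)
    have "(2 * l * R) powr ?a = (2 * R) powr ?a * l powr ?a"
      using l R_pos by (simp add: powr_mult)
    moreover have "(2 / l) ^ ?d = 2 ^ ?d * l powr (- real ?d)" "(1 / l) ^ ?d = l powr (- real ?d)"
      using l by (simp_all add: powr_minus powr_realpow power_divide divide_inverse power_inverse)
    ultimately have "(2 / l) ^ ?d * (1 / l) ^ ?d * (2 * l * R) powr ?a
        = 2 ^ ?d * (2 * R) powr ?a * (l powr (- real ?d) * l powr (- real ?d) * l powr ?a)"
      by simp
    also have "l powr (- real ?d) * l powr (- real ?d) * l powr ?a = l powr (7 / 2 - ?d)"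
      by (simp add: powr_add[symmetric])
    \<comment> \<open>The two contractions cost l^(-2d) and the kernel returns l^(d + 7/2). Since d
      <= 3 and l <= 1, a positive power of l survives, which will make the differences of averages
      summable.\<close>
    also have "l powr (7 / 2 - ?d) \<le> l powr (1 / 2)"
      using l d by (intro powr_mono') auto
    also have "l powr (1 / 2) = sqrt l" using l by (simp add: powr_half_sqrt)
    finally show "(2 / l) ^ ?d * (1 / l) ^ ?d * (2 * l * R) powr ?a \<le> 2 ^ ?d * (2 * R) powr ?a * sqrt l"
      by (simp add: mult_left_mono)
  qed simp
  finally show ?thesis
    by (simp add: mult_left_mono)
qed

text \<open>The right side contains the inner integral of the seminorm at the single point x. It is
  finite for almost every x, and at such points the averages converge to u x as l tends to
  0.\<close>

lemma average_tends_to_value: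
  fixes u :: "'a \<Rightarrow> real"
  assumes [measurable]: "u \<in> borel_measurable borel" and x: "x \<in> E" and l: "0 < l" "l \<le> 1"
  shows "(\<integral>\<^sup>+z. ennreal \<bar>u x - u (x + l *\<^sub>R (z - x))\<bar> \<partial>M) ^ 4
    \<le> ennreal (R powr (DIM('a) + 7 / 2) * l) * (\<integral>\<^sup>+y. ennreal (norm (u x - u y) ^ 4 / norm (x - y) powr (DIM('a) + 7 / 2)) \<partial>M)"
proof -
  let ?d = "DIM('a)" and ?a = "DIM('a) + 7 / 2 :: real"
  have "(\<integral>\<^sup>+z. ennreal \<bar>u x - u (x + l *\<^sub>R (z - x))\<bar> \<partial>M) ^ 4
      \<le> (\<integral>\<^sup>+z. ennreal \<bar>u x - u (x + l *\<^sub>R (z - x))\<bar> ^ 4 \<partial>M)"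
    using nn_integral_power_le[of "\<lambda>z. ennreal \<bar>u x - u (x + l *\<^sub>R (z - x))\<bar>" M 2] emeasure_space_1 by simp
  also have "\<dots> \<le> ennreal ((1 / l) ^ ?d) * (\<integral>\<^sup>+y. indicator (cball x (l * R)) y * ennreal \<bar>u x - u y\<bar> ^ 4 \<partial>M)"
    by (rule nn_integral_contract) (use x l in auto)
  also have "\<dots> \<le> ennreal ((1 / l) ^ ?d) *
        (\<integral>\<^sup>+y. ennreal ((l * R) powr ?a) * ennreal (norm (u x - u y) ^ 4 / norm (x - y) powr ?a) \<partial>M)"
  proof (intro mult_left_mono nn_integral_mono)
    fix y
    show "indicator (cball x (l * R)) y * ennreal \<bar>u x - u y\<bar> ^ 4
         \<le> ennreal ((l * R) powr ?a) * ennreal (norm (u x - u y) ^ 4 / norm (x - y) powr ?a)"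
      using difference_le_kernel[of x y "l * R" ?a 4 u]
      by (cases "y \<in> cball x (l * R)") (auto simp: dist_norm ennreal_power)
  qed simp
  also have "\<dots> = ennreal ((1 / l) ^ ?d * (l * R) powr ?a) *
      (\<integral>\<^sup>+y. ennreal (norm (u x - u y) ^ 4 / norm (x - y) powr ?a) \<partial>M)"
    using l by (subst nn_integral_cmult) (auto simp: ennreal_mult mult.assoc)
  also have "\<dots> \<le> ennreal (R powr ?a * l) * (\<integral>\<^sup>+y. ennreal (norm (u x - u y) ^ 4 / norm (x - y) powr ?a) \<partial>M)"
  proof (intro mult_right_mono ennreal_leI)
    have "(1 / l) ^ ?d = l powr (- real ?d)"
      using l by (simp add: powr_minus powr_realpow divide_inverse power_inverse)
    moreover have "(l * R) powr ?a = R powr ?a * l powr ?a"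
      using l R_pos by (simp add: powr_mult)
    ultimately have "(1 / l) ^ ?d * (l * R) powr ?a = R powr ?a * (l powr (- real ?d) * l powr ?a)"
      by simp
    also have "l powr (- real ?d) * l powr ?a = l powr (7 / 2)"
      by (simp add: powr_add[symmetric])
    also have "l powr (7 / 2) \<le> l powr 1" using l by (intro powr_mono') auto
    finally show "(1 / l) ^ ?d * (l * R) powr ?a \<le> R powr ?a * l"
      using l by (simp add: mult_left_mono)
  qed simp
  finally show ?thesis .
qed

text \<open>Telescoping over the contraction factors 2^(-k): |u x| is bounded by the average of |u|
  over E, the geometric series of differences of successive averages, and a last error that tends to
  0 wherever the inner integral of the seminorm is finite.\<close>

lemma Linf_bound_scalar:
  assumes d: "DIM('a) \<le> 3"
  shows "\<exists>C\<ge>0. \<forall>u :: 'a \<Rightarrow> real. u \<in> borel_measurable borel \<longrightarrow> slobodeckij M 4 (DIM('a) + 7 / 2) u < \<infinity> \<longrightarrow>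
     (AE x in M. ennreal \<bar>u x\<bar> ^ 4 \<le> ennreal C * ((\<integral>\<^sup>+x. ennreal \<bar>u x\<bar> ^ 4 \<partial>M) + slobodeckij M 4 (DIM('a) + 7 / 2) u))"
proof -
  let ?d = "DIM('a)" and ?a = "DIM('a) + 7 / 2 :: real"
  \<comment> \<open>Fourth root of the constant in \<open>average_step\<close>, which controls
    fourth powers of differences.\<close>
  define c where "c = root 4 (2 ^ ?d * (2 * R) powr ?a)"
  have c: "c \<ge> 0" "c ^ 4 = 2 ^ ?d * (2 * R) powr ?a"
    unfolding c_def using R_pos by auto
  \<comment> \<open>\<open>average_step\<close> provides sqrt l with l = 2^(-k); its fourth root is
    2^(-k/8).\<close>
  define \<rho> :: real where "\<rho> = 2 powr (- 1 / 8)"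
  have \<rho>: "0 < \<rho>" "\<rho> < 1" "\<rho> ^ 8 = 1 / 2"
  proof -
    show "0 < \<rho>" by (simp add: \<rho>_def)
    have "\<rho> < 2 powr 0" unfolding \<rho>_def by (intro powr_less_mono) auto
    then show "\<rho> < 1" by simp
    have "\<rho> ^ 8 = \<rho> powr 8" using \<open>0 < \<rho>\<close> by simp
    also have "\<dots> = 2 powr (- 1)" by (simp add: \<rho>_def powr_powr)
    finally show "\<rho> ^ 8 = 1 / 2" by (simp add: powr_minus)
  qed
  define K where "K = c / (1 - \<rho>)"
  have K: "K \<ge> 0" using c \<rho> by (simp add: K_def)
  have main: "AE x in M. ennreal \<bar>u x\<bar> ^ 4 \<le> ennreal (16 * (1 + K ^ 4)) * ((\<integral>\<^sup>+x. ennreal \<bar>u x\<bar> ^ 4 \<partial>M) + slobodeckij M 4 ?a u)"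
    if [measurable]: "u \<in> borel_measurable borel" and S: "slobodeckij M 4 ?a u < \<infinity>" for u :: "'a \<Rightarrow> real"
  proof -
    define G where "G x = (\<integral>\<^sup>+y. ennreal (norm (u x - u y) ^ 4 / norm (x - y) powr ?a) \<partial>M)" for x
    have [measurable]: "G \<in> borel_measurable borel" unfolding G_def by measurable
    obtain S' where S': "slobodeckij M 4 ?a u = ennreal S'" "0 \<le> S'"
      using S by (cases "slobodeckij M 4 ?a u") auto
    define \<sigma> where "\<sigma> = root 4 S'"
    have \<sigma>: "\<sigma> \<ge> 0" "\<sigma> ^ 4 = S'" using S' by (auto simp: \<sigma>_def)
    have "AE x in M. G x \<noteq> \<infinity>"
      using S by (intro nn_integral_noteq_infinite) (auto simp: slobodeckij_def G_def)
    with AE_M show ?thesis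
    proof eventually_elim
      case (elim x)
      define y where "y k z = x + ((1/2) ^ k) *\<^sub>R (z - x)" for k z
      have [measurable]: "y k \<in> borel_measurable borel" for k unfolding y_def by measurable
      define A where "A k = (\<integral>\<^sup>+z. ennreal \<bar>u (y k z)\<bar> \<partial>M)" for k
      define D where "D k = (\<integral>\<^sup>+z. \<integral>\<^sup>+w. ennreal \<bar>u (y k z) - u (y (Suc k) w)\<bar> \<partial>M \<partial>M)" for k
      define e where "e k = (\<integral>\<^sup>+z. ennreal \<bar>u x - u (y k z)\<bar> \<partial>M)" for k
      have D: "D k \<le> ennreal (c * \<sigma> * \<rho> ^ k)" for k
      proof (rule ennreal_power_le_imp_le[of _ 4])
        have "D k ^ 4 \<le> ennreal (2 ^ ?d * (2 * R) powr ?a * sqrt ((1/2) ^ k)) * slobodeckij M 4 ?a u"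
          using average_step[OF _ d elim(1), of u "(1/2) ^ k"]
          by (simp add: D_def y_def power_le_one field_simps)
        also have "sqrt ((1/2) ^ k) = (\<rho> ^ k) ^ 4"
        proof (rule real_sqrt_unique)
          have "((\<rho> ^ k) ^ 4)\<^sup>2 = (\<rho> ^ 8) ^ k"
            by (simp add: power_mult[symmetric] mult.commute)
          then show "((\<rho> ^ k) ^ 4)\<^sup>2 = (1/2) ^ k" using \<rho> by simp
        qed (use \<rho> in auto)
        also have "ennreal (2 ^ ?d * (2 * R) powr ?a * (\<rho> ^ k) ^ 4) * slobodeckij M 4 ?a u = ennreal (c * \<sigma> * \<rho> ^ k) ^ 4"
          using c \<sigma> \<rho> S' by (simp add: ennreal_power ennreal_mult[symmetric] power_mult_distrib mult_ac)
        finally show "D k ^ 4 \<le> ennreal (c * \<sigma> * \<rho> ^ k) ^ 4" .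
      qed simp
      have step: "A (Suc k) \<le> A k + D k" for k
      proof -
        have "A (Suc k) = (\<integral>\<^sup>+z. \<integral>\<^sup>+w. ennreal \<bar>u (y (Suc k) w)\<bar> \<partial>M \<partial>M)"
          by (simp add: A_def emeasure_space_1[simplified])
        also have "\<dots> \<le> (\<integral>\<^sup>+z. \<integral>\<^sup>+w. ennreal \<bar>u (y k z)\<bar> + ennreal \<bar>u (y k z) - u (y (Suc k) w)\<bar> \<partial>M \<partial>M)"
          by (intro nn_integral_mono) (auto simp: ennreal_plus[symmetric] simp del: ennreal_plus intro!: ennreal_leI)
        also have "\<dots> = A k + D k"
          by (simp add: nn_integral_add A_def D_def emeasure_space_1[simplified])
        finally show ?thesis .
      qed
      have tele: "A k \<le> A 0 + ennreal (c * \<sigma> * (\<Sum>j<k. \<rho> ^ j))" for k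
      proof (induction k)
        case (Suc k)
        have "A (Suc k) \<le> (A 0 + ennreal (c * \<sigma> * (\<Sum>j<k. \<rho> ^ j))) + ennreal (c * \<sigma> * \<rho> ^ k)"
          using step[of k] Suc D[of k] by (meson add_mono order_trans)
        also have "\<dots> = A 0 + ennreal (c * \<sigma> * (\<Sum>j<Suc k. \<rho> ^ j))"
          using c \<sigma> \<rho> by (simp add: add.assoc distrib_left ennreal_plus[symmetric] sum_nonneg del: ennreal_plus)
        finally show ?case .
      qed simp
      have bound: "ennreal \<bar>u x\<bar> \<le> A 0 + ennreal (K * \<sigma>) + e k" for k
      proof -
        have "ennreal \<bar>u x\<bar> = (\<integral>\<^sup>+z. ennreal \<bar>u x\<bar> \<partial>M)"
          by (simp add: emeasure_space_1[simplified])
        also have "\<dots> \<le> (\<integral>\<^sup>+z. ennreal \<bar>u (y k z)\<bar> + ennreal \<bar>u x - u (y k z)\<bar> \<partial>M)"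
          by (intro nn_integral_mono) (auto simp: ennreal_plus[symmetric] simp del: ennreal_plus intro!: ennreal_leI)
        also have "\<dots> = A k + e k"
          by (simp add: nn_integral_add A_def e_def)
        also have "\<dots> \<le> (A 0 + ennreal (c * \<sigma> * (\<Sum>j<k. \<rho> ^ j))) + e k"
          by (intro add_right_mono tele)
        also have "\<dots> \<le> (A 0 + ennreal (K * \<sigma>)) + e k"
        proof (intro add_mono order_refl ennreal_leI)
          have "(\<Sum>j<k. \<rho> ^ j) = (1 - \<rho> ^ k) / (1 - \<rho>)"
            using \<rho> sum_gp_strict[of \<rho> k] by auto
          also have "\<dots> \<le> 1 / (1 - \<rho>)" using \<rho> by (intro divide_right_mono) auto
          finally have "c * \<sigma> * (\<Sum>j<k. \<rho> ^ j) \<le> c * \<sigma> * (1 / (1 - \<rho>))"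
            using c \<sigma> by (intro mult_left_mono) auto
          then show "c * \<sigma> * (\<Sum>j<k. \<rho> ^ j) \<le> K * \<sigma>" by (simp add: K_def field_simps)
        qed
        finally show ?thesis .
      qed
      obtain g where g: "G x = ennreal g" "0 \<le> g" using elim by (cases "G x") auto
      have e: "e k ^ 4 \<le> ennreal (R powr ?a * g * (1/2) ^ k)" for k
      proof -
        have "e k ^ 4 \<le> ennreal (R powr ?a * (1/2) ^ k) * G x"
          unfolding e_def y_def G_def using elim(1)
          by (intro average_tends_to_value) (auto simp: power_le_one)
        also have "\<dots> = ennreal (R powr ?a * g * (1/2) ^ k)"
          using g by (simp add: ennreal_mult[symmetric] mult_ac)
        finally show ?thesis .
      qed
      have le: "ennreal \<bar>u x\<bar> \<le> A 0 + ennreal (K * \<sigma>)"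
      proof (rule ennreal_le_epsilon)
        fix r :: real assume r: "0 < r"
        have "(\<lambda>k. R powr ?a * g * (1/2) ^ k) \<longlonglongrightarrow> R powr ?a * g * 0"
          by (intro tendsto_intros LIMSEQ_realpow_zero) auto
        then have "eventually (\<lambda>k. R powr ?a * g * (1/2) ^ k < r ^ 4) sequentially"
          by (rule order_tendstoD(2)) (use r in simp)
        then obtain k where k: "R powr ?a * g * (1/2) ^ k < r ^ 4"
          by (auto simp: eventually_sequentially)
        have "e k ^ 4 \<le> ennreal r ^ 4"
          using k r by (intro order_trans[OF e]) (simp add: ennreal_power ennreal_leI)
        then have "e k \<le> ennreal r" by (rule ennreal_power_le_imp_le) simp
        then show "ennreal \<bar>u x\<bar> \<le> A 0 + ennreal (K * \<sigma>) + ennreal r"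
          using bound[of k] by (meson add_left_mono order_trans)
      qed
      have "ennreal \<bar>u x\<bar> ^ 4 \<le> (A 0 + ennreal (K * \<sigma>)) ^ 4"
        using le by (rule power_mono) simp
      also have "\<dots> \<le> 2 ^ 4 * (A 0 ^ 4 + ennreal (K * \<sigma>) ^ 4)"
        by (rule ennreal_add_power_le)
      also have "A 0 ^ 4 \<le> (\<integral>\<^sup>+x. ennreal \<bar>u x\<bar> ^ 4 \<partial>M)"
        using nn_integral_power_le[of "\<lambda>z. ennreal \<bar>u z\<bar>" M 2] emeasure_space_1 by (simp add: A_def y_def)
      also have "ennreal (K * \<sigma>) ^ 4 = ennreal (K ^ 4) * slobodeckij M 4 ?a u"
        using K \<sigma> S' by (simp add: ennreal_power power_mult_distrib ennreal_mult[symmetric])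
      also have "2 ^ 4 * ((\<integral>\<^sup>+x. ennreal \<bar>u x\<bar> ^ 4 \<partial>M) + ennreal (K ^ 4) * slobodeckij M 4 ?a u)
          \<le> ennreal (16 * (1 + K ^ 4)) * ((\<integral>\<^sup>+x. ennreal \<bar>u x\<bar> ^ 4 \<partial>M) + slobodeckij M 4 ?a u)"
      proof -
        have "ennreal (16 * (1 + K ^ 4)) = 2 ^ 4 * (1 + ennreal (K ^ 4))"
          using K by (simp add: ennreal_mult)
        moreover have "X + ennreal (K ^ 4) * Y \<le> (1 + ennreal (K ^ 4)) * (X + Y)" for X Y
        proof -
          have "(1 + ennreal (K ^ 4)) * (X + Y) = (X + ennreal (K ^ 4) * Y) + (Y + ennreal (K ^ 4) * X)"
            by (simp add: distrib_left distrib_right ac_simps)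
          then show ?thesis by simp
        qed
        ultimately show ?thesis by (simp only: mult.assoc) (rule mult_left_mono, simp_all)
      qed
      finally show ?case
        by (simp add: add_left_mono mult_left_mono)
    qed
  qed
  show ?thesis
    using main K by (intro exI[of _ "16 * (1 + K ^ 4)"]) auto
qed

end

section \<open>Transfer to the domain\<close>

lemma esqrt_power2 [simp]: "(esqrt x)\<^sup>2 = x"
  by (cases x) (auto simp: esqrt_def ennreal_power infinity_ennreal_def)

lemma esqrt_eq_top_iff [simp]: "esqrt x = top \<longleftrightarrow> x = top"
  by (auto simp: esqrt_def infinity_ennreal_def)

lemma esqrt_less_top_iff [simp]: "esqrt x < top \<longleftrightarrow> x < top"
  by (metis esqrt_eq_top_iff less_top)

lemma L2_measurable: "L2 D f < \<infinity> \<Longrightarrow> f \<in> borel_measurable (lebesgue_on D)"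
  by (auto simp: L2_def split: if_splits)

lemma L2_power2:
  "f \<in> borel_measurable (lebesgue_on D) \<Longrightarrow> (L2 D f)\<^sup>2 = (\<integral>\<^sup>+x. ennreal ((norm (f x))\<^sup>2) \<partial>lebesgue_on D)"
  by (simp add: L2_def)

lemma L2_finite_iff:
  "L2 D f < \<infinity> \<longleftrightarrow> f \<in> borel_measurable (lebesgue_on D) \<and> (\<integral>\<^sup>+x. ennreal ((norm (f x))\<^sup>2) \<partial>lebesgue_on D) < \<infinity>"
  by (auto simp: L2_def)

text \<open>Fubini, translation invariance and changes of variables are applied on
  \<open>lborel\<close>, whereas the norms live on the completed measure
  \<open>lebesgue_on D\<close>. Borel representatives extended by 0 mediate between the two.\<close>

definition borel_rep :: "'a::euclidean_space set \<Rightarrow> ('a \<Rightarrow> 'b::euclidean_space) \<Rightarrow> ('a \<Rightarrow> 'b) \<Rightarrow> bool" where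
  "borel_rep D f f' \<longleftrightarrow> f \<in> borel_measurable (lebesgue_on D) \<and> f' \<in> borel_measurable borel \<and> (\<forall>x. x \<notin> D \<longrightarrow> f' x = 0) \<and>
     (AE x in lebesgue_on D. f x = f' x)"

lemma borel_rep_exists:
  fixes f :: "'a::euclidean_space \<Rightarrow> 'b::euclidean_space"
  assumes D: "D \<in> sets borel" and f: "f \<in> borel_measurable (lebesgue_on D)"
  shows "\<exists>f'. borel_rep D f f'"
proof -
  have DL: "D \<in> sets lebesgue" using D by simp
  have "(\<lambda>x. if x \<in> D then f x else 0) \<in> borel_measurable lebesgue"
    using borel_measurable_if_I[OF f DL] .
  then have "\<exists>g\<in>borel_measurable lborel. AE x in lborel. (if x \<in> D then f x else 0) \<bullet> b = g x" for b
    by (intro completion_ex_borel_measurable_real) auto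
  then obtain g where g: "\<And>b. g b \<in> borel_measurable borel"
    "\<And>b. AE x in lborel. (if x \<in> D then f x else 0) \<bullet> b = g b x"
    by (metis measurable_lborel2)
  define f' where "f' x = indicator D x *\<^sub>R (\<Sum>b\<in>Basis. g b x *\<^sub>R b)" for x
  have "f' \<in> borel_measurable borel"
    unfolding f'_def using g(1) D by measurable
  moreover have "AE x in lborel. \<forall>b\<in>Basis. (if x \<in> D then f x else 0) \<bullet> b = g b x"
    using g(2) by (subst AE_ball_countable) (auto simp: countable_finite)
  then have "AE x in lborel. x \<in> D \<longrightarrow> f x = f' x"
    by eventually_elim (auto simp: f'_def euclidean_eq_iff[where 'a='b])
  then have "AE x in lebesgue. x \<in> D \<longrightarrow> f x = f' x"
    by (rule AE_completion)
  then have "AE x in lebesgue_on D. f x = f' x"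
    using DL by (subst AE_restrict_space_iff) auto
  ultimately show ?thesis
    using f by (auto simp: borel_rep_def f'_def)
qed

lemma nn_integral_lebesgue_on:
  assumes D: "D \<in> sets borel" and F: "F \<in> borel_measurable borel"
  shows "(\<integral>\<^sup>+x. F x \<partial>lebesgue_on D) = (\<integral>\<^sup>+x. indicator D x * F x \<partial>lborel)"
proof -
  have "(\<integral>\<^sup>+x. F x \<partial>lebesgue_on D) = (\<integral>\<^sup>+x. F x * indicator D x \<partial>lebesgue)"
    using D by (intro nn_integral_restrict_space) auto
  also have "\<dots> = (\<integral>\<^sup>+x. F x * indicator D x \<partial>lborel)"
    by (rule nn_integral_completion)
  finally show ?thesis by (simp add: mult.commute)
qed

lemma borel_rep_nn_integral:
  assumes D: "D \<in> sets borel" and f: "borel_rep D f f'" and H: "H \<in> borel_measurable borel"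
  shows "(\<integral>\<^sup>+x. H (f x) \<partial>lebesgue_on D) = (\<integral>\<^sup>+x. indicator D x * H (f' x) \<partial>lborel)"
proof -
  have "(\<integral>\<^sup>+x. H (f x) \<partial>lebesgue_on D) = (\<integral>\<^sup>+x. H (f' x) \<partial>lebesgue_on D)"
    using f by (intro nn_integral_cong_AE) (auto simp: borel_rep_def elim!: eventually_mono)
  also have "\<dots> = (\<integral>\<^sup>+x. indicator D x * H (f' x) \<partial>lborel)"
    using f H by (intro nn_integral_lebesgue_on D) (auto simp: borel_rep_def intro: measurable_compose)
  finally show ?thesis .
qed

text \<open>f is replaced in the inner integral first, at those x where f x = f' x, and then in the
  outer one. The result is an iterated \<open>lborel\<close> integral of a jointly Borel function,
  to which Tonelli applies.\<close>

lemma borel_rep_nn_integral2: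
  assumes D: "D \<in> sets borel" and f: "borel_rep D f f'"
    and H: "(\<lambda>(a, b, x, y). H a b x y) \<in> borel_measurable (borel \<Otimes>\<^sub>M borel \<Otimes>\<^sub>M borel \<Otimes>\<^sub>M borel)"
  shows "(\<integral>\<^sup>+x. \<integral>\<^sup>+y. H (f x) (f y) x y \<partial>lebesgue_on D \<partial>lebesgue_on D)
    = (\<integral>\<^sup>+x. \<integral>\<^sup>+y. indicator D x * indicator D y * H (f' x) (f' y) x y \<partial>lborel \<partial>lborel)"
proof -
  have [measurable]: "D \<in> sets borel" by (fact D)
  have [measurable]: "f' \<in> borel_measurable borel" using f by (simp add: borel_rep_def)
  have m: "(\<lambda>p. H (f' (fst p)) (f' (snd p)) (fst p) (snd p)) \<in> borel_measurable (borel \<Otimes>\<^sub>M borel)"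
    using measurable_compose[OF _ H, of "\<lambda>p. (f' (fst p), f' (snd p), fst p, snd p)" "borel \<Otimes>\<^sub>M borel"]
    by (simp add: case_prod_beta)
  have m1: "(\<lambda>y. H (f' x) (f' y) x y) \<in> borel_measurable borel" for x
    using measurable_compose[OF _ H, of "\<lambda>y. (f' x, f' y, x, y)"] by simp
  have 1: "(\<integral>\<^sup>+y. H (f x) (f y) x y \<partial>lebesgue_on D) = (\<integral>\<^sup>+y. indicator D y * H (f' x) (f' y) x y \<partial>lborel)"
    if "f x = f' x" for x
  proof -
    have "(\<integral>\<^sup>+y. H (f x) (f y) x y \<partial>lebesgue_on D) = (\<integral>\<^sup>+y. H (f' x) (f' y) x y \<partial>lebesgue_on D)"
      using f that by (intro nn_integral_cong_AE) (auto simp: borel_rep_def elim!: eventually_mono)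
    then show ?thesis using nn_integral_lebesgue_on[OF D m1] by simp
  qed
  have "(\<integral>\<^sup>+x. \<integral>\<^sup>+y. H (f x) (f y) x y \<partial>lebesgue_on D \<partial>lebesgue_on D)
     = (\<integral>\<^sup>+x. \<integral>\<^sup>+y. indicator D y * H (f' x) (f' y) x y \<partial>lborel \<partial>lebesgue_on D)"
    using f 1 by (intro nn_integral_cong_AE) (auto simp: borel_rep_def elim!: eventually_mono)
  also have "\<dots> = (\<integral>\<^sup>+x. indicator D x * (\<integral>\<^sup>+y. indicator D y * H (f' x) (f' y) x y \<partial>lborel) \<partial>lborel)"
  proof (rule nn_integral_lebesgue_on[OF D])
    have "(\<lambda>p. indicator D (snd p) * H (f' (fst p)) (f' (snd p)) (fst p) (snd p)) \<in> borel_measurable (borel \<Otimes>\<^sub>M lborel)"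
      using m by measurable
    from lborel.borel_measurable_nn_integral_fst[OF this]
    show "(\<lambda>x. \<integral>\<^sup>+y. indicator D y * H (f' x) (f' y) x y \<partial>lborel) \<in> borel_measurable borel" by simp
  qed
  also have "\<dots> = (\<integral>\<^sup>+x. \<integral>\<^sup>+y. indicator D x * indicator D y * H (f' x) (f' y) x y \<partial>lborel \<partial>lborel)"
  proof (rule nn_integral_cong)
    fix x
    have "(\<lambda>y. indicator D y * H (f' x) (f' y) x y) \<in> borel_measurable lborel"
      using m1[of x] by measurable
    from nn_integral_cmult[OF this, of "indicator D x"]
    show "indicator D x * (\<integral>\<^sup>+y. indicator D y * H (f' x) (f' y) x y \<partial>lborel)
        = (\<integral>\<^sup>+y. indicator D x * indicator D y * H (f' x) (f' y) x y \<partial>lborel)"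
      by (simp add: mult.assoc)
  qed
  finally show ?thesis .
qed

lemma borel_rep_integral:
  assumes D: "D \<in> sets borel" and f: "borel_rep D f f'" and k: "k \<in> borel_measurable borel"
  shows "(\<integral>x. k x *\<^sub>R f x \<partial>lebesgue_on D) = (\<integral>x. k x *\<^sub>R f' x \<partial>lborel)"
proof -
  have [measurable]: "f' \<in> borel_measurable borel" "k \<in> borel_measurable borel" "D \<in> sets borel"
    using f k D by (simp_all add: borel_rep_def)
  have "f' \<in> borel_measurable (lebesgue_on D)" "k \<in> borel_measurable (lebesgue_on D)"
    by (auto intro!: measurable_restrict_space1 measurable_completion)
  note [measurable] = this
  have ae: "AE x in lebesgue_on D. f x = f' x" using f by (simp add: borel_rep_def)
  have [measurable]: "f \<in> borel_measurable (lebesgue_on D)" using f by (simp add: borel_rep_def)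
  have "(\<integral>x. k x *\<^sub>R f x \<partial>lebesgue_on D) = (\<integral>x. k x *\<^sub>R f' x \<partial>lebesgue_on D)"
    using ae by (intro integral_cong_AE) (auto elim!: eventually_mono)
  also have "\<dots> = (\<integral>x. indicator D x *\<^sub>R k x *\<^sub>R f' x \<partial>lebesgue)"
    using D by (intro integral_restrict_space) auto
  also have "\<dots> = (\<integral>x. k x *\<^sub>R f' x \<partial>lebesgue)"
    using f by (intro Bochner_Integration.integral_cong) (auto simp: borel_rep_def indicator_def)
  also have "\<dots> = (\<integral>x. k x *\<^sub>R f' x \<partial>lborel)"
    by (rule integral_completion) measurable
  finally show ?thesis .
qed

lemma sum_power_le:
  fixes a :: "'i \<Rightarrow> real"
  assumes "finite I" "\<And>i. i \<in> I \<Longrightarrow> 0 \<le> a i" "0 < p"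
  shows "(\<Sum>i\<in>I. a i) ^ p \<le> real (card I) ^ p * (\<Sum>i\<in>I. a i ^ p)"
proof (cases "I = {}")
  case False
  define m where "m = Max (a ` I)"
  have "m \<in> a ` I" unfolding m_def using assms False by (intro Max_in) auto
  then obtain j where j: "j \<in> I" "m = a j" by auto
  have "(\<Sum>i\<in>I. a i) \<le> card I * m"
    using assms by (intro sum_bounded_above) (auto simp: m_def)
  then have "(\<Sum>i\<in>I. a i) ^ p \<le> (card I * m) ^ p"
    using assms by (intro power_mono sum_nonneg) auto
  also have "\<dots> = real (card I) ^ p * a j ^ p" by (simp add: power_mult_distrib j)
  also have "a j ^ p \<le> (\<Sum>i\<in>I. a i ^ p)"
    using assms j by (intro member_le_sum) auto
  finally show ?thesis by (simp add: mult_left_mono)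
next
  case True
  then show ?thesis using assms by (simp add: power_0_left)
qed

section \<open>The estimates on one convex set in terms of Lebesgue integrals\<close>

context convex_region
begin

definition V where "V = measure lborel E"

lemma V: "V > 0" "emeasure lborel E = ennreal V"
proof -
  show "emeasure lborel E = ennreal V"
    using emeasure_E by (simp add: V_def emeasure_eq_ennreal_measure)
  with emeasure_E show "V > 0" by (cases "V > 0") (auto simp: ennreal_neg)
qed

lemma nn_integral_M':
  assumes "f \<in> borel_measurable borel"
  shows "(\<integral>\<^sup>+x. f x \<partial>M) = ennreal (1 / V) * (\<integral>\<^sup>+x. indicator E x * f x \<partial>lborel)"
  using V by (simp add: nn_integral_M[OF assms] divide_ennreal_def inverse_ennreal mult.commute inverse_eq_divide)

lemma nn_integral_E:
  assumes "f \<in> borel_measurable borel"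
  shows "(\<integral>\<^sup>+x. indicator E x * f x \<partial>lborel) = ennreal V * (\<integral>\<^sup>+x. f x \<partial>M)"
  using V by (simp add: nn_integral_M'[OF assms] mult.assoc[symmetric] ennreal_mult[symmetric])

lemma slobodeckij_M':
  fixes g :: "'a \<Rightarrow> 'b::euclidean_space"
  assumes "g \<in> borel_measurable borel"
  shows "slobodeckij M p a g = ennreal (1 / V) * ennreal (1 / V) * (\<integral>\<^sup>+x. \<integral>\<^sup>+y. indicator E x * indicator E y *
      ennreal (norm (g x - g y) ^ p / norm (x - y) powr a) \<partial>lborel \<partial>lborel)"
  using V by (simp add: slobodeckij_M[OF assms] divide_ennreal_def inverse_ennreal mult.commute mult.left_commute mult.assoc inverse_eq_divide)

lemma slobodeckij_le_grad:
  "\<exists>C\<ge>0. \<forall>(g :: 'a \<Rightarrow> 'b::euclidean_space) G. has_weak_grad E g G \<longrightarrow>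
    slobodeckij M (2 ^ k) (DIM('a) + 2 ^ k - 1/2) g
      \<le> ennreal C * (\<integral>\<^sup>+x. indicator E x * ennreal ((\<Sum>b\<in>Basis. norm (G b x)) ^ (2 ^ k)) \<partial>lborel)"
proof -
  obtain C where C: "C \<ge> 0" "\<And>(g :: 'a \<Rightarrow> 'b) G. has_weak_grad E g G \<Longrightarrow>
    (\<integral>\<^sup>+x. \<integral>\<^sup>+y. indicator E x * indicator E y *
        ennreal (norm (g x - g y) ^ (2 ^ k) / norm (x - y) powr (DIM('a) + 2 ^ k - 1/2)) \<partial>lborel \<partial>lborel)
      \<le> ennreal C * (\<integral>\<^sup>+x. indicator E x * ennreal ((\<Sum>b\<in>Basis. norm (G b x)) ^ (2 ^ k)) \<partial>lborel)"
    using slobodeckij_le_gradient[OF open_E convex_E bounded_E, where 'b='b and k=k] by blast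
  have "slobodeckij M (2 ^ k) (DIM('a) + 2 ^ k - 1/2) g
      \<le> ennreal (1 / V * (1 / V) * C) * (\<integral>\<^sup>+x. indicator E x * ennreal ((\<Sum>b\<in>Basis. norm (G b x)) ^ (2 ^ k)) \<partial>lborel)"
    if G: "has_weak_grad E g G" for g :: "'a \<Rightarrow> 'b" and G
  proof -
    have "g \<in> borel_measurable borel"
      using G by (auto simp: has_weak_grad_def dest: borel_measurable_integrable)
    from slobodeckij_M'[OF this] have "slobodeckij M (2 ^ k) (DIM('a) + 2 ^ k - 1/2) g
      \<le> ennreal (1 / V) * ennreal (1 / V) * (ennreal C * (\<integral>\<^sup>+x. indicator E x * ennreal ((\<Sum>b\<in>Basis. norm (G b x)) ^ (2 ^ k)) \<partial>lborel))"
      using C(2)[OF G] by (simp add: mult_left_mono)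
    also have "\<dots> = ennreal (1 / V * (1 / V) * C) * (\<integral>\<^sup>+x. indicator E x * ennreal ((\<Sum>b\<in>Basis. norm (G b x)) ^ (2 ^ k)) \<partial>lborel)"
      using V C by (simp only: ennreal_mult divide_nonneg_nonneg less_imp_le zero_le_one mult_nonneg_nonneg mult.assoc)
    finally show ?thesis .
  qed
  then show ?thesis using C V by (intro exI[of _ "1 / V * (1 / V) * C"]) auto
qed

lemma L4_slobodeckij_E:
  fixes s :: real
  assumes s: "DIM('a) \<le> 4 * s"
  shows "\<exists>C\<ge>0. \<forall>g :: 'a \<Rightarrow> 'b::euclidean_space. g \<in> borel_measurable borel \<longrightarrow>
    (\<integral>\<^sup>+x. indicator E x * ennreal (norm (g x) ^ 4) \<partial>lborel)
      \<le> ennreal C * (slobodeckij M 2 (DIM('a) + 2 * s) g + (\<integral>\<^sup>+x. indicator E x * ennreal ((norm (g x))\<^sup>2) \<partial>lborel))\<^sup>2"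
proof -
  define c where "c = 16 * R powr (DIM('a) + 2 * s) + 4"
  have c: "c \<ge> 0" by (simp add: c_def)
  have "(\<integral>\<^sup>+x. indicator E x * ennreal (norm (g x) ^ 4) \<partial>lborel)
      \<le> ennreal (V * (c * (1 + 1 / V))\<^sup>2) * (slobodeckij M 2 (DIM('a) + 2 * s) g + (\<integral>\<^sup>+x. indicator E x * ennreal ((norm (g x))\<^sup>2) \<partial>lborel))\<^sup>2"
    (is "_ \<le> _ * (?S + ?q)\<^sup>2")
    if [measurable]: "g \<in> borel_measurable borel" for g :: "'a \<Rightarrow> 'b"
  proof -
    have "(\<integral>\<^sup>+x. indicator E x * ennreal (norm (g x) ^ 4) \<partial>lborel) = ennreal V * (\<integral>\<^sup>+x. ennreal (norm (g x) ^ 4) \<partial>M)"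
      by (rule nn_integral_E) measurable
    also have "\<dots> \<le> ennreal V * (ennreal c * (?S + (\<integral>\<^sup>+x. ennreal ((norm (g x))\<^sup>2) \<partial>M)))\<^sup>2"
      unfolding c_def by (intro mult_left_mono L4_bound s) auto
    also have "(\<integral>\<^sup>+x. ennreal ((norm (g x))\<^sup>2) \<partial>M) = ennreal (1 / V) * ?q"
      by (rule nn_integral_M') measurable
    also have "ennreal V * (ennreal c * (?S + ennreal (1 / V) * ?q))\<^sup>2 \<le> ennreal V * (ennreal c * (ennreal (1 + 1 / V) * (?S + ?q)))\<^sup>2"
    proof (intro mult_left_mono power_mono)
      have "ennreal (1 + 1 / V) * (?S + ?q) = (1 + ennreal (1 / V)) * (?S + ?q)"
        using V by (subst ennreal_plus) auto
      also have "\<dots> = (?S + ennreal (1 / V) * ?q) + (ennreal (1 / V) * ?S + ?q)"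
        by (simp add: distrib_left distrib_right ac_simps)
      finally show "?S + ennreal (1 / V) * ?q \<le> ennreal (1 + 1 / V) * (?S + ?q)" by simp
    qed auto
    also have "\<dots> = ennreal (V * (c * (1 + 1 / V))\<^sup>2) * (?S + ?q)\<^sup>2"
      using V c by (simp add: ennreal_mult power_mult_distrib ennreal_power mult.assoc del: ennreal_plus)
    finally show ?thesis by (simp add: mult_left_mono)
  qed
  then show ?thesis using V by (intro exI[of _ "V * (c * (1 + 1 / V))\<^sup>2"]) auto
qed

text \<open>The order s = 3/4 meets both requirements: 4 s = 3 is at least the dimension, and the
  exponent d + 3/2 equals d + 2 - 1/2, the case k = 1 of the gradient bound.\<close>

lemma L4_grad_E:
  assumes d: "DIM('a) \<le> 3"
  shows "\<exists>C\<ge>0. \<forall>(g :: 'a \<Rightarrow> 'b::euclidean_space) G. has_weak_grad E g G \<longrightarrow>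
    (\<integral>\<^sup>+x. indicator E x * ennreal (norm (g x) ^ 4) \<partial>lborel)
      \<le> ennreal C * ((\<integral>\<^sup>+x. indicator E x * ennreal ((\<Sum>b\<in>Basis. norm (G b x))\<^sup>2) \<partial>lborel)
          + (\<integral>\<^sup>+x. indicator E x * ennreal ((norm (g x))\<^sup>2) \<partial>lborel))\<^sup>2"
proof -
  have s: "DIM('a) \<le> 4 * (3 / 4 :: real)" using d by simp
  obtain C where C: "C \<ge> 0" "\<And>g :: 'a \<Rightarrow> 'b. g \<in> borel_measurable borel \<Longrightarrow>
    (\<integral>\<^sup>+x. indicator E x * ennreal (norm (g x) ^ 4) \<partial>lborel)
      \<le> ennreal C * (slobodeckij M 2 (DIM('a) + 2 * (3 / 4)) g + (\<integral>\<^sup>+x. indicator E x * ennreal ((norm (g x))\<^sup>2) \<partial>lborel))\<^sup>2"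
    using L4_slobodeckij_E[OF s, where 'b='b] by blast
  obtain C' where C': "C' \<ge> 0" "\<And>(g :: 'a \<Rightarrow> 'b) G. has_weak_grad E g G \<Longrightarrow>
    slobodeckij M (2 ^ 1) (DIM('a) + 2 ^ 1 - 1/2) g
      \<le> ennreal C' * (\<integral>\<^sup>+x. indicator E x * ennreal ((\<Sum>b\<in>Basis. norm (G b x)) ^ (2 ^ 1)) \<partial>lborel)"
    using slobodeckij_le_grad[where 'b='b and k=1] by blast
  have "(\<integral>\<^sup>+x. indicator E x * ennreal (norm (g x) ^ 4) \<partial>lborel)
      \<le> ennreal (C * (1 + C')\<^sup>2) * ((\<integral>\<^sup>+x. indicator E x * ennreal ((\<Sum>b\<in>Basis. norm (G b x))\<^sup>2) \<partial>lborel)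
          + (\<integral>\<^sup>+x. indicator E x * ennreal ((norm (g x))\<^sup>2) \<partial>lborel))\<^sup>2" (is "_ \<le> _ * (?G + ?q)\<^sup>2")
    if G: "has_weak_grad E g G" for g :: "'a \<Rightarrow> 'b" and G
  proof -
    have g: "g \<in> borel_measurable borel"
      using G by (auto simp: has_weak_grad_def dest: borel_measurable_integrable)
    have e: "DIM('a) + 2 ^ 1 - 1/2 = DIM('a) + 2 * (3 / 4 :: real)" by simp
    have "slobodeckij M 2 (DIM('a) + 2 * (3 / 4)) g \<le> ennreal C' * ?G"
      using C'(2)[OF G] unfolding e by simp
    then have "slobodeckij M 2 (DIM('a) + 2 * (3 / 4)) g + ?q \<le> ennreal C' * ?G + ?q"
      by (rule add_right_mono)
    also have "\<dots> \<le> (ennreal C' * ?G + ?q) + (?G + ennreal C' * ?q)" by simp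
    also have "\<dots> = ennreal (1 + C') * (?G + ?q)"
      using C' by (subst ennreal_plus) (auto simp: distrib_left distrib_right ac_simps)
    finally have "ennreal C * (slobodeckij M 2 (DIM('a) + 2 * (3 / 4)) g + ?q)\<^sup>2
        \<le> ennreal C * (ennreal (1 + C') * (?G + ?q))\<^sup>2"
      by (intro mult_left_mono power_mono) auto
    also have "\<dots> = ennreal (C * (1 + C')\<^sup>2) * (?G + ?q)\<^sup>2"
      using C C' by (simp add: ennreal_mult power_mult_distrib ennreal_power mult.assoc del: ennreal_plus)
    finally show ?thesis using C(2)[OF g] by (rule order_trans[rotated])
  qed
  then show ?thesis using C C' by (intro exI[of _ "C * (1 + C')\<^sup>2"]) auto
qed

text \<open>The exponent d + 7/2 of \<open>Linf_bound_scalar\<close> is the case k = 2 of the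
  gradient bound. A vector-valued g is reduced to the scalar function |g|, whose seminorm is not
  larger.\<close>

lemma Linf_grad_E:
  assumes d: "DIM('a) \<le> 3"
  shows "\<exists>C\<ge>0. \<forall>(g :: 'a \<Rightarrow> 'b::euclidean_space) G. has_weak_grad E g G \<longrightarrow>
    (\<integral>\<^sup>+x. indicator E x * ennreal ((\<Sum>b\<in>Basis. norm (G b x)) ^ 4) \<partial>lborel) < \<infinity> \<longrightarrow>
    (AE x in lborel. x \<in> E \<longrightarrow> ennreal (norm (g x)) ^ 4
      \<le> ennreal C * ((\<integral>\<^sup>+x. indicator E x * ennreal ((\<Sum>b\<in>Basis. norm (G b x)) ^ 4) \<partial>lborel)
          + (\<integral>\<^sup>+x. indicator E x * ennreal (norm (g x) ^ 4) \<partial>lborel)))"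
proof -
  obtain C where C: "C \<ge> 0" "\<And>u :: 'a \<Rightarrow> real. u \<in> borel_measurable borel \<Longrightarrow> slobodeckij M 4 (DIM('a) + 7 / 2) u < \<infinity> \<Longrightarrow>
     (AE x in M. ennreal \<bar>u x\<bar> ^ 4 \<le> ennreal C * ((\<integral>\<^sup>+x. ennreal \<bar>u x\<bar> ^ 4 \<partial>M) + slobodeckij M 4 (DIM('a) + 7 / 2) u))"
    using Linf_bound_scalar[OF d] by blast
  obtain C' where C': "C' \<ge> 0" "\<And>(g :: 'a \<Rightarrow> 'b) G. has_weak_grad E g G \<Longrightarrow>
    slobodeckij M (2 ^ 2) (DIM('a) + 2 ^ 2 - 1/2) g
      \<le> ennreal C' * (\<integral>\<^sup>+x. indicator E x * ennreal ((\<Sum>b\<in>Basis. norm (G b x)) ^ (2 ^ 2)) \<partial>lborel)"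
    using slobodeckij_le_grad[where 'b='b and k=2] by blast
  have "AE x in lborel. x \<in> E \<longrightarrow> ennreal (norm (g x)) ^ 4
      \<le> ennreal (C * (1 / V + C')) * ((\<integral>\<^sup>+x. indicator E x * ennreal ((\<Sum>b\<in>Basis. norm (G b x)) ^ 4) \<partial>lborel)
          + (\<integral>\<^sup>+x. indicator E x * ennreal (norm (g x) ^ 4) \<partial>lborel))" (is "AE x in lborel. x \<in> E \<longrightarrow> _ \<le> _ * (?G + ?q)")
    if G: "has_weak_grad E g G" and fin: "(\<integral>\<^sup>+x. indicator E x * ennreal ((\<Sum>b\<in>Basis. norm (G b x)) ^ 4) \<partial>lborel) < \<infinity>"
    for g :: "'a \<Rightarrow> 'b" and G
  proof -
    have [measurable]: "g \<in> borel_measurable borel"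
      using G by (auto simp: has_weak_grad_def dest: borel_measurable_integrable)
    define u where "u x = norm (g x)" for x
    have [measurable]: "u \<in> borel_measurable borel" unfolding u_def by measurable
    have e: "DIM('a) + 2 ^ 2 - 1/2 = DIM('a) + (7 / 2 :: real)" by simp
    have "slobodeckij M 4 (DIM('a) + 7 / 2) u \<le> slobodeckij M 4 (DIM('a) + 7 / 2) g"
      unfolding slobodeckij_def u_def
      by (intro nn_integral_mono ennreal_leI divide_right_mono power_mono) (auto intro: norm_triangle_ineq3)
    also have "\<dots> \<le> ennreal C' * ?G"
      using C'(2)[OF G] unfolding e by simp
    finally have S: "slobodeckij M 4 (DIM('a) + 7 / 2) u \<le> ennreal C' * ?G" .
    moreover have "ennreal C' * ?G < \<infinity>" using fin by (simp add: ennreal_mult_less_top)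
    ultimately have "slobodeckij M 4 (DIM('a) + 7 / 2) u < \<infinity>" by (rule le_less_trans)
    from C(2)[OF _ this]
    have ae: "AE x in M. ennreal \<bar>u x\<bar> ^ 4 \<le> ennreal C * ((\<integral>\<^sup>+x. ennreal \<bar>u x\<bar> ^ 4 \<partial>M) + slobodeckij M 4 (DIM('a) + 7 / 2) u)"
      by simp
    have q: "(\<integral>\<^sup>+x. ennreal \<bar>u x\<bar> ^ 4 \<partial>M) = ennreal (1 / V) * ?q"
      by (subst nn_integral_M') (auto simp: u_def ennreal_power)
    have "(\<integral>\<^sup>+x. ennreal \<bar>u x\<bar> ^ 4 \<partial>M) + slobodeckij M 4 (DIM('a) + 7 / 2) u \<le> ennreal (1 / V) * ?q + ennreal C' * ?G"
      unfolding q by (intro add_left_mono S)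
    also have "\<dots> \<le> (ennreal (1 / V) * ?q + ennreal C' * ?G) + (ennreal (1 / V) * ?G + ennreal C' * ?q)" by simp
    also have "\<dots> = ennreal (1 / V + C') * (?G + ?q)"
      using C' V by (subst ennreal_plus) (auto simp: distrib_left distrib_right ac_simps)
    finally have "ennreal C * ((\<integral>\<^sup>+x. ennreal \<bar>u x\<bar> ^ 4 \<partial>M) + slobodeckij M 4 (DIM('a) + 7 / 2) u)
        \<le> ennreal C * (ennreal (1 / V + C') * (?G + ?q))"
      by (rule mult_left_mono) simp
    also have "\<dots> = ennreal (C * (1 / V + C')) * (?G + ?q)"
      using C C' V by (simp add: ennreal_mult mult.assoc del: ennreal_plus)
    finally have "AE x in M. ennreal (norm (g x)) ^ 4 \<le> ennreal (C * (1 / V + C')) * (?G + ?q)"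
      using ae by (auto elim!: eventually_mono simp: u_def intro: order_trans)
    then show ?thesis
      unfolding M_def using emeasure_E by (subst (asm) AE_uniform_measure) (auto simp: less_top)
  qed
  then show ?thesis using C C' V by (intro exI[of _ "C * (1 / V + C')"]) auto
qed

end

section \<open>The embeddings on a finite union of convex sets\<close>

lemma H1_finite_iff: "H1 D f < \<infinity> \<longleftrightarrow> (\<forall>b\<in>Basis. \<exists>g. weak_pdiff D b f g)"
proof -
  have "L2 D f < \<infinity> \<and> (\<forall>b\<in>Basis. L2 D (wpd D b f) < \<infinity>)" if *: "\<forall>b\<in>Basis. \<exists>g. weak_pdiff D b f g"
  proof -
    have w: "weak_pdiff D b f (wpd D b f)" if "b \<in> Basis" for b
      unfolding wpd_def using * that someI_ex[of "weak_pdiff D b f"] by blast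
    then have "L2 D f < \<infinity>" "L2 D (wpd D b f) < \<infinity>" if "b \<in> Basis" for b
      unfolding weak_pdiff_def using that by blast+
    \<comment> \<open>\<open>Basis\<close> is non-empty, so some weak derivative exists and brings
      the L2 bound of f with it.\<close>
    then show ?thesis using SOME_Basis by blast
  qed
  note * = this
  show ?thesis
  proof (cases "\<forall>b\<in>Basis. \<exists>g. weak_pdiff D b f g")
    case True
    then have "(L2 D f)\<^sup>2 + (\<Sum>b\<in>Basis. (L2 D (wpd D b f))\<^sup>2) < top"
      using *[OF True] by (simp add: power_less_top_ennreal ennreal_sum_less_top)
    then show ?thesis unfolding H1_def if_P[OF True] using True by simp
  next
    case False
    then show ?thesis unfolding H1_def if_not_P[OF False] by simp
  qed
qed

lemma H1_wpd: "H1 D f < \<infinity> \<Longrightarrow> b \<in> Basis \<Longrightarrow> weak_pdiff D b f (wpd D b f)"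
  unfolding wpd_def H1_finite_iff using someI_ex[of "weak_pdiff D b f"] by blast

lemma H1_power2: "H1 D f < \<infinity> \<Longrightarrow> (H1 D f)\<^sup>2 = (L2 D f)\<^sup>2 + (\<Sum>b\<in>Basis. (L2 D (wpd D b f))\<^sup>2)"
  unfolding H1_finite_iff by (simp add: H1_def)

lemma H1_L2: "H1 D f < \<infinity> \<Longrightarrow> L2 D f < \<infinity>"
  using H1_wpd[OF _ SOME_Basis] unfolding weak_pdiff_def by blast

lemma borel_rep_integrable:
  fixes f' :: "'a::euclidean_space \<Rightarrow> 'b::euclidean_space"
  assumes D: "open D" "bounded D" and f: "borel_rep D f f'" and L2: "L2 D f < \<infinity>"
  shows "integrable lborel f'"
proof -
  have Db [measurable]: "D \<in> sets borel" using D by simp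
  have [measurable]: "f' \<in> borel_measurable borel" using f by (simp add: borel_rep_def)
  have sq: "(\<integral>\<^sup>+x. indicator D x * ennreal ((norm (f' x))\<^sup>2) \<partial>lborel) < \<infinity>"
    using L2 borel_rep_nn_integral[OF Db f, of "\<lambda>y. ennreal ((norm y)\<^sup>2)"]
    unfolding L2_finite_iff by simp
  have "(\<integral>\<^sup>+x. ennreal (norm (f' x)) \<partial>lborel) \<le> (\<integral>\<^sup>+x. indicator D x + indicator D x * ennreal ((norm (f' x))\<^sup>2) \<partial>lborel)"
  proof (rule nn_integral_mono)
    fix x
    have "norm (f' x) \<le> 1 + (norm (f' x))\<^sup>2"
      using sum_squares_ge_zero[of "norm (f' x) - 1" 0] norm_ge_zero[of "f' x"]
      unfolding power2_eq_square by (simp add: algebra_simps del: norm_ge_zero)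
    then have "ennreal (norm (f' x)) \<le> ennreal (1 + (norm (f' x))\<^sup>2)" by (rule ennreal_leI)
    then show "ennreal (norm (f' x)) \<le> indicator D x + indicator D x * ennreal ((norm (f' x))\<^sup>2)"
      using f by (cases "x \<in> D") (auto simp: borel_rep_def)
  qed
  also have "\<dots> = emeasure lborel D + (\<integral>\<^sup>+x. indicator D x * ennreal ((norm (f' x))\<^sup>2) \<partial>lborel)"
    by (subst nn_integral_add) auto
  also have "\<dots> < \<infinity>" using sq emeasure_bounded_finite[OF D(2)] by simp
  finally show ?thesis by (intro integrableI_bounded) auto
qed

text \<open>A test function on E is also one on D, so restriction costs nothing. The Borel
  representatives carry the weak gradient on D to the setting in which the embeddings on E are
  stated.\<close>

lemma has_weak_grad_rep:
  fixes f f' :: "'a::euclidean_space \<Rightarrow> 'b::euclidean_space"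
  assumes D: "open D" "bounded D" and E: "E \<subseteq> D" and H1: "H1 D f < \<infinity>"
    and f: "borel_rep D f f'" and G: "\<And>b. b \<in> Basis \<Longrightarrow> borel_rep D (wpd D b f) (G b)"
  shows "has_weak_grad E f' G"
proof -
  have Db [measurable]: "D \<in> sets borel" using D by simp
  have "(\<integral>x. pdiff b \<phi> x *\<^sub>R f' x \<partial>lborel) = - (\<integral>x. \<phi> x *\<^sub>R G b x \<partial>lborel)"
    if b: "b \<in> Basis" and \<phi>: "\<phi> \<in> test_functions E" for b \<phi>
  proof -
    have "\<phi> \<in> test_functions D" using \<phi> E test_functions_mono by blast
    then have "(\<integral>x. pdiff b \<phi> x *\<^sub>R f x \<partial>lebesgue_on D) = - (\<integral>x. \<phi> x *\<^sub>R wpd D b f x \<partial>lebesgue_on D)"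
      using H1_wpd[OF H1 b] by (auto simp: weak_pdiff_def)
    then show ?thesis
      using borel_rep_integral[OF Db f test_borel[OF test_pdiff[OF \<phi> b]]]
        borel_rep_integral[OF Db G[OF b] test_borel[OF \<phi>]] by simp
  qed
  moreover have "integrable lborel f'"
    using borel_rep_integrable[OF D f] H1_L2[OF H1] by simp
  moreover have "integrable lborel (G b)" if "b \<in> Basis" for b
    using borel_rep_integrable[OF D G[OF that]] H1_wpd[OF H1 that] by (simp add: weak_pdiff_def)
  ultimately show ?thesis by (simp add: has_weak_grad_def)
qed

text \<open>Containment in D lets weak derivatives on D restrict to each piece. Overlaps are
  harmless, since only upper bounds are summed over finitely many pieces.\<close>

definition convex_cover :: "'a::euclidean_space set \<Rightarrow> 'a set set \<Rightarrow> bool" where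
  "convex_cover D \<E> \<longleftrightarrow> finite \<E> \<and> (\<forall>E\<in>\<E>. convex_region E \<and> E \<subseteq> D) \<and> D \<subseteq> \<Union>\<E>"

text \<open>The parameter g is meant to be a tuple of a function and its Borel representatives: the
  constant is uniform, although the representatives are chosen separately for each function.\<close>

lemma nn_integral_cover_bound:
  assumes cov: "convex_cover D \<E>"
    and bound: "\<And>E. E \<in> \<E> \<Longrightarrow> \<exists>C\<ge>0::real. \<forall>g. P g \<longrightarrow> (\<integral>\<^sup>+x. indicator E x * F g x \<partial>lborel) \<le> ennreal C * B g"
    and F: "\<And>g. P g \<Longrightarrow> F g \<in> borel_measurable borel"
  shows "\<exists>C\<ge>0::real. \<forall>g. P g \<longrightarrow> (\<integral>\<^sup>+x. indicator D x * F g x \<partial>lborel) \<le> ennreal C * B g"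
proof -
  have fin: "finite \<E>" and D: "D \<subseteq> \<Union>\<E>" and reg: "\<And>E. E \<in> \<E> \<Longrightarrow> convex_region E"
    using cov by (auto simp: convex_cover_def)
  obtain C where C: "\<And>E. E \<in> \<E> \<Longrightarrow> C E \<ge> (0::real)"
    "\<And>E g. E \<in> \<E> \<Longrightarrow> P g \<Longrightarrow> (\<integral>\<^sup>+x. indicator E x * F g x \<partial>lborel) \<le> ennreal (C E) * B g"
    using bound by metis
  have "(\<integral>\<^sup>+x. indicator D x * F g x \<partial>lborel) \<le> ennreal (\<Sum>E\<in>\<E>. C E) * B g" if P: "P g" for g
  proof -
    have "(\<integral>\<^sup>+x. indicator D x * F g x \<partial>lborel) \<le> (\<integral>\<^sup>+x. (\<Sum>E\<in>\<E>. indicator E x * F g x) \<partial>lborel)"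
    proof (rule nn_integral_mono)
      fix x
      show "indicator D x * F g x \<le> (\<Sum>E\<in>\<E>. indicator E x * F g x)"
      proof (cases "x \<in> D")
        case True
        then obtain E where E: "E \<in> \<E>" "x \<in> E" using D by blast
        have "indicator D x * F g x = indicator E x * F g x" using True E by simp
        also have "\<dots> \<le> (\<Sum>E\<in>\<E>. indicator E x * F g x)"
          using E fin by (intro member_le_sum) auto
        finally show ?thesis .
      qed simp
    qed
    also have "\<dots> = (\<Sum>E\<in>\<E>. \<integral>\<^sup>+x. indicator E x * F g x \<partial>lborel)"
    proof (rule nn_integral_sum)
      fix E assume "E \<in> \<E>"
      then have [measurable]: "E \<in> sets borel" using reg convex_region.E_borel by blast
      have [measurable]: "F g \<in> borel_measurable borel" by (rule F[OF P])
      show "(\<lambda>x. indicator E x * F g x) \<in> borel_measurable lborel" by measurable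
    qed
    also have "\<dots> \<le> (\<Sum>E\<in>\<E>. ennreal (C E) * B g)"
      using C P by (intro sum_mono) auto
    also have "\<dots> = ennreal (\<Sum>E\<in>\<E>. C E) * B g"
      using C by (simp add: sum_ennreal sum_distrib_right[symmetric])
    finally show ?thesis .
  qed
  then show ?thesis using C by (intro exI[of _ "\<Sum>E\<in>\<E>. C E"]) (auto intro: sum_nonneg)
qed

lemma nn_integral_indicator_mono:
  "E \<subseteq> D \<Longrightarrow> (\<integral>\<^sup>+x. indicator E x * f x \<partial>M) \<le> (\<integral>\<^sup>+x. indicator D x * f x \<partial>M)"
  by (intro nn_integral_mono mult_right_mono) (auto simp: indicator_def)

lemma gradient_power_le:
  fixes G :: "'a::euclidean_space \<Rightarrow> 'a \<Rightarrow> 'b::euclidean_space"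
  assumes D: "D \<in> sets borel" and E: "E \<subseteq> D" and p: "p > 0"
    and G: "\<And>b. b \<in> Basis \<Longrightarrow> G b \<in> borel_measurable borel"
  shows "(\<integral>\<^sup>+x. indicator E x * ennreal ((\<Sum>b\<in>Basis. norm (G b x)) ^ p) \<partial>lborel)
    \<le> ennreal (real DIM('a) ^ p) * (\<Sum>b\<in>Basis. \<integral>\<^sup>+x. indicator D x * ennreal (norm (G b x) ^ p) \<partial>lborel)"
proof -
  have [measurable]: "D \<in> sets borel" by fact
  have "(\<integral>\<^sup>+x. indicator E x * ennreal ((\<Sum>b\<in>Basis. norm (G b x)) ^ p) \<partial>lborel)
      \<le> (\<integral>\<^sup>+x. indicator D x * ennreal ((\<Sum>b\<in>Basis. norm (G b x)) ^ p) \<partial>lborel)"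
    by (rule nn_integral_indicator_mono[OF E])
  also have "\<dots> \<le> (\<integral>\<^sup>+x. ennreal (real DIM('a) ^ p) * (\<Sum>b\<in>Basis. indicator D x * ennreal (norm (G b x) ^ p)) \<partial>lborel)"
  proof (rule nn_integral_mono)
    fix x
    have "(\<Sum>b\<in>Basis. norm (G b x)) ^ p \<le> real DIM('a) ^ p * (\<Sum>b\<in>Basis. norm (G b x) ^ p)"
      by (rule sum_power_le) (use p in auto)
    then have "ennreal ((\<Sum>b\<in>Basis. norm (G b x)) ^ p) \<le> ennreal (real DIM('a) ^ p) * (\<Sum>b\<in>Basis. ennreal (norm (G b x) ^ p))"
      by (simp add: ennreal_mult[symmetric] sum_nonneg ennreal_leI)
    then show "indicator D x * ennreal ((\<Sum>b\<in>Basis. norm (G b x)) ^ p)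
        \<le> ennreal (real DIM('a) ^ p) * (\<Sum>b\<in>Basis. indicator D x * ennreal (norm (G b x) ^ p))"
      by (cases "x \<in> D") auto
  qed
  also have "\<dots> = ennreal (real DIM('a) ^ p) * (\<integral>\<^sup>+x. (\<Sum>b\<in>Basis. indicator D x * ennreal (norm (G b x) ^ p)) \<partial>lborel)"
    using G by (intro nn_integral_cmult) measurable
  also have "(\<integral>\<^sup>+x. (\<Sum>b\<in>Basis. indicator D x * ennreal (norm (G b x) ^ p)) \<partial>lborel)
      = (\<Sum>b\<in>Basis. \<integral>\<^sup>+x. indicator D x * ennreal (norm (G b x) ^ p) \<partial>lborel)"
    using G by (intro nn_integral_sum) measurable
  finally show ?thesis .
qed

lemma L2_rep:
  assumes D: "D \<in> sets borel" and f: "borel_rep D f f'"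
  shows "(L2 D f)\<^sup>2 = (\<integral>\<^sup>+x. indicator D x * ennreal ((norm (f' x))\<^sup>2) \<partial>lborel)"
  using borel_rep_nn_integral[OF D f, of "\<lambda>y. ennreal ((norm y)\<^sup>2)"] f
  by (simp add: L2_power2 borel_rep_def)

lemma L4_rep:
  assumes D: "D \<in> sets borel" and f: "borel_rep D f f'"
  shows "(\<integral>\<^sup>+x. ennreal (norm (f x) ^ 4) \<partial>lebesgue_on D) = (\<integral>\<^sup>+x. indicator D x * ennreal (norm (f' x) ^ 4) \<partial>lborel)"
  using borel_rep_nn_integral[OF D f, of "\<lambda>y. ennreal (norm y ^ 4)"] by simp

lemma H1_reps:
  fixes f :: "'a::euclidean_space \<Rightarrow> 'b::euclidean_space"
  assumes D: "D \<in> sets borel" and H1: "H1 D f < \<infinity>"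
  obtains f' G where "borel_rep D f f'" "\<And>b. b \<in> Basis \<Longrightarrow> borel_rep D (wpd D b f) (G b)"
proof -
  obtain f' where f': "borel_rep D f f'"
    using borel_rep_exists[OF D L2_measurable[OF H1_L2[OF H1]]] by blast
  have "\<exists>g. borel_rep D (wpd D b f) g" if "b \<in> Basis" for b
    using borel_rep_exists[OF D L2_measurable] H1_wpd[OF H1 that] unfolding weak_pdiff_def by blast
  then obtain G where "\<And>b. b \<in> Basis \<Longrightarrow> borel_rep D (wpd D b f) (G b)" by metis
  with f' that show ?thesis by blast
qed

lemma H1_L4:
  fixes D :: "'a::euclidean_space set"
  assumes D: "open D" "bounded D" and cov: "convex_cover D \<E>" and d: "DIM('a) \<le> 3"
  shows "\<exists>C\<ge>0. \<forall>f :: 'a \<Rightarrow> 'b::euclidean_space. H1 D f < \<infinity> \<longrightarrow>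
    (\<integral>\<^sup>+x. ennreal (norm (f x) ^ 4) \<partial>lebesgue_on D) \<le> ennreal C * (H1 D f) ^ 4"
proof -
  have Db: "D \<in> sets borel" using D by simp
  let ?d = "real DIM('a)"
  define P where "P = (\<lambda>(f :: 'a \<Rightarrow> 'b, f', G). H1 D f < \<infinity> \<and> borel_rep D f f' \<and> (\<forall>b\<in>Basis. borel_rep D (wpd D b f) (G b)))"
  \<comment> \<open>Lets the factor d^2, which arises from the sum over the partial derivatives,
    dominate the L2 part as well.\<close>
  have d1: "1 \<le> ?d ^ 2"
    by (rule one_le_power) (metis DIM_ge_Suc0 One_nat_def of_nat_1 of_nat_mono)
  have "\<exists>C\<ge>0. \<forall>g. P g \<longrightarrow> (\<integral>\<^sup>+x. indicator D x * ennreal (norm (fst (snd g) x) ^ 4) \<partial>lborel) \<le> ennreal C * (H1 D (fst g)) ^ 4"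
  proof (rule nn_integral_cover_bound[OF cov])
    fix E assume "E \<in> \<E>"
    then have E: "convex_region E" "E \<subseteq> D" using cov by (auto simp: convex_cover_def)
    obtain C where C: "C \<ge> 0" "\<And>(g :: 'a \<Rightarrow> 'b) G. has_weak_grad E g G \<Longrightarrow>
    (\<integral>\<^sup>+x. indicator E x * ennreal (norm (g x) ^ 4) \<partial>lborel)
      \<le> ennreal C * ((\<integral>\<^sup>+x. indicator E x * ennreal ((\<Sum>b\<in>Basis. norm (G b x))\<^sup>2) \<partial>lborel)
          + (\<integral>\<^sup>+x. indicator E x * ennreal ((norm (g x))\<^sup>2) \<partial>lborel))\<^sup>2"
      using convex_region.L4_grad_E[OF E(1) d, where 'b='b] by blast
    have "(\<integral>\<^sup>+x. indicator E x * ennreal (norm (f' x) ^ 4) \<partial>lborel) \<le> ennreal (C * (?d\<^sup>2)\<^sup>2) * (H1 D f) ^ 4"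
      if f: "H1 D f < \<infinity>" "borel_rep D f f'" and G: "\<And>b. b \<in> Basis \<Longrightarrow> borel_rep D (wpd D b f) (G b)"
      for f f' :: "'a \<Rightarrow> 'b" and G
    proof -
      have "(\<integral>\<^sup>+x. indicator E x * ennreal ((\<Sum>b\<in>Basis. norm (G b x))\<^sup>2) \<partial>lborel)
          \<le> ennreal (?d\<^sup>2) * (\<Sum>b\<in>Basis. \<integral>\<^sup>+x. indicator D x * ennreal (norm (G b x) ^ 2) \<partial>lborel)"
        using G by (intro gradient_power_le[OF Db E(2)]) (auto simp: borel_rep_def)
      also have "(\<Sum>b\<in>Basis. \<integral>\<^sup>+x. indicator D x * ennreal (norm (G b x) ^ 2) \<partial>lborel) = (\<Sum>b\<in>Basis. (L2 D (wpd D b f))\<^sup>2)"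
        by (intro sum.cong refl L2_rep[OF Db G, symmetric])
      finally have 1: "(\<integral>\<^sup>+x. indicator E x * ennreal ((\<Sum>b\<in>Basis. norm (G b x))\<^sup>2) \<partial>lborel)
          \<le> ennreal (?d\<^sup>2) * (\<Sum>b\<in>Basis. (L2 D (wpd D b f))\<^sup>2)" .
      have "(\<integral>\<^sup>+x. indicator E x * ennreal ((norm (f' x))\<^sup>2) \<partial>lborel) \<le> 1 * (L2 D f)\<^sup>2"
        using nn_integral_indicator_mono[OF E(2)] by (simp add: L2_rep[OF Db f(2)])
      also have "\<dots> \<le> ennreal (?d\<^sup>2) * (L2 D f)\<^sup>2"
        using d1 by (intro mult_right_mono) (simp_all add: ennreal_1[symmetric] del: ennreal_1)
      finally have "(\<integral>\<^sup>+x. indicator E x * ennreal ((\<Sum>b\<in>Basis. norm (G b x))\<^sup>2) \<partial>lborel)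
          + (\<integral>\<^sup>+x. indicator E x * ennreal ((norm (f' x))\<^sup>2) \<partial>lborel)
          \<le> ennreal (?d\<^sup>2) * (\<Sum>b\<in>Basis. (L2 D (wpd D b f))\<^sup>2) + ennreal (?d\<^sup>2) * (L2 D f)\<^sup>2"
        by (intro add_mono 1)
      also have "\<dots> = ennreal (?d\<^sup>2) * (H1 D f)\<^sup>2"
        by (simp add: H1_power2[OF f(1)] distrib_left add.commute)
      finally have "ennreal C * ((\<integral>\<^sup>+x. indicator E x * ennreal ((\<Sum>b\<in>Basis. norm (G b x))\<^sup>2) \<partial>lborel)
          + (\<integral>\<^sup>+x. indicator E x * ennreal ((norm (f' x))\<^sup>2) \<partial>lborel))\<^sup>2 \<le> ennreal C * (ennreal (?d\<^sup>2) * (H1 D f)\<^sup>2)\<^sup>2"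
        by (intro mult_left_mono power_mono) auto
      also have "\<dots> = ennreal (C * (?d\<^sup>2)\<^sup>2) * (H1 D f) ^ 4"
        using C by (simp add: ennreal_mult power_mult_distrib ennreal_power mult.assoc flip: power_mult)
      finally show ?thesis
        using C(2)[of f' G] has_weak_grad_rep[OF D E(2) f] G by (meson order_trans)
    qed
    note key = this
    have "(\<integral>\<^sup>+x. indicator E x * ennreal (norm (fst (snd g) x) ^ 4) \<partial>lborel) \<le> ennreal (C * (?d\<^sup>2)\<^sup>2) * (H1 D (fst g)) ^ 4"
      if "P g" for g
    proof -
      obtain f f' G where g: "g = (f, f', G)" by (cases g)
      show ?thesis using that key[of f f' G] unfolding g P_def by simp
    qed
    then show "\<exists>C\<ge>0. \<forall>g. P g \<longrightarrow> (\<integral>\<^sup>+x. indicator E x * ennreal (norm (fst (snd g) x) ^ 4) \<partial>lborel) \<le> ennreal C * (H1 D (fst g)) ^ 4"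
      using C(1) by (intro exI[of _ "C * (?d\<^sup>2)\<^sup>2"]) simp
  qed (auto simp: P_def borel_rep_def)
  then obtain C where C: "C \<ge> 0" "\<And>f f' G. P (f, f', G) \<Longrightarrow> (\<integral>\<^sup>+x. indicator D x * ennreal (norm (f' x) ^ 4) \<partial>lborel) \<le> ennreal C * (H1 D f) ^ 4"
    by auto
  have "(\<integral>\<^sup>+x. ennreal (norm (f x) ^ 4) \<partial>lebesgue_on D) \<le> ennreal C * (H1 D f) ^ 4" if "H1 D f < \<infinity>" for f :: "'a \<Rightarrow> 'b"
  proof -
    obtain f' G where f': "borel_rep D f f'" "\<And>b. b \<in> Basis \<Longrightarrow> borel_rep D (wpd D b f) (G b)"
      using H1_reps[OF Db \<open>H1 D f < \<infinity>\<close>] by blast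
    then show ?thesis using C(2)[of f f' G] that L4_rep[OF Db f'(1)] by (simp add: P_def)
  qed
  then show ?thesis using C by blast
qed

text \<open>For s different from 1, \<open>Hfrac\<close> contains the Slobodeckij seminorm itself,
  so no weak derivative is involved: the double integral over pairs in E is part of that over pairs
  in D.\<close>

lemma Hfrac_L4_neq_1:
  fixes D :: "'a::euclidean_space set" and s :: real
  assumes D: "open D" "bounded D" and cov: "convex_cover D \<E>" and s: "DIM('a) \<le> 4 * s" "s \<noteq> 1"
  shows "\<exists>C\<ge>0. \<forall>g :: 'a \<Rightarrow> 'b::euclidean_space. Hfrac D s g < \<infinity> \<longrightarrow>
    (\<integral>\<^sup>+x. ennreal (norm (g x) ^ 4) \<partial>lebesgue_on D) \<le> ennreal C * (Hfrac D s g) ^ 4"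
proof -
  have Db: "D \<in> sets borel" using D by simp
  define a where "a = DIM('a) + 2 * s"
  define P where "P = (\<lambda>(f :: 'a \<Rightarrow> 'b, f'). Hfrac D s f < \<infinity> \<and> borel_rep D f f')"
  have Hf: "(Hfrac D s f)\<^sup>2 = (L2 D f)\<^sup>2 +
       (\<integral>\<^sup>+x. (\<integral>\<^sup>+y. ennreal ((norm (f x - f y))\<^sup>2 / norm (x - y) powr a) \<partial>lebesgue_on D) \<partial>lebesgue_on D)" for f :: "'a \<Rightarrow> 'b"
    using s by (simp add: Hfrac_def a_def)
  have "\<exists>C\<ge>0. \<forall>g. P g \<longrightarrow> (\<integral>\<^sup>+x. indicator D x * ennreal (norm (snd g x) ^ 4) \<partial>lborel) \<le> ennreal C * (Hfrac D s (fst g)) ^ 4"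
  proof (rule nn_integral_cover_bound[OF cov])
    fix E assume "E \<in> \<E>"
    then have E: "convex_region E" "E \<subseteq> D" using cov by (auto simp: convex_cover_def)
    interpret convex_region E by fact
    obtain C where C: "C \<ge> 0" "\<And>g :: 'a \<Rightarrow> 'b. g \<in> borel_measurable borel \<Longrightarrow>
    (\<integral>\<^sup>+x. indicator E x * ennreal (norm (g x) ^ 4) \<partial>lborel)
      \<le> ennreal C * (slobodeckij M 2 a g + (\<integral>\<^sup>+x. indicator E x * ennreal ((norm (g x))\<^sup>2) \<partial>lborel))\<^sup>2"
      unfolding a_def using L4_slobodeckij_E[OF s(1), where 'b='b] by blast
    define v where "v = 1 / V * (1 / V)"
    have v: "v \<ge> 0" using V by (simp add: v_def)
    have "(\<integral>\<^sup>+x. indicator E x * ennreal (norm (f' x) ^ 4) \<partial>lborel) \<le> ennreal (C * (1 + v)\<^sup>2) * (Hfrac D s f) ^ 4"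
      if f: "Hfrac D s f < \<infinity>" "borel_rep D f f'" for f f' :: "'a \<Rightarrow> 'b"
    proof -
      have f'm: "f' \<in> borel_measurable borel" using f by (simp add: borel_rep_def)
      have "slobodeckij M 2 a f' = ennreal v * (\<integral>\<^sup>+x. \<integral>\<^sup>+y. indicator E x * indicator E y *
          ennreal (norm (f' x - f' y) ^ 2 / norm (x - y) powr a) \<partial>lborel \<partial>lborel)"
        using V by (subst slobodeckij_M'[OF f'm]) (simp add: v_def ennreal_mult[symmetric])
      also have "\<dots> \<le> ennreal v * (\<integral>\<^sup>+x. \<integral>\<^sup>+y. indicator D x * indicator D y *
          ennreal (norm (f' x - f' y) ^ 2 / norm (x - y) powr a) \<partial>lborel \<partial>lborel)"
        using E(2) by (intro mult_left_mono nn_integral_mono mult_right_mono) (auto simp: indicator_def)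
      also have "(\<integral>\<^sup>+x. \<integral>\<^sup>+y. indicator D x * indicator D y *
          ennreal (norm (f' x - f' y) ^ 2 / norm (x - y) powr a) \<partial>lborel \<partial>lborel)
        = (\<integral>\<^sup>+x. (\<integral>\<^sup>+y. ennreal ((norm (f x - f y))\<^sup>2 / norm (x - y) powr a) \<partial>lebesgue_on D) \<partial>lebesgue_on D)"
        by (rule borel_rep_nn_integral2[OF Db f(2), of "\<lambda>p q x y. ennreal ((norm (p - q))\<^sup>2 / norm (x - y) powr a)", symmetric])
          measurable
      finally have 1: "slobodeckij M 2 a f' \<le> ennreal v *
          (\<integral>\<^sup>+x. (\<integral>\<^sup>+y. ennreal ((norm (f x - f y))\<^sup>2 / norm (x - y) powr a) \<partial>lebesgue_on D) \<partial>lebesgue_on D)" (is "_ \<le> _ * ?S") .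
      have "(\<integral>\<^sup>+x. indicator E x * ennreal ((norm (f' x))\<^sup>2) \<partial>lborel) \<le> (L2 D f)\<^sup>2"
        using nn_integral_indicator_mono[OF E(2)] by (simp add: L2_rep[OF Db f(2)])
      with 1 have "slobodeckij M 2 a f' + (\<integral>\<^sup>+x. indicator E x * ennreal ((norm (f' x))\<^sup>2) \<partial>lborel) \<le> ennreal v * ?S + (L2 D f)\<^sup>2"
        by (rule add_mono)
      also have "\<dots> \<le> (ennreal v * ?S + (L2 D f)\<^sup>2) + (?S + ennreal v * (L2 D f)\<^sup>2)" by simp
      also have "\<dots> = ennreal (1 + v) * (Hfrac D s f)\<^sup>2"
        unfolding Hf using v by (subst ennreal_plus) (auto simp: distrib_left distrib_right ac_simps)
      finally have "ennreal C * (slobodeckij M 2 a f' + (\<integral>\<^sup>+x. indicator E x * ennreal ((norm (f' x))\<^sup>2) \<partial>lborel))\<^sup>2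
          \<le> ennreal C * (ennreal (1 + v) * (Hfrac D s f)\<^sup>2)\<^sup>2"
        by (intro mult_left_mono power_mono) auto
      also have "\<dots> = ennreal (C * (1 + v)\<^sup>2) * (Hfrac D s f) ^ 4"
        using C v by (simp add: ennreal_mult power_mult_distrib ennreal_power mult.assoc flip: power_mult del: ennreal_plus)
      finally show ?thesis using C(2)[OF f'm] by (rule order_trans[rotated])
    qed
    then show "\<exists>C\<ge>0. \<forall>g. P g \<longrightarrow> (\<integral>\<^sup>+x. indicator E x * ennreal (norm (snd g x) ^ 4) \<partial>lborel) \<le> ennreal C * (Hfrac D s (fst g)) ^ 4"
      using C by (intro exI[of _ "C * (1 + v)\<^sup>2"]) (auto simp: P_def)
  qed (auto simp: P_def borel_rep_def)
  then obtain C where C: "C \<ge> 0" "\<And>f f'. P (f, f') \<Longrightarrow> (\<integral>\<^sup>+x. indicator D x * ennreal (norm (f' x) ^ 4) \<partial>lborel) \<le> ennreal C * (Hfrac D s f) ^ 4"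
    by auto
  have "(\<integral>\<^sup>+x. ennreal (norm (f x) ^ 4) \<partial>lebesgue_on D) \<le> ennreal C * (Hfrac D s f) ^ 4" if "Hfrac D s f < \<infinity>" for f :: "'a \<Rightarrow> 'b"
  proof -
    have "(Hfrac D s f)\<^sup>2 < top" using that by (simp add: power_less_top_ennreal)
    then have "L2 D f < \<infinity>" unfolding Hf by (simp add: power_less_top_ennreal)
    then obtain f' where f': "borel_rep D f f'"
      using borel_rep_exists[OF Db L2_measurable] by blast
    then show ?thesis using C(2)[of f f'] that L4_rep[OF Db f'] by (simp add: P_def)
  qed
  then show ?thesis using C by blast
qed

lemma Hfrac_L4:
  fixes D :: "'a::euclidean_space set" and s :: real
  assumes D: "open D" "bounded D" and cov: "convex_cover D \<E>" and d: "DIM('a) \<le> 3"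
    and s: "s = 1 \<or> DIM('a) \<le> 4 * s"
  shows "\<exists>C\<ge>0. \<forall>g :: 'a \<Rightarrow> 'b::euclidean_space. Hfrac D s g < \<infinity> \<longrightarrow>
    (\<integral>\<^sup>+x. ennreal (norm (g x) ^ 4) \<partial>lebesgue_on D) \<le> ennreal C * (Hfrac D s g) ^ 4"
proof (cases "s = 1")
  case True
  then show ?thesis using H1_L4[OF D cov d, where 'b='b] by (simp add: Hfrac_def)
next
  case False
  then show ?thesis using s Hfrac_L4_neq_1[OF D cov, where 'b='b] by blast
qed

lemma Hfrac_finite_L2:
  assumes "Hfrac D s f < \<infinity>"
  shows "L2 D f < \<infinity>" "(L2 D f)\<^sup>2 \<le> (Hfrac D s f)\<^sup>2"
proof -
  show "(L2 D f)\<^sup>2 \<le> (Hfrac D s f)\<^sup>2"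
  proof (cases "s = 1")
    case True
    then show ?thesis using assms H1_power2[of D f] by (simp add: Hfrac_def)
  next
    case False
    then show ?thesis by (simp add: Hfrac_def)
  qed
  also have "\<dots> < top" using assms by (simp add: power_less_top_ennreal)
  finally show "L2 D f < \<infinity>" by (simp add: power_less_top_ennreal)
qed

lemma H1plus_power2:
  assumes "H1plus D s f < \<infinity>"
  shows "H1 D f < \<infinity>" "(H1plus D s f)\<^sup>2 = (L2 D f)\<^sup>2 + (\<Sum>b\<in>Basis. (Hfrac D s (wpd D b f))\<^sup>2)"
    "b \<in> Basis \<Longrightarrow> Hfrac D s (wpd D b f) < \<infinity>"
proof -
  show H1: "H1 D f < \<infinity>" using assms by (auto simp: H1plus_def split: if_splits)
  then show eq: "(H1plus D s f)\<^sup>2 = (L2 D f)\<^sup>2 + (\<Sum>b\<in>Basis. (Hfrac D s (wpd D b f))\<^sup>2)"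
    by (simp add: H1plus_def)
  assume b: "b \<in> Basis"
  have "(H1plus D s f)\<^sup>2 < top" using assms by (simp add: power_less_top_ennreal)
  then have "(\<Sum>b\<in>Basis. (Hfrac D s (wpd D b f))\<^sup>2) < top" unfolding eq by simp
  then show "Hfrac D s (wpd D b f) < \<infinity>"
    using b by (simp add: power_less_top_ennreal)
qed

lemma H1_le_H1plus:
  assumes "H1plus D s f < \<infinity>"
  shows "H1 D f \<le> H1plus D s f"
proof (rule ennreal_power_le_imp_le[of _ 2])
  show "(H1 D f)\<^sup>2 \<le> (H1plus D s f)\<^sup>2"
    unfolding H1plus_power2(2)[OF assms] H1_power2[OF H1plus_power2(1)[OF assms]]
    by (intro add_left_mono sum_mono Hfrac_finite_L2 H1plus_power2(3)[OF assms])
qed simp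

text \<open>The partial derivatives are in L^4 by \<open>Hfrac_L4\<close> and u itself by
  \<open>H1_L4\<close>, so \<open>Linf_grad_E\<close> applies on every piece. All bounds are
  homogeneous of degree 4 until the final fourth root.\<close>

lemma H1plus_Linf:
  fixes D :: "'a::euclidean_space set" and s :: real
  assumes D: "open D" "bounded D" and cov: "convex_cover D \<E>" and d: "DIM('a) \<le> 3"
    and s: "s = 1 \<or> DIM('a) \<le> 4 * s"
  shows "\<exists>C\<ge>0. \<forall>u :: 'a \<Rightarrow> 'b::euclidean_space. H1plus D s u < \<infinity> \<longrightarrow>
    (AE x in lebesgue_on D. ennreal (norm (u x)) \<le> ennreal C * H1plus D s u)"
proof -
  have Db: "D \<in> sets borel" using D by simp
  let ?d = "real DIM('a)"
  obtain C1 where C1: "C1 \<ge> 0" "\<And>g :: 'a \<Rightarrow> 'b. Hfrac D s g < \<infinity> \<Longrightarrow>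
    (\<integral>\<^sup>+x. ennreal (norm (g x) ^ 4) \<partial>lebesgue_on D) \<le> ennreal C1 * (Hfrac D s g) ^ 4"
    using Hfrac_L4[OF D cov d s, where 'b='b] by blast
  obtain C2 where C2: "C2 \<ge> 0" "\<And>f :: 'a \<Rightarrow> 'b. H1 D f < \<infinity> \<Longrightarrow>
    (\<integral>\<^sup>+x. ennreal (norm (f x) ^ 4) \<partial>lebesgue_on D) \<le> ennreal C2 * (H1 D f) ^ 4"
    using H1_L4[OF D cov d, where 'b='b] by blast
  have "\<forall>E\<in>\<E>. \<exists>C\<ge>0. \<forall>(g :: 'a \<Rightarrow> 'b) G. has_weak_grad E g G \<longrightarrow>
    (\<integral>\<^sup>+x. indicator E x * ennreal ((\<Sum>b\<in>Basis. norm (G b x)) ^ 4) \<partial>lborel) < \<infinity> \<longrightarrow>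
    (AE x in lborel. x \<in> E \<longrightarrow> ennreal (norm (g x)) ^ 4
      \<le> ennreal C * ((\<integral>\<^sup>+x. indicator E x * ennreal ((\<Sum>b\<in>Basis. norm (G b x)) ^ 4) \<partial>lborel)
          + (\<integral>\<^sup>+x. indicator E x * ennreal (norm (g x) ^ 4) \<partial>lborel)))"
    using convex_region.Linf_grad_E[OF _ d, where 'b='b] cov unfolding convex_cover_def by blast
  from bchoice[OF this] obtain C where CE: "\<forall>E\<in>\<E>. 0 \<le> C E \<and> (\<forall>(g :: 'a \<Rightarrow> 'b) G. has_weak_grad E g G \<longrightarrow>
    (\<integral>\<^sup>+x. indicator E x * ennreal ((\<Sum>b\<in>Basis. norm (G b x)) ^ 4) \<partial>lborel) < \<infinity> \<longrightarrow>
    (AE x in lborel. x \<in> E \<longrightarrow> ennreal (norm (g x)) ^ 4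
      \<le> ennreal (C E) * ((\<integral>\<^sup>+x. indicator E x * ennreal ((\<Sum>b\<in>Basis. norm (G b x)) ^ 4) \<partial>lborel)
          + (\<integral>\<^sup>+x. indicator E x * ennreal (norm (g x) ^ 4) \<partial>lborel))))" ..
  then have C0: "\<And>E. E \<in> \<E> \<Longrightarrow> C E \<ge> 0" by simp
  have C: "AE x in lborel. x \<in> E \<longrightarrow> ennreal (norm (g x)) ^ 4
      \<le> ennreal (C E) * ((\<integral>\<^sup>+x. indicator E x * ennreal ((\<Sum>b\<in>Basis. norm (G b x)) ^ 4) \<partial>lborel)
          + (\<integral>\<^sup>+x. indicator E x * ennreal (norm (g x) ^ 4) \<partial>lborel))"
    if "E \<in> \<E>" "has_weak_grad E g G"
      "(\<integral>\<^sup>+x. indicator E x * ennreal ((\<Sum>b\<in>Basis. norm (G b x)) ^ 4) \<partial>lborel) < \<infinity>" for E and g :: "'a \<Rightarrow> 'b" and G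
    using CE[rule_format, OF that(1), THEN conjunct2, rule_format, OF that(2,3)] by simp
  have fin: "finite \<E>" and DE: "D \<subseteq> \<Union>\<E>" and ED: "\<And>E. E \<in> \<E> \<Longrightarrow> E \<subseteq> D"
    using cov by (auto simp: convex_cover_def)
  \<comment> \<open>The factor d^4 stems from \<open>gradient_power_le\<close>, d C1 from the d
    partial derivatives and C2 from u itself; the sum of the constants C E serves all pieces at
    once.\<close>
  define K where "K = (\<Sum>E\<in>\<E>. C E) * (?d ^ 4 * (?d * C1) + C2)"
  have CS: "C E \<le> (\<Sum>E\<in>\<E>. C E)" if "E \<in> \<E>" for E
    using that C0 fin by (intro member_le_sum) auto
  have K: "K \<ge> 0" using C0 C1 C2 by (auto simp: K_def intro!: mult_nonneg_nonneg sum_nonneg add_nonneg_nonneg)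
  have "AE x in lebesgue_on D. ennreal (norm (u x)) \<le> ennreal (root 4 K) * H1plus D s u"
    if H: "H1plus D s u < \<infinity>" for u :: "'a \<Rightarrow> 'b"
  proof -
    let ?N = "H1plus D s u"
    have H1: "H1 D u < \<infinity>" using H1plus_power2(1)[OF H] .
    obtain u' G where u': "borel_rep D u u'" and G: "\<And>b. b \<in> Basis \<Longrightarrow> borel_rep D (wpd D b u) (G b)"
      using H1_reps[OF Db H1] by blast
    have grad: "(\<integral>\<^sup>+x. indicator E x * ennreal ((\<Sum>b\<in>Basis. norm (G b x)) ^ 4) \<partial>lborel) \<le> ennreal (?d ^ 4 * (?d * C1)) * ?N ^ 4"
      if "E \<in> \<E>" for E
    proof -
      have "(\<integral>\<^sup>+x. indicator E x * ennreal ((\<Sum>b\<in>Basis. norm (G b x)) ^ 4) \<partial>lborel)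
          \<le> ennreal (?d ^ 4) * (\<Sum>b\<in>Basis. \<integral>\<^sup>+x. indicator D x * ennreal (norm (G b x) ^ 4) \<partial>lborel)"
        using G by (intro gradient_power_le[OF Db ED[OF that]]) (auto simp: borel_rep_def)
      also have "\<dots> \<le> ennreal (?d ^ 4) * (\<Sum>b\<in>(Basis::'a set). ennreal C1 * ?N ^ 4)"
      proof (intro mult_left_mono sum_mono)
        fix b :: 'a assume b: "b \<in> Basis"
        have "(\<integral>\<^sup>+x. indicator D x * ennreal (norm (G b x) ^ 4) \<partial>lborel) \<le> ennreal C1 * (Hfrac D s (wpd D b u)) ^ 4"
          using C1(2)[OF H1plus_power2(3)[OF H b]] L4_rep[OF Db G[OF b]] by simp
        also have "\<dots> \<le> ennreal C1 * ?N ^ 4"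
        proof (intro mult_left_mono power_mono)
          show "Hfrac D s (wpd D b u) \<le> ?N"
          proof (rule ennreal_power_le_imp_le[of _ 2])
            have "(Hfrac D s (wpd D b u))\<^sup>2 \<le> (\<Sum>b\<in>Basis. (Hfrac D s (wpd D b u))\<^sup>2)"
              using b by (intro member_le_sum) auto
            also have "\<dots> \<le> ?N\<^sup>2" unfolding H1plus_power2(2)[OF H] by simp
            finally show "(Hfrac D s (wpd D b u))\<^sup>2 \<le> ?N\<^sup>2" .
          qed simp
        qed auto
        finally show "(\<integral>\<^sup>+x. indicator D x * ennreal (norm (G b x) ^ 4) \<partial>lborel) \<le> ennreal C1 * ?N ^ 4" .
      qed simp
      also have "\<dots> = ennreal (?d ^ 4 * (?d * C1)) * ?N ^ 4"
        using C1 by (simp add: ennreal_mult mult.assoc ennreal_of_nat_eq_real_of_nat)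
      finally show ?thesis .
    qed
    have val: "(\<integral>\<^sup>+x. indicator E x * ennreal (norm (u' x) ^ 4) \<partial>lborel) \<le> ennreal C2 * ?N ^ 4" if "E \<in> \<E>" for E
    proof -
      have "(\<integral>\<^sup>+x. indicator E x * ennreal (norm (u' x) ^ 4) \<partial>lborel) \<le> (\<integral>\<^sup>+x. indicator D x * ennreal (norm (u' x) ^ 4) \<partial>lborel)"
        by (rule nn_integral_indicator_mono[OF ED[OF that]])
      also have "\<dots> \<le> ennreal C2 * (H1 D u) ^ 4"
        using C2(2)[OF H1] L4_rep[OF Db u'] by simp
      also have "\<dots> \<le> ennreal C2 * ?N ^ 4"
        by (intro mult_left_mono power_mono H1_le_H1plus H) auto
      finally show ?thesis .
    qed
    have "AE x in lborel. x \<in> E \<longrightarrow> ennreal (norm (u' x)) ^ 4 \<le> ennreal K * ?N ^ 4" if E: "E \<in> \<E>" for E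
    proof -
      have "ennreal (?d ^ 4 * (?d * C1)) * ?N ^ 4 < \<infinity>"
        using H by (simp add: ennreal_mult_less_top power_less_top_ennreal)
      then have f: "(\<integral>\<^sup>+x. indicator E x * ennreal ((\<Sum>b\<in>Basis. norm (G b x)) ^ 4) \<partial>lborel) < \<infinity>"
        using grad[OF E] by (rule le_less_trans[rotated])
      have w: "has_weak_grad E u' G"
        using has_weak_grad_rep[OF D ED[OF E] H1 u'] G by blast
      have "ennreal (C E) * ((\<integral>\<^sup>+x. indicator E x * ennreal ((\<Sum>b\<in>Basis. norm (G b x)) ^ 4) \<partial>lborel)
          + (\<integral>\<^sup>+x. indicator E x * ennreal (norm (u' x) ^ 4) \<partial>lborel))
         \<le> ennreal (\<Sum>E\<in>\<E>. C E) * (ennreal (?d ^ 4 * (?d * C1)) * ?N ^ 4 + ennreal C2 * ?N ^ 4)"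
        by (intro mult_mono add_mono grad[OF E] val[OF E] ennreal_leI CS[OF E]) auto
      also have "\<dots> = ennreal K * ?N ^ 4"
        unfolding K_def using C0 C1 C2 by (simp add: ennreal_mult sum_nonneg distrib_right mult.assoc)
      finally show ?thesis
        using C[OF E w f]
        by (auto elim!: eventually_mono intro: order_trans)
    qed
    then have "AE x in lborel. \<forall>E\<in>\<E>. x \<in> E \<longrightarrow> ennreal (norm (u' x)) ^ 4 \<le> ennreal K * ?N ^ 4"
      using fin by (subst AE_ball_countable) (auto simp: countable_finite)
    then have "AE x in lebesgue. x \<in> D \<longrightarrow> ennreal (norm (u' x)) ^ 4 \<le> ennreal K * ?N ^ 4"
      using DE by (intro AE_completion) (auto elim!: eventually_mono)
    then have "AE x in lebesgue_on D. ennreal (norm (u' x)) ^ 4 \<le> ennreal K * ?N ^ 4"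
      using Db by (subst AE_restrict_space_iff) auto
    moreover have "AE x in lebesgue_on D. u x = u' x" using u' by (simp add: borel_rep_def)
    ultimately show ?thesis
    proof eventually_elim
      case (elim x)
      show ?case
      proof (rule ennreal_power_le_imp_le[of _ 4])
        have "ennreal K = ennreal (root 4 K) ^ 4" using K by (simp add: ennreal_power)
        then show "ennreal (norm (u x)) ^ 4 \<le> (ennreal (root 4 K) * ?N) ^ 4"
          using elim by (simp add: power_mult_distrib)
      qed simp
    qed
  qed
  then show ?thesis using K by (intro exI[of _ "root 4 K"]) auto
qed

section \<open>Polytopal domains as finite unions of convex sets\<close>

text \<open>A non-zero remainder would be orthogonal to e and f, which would give three independent
  vectors in dimension two.\<close>

lemma orthonormal_pair_expansion:
  fixes e f v :: "'a::euclidean_space"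
  assumes dim: "DIM('a) = 2" and ef: "norm e = 1" "norm f = 1" "e \<bullet> f = 0"
  shows "v = (v \<bullet> e) *\<^sub>R e + (v \<bullet> f) *\<^sub>R f"
proof (rule ccontr)
  assume ne: "v \<noteq> (v \<bullet> e) *\<^sub>R e + (v \<bullet> f) *\<^sub>R f"
  define w where "w = v - (v \<bullet> e) *\<^sub>R e - (v \<bullet> f) *\<^sub>R f"
  have ee: "e \<bullet> e = 1" "f \<bullet> f = 1" "f \<bullet> e = 0"
    using ef by (auto simp: norm_eq_1 inner_commute)
  have w: "w \<noteq> 0" using ne by (auto simp: w_def algebra_simps)
  have we: "w \<bullet> e = 0" "w \<bullet> f = 0"
    using ee ef by (simp_all add: w_def inner_diff_left)
  have distinct: "e \<noteq> f" "w \<noteq> e" "w \<noteq> f" "e \<noteq> 0" "f \<noteq> 0"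
    using ee ef we w by auto
  have "pairwise orthogonal {e, f, w}"
    using ee ef we by (auto simp: pairwise_def orthogonal_def inner_commute)
  then have "independent {e, f, w}"
    using distinct w by (intro pairwise_orthogonal_independent) auto
  then have "card {e, f, w} \<le> DIM('a)" by (rule independent_bound[THEN conjunct2])
  moreover have "card {e, f, w} = 3" using distinct by (auto simp: card_insert_if)
  ultimately show False using dim by simp
qed

text \<open>In polar coordinates the inner products with f and n are \<rho> sin \<theta> and \<rho>
  sin (\<omega> - \<theta>), so X1 and X2 are the half-discs on the inner sides of the two edges. Up
  to the angle pi the sector is their intersection; beyond pi it is their union, which is why a
  re-entrant corner gets two convex pieces.\<close>

lemma sector_half_planes:
  fixes p e f :: "'a::euclidean_space"
  assumes dim: "DIM('a) = 2" and ef: "norm e = 1" "norm f = 1" "e \<bullet> f = 0"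
    and \<omega>: "0 < \<omega>" "\<omega> < 2 * pi" and r: "r > 0"
  defines "n \<equiv> sin \<omega> *\<^sub>R e - cos \<omega> *\<^sub>R f"
  defines "X1 \<equiv> ball p r \<inter> {x. (x - p) \<bullet> f > 0}" and "X2 \<equiv> ball p r \<inter> {x. (x - p) \<bullet> n > 0}"
  shows "{p + \<rho> *\<^sub>R (cos \<theta> *\<^sub>R e + sin \<theta> *\<^sub>R f) | \<rho> \<theta>. 0 < \<rho> \<and> \<rho> < r \<and> 0 < \<theta> \<and> \<theta> < \<omega>}
    = (if \<omega> \<le> pi then X1 \<inter> X2 else X1 \<union> X2)" (is "?S = _")
proof -
  have ee: "e \<bullet> e = 1" "f \<bullet> f = 1" "f \<bullet> e = 0"
    using ef by (auto simp: norm_eq_1 inner_commute)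
  have polar: "x \<in> ball p r \<and> (x - p) \<bullet> f = \<rho> * sin \<theta> \<and> (x - p) \<bullet> n = \<rho> * sin (\<omega> - \<theta>)"
    if "x = p + \<rho> *\<^sub>R (cos \<theta> *\<^sub>R e + sin \<theta> *\<^sub>R f)" "0 < \<rho>" "\<rho> < r" for x \<rho> \<theta>
  proof -
    have "(norm (cos \<theta> *\<^sub>R e + sin \<theta> *\<^sub>R f))\<^sup>2 = 1"
      unfolding power2_norm_eq_inner using ee ef
      by (simp add: inner_add_left inner_add_right flip: power2_eq_square)
    then have "norm (cos \<theta> *\<^sub>R e + sin \<theta> *\<^sub>R f) = 1" by (simp add: power2_eq_1_iff) (smt (verit) norm_ge_zero)
    then have "x \<in> ball p r" using that by (simp add: dist_norm)
    moreover have "(x - p) \<bullet> f = \<rho> * sin \<theta>" "(x - p) \<bullet> n = \<rho> * sin (\<omega> - \<theta>)"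
      using that ee ef by (simp_all add: n_def inner_add_left inner_diff_right sin_diff algebra_simps)
    ultimately show ?thesis by simp
  qed
  have sub: "x \<in> (if \<omega> \<le> pi then X1 \<inter> X2 else X1 \<union> X2)"
    if x: "x = p + \<rho> *\<^sub>R (cos \<theta> *\<^sub>R e + sin \<theta> *\<^sub>R f)" "0 < \<rho>" "\<rho> < r" and \<theta>: "0 < \<theta>" "\<theta> < \<omega>" for x \<rho> \<theta>
  proof (cases "\<omega> \<le> pi")
    case True
    then have "sin \<theta> > 0" "sin (\<omega> - \<theta>) > 0"
      using \<theta> by (auto intro!: sin_gt_zero)
    then show ?thesis using polar[OF x] x(2) True by (simp add: X1_def X2_def)
  next
    case False
    then have "sin \<theta> > 0 \<or> sin (\<omega> - \<theta>) > 0"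
      using \<theta> \<omega> by (cases "\<theta> < pi") (auto intro!: sin_gt_zero)
    then show ?thesis using polar[OF x] x(2) False by (auto simp: X1_def X2_def)
  qed
  \<comment> \<open>Reduces membership in the sector to a statement about the polar angle of x,
    taken in [0, 2 pi).\<close>
  have sup: "x \<in> ?S"
    if x: "x \<in> ball p r" "x \<noteq> p"
      and \<theta>: "\<And>\<theta>. 0 \<le> \<theta> \<Longrightarrow> \<theta> < 2 * pi \<Longrightarrow> (x - p) \<bullet> f = norm (x - p) * sin \<theta> \<Longrightarrow>
         (x - p) \<bullet> n = norm (x - p) * sin (\<omega> - \<theta>) \<Longrightarrow> 0 < \<theta> \<and> \<theta> < \<omega>" for x
  proof -
    define v where "v = x - p"
    define \<rho> where "\<rho> = norm v"
    have \<rho>: "0 < \<rho>" "\<rho> < r" using x by (auto simp: \<rho>_def v_def dist_norm norm_minus_commute)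
    have v: "v = (v \<bullet> e) *\<^sub>R e + (v \<bullet> f) *\<^sub>R f" by (rule orthonormal_pair_expansion[OF dim ef])
    have "\<rho>\<^sup>2 = v \<bullet> v" by (simp add: \<rho>_def power2_norm_eq_inner)
    also have "\<dots> = ((v \<bullet> e) *\<^sub>R e + (v \<bullet> f) *\<^sub>R f) \<bullet> v" using v by simp
    also have "\<dots> = (v \<bullet> e)\<^sup>2 + (v \<bullet> f)\<^sup>2"
      unfolding inner_add_left inner_scaleR_left power2_eq_square by (simp only: inner_commute)
    finally have "(v \<bullet> e / \<rho>)\<^sup>2 + (v \<bullet> f / \<rho>)\<^sup>2 = \<rho>\<^sup>2 / \<rho>\<^sup>2"
      by (simp only: power_divide add_divide_distrib)
    also have "\<dots> = 1" using \<rho> by simp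
    finally have "(v \<bullet> e / \<rho>)\<^sup>2 + (v \<bullet> f / \<rho>)\<^sup>2 = 1" .
    then obtain t where t: "0 \<le> t" "t < 2 * pi" "v \<bullet> e / \<rho> = cos t" "v \<bullet> f / \<rho> = sin t"
      using sincos_total_2pi by metis
    then have ve: "v \<bullet> e = \<rho> * cos t" "v \<bullet> f = \<rho> * sin t" using \<rho> by (auto simp: field_simps)
    have "x = p + \<rho> *\<^sub>R (cos t *\<^sub>R e + sin t *\<^sub>R f)"
      using v unfolding ve by (simp add: v_def algebra_simps)
    moreover have "0 < t \<and> t < \<omega>"
      using \<theta>[OF t(1,2)] polar[OF calculation \<rho>] by (simp add: \<rho>_def v_def)
    ultimately show ?thesis using \<rho> by blast
  qed
  show ?thesis
  proof (intro equalityI subsetI)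
    fix x assume "x \<in> ?S"
    then show "x \<in> (if \<omega> \<le> pi then X1 \<inter> X2 else X1 \<union> X2)" using sub by blast
  next
    fix x assume x: "x \<in> (if \<omega> \<le> pi then X1 \<inter> X2 else X1 \<union> X2)"
    then have xb: "x \<in> ball p r" "x \<noteq> p" by (auto simp: X1_def X2_def split: if_splits)
    then have pos: "norm (x - p) > 0" by simp
    show "x \<in> ?S"
    proof (rule sup[OF xb])
      fix t assume t: "0 \<le> t" "t < 2 * pi" "(x - p) \<bullet> f = norm (x - p) * sin t"
         "(x - p) \<bullet> n = norm (x - p) * sin (\<omega> - t)"
      have h1: "0 < t \<and> t < pi" if "x \<in> X1"
      proof -
        have "sin t > 0" using that t pos by (simp add: X1_def zero_less_mult_iff)
        moreover have "sin t \<le> 0" if "pi \<le> t" using sin_le_zero[of t] that t by simp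
        ultimately show ?thesis using t(1) by (cases "t = 0") force+
      qed
      \<comment> \<open>If t were at least \<omega>, then t - \<omega> would lie in [0, pi] and sin
        (\<omega> - t) could not be positive. The side condition ensures t - \<omega> <= pi when
        \<omega> is at most pi; otherwise t < 2 pi does.\<close>
      have h2: "t < \<omega>" "sin (\<omega> - t) > 0" if "x \<in> X2" and "\<omega> \<le> pi \<longrightarrow> t < pi"
      proof -
        show s: "sin (\<omega> - t) > 0" using that t pos by (simp add: X2_def zero_less_mult_iff)
        show "t < \<omega>"
        proof (rule ccontr)
          assume "\<not> t < \<omega>"
          then have "sin (t - \<omega>) \<ge> 0" using that t \<omega> by (intro sin_ge_zero) auto
          then show False using s sin_minus[of "t - \<omega>"] by simp
        qed
      qed
      show "0 < t \<and> t < \<omega>"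
      proof (cases "\<omega> \<le> pi")
        case True
        then have "x \<in> X1" "x \<in> X2" using x by auto
        then show ?thesis using h1 h2 by auto
      next
        case False
        then consider "x \<in> X1" | "x \<in> X2" using x by auto
        then show ?thesis
        proof cases
          case 1
          then show ?thesis using h1 False by auto
        next
          case 2
          then have "t < \<omega>" "sin (\<omega> - t) > 0" using h2 False by auto
          \<comment> \<open>The angle 0 is excluded because sin \<omega> <= 0 for pi < \<omega> < 2
            pi.\<close>
          moreover have "t \<noteq> 0" using calculation(2) sin_le_zero[of \<omega>] False \<omega> by auto
          ultimately show ?thesis using t(1) by simp
        qed
      qed
    qed
  qed
qed

definition locally_convex_cover :: "'a::euclidean_space set \<Rightarrow> 'a set \<Rightarrow> 'a set set \<Rightarrow> bool" where
  "locally_convex_cover D U \<E> \<longleftrightarrow> finite \<E> \<and> (\<forall>E\<in>\<E>. open E \<and> convex E) \<and> \<Union>\<E> = D \<inter> U"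

lemma sector_cover:
  fixes D :: "'a::euclidean_space set"
  assumes dim: "DIM('a) = 2" and "sector_at D p \<omega>"
  shows "\<exists>r>0. \<exists>\<E>. locally_convex_cover D (ball p r) \<E>"
proof -
  obtain r e f where \<omega>: "0 < \<omega>" "\<omega> < 2 * pi" and r: "r > 0" and ef: "norm e = 1" "norm f = 1" "e \<bullet> f = 0"
    and eq: "D \<inter> ball p r =
          {p + \<rho> *\<^sub>R (cos \<theta> *\<^sub>R e + sin \<theta> *\<^sub>R f) | \<rho> \<theta>. 0 < \<rho> \<and> \<rho> < r \<and> 0 < \<theta> \<and> \<theta> < \<omega>}"
    using assms(2) unfolding sector_at_def by blast
  define n where "n = sin \<omega> *\<^sub>R e - cos \<omega> *\<^sub>R f"
  define H where "H m = ball p r \<inter> {x. (x - p) \<bullet> m > 0}" for m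
  have half: "open (H m)" "convex (H m)" for m
  proof -
    have "{x. (x - p) \<bullet> m > 0} = {x. m \<bullet> x > m \<bullet> p}"
      by (auto simp: inner_diff_left inner_commute[of m])
    then show "open (H m)" "convex (H m)"
      unfolding H_def by (auto intro!: open_Int convex_Int open_halfspace_gt convex_halfspace_gt)
  qed
  have "D \<inter> ball p r = (if \<omega> \<le> pi then H f \<inter> H n else H f \<union> H n)"
    unfolding eq H_def n_def by (rule sector_half_planes[OF dim ef \<omega> r])
  then have "locally_convex_cover D (ball p r) (if \<omega> \<le> pi then {H f \<inter> H n} else {H f, H n})"
    unfolding locally_convex_cover_def using half by (auto intro: open_Int convex_Int)
  then show ?thesis using r by blast
qed

text \<open>Compactness belongs to the closure of D, so local covers are required at boundary points
  as well; this is where the sectors enter.\<close>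

lemma convex_cover_of_local:
  fixes D :: "'a::euclidean_space set"
  assumes D: "bounded D" and loc: "\<And>x. x \<in> closure D \<Longrightarrow> \<exists>r>0. \<exists>\<E>. locally_convex_cover D (ball x r) \<E>"
  shows "\<exists>\<E>. convex_cover D \<E>"
proof -
  obtain r where r: "\<And>x. x \<in> closure D \<Longrightarrow> r x > 0 \<and> (\<exists>\<E>. locally_convex_cover D (ball x (r x)) \<E>)"
    using loc by metis
  then obtain \<C> where \<C>: "\<And>x. x \<in> closure D \<Longrightarrow> locally_convex_cover D (ball x (r x)) (\<C> x)"
    by metis
  have "compact (closure D)" using D by (simp add: compact_closure)
  moreover have "closure D \<subseteq> (\<Union>x\<in>closure D. ball x (r x))" using r by force
  ultimately obtain F where F: "F \<subseteq> closure D" "finite F" "closure D \<subseteq> (\<Union>x\<in>F. ball x (r x))"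
    using compactE_image[of "closure D" "closure D" "\<lambda>x. ball x (r x)"] by (metis open_ball)
  \<comment> \<open>A \<open>convex_region\<close> is non-empty, so empty pieces are
    discarded.\<close>
  define \<E> where "\<E> = (\<Union>x\<in>F. \<C> x) - {{}}"
  have mem: "open E \<and> convex E \<and> E \<subseteq> D" if "E \<in> \<E>" for E
  proof -
    obtain x where "x \<in> F" "E \<in> \<C> x" using \<open>E \<in> \<E>\<close> by (auto simp: \<E>_def)
    then show ?thesis using \<C>[of x] F(1) unfolding locally_convex_cover_def by blast
  qed
  have "convex_cover D \<E>"
    unfolding convex_cover_def
  proof (intro conjI ballI)
    show "finite \<E>" unfolding \<E>_def using F \<C> by (auto simp: locally_convex_cover_def)
    fix E assume E: "E \<in> \<E>"
    then show "E \<subseteq> D" using mem by blast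
    show "convex_region E"
      using mem[OF E] E D bounded_subset by unfold_locales (auto simp: \<E>_def)
  next
    show "D \<subseteq> \<Union>\<E>"
    proof
      fix y assume y: "y \<in> D"
      then obtain x where x: "x \<in> F" "y \<in> ball x (r x)" using F(3) closure_subset by blast
      then have "y \<in> \<Union>(\<C> x)" using \<C>[of x] F(1) y unfolding locally_convex_cover_def by blast
      then show "y \<in> \<Union>\<E>" using x(1) by (auto simp: \<E>_def)
    qed
  qed
  then show ?thesis by blast
qed

lemma polytopal_domain_cover:
  fixes D :: "'a::euclidean_space set"
  assumes "polytopal_domain D"
  shows "open D" "bounded D" "D \<noteq> {}" "DIM('a) \<le> 3" "\<exists>\<E>. convex_cover D \<E>"
proof -
  show "DIM('a) \<le> 3" using assms by (auto simp: polytopal_domain_def)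
  consider P where "polytope P" "D = interior P" "D \<noteq> {}" | "polygonal D"
    using assms by (auto simp: polytopal_domain_def)
  then have "open D \<and> bounded D \<and> D \<noteq> {} \<and> (\<exists>\<E>. convex_cover D \<E>)"
  proof cases
    case 1
    then have D: "open D" "convex D" "bounded D"
      using polytope_imp_convex polytope_imp_bounded bounded_interior convex_interior by auto
    then have "convex_region D" using 1 by unfold_locales auto
    then have "convex_cover D {D}" by (auto simp: convex_cover_def)
    then show ?thesis using D 1 by blast
  next
    case 2
    then have D: "open D" "bounded D" "D \<noteq> {}" "DIM('a) = 2" and fr: "\<And>p. p \<in> frontier D \<Longrightarrow> \<exists>\<omega>. sector_at D p \<omega>"
      by (auto simp: polygonal_def)
    have "\<exists>r>0. \<exists>\<E>. locally_convex_cover D (ball x r) \<E>" if "x \<in> closure D" for x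
    proof (cases "x \<in> D")
      case True
      then obtain r where "r > 0" "ball x r \<subseteq> D" using D(1) open_contains_ball by blast
      then have "locally_convex_cover D (ball x r) {ball x r}" by (auto simp: locally_convex_cover_def)
      then show ?thesis using \<open>r > 0\<close> by blast
    next
      case False
      then have "x \<in> frontier D" using that D(1) by (simp add: frontier_def interior_open)
      then show ?thesis using fr sector_cover[OF D(4)] by blast
    qed
    then show ?thesis using convex_cover_of_local D by blast
  qed
  then show "open D" "bounded D" "D \<noteq> {}" "\<exists>\<E>. convex_cover D \<E>" by blast+
qed

text \<open>Non-convex domains occur only in dimension two, where \<alpha> > 1/2 gives d <= 4
  \<alpha>, the condition under which the fractional space of order \<alpha> embeds into L^4. The
  alternative \<alpha> = 1 is served by \<open>H1_L4\<close>.\<close>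

lemma admissible_exponent:
  fixes D :: "'a::euclidean_space set" and \<alpha> :: real
  assumes D: "polytopal_domain D" and adm: "admissible D \<alpha>"
  shows "\<alpha> = 1 \<or> DIM('a) \<le> 4 * \<alpha>"
proof (cases "convex D")
  case True
  then show ?thesis using adm by (simp add: admissible_def)
next
  case False
  then have "polygonal D"
    using D polytope_imp_convex convex_interior unfolding polytopal_domain_def by blast
  then have "DIM('a) = 2" by (simp add: polygonal_def)
  moreover have "1/2 < \<alpha>" using adm False by (simp add: admissible_def)
  ultimately show ?thesis by simp
qed

section \<open>Algebra of the Sobolev norms\<close>

text \<open>Squared norms and (a + b)^2 <= 2 a^2 + 2 b^2 replace the triangle inequality: squares
  are plain integrals, and the factor 2 is harmless for finiteness and limits.\<close>

lemma L2_lincomb: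
  fixes f g :: "'a::euclidean_space \<Rightarrow> 'b::euclidean_space"
  assumes f: "L2 D f < \<infinity>" and g: "L2 D g < \<infinity>"
  shows "(L2 D (\<lambda>x. f x + c *\<^sub>R g x))\<^sup>2 \<le> 2 * (L2 D f)\<^sup>2 + ennreal (2 * c\<^sup>2) * (L2 D g)\<^sup>2"
    and "L2 D (\<lambda>x. f x + c *\<^sub>R g x) < \<infinity>"
proof -
  have [measurable]: "f \<in> borel_measurable (lebesgue_on D)" "g \<in> borel_measurable (lebesgue_on D)"
    using L2_measurable[OF f] L2_measurable[OF g] .
  have "(L2 D (\<lambda>x. f x + c *\<^sub>R g x))\<^sup>2 = (\<integral>\<^sup>+x. ennreal ((norm (f x + c *\<^sub>R g x))\<^sup>2) \<partial>lebesgue_on D)"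
    by (rule L2_power2) measurable
  also have "\<dots> \<le> (\<integral>\<^sup>+x. 2 * ennreal ((norm (f x))\<^sup>2) + ennreal (2 * c\<^sup>2) * ennreal ((norm (g x))\<^sup>2) \<partial>lebesgue_on D)"
  proof (rule nn_integral_mono)
    fix x
    have "(norm (f x + c *\<^sub>R g x))\<^sup>2 \<le> (norm (f x) + norm (c *\<^sub>R g x))\<^sup>2"
      by (intro power_mono norm_triangle_ineq) auto
    also have "\<dots> \<le> 2 * (norm (f x))\<^sup>2 + 2 * (norm (c *\<^sub>R g x))\<^sup>2"
      using sum_squares_ge_zero[of "norm (f x) - norm (c *\<^sub>R g x)" 0]
      by (simp add: power2_eq_square algebra_simps)
    also have "\<dots> = 2 * (norm (f x))\<^sup>2 + (2 * c\<^sup>2) * (norm (g x))\<^sup>2"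
      by (simp add: power_mult_distrib)
    finally have "ennreal ((norm (f x + c *\<^sub>R g x))\<^sup>2) \<le> ennreal \<dots>" by (rule ennreal_leI)
    then show "ennreal ((norm (f x + c *\<^sub>R g x))\<^sup>2) \<le> 2 * ennreal ((norm (f x))\<^sup>2) + ennreal (2 * c\<^sup>2) * ennreal ((norm (g x))\<^sup>2)"
      by (simp add: ennreal_mult)
  qed
  also have "\<dots> = 2 * (L2 D f)\<^sup>2 + ennreal (2 * c\<^sup>2) * (L2 D g)\<^sup>2"
    by (simp add: nn_integral_add nn_integral_cmult L2_power2)
  finally show le: "(L2 D (\<lambda>x. f x + c *\<^sub>R g x))\<^sup>2 \<le> 2 * (L2 D f)\<^sup>2 + ennreal (2 * c\<^sup>2) * (L2 D g)\<^sup>2" .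
  also have "\<dots> < top"
    using f g by (simp add: ennreal_mult_less_top power_less_top_ennreal)
  finally show "L2 D (\<lambda>x. f x + c *\<^sub>R g x) < \<infinity>" by (simp add: power_less_top_ennreal)
qed

lemma borel_rep_lincomb:
  assumes "borel_rep D f f'" "borel_rep D g g'"
  shows "borel_rep D (\<lambda>x. f x + c *\<^sub>R g x) (\<lambda>x. f' x + c *\<^sub>R g' x)"
  using assms unfolding borel_rep_def by (auto elim!: eventually_elim2)

section \<open>Linearity and invariance under null sets of weak derivatives and Sobolev
  norms\<close>

locale sobolev_region =
  fixes D :: "'a::euclidean_space set"
  assumes open_D: "open D" and bounded_D: "bounded D"
begin

lemma D_borel [measurable]: "D \<in> sets borel" using open_D by simp

lemma weak_pdiff_rep:
  assumes w: "weak_pdiff D b f f1" and f: "borel_rep D f f'" and f1: "borel_rep D f1 f1'"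
    and b: "b \<in> Basis" and \<phi>: "\<phi> \<in> test_functions D"
  shows "(\<integral>x. pdiff b \<phi> x *\<^sub>R f' x \<partial>lborel) = - (\<integral>x. \<phi> x *\<^sub>R f1' x \<partial>lborel)"
  using w borel_rep_integral[OF D_borel f test_borel[OF test_pdiff[OF \<phi> b]]]
    borel_rep_integral[OF D_borel f1 test_borel[OF \<phi>]] \<phi> unfolding weak_pdiff_def by metis

text \<open>\<open>wpd\<close> is selected by choice, so calculations with it are possible only up
  to null sets; this consequence of the fundamental lemma is what makes it linear almost
  everywhere.\<close>

lemma weak_pdiff_unique:
  fixes f :: "'a \<Rightarrow> 'b::euclidean_space"
  assumes b: "b \<in> Basis" and w: "weak_pdiff D b f g" "weak_pdiff D b f h"
  shows "AE x in lebesgue_on D. g x = h x"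
proof -
  have L: "L2 D f < \<infinity>" "L2 D g < \<infinity>" "L2 D h < \<infinity>" using w by (auto simp: weak_pdiff_def)
  obtain f' g' h' where r: "borel_rep D f f'" "borel_rep D g g'" "borel_rep D h h'"
    using L borel_rep_exists[OF D_borel L2_measurable] by metis
  note int = borel_rep_integrable[OF open_D bounded_D r(2) L(2)] borel_rep_integrable[OF open_D bounded_D r(3) L(3)]
  have "AE x in lborel. x \<in> D \<longrightarrow> g' x - h' x = 0"
  proof (rule fundamental_lemma[OF _ open_D])
    show "integrable lborel (\<lambda>x. g' x - h' x)" using int by auto
    fix \<phi> assume \<phi>: "\<phi> \<in> test_functions D"
    have "(\<integral>x. \<phi> x *\<^sub>R (g' x - h' x) \<partial>lborel) = (\<integral>x. \<phi> x *\<^sub>R g' x \<partial>lborel) - (\<integral>x. \<phi> x *\<^sub>R h' x \<partial>lborel)"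
      unfolding scaleR_diff_right
      by (intro Bochner_Integration.integral_diff test_scaleR_integrable[OF \<phi>] int)
    then show "(\<integral>x. \<phi> x *\<^sub>R (g' x - h' x) \<partial>lborel) = 0"
      using weak_pdiff_rep[OF w(1) r(1,2) b \<phi>] weak_pdiff_rep[OF w(2) r(1,3) b \<phi>] by simp
  qed
  then have "AE x in lebesgue. x \<in> D \<longrightarrow> g' x - h' x = 0" by (rule AE_completion)
  then have "AE x in lebesgue_on D. g' x = h' x"
    by (subst AE_restrict_space_iff) auto
  moreover have "AE x in lebesgue_on D. g x = g' x" "AE x in lebesgue_on D. h x = h' x"
    using r by (auto simp: borel_rep_def)
  ultimately show ?thesis by eventually_elim simp
qed

lemma weak_pdiff_lincomb:
  fixes f g :: "'a \<Rightarrow> 'b::euclidean_space"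
  assumes b: "b \<in> Basis" and w: "weak_pdiff D b f f1" "weak_pdiff D b g g1"
  shows "weak_pdiff D b (\<lambda>x. f x + c *\<^sub>R g x) (\<lambda>x. f1 x + c *\<^sub>R g1 x)"
proof -
  have L: "L2 D f < \<infinity>" "L2 D g < \<infinity>" "L2 D f1 < \<infinity>" "L2 D g1 < \<infinity>"
    using w by (auto simp: weak_pdiff_def)
  obtain f' g' f1' g1' where r: "borel_rep D f f'" "borel_rep D g g'" "borel_rep D f1 f1'" "borel_rep D g1 g1'"
    using L borel_rep_exists[OF D_borel L2_measurable] by metis
  note int = borel_rep_integrable[OF open_D bounded_D r(1) L(1)] borel_rep_integrable[OF open_D bounded_D r(2) L(2)]
    borel_rep_integrable[OF open_D bounded_D r(3) L(3)] borel_rep_integrable[OF open_D bounded_D r(4) L(4)]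
  have split: "(\<integral>x. \<psi> x *\<^sub>R (p x + c *\<^sub>R q x) \<partial>lborel) = (\<integral>x. \<psi> x *\<^sub>R p x \<partial>lborel) + c *\<^sub>R (\<integral>x. \<psi> x *\<^sub>R q x \<partial>lborel)"
    if "\<psi> \<in> test_functions D" "integrable lborel p" "integrable lborel q" for \<psi> and p q :: "'a \<Rightarrow> 'b"
  proof -
    have "(\<integral>x. \<psi> x *\<^sub>R (p x + c *\<^sub>R q x) \<partial>lborel) = (\<integral>x. \<psi> x *\<^sub>R p x + c *\<^sub>R (\<psi> x *\<^sub>R q x) \<partial>lborel)"
      by (simp add: scaleR_add_right mult.commute)
    also have "\<dots> = (\<integral>x. \<psi> x *\<^sub>R p x \<partial>lborel) + (\<integral>x. c *\<^sub>R (\<psi> x *\<^sub>R q x) \<partial>lborel)"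
      by (intro Bochner_Integration.integral_add integrable_scaleR_right test_scaleR_integrable[OF that(1)] that)
    finally show ?thesis by (simp only: integral_scaleR_right)
  qed
  have "(\<integral>x. pdiff b \<phi> x *\<^sub>R (f x + c *\<^sub>R g x) \<partial>lebesgue_on D) = - (\<integral>x. \<phi> x *\<^sub>R (f1 x + c *\<^sub>R g1 x) \<partial>lebesgue_on D)"
    if \<phi>: "\<phi> \<in> test_functions D" for \<phi>
    unfolding borel_rep_integral[OF D_borel borel_rep_lincomb[OF r(1,2)] test_borel[OF test_pdiff[OF \<phi> b]]]
      borel_rep_integral[OF D_borel borel_rep_lincomb[OF r(3,4)] test_borel[OF \<phi>]]
      split[OF test_pdiff[OF \<phi> b] int(1,2)] split[OF \<phi> int(3,4)]
      weak_pdiff_rep[OF w(1) r(1,3) b \<phi>] weak_pdiff_rep[OF w(2) r(2,4) b \<phi>]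
    by simp
  then show ?thesis
    unfolding weak_pdiff_def using L2_lincomb(2) L by blast
qed

lemma H1_lincomb_finite:
  fixes f g :: "'a \<Rightarrow> 'b::euclidean_space"
  assumes "H1 D f < \<infinity>" "H1 D g < \<infinity>"
  shows "H1 D (\<lambda>x. f x + c *\<^sub>R g x) < \<infinity>"
  using weak_pdiff_lincomb[OF _ H1_wpd[OF assms(1)] H1_wpd[OF assms(2)]] unfolding H1_finite_iff by blast

lemma wpd_lincomb:
  fixes f g :: "'a \<Rightarrow> 'b::euclidean_space"
  assumes "H1 D f < \<infinity>" "H1 D g < \<infinity>" "b \<in> Basis"
  shows "AE x in lebesgue_on D. wpd D b (\<lambda>x. f x + c *\<^sub>R g x) x = wpd D b f x + c *\<^sub>R wpd D b g x"
  using weak_pdiff_unique[OF assms(3) H1_wpd[OF H1_lincomb_finite[OF assms(1,2)] assms(3)]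
      weak_pdiff_lincomb[OF assms(3) H1_wpd[OF assms(1,3)] H1_wpd[OF assms(2,3)]]] .

lemma L2_cong_AE:
  assumes "f \<in> borel_measurable (lebesgue_on D)" "g \<in> borel_measurable (lebesgue_on D)"
    and "AE x in lebesgue_on D. f x = g x"
  shows "L2 D f = L2 D g"
proof -
  have "(\<integral>\<^sup>+x. ennreal ((norm (f x))\<^sup>2) \<partial>lebesgue_on D) = (\<integral>\<^sup>+x. ennreal ((norm (g x))\<^sup>2) \<partial>lebesgue_on D)"
    using assms(3) by (intro nn_integral_cong_AE) (auto elim!: eventually_mono)
  then show ?thesis using assms by (simp add: L2_def)
qed

lemma L2_wpd_measurable:
  assumes "H1 D f < \<infinity>" "b \<in> Basis"
  shows "L2 D (wpd D b f) < \<infinity>" "wpd D b f \<in> borel_measurable (lebesgue_on D)"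
  using H1_wpd[OF assms] L2_measurable unfolding weak_pdiff_def by blast+

lemma L2_wpd_lincomb:
  fixes f g :: "'a \<Rightarrow> 'b::euclidean_space"
  assumes f: "H1 D f < \<infinity>" and g: "H1 D g < \<infinity>" and b: "b \<in> Basis"
  shows "L2 D (wpd D b (\<lambda>x. f x + c *\<^sub>R g x)) = L2 D (\<lambda>x. wpd D b f x + c *\<^sub>R wpd D b g x)"
proof -
  note [measurable] = L2_wpd_measurable(2)[OF f b] L2_wpd_measurable(2)[OF g b]
    L2_wpd_measurable(2)[OF H1_lincomb_finite[OF f g] b]
  show ?thesis by (rule L2_cong_AE[OF _ _ wpd_lincomb[OF f g b]]) measurable
qed

lemma sum_lincomb_bound:
  fixes A B C :: "'i \<Rightarrow> ennreal"
  assumes "\<And>i. i \<in> I \<Longrightarrow> A i \<le> 2 * B i + k * C i" "a \<le> 2 * b + k * c"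
  shows "a + (\<Sum>i\<in>I. A i) \<le> 2 * (b + (\<Sum>i\<in>I. B i)) + k * (c + (\<Sum>i\<in>I. C i))"
proof -
  have "a + (\<Sum>i\<in>I. A i) \<le> (2 * b + k * c) + (\<Sum>i\<in>I. 2 * B i + k * C i)"
    using assms by (intro add_mono sum_mono)
  also have "\<dots> = 2 * (b + (\<Sum>i\<in>I. B i)) + k * (c + (\<Sum>i\<in>I. C i))"
    unfolding sum.distrib sum_distrib_left[symmetric] distrib_left by (simp only: ac_simps)
  finally show ?thesis .
qed

lemma H1_lincomb:
  fixes f g :: "'a \<Rightarrow> 'b::euclidean_space"
  assumes f: "H1 D f < \<infinity>" and g: "H1 D g < \<infinity>"
  shows "(H1 D (\<lambda>x. f x + c *\<^sub>R g x))\<^sup>2 \<le> 2 * (H1 D f)\<^sup>2 + ennreal (2 * c\<^sup>2) * (H1 D g)\<^sup>2"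
  unfolding H1_power2[OF f] H1_power2[OF g] H1_power2[OF H1_lincomb_finite[OF f g]]
  by (intro sum_lincomb_bound) (simp_all add: L2_wpd_lincomb[OF f g] L2_lincomb L2_wpd_measurable(1) f g H1_L2[OF f] H1_L2[OF g] del: infinity_ennreal_def)

text \<open>The conclusion is an equality of predicates. Since \<open>wpd\<close> is chosen from the
  predicate, functions that agree almost everywhere get literally the same derivative and not merely
  an equivalent one.\<close>

lemma weak_pdiff_cong_AE:
  fixes f g :: "'a \<Rightarrow> 'b::euclidean_space"
  assumes f: "f \<in> borel_measurable (lebesgue_on D)" and g: "g \<in> borel_measurable (lebesgue_on D)"
    and ae: "AE x in lebesgue_on D. f x = g x" and b: "b \<in> Basis"
  shows "weak_pdiff D b f = weak_pdiff D b g"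
proof -
  have "(\<integral>x. pdiff b \<phi> x *\<^sub>R f x \<partial>lebesgue_on D) = (\<integral>x. pdiff b \<phi> x *\<^sub>R g x \<partial>lebesgue_on D)"
    if \<phi>: "\<phi> \<in> test_functions D" for \<phi>
  proof -
    have [measurable]: "pdiff b \<phi> \<in> borel_measurable (lebesgue_on D)"
      using test_borel[OF test_pdiff[OF \<phi> b]] by (auto intro!: measurable_restrict_space1 measurable_completion)
    note [measurable] = f g
    show ?thesis using ae by (intro integral_cong_AE) (auto elim!: eventually_mono)
  qed
  moreover have "L2 D f = L2 D g" by (rule L2_cong_AE[OF f g ae])
  ultimately show ?thesis by (intro ext) (auto simp: weak_pdiff_def)
qed

lemma H1_cong_AE:
  fixes f g :: "'a \<Rightarrow> 'b::euclidean_space"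
  assumes f: "f \<in> borel_measurable (lebesgue_on D)" and g: "g \<in> borel_measurable (lebesgue_on D)"
    and ae: "AE x in lebesgue_on D. f x = g x"
  shows "H1 D f = H1 D g"
proof -
  have "wpd D b f = wpd D b g" if "b \<in> Basis" for b
    unfolding wpd_def weak_pdiff_cong_AE[OF f g ae that] ..
  then have "(\<Sum>b\<in>Basis. (L2 D (wpd D b f))\<^sup>2) = (\<Sum>b\<in>Basis. (L2 D (wpd D b g))\<^sup>2)" by simp
  moreover have "(\<forall>b\<in>Basis. \<exists>h. weak_pdiff D b f h) \<longleftrightarrow> (\<forall>b\<in>Basis. \<exists>h. weak_pdiff D b g h)"
    using weak_pdiff_cong_AE[OF f g ae] by simp
  ultimately show ?thesis
    unfolding H1_def L2_cong_AE[OF f g ae] by (simp only:)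
qed

lemma Hfrac_cong_AE:
  fixes f g :: "'a \<Rightarrow> 'b::euclidean_space"
  assumes f: "f \<in> borel_measurable (lebesgue_on D)" and g: "g \<in> borel_measurable (lebesgue_on D)"
    and ae: "AE x in lebesgue_on D. f x = g x"
  shows "Hfrac D s f = Hfrac D s g"
proof -
  have "(\<integral>\<^sup>+x. (\<integral>\<^sup>+y. ennreal ((norm (f x - f y))\<^sup>2 / norm (x - y) powr (real DIM('a) + 2 * s)) \<partial>lebesgue_on D) \<partial>lebesgue_on D)
     = (\<integral>\<^sup>+x. (\<integral>\<^sup>+y. ennreal ((norm (g x - g y))\<^sup>2 / norm (x - y) powr (real DIM('a) + 2 * s)) \<partial>lebesgue_on D) \<partial>lebesgue_on D)"
  proof (rule nn_integral_cong_AE)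
    show "AE x in lebesgue_on D. (\<integral>\<^sup>+y. ennreal ((norm (f x - f y))\<^sup>2 / norm (x - y) powr (real DIM('a) + 2 * s)) \<partial>lebesgue_on D)
       = (\<integral>\<^sup>+y. ennreal ((norm (g x - g y))\<^sup>2 / norm (x - y) powr (real DIM('a) + 2 * s)) \<partial>lebesgue_on D)"
      using ae
    proof eventually_elim
      case (elim x)
      show ?case using ae elim by (intro nn_integral_cong_AE) (auto elim!: eventually_mono)
    qed
  qed
  then show ?thesis
    unfolding Hfrac_def using H1_cong_AE[OF f g ae] L2_cong_AE[OF f g ae] by simp
qed

text \<open>The double integrals are rewritten with Borel representatives, because splitting a sum
  under them requires measurability in both variables.\<close>

lemma Hfrac_lincomb:
  fixes f g :: "'a \<Rightarrow> 'b::euclidean_space"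
  assumes f: "Hfrac D s f < \<infinity>" and g: "Hfrac D s g < \<infinity>"
  shows "(Hfrac D s (\<lambda>x. f x + c *\<^sub>R g x))\<^sup>2 \<le> 2 * (Hfrac D s f)\<^sup>2 + ennreal (2 * c\<^sup>2) * (Hfrac D s g)\<^sup>2"
proof (cases "s = 1")
  case True
  then show ?thesis using H1_lincomb[of f g c] f g by (simp add: Hfrac_def)
next
  case False
  define a where "a = real DIM('a) + 2 * s"
  define S where "S h = (\<integral>\<^sup>+x. (\<integral>\<^sup>+y. ennreal ((norm (h x - h y))\<^sup>2 / norm (x - y) powr a) \<partial>lebesgue_on D) \<partial>lebesgue_on D)" for h :: "'a \<Rightarrow> 'b"
  have H: "(Hfrac D s h)\<^sup>2 = (L2 D h)\<^sup>2 + S h" for h :: "'a \<Rightarrow> 'b"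
    using False by (simp add: Hfrac_def S_def a_def)
  have L: "L2 D f < \<infinity>" "L2 D g < \<infinity>" using Hfrac_finite_L2(1) f g by blast+
  obtain f' g' where r: "borel_rep D f f'" "borel_rep D g g'"
    using L borel_rep_exists[OF D_borel L2_measurable] by metis
  have [measurable]: "f' \<in> borel_measurable borel" "g' \<in> borel_measurable borel"
    using r by (auto simp: borel_rep_def)
  have S': "S h = (\<integral>\<^sup>+x. \<integral>\<^sup>+y. indicator D x * indicator D y * ennreal ((norm (h' x - h' y))\<^sup>2 / norm (x - y) powr a) \<partial>lborel \<partial>lborel)"
    if "borel_rep D h h'" for h h'
    unfolding S_def
    by (rule borel_rep_nn_integral2[OF D_borel that, of "\<lambda>p q x y. ennreal ((norm (p - q))\<^sup>2 / norm (x - y) powr a)"])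
      measurable
  let ?k = "ennreal (2 * c\<^sup>2)"
  have "S (\<lambda>x. f x + c *\<^sub>R g x) = (\<integral>\<^sup>+x. \<integral>\<^sup>+y. indicator D x * indicator D y *
      ennreal ((norm ((f' x + c *\<^sub>R g' x) - (f' y + c *\<^sub>R g' y)))\<^sup>2 / norm (x - y) powr a) \<partial>lborel \<partial>lborel)"
    by (rule S'[OF borel_rep_lincomb[OF r]])
  also have "\<dots> \<le> (\<integral>\<^sup>+x. \<integral>\<^sup>+y. 2 * (indicator D x * indicator D y * ennreal ((norm (f' x - f' y))\<^sup>2 / norm (x - y) powr a))
     + ?k * (indicator D x * indicator D y * ennreal ((norm (g' x - g' y))\<^sup>2 / norm (x - y) powr a)) \<partial>lborel \<partial>lborel)"
  proof (intro nn_integral_mono)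
    fix x y :: 'a
    let ?p = "f' x - f' y" and ?q = "g' x - g' y" and ?w = "norm (x - y) powr a"
    have "(norm (?p + c *\<^sub>R ?q))\<^sup>2 \<le> (norm ?p + norm (c *\<^sub>R ?q))\<^sup>2"
      by (intro power_mono norm_triangle_ineq) auto
    also have "\<dots> \<le> 2 * (norm ?p)\<^sup>2 + 2 * (norm (c *\<^sub>R ?q))\<^sup>2"
      using sum_squares_ge_zero[of "norm ?p - norm (c *\<^sub>R ?q)" 0]
      by (simp add: power2_eq_square algebra_simps)
    also have "\<dots> = 2 * (norm ?p)\<^sup>2 + (2 * c\<^sup>2) * (norm ?q)\<^sup>2" by (simp add: power_mult_distrib)
    finally have "(norm (?p + c *\<^sub>R ?q))\<^sup>2 / ?w \<le> (2 * (norm ?p)\<^sup>2 + (2 * c\<^sup>2) * (norm ?q)\<^sup>2) / ?w"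
      by (intro divide_right_mono) auto
    then have "ennreal ((norm (?p + c *\<^sub>R ?q))\<^sup>2 / ?w) \<le> ennreal (2 * ((norm ?p)\<^sup>2 / ?w) + (2 * c\<^sup>2) * ((norm ?q)\<^sup>2 / ?w))"
      by (intro ennreal_leI) (simp add: add_divide_distrib)
    also have "\<dots> = 2 * ennreal ((norm ?p)\<^sup>2 / ?w) + ?k * ennreal ((norm ?q)\<^sup>2 / ?w)"
    proof -
      have split: "ennreal (2 * u + (2 * c\<^sup>2) * v) = 2 * ennreal u + ?k * ennreal v" if "0 \<le> u" "0 \<le> v" for u v
        using that by (simp add: ennreal_mult)
      show ?thesis by (rule split) auto
    qed
    finally have "ennreal ((norm (?p + c *\<^sub>R ?q))\<^sup>2 / ?w) \<le> 2 * ennreal ((norm ?p)\<^sup>2 / ?w) + ?k * ennreal ((norm ?q)\<^sup>2 / ?w)" .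
    moreover have e: "(f' x + c *\<^sub>R g' x) - (f' y + c *\<^sub>R g' y) = ?p + c *\<^sub>R ?q" by (simp add: algebra_simps)
    ultimately show "indicator D x * indicator D y *
        ennreal ((norm ((f' x + c *\<^sub>R g' x) - (f' y + c *\<^sub>R g' y)))\<^sup>2 / ?w)
      \<le> 2 * (indicator D x * indicator D y * ennreal ((norm ?p)\<^sup>2 / ?w)) + ?k * (indicator D x * indicator D y * ennreal ((norm ?q)\<^sup>2 / ?w))"
      unfolding e by (auto simp: indicator_def)
  qed
  also have "\<dots> = 2 * S f + ?k * S g"
    unfolding S'[OF r(1)] S'[OF r(2)]
    by (simp add: nn_integral_add nn_integral_cmult)
  finally have "S (\<lambda>x. f x + c *\<^sub>R g x) \<le> 2 * S f + ?k * S g" .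
  then have "(L2 D (\<lambda>x. f x + c *\<^sub>R g x))\<^sup>2 + S (\<lambda>x. f x + c *\<^sub>R g x)
      \<le> (2 * (L2 D f)\<^sup>2 + ?k * (L2 D g)\<^sup>2) + (2 * S f + ?k * S g)"
    by (intro add_mono L2_lincomb L)
  then show ?thesis unfolding H by (simp add: distrib_left ac_simps)
qed

lemma H1plus_lincomb:
  fixes f g :: "'a \<Rightarrow> 'b::euclidean_space"
  assumes f: "H1plus D s f < \<infinity>" and g: "H1plus D s g < \<infinity>"
  shows "(H1plus D s (\<lambda>x. f x + c *\<^sub>R g x))\<^sup>2 \<le> 2 * (H1plus D s f)\<^sup>2 + ennreal (2 * c\<^sup>2) * (H1plus D s g)\<^sup>2"
    and "H1plus D s (\<lambda>x. f x + c *\<^sub>R g x) < \<infinity>"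
proof -
  let ?h = "\<lambda>x. f x + c *\<^sub>R g x"
  have f1: "H1 D f < \<infinity>" and g1: "H1 D g < \<infinity>" using H1plus_power2(1) f g by blast+
  have h1: "H1 D ?h < \<infinity>" by (rule H1_lincomb_finite[OF f1 g1])
  have eq: "(H1plus D s ?h)\<^sup>2 = (L2 D ?h)\<^sup>2 + (\<Sum>b\<in>Basis. (Hfrac D s (wpd D b ?h))\<^sup>2)"
    using h1 by (simp add: H1plus_def)
  have "(Hfrac D s (wpd D b ?h))\<^sup>2 \<le> 2 * (Hfrac D s (wpd D b f))\<^sup>2 + ennreal (2 * c\<^sup>2) * (Hfrac D s (wpd D b g))\<^sup>2"
    if b: "b \<in> Basis" for b
  proof -
    note [measurable] = L2_wpd_measurable(2)[OF f1 b] L2_wpd_measurable(2)[OF g1 b] L2_wpd_measurable(2)[OF h1 b]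
    have "Hfrac D s (wpd D b ?h) = Hfrac D s (\<lambda>x. wpd D b f x + c *\<^sub>R wpd D b g x)"
      by (rule Hfrac_cong_AE[OF _ _ wpd_lincomb[OF f1 g1 b]]) measurable
    then show ?thesis
      using Hfrac_lincomb[OF H1plus_power2(3)[OF f b] H1plus_power2(3)[OF g b], of c] by simp
  qed
  then show le: "(H1plus D s ?h)\<^sup>2 \<le> 2 * (H1plus D s f)\<^sup>2 + ennreal (2 * c\<^sup>2) * (H1plus D s g)\<^sup>2"
    unfolding eq H1plus_power2(2)[OF f] H1plus_power2(2)[OF g]
    by (intro sum_lincomb_bound L2_lincomb H1_L2 f1 g1)
  also have "\<dots> < top" using f g by (simp add: ennreal_mult_less_top power_less_top_ennreal)
  finally show "H1plus D s ?h < \<infinity>" by (simp add: power_less_top_ennreal)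
qed

end

section \<open>Lipschitz estimates for the integrands of the weak formulation\<close>

text \<open>Integrability is obtained together with the bound, since differences of the forms are
  later split into integrals of their summands.\<close>

lemma L2_product_bound:
  fixes f a b :: "'x \<Rightarrow> real"
  assumes [measurable]: "f \<in> borel_measurable M" "a \<in> borel_measurable M" "b \<in> borel_measurable M"
    and le: "AE x in M. \<bar>f x\<bar> \<le> a x * b x"
    and a: "(\<integral>\<^sup>+x. ennreal ((a x)\<^sup>2) \<partial>M) \<le> ennreal (A\<^sup>2)" and b: "(\<integral>\<^sup>+x. ennreal ((b x)\<^sup>2) \<partial>M) \<le> ennreal (B\<^sup>2)"
    and AB: "0 \<le> A" "0 \<le> B"
  shows "integrable M f" "\<bar>integral\<^sup>L M f\<bar> \<le> A * B"
proof -
  have "(\<integral>\<^sup>+x. ennreal \<bar>f x\<bar> \<partial>M) \<le> (\<integral>\<^sup>+x. ennreal \<bar>a x\<bar> * ennreal \<bar>b x\<bar> \<partial>M)"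
    using le
  proof (intro nn_integral_mono_AE, eventually_elim)
    case (elim x)
    then have "\<bar>f x\<bar> \<le> \<bar>a x\<bar> * \<bar>b x\<bar>" by (metis abs_ge_self abs_mult order_trans)
    then show ?case by (simp add: ennreal_mult[symmetric] ennreal_leI)
  qed
  also have "\<dots> \<le> ennreal (A * B)"
  proof (rule ennreal_power_le_imp_le[of _ 2])
    have "(\<integral>\<^sup>+x. ennreal \<bar>a x\<bar> * ennreal \<bar>b x\<bar> \<partial>M)\<^sup>2
        \<le> (\<integral>\<^sup>+x. (ennreal \<bar>a x\<bar>)\<^sup>2 \<partial>M) * (\<integral>\<^sup>+x. (ennreal \<bar>b x\<bar>)\<^sup>2 \<partial>M)"
      by (rule Cauchy_Schwarz_nn_integral) measurable
    also have "\<dots> \<le> ennreal (A\<^sup>2) * ennreal (B\<^sup>2)"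
      using a b by (intro mult_mono) (auto simp: ennreal_power)
    also have "\<dots> = ennreal (A * B) ^ 2"
      using AB by (simp add: ennreal_mult[symmetric] ennreal_power power_mult_distrib)
    finally show "(\<integral>\<^sup>+x. ennreal \<bar>a x\<bar> * ennreal \<bar>b x\<bar> \<partial>M)\<^sup>2 \<le> ennreal (A * B) ^ 2" .
  qed simp
  finally have nn: "(\<integral>\<^sup>+x. ennreal \<bar>f x\<bar> \<partial>M) \<le> ennreal (A * B)" .
  then show int: "integrable M f"
    by (intro integrableI_bounded) (auto simp: le_less_trans)
  have "ennreal \<bar>integral\<^sup>L M f\<bar> \<le> (\<integral>\<^sup>+x. ennreal \<bar>f x\<bar> \<partial>M)"
    using integral_norm_bound_ennreal[OF int] by simp
  then have "ennreal \<bar>integral\<^sup>L M f\<bar> \<le> ennreal (A * B)" using nn by (rule order_trans)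
  then show "\<bar>integral\<^sup>L M f\<bar> \<le> A * B" using AB by (subst (asm) ennreal_le_iff) auto
qed

lemma norm_cross3_le: "norm (cross3 x y) \<le> norm x * norm y"
proof (rule power2_le_imp_le)
  have "(norm (cross3 x y))\<^sup>2 \<le> (norm x)\<^sup>2 * (norm y)\<^sup>2"
    using norm_cross[of x y] by simp
  then show "(norm (cross3 x y))\<^sup>2 \<le> (norm x * norm y)\<^sup>2" by (simp add: power_mult_distrib)
qed simp

lemma cubic_difference_le:
  fixes a b :: "'v::real_inner"
  assumes \<mu>: "0 \<le> \<mu>"
  shows "norm ((1 + \<mu> * (norm a)\<^sup>2) *\<^sub>R a - (1 + \<mu> * (norm b)\<^sup>2) *\<^sub>R b)
    \<le> (1 + 2 * \<mu> * ((norm a)\<^sup>2 + (norm b)\<^sup>2)) * norm (a - b)"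
proof -
  let ?A = "norm a" and ?B = "norm b" and ?W = "norm (a - b)"
  \<comment> \<open>The first summand keeps the factor belonging to a; the change of that factor is
    charged to b.\<close>
  have "(1 + \<mu> * ?A\<^sup>2) *\<^sub>R a - (1 + \<mu> * ?B\<^sup>2) *\<^sub>R b = (1 + \<mu> * ?A\<^sup>2) *\<^sub>R (a - b) + (\<mu> * (?A\<^sup>2 - ?B\<^sup>2)) *\<^sub>R b"
    by (simp add: algebra_simps)
  then have "norm ((1 + \<mu> * ?A\<^sup>2) *\<^sub>R a - (1 + \<mu> * ?B\<^sup>2) *\<^sub>R b)
      \<le> norm ((1 + \<mu> * ?A\<^sup>2) *\<^sub>R (a - b)) + norm ((\<mu> * (?A\<^sup>2 - ?B\<^sup>2)) *\<^sub>R b)"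
    by (simp only: norm_triangle_ineq)
  also have "norm ((1 + \<mu> * ?A\<^sup>2) *\<^sub>R (a - b)) = (1 + \<mu> * ?A\<^sup>2) * ?W"
    using \<mu> by simp
  also have "norm ((\<mu> * (?A\<^sup>2 - ?B\<^sup>2)) *\<^sub>R b) = \<mu> * (\<bar>?A - ?B\<bar> * (?A + ?B) * ?B)"
    using \<mu> by (simp add: abs_mult power2_eq_square square_diff_square_factored mult_ac)
  \<comment> \<open>The subtracted square of \<open>?A\<close> leaves room for the first summand,
    whose coefficient contains \<mu> times that same square.\<close>
  also have "\<mu> * (\<bar>?A - ?B\<bar> * (?A + ?B) * ?B) \<le> \<mu> * (?W * (2 * (?A\<^sup>2 + ?B\<^sup>2) - ?A\<^sup>2))"
  proof (intro mult_left_mono \<mu>)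
    have "\<bar>?A - ?B\<bar> * ((?A + ?B) * ?B) \<le> ?W * (2 * (?A\<^sup>2 + ?B\<^sup>2) - ?A\<^sup>2)"
    proof (rule mult_mono)
      show "\<bar>?A - ?B\<bar> \<le> ?W" by (rule norm_triangle_ineq3)
      have "0 \<le> ?A\<^sup>2" "0 \<le> ?B\<^sup>2" by (rule zero_le_power2)+
      moreover have "2 * (?A * ?B) \<le> ?A\<^sup>2 + ?B\<^sup>2"
        using zero_le_power2[of "?A - ?B"] unfolding power2_diff by simp
      moreover have eq: "(?A + ?B) * ?B = ?A * ?B + ?B\<^sup>2" by (simp add: distrib_right power2_eq_square)
      ultimately show "(?A + ?B) * ?B \<le> 2 * (?A\<^sup>2 + ?B\<^sup>2) - ?A\<^sup>2" unfolding eq by argo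
    qed auto
    then show "\<bar>?A - ?B\<bar> * (?A + ?B) * ?B \<le> ?W * (2 * (?A\<^sup>2 + ?B\<^sup>2) - ?A\<^sup>2)" by (simp add: mult.assoc)
  qed
  finally show ?thesis by (simp add: algebra_simps)
qed

section \<open>Real-valued norms and the estimates of the three forms\<close>

locale embedding_region = sobolev_region D for D :: "'a::euclidean_space set" +
  fixes \<alpha> :: real
  assumes dim: "DIM('a) \<le> 3" and cover: "\<exists>\<E>. convex_cover D \<E>" and exponent: "\<alpha> = 1 \<or> DIM('a) \<le> 4 * \<alpha>"
begin

text \<open>Real-valued norms admit subtraction and cancellation. An infinite norm is sent to 0 by
  \<open>enn2real\<close>, so the estimates with \<open>n1\<close> and \<open>N\<close> carry
  finiteness assumptions.\<close>

definition n1 :: "('a \<Rightarrow> 'b::euclidean_space) \<Rightarrow> real" where "n1 f = enn2real (H1 D f)"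
definition N :: "('a \<Rightarrow> 'b::euclidean_space) \<Rightarrow> real" where "N f = enn2real (H1plus D \<alpha> f)"

lemma n1_nonneg [simp]: "0 \<le> n1 f" and N_nonneg [simp]: "0 \<le> N f"
  by (simp_all add: n1_def N_def)

lemma H1_eq: "H1 D f < \<infinity> \<Longrightarrow> H1 D f = ennreal (n1 f)"
  by (simp add: n1_def less_top)

lemma H1plus_eq: "H1plus D \<alpha> f < \<infinity> \<Longrightarrow> H1plus D \<alpha> f = ennreal (N f)"
  by (simp add: N_def less_top)

lemma n1_le_N: "H1plus D \<alpha> f < \<infinity> \<Longrightarrow> n1 f \<le> N f"
  using H1_le_H1plus[of D \<alpha> f] H1_eq[OF H1plus_power2(1)] H1plus_eq by fastforce

lemma L2_le_n1:
  assumes f: "H1 D f < \<infinity>"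
  shows "(\<integral>\<^sup>+x. ennreal ((norm (f x))\<^sup>2) \<partial>lebesgue_on D) \<le> ennreal ((n1 f)\<^sup>2)"
    and "b \<in> Basis \<Longrightarrow> (\<integral>\<^sup>+x. ennreal ((norm (wpd D b f x))\<^sup>2) \<partial>lebesgue_on D) \<le> ennreal ((n1 f)\<^sup>2)"
proof -
  have eq: "ennreal ((n1 f)\<^sup>2) = (L2 D f)\<^sup>2 + (\<Sum>b\<in>Basis. (L2 D (wpd D b f))\<^sup>2)"
    using H1_power2[OF f] H1_eq[OF f] by (simp add: ennreal_power)
  show "(\<integral>\<^sup>+x. ennreal ((norm (f x))\<^sup>2) \<partial>lebesgue_on D) \<le> ennreal ((n1 f)\<^sup>2)"
    unfolding eq using L2_power2[OF L2_measurable[OF H1_L2[OF f]]] by simp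
  assume b: "b \<in> Basis"
  have "(L2 D (wpd D b f))\<^sup>2 \<le> (\<Sum>b\<in>Basis. (L2 D (wpd D b f))\<^sup>2)"
    using b by (intro member_le_sum) auto
  also have "\<dots> \<le> ennreal ((n1 f)\<^sup>2)" unfolding eq by simp
  finally show "(\<integral>\<^sup>+x. ennreal ((norm (wpd D b f x))\<^sup>2) \<partial>lebesgue_on D) \<le> ennreal ((n1 f)\<^sup>2)"
    using L2_power2[OF L2_wpd_measurable(2)[OF f b]] by simp
qed

lemma H1_diff:
  fixes f g :: "'a \<Rightarrow> 'b::euclidean_space"
  assumes f: "H1 D f < \<infinity>" and g: "H1 D g < \<infinity>"
  shows "H1 D (\<lambda>x. f x - g x) < \<infinity>" "(n1 (\<lambda>x. f x - g x))\<^sup>2 \<le> 2 * (n1 f)\<^sup>2 + 2 * (n1 g)\<^sup>2"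
    and "b \<in> Basis \<Longrightarrow> AE x in lebesgue_on D. wpd D b (\<lambda>x. f x - g x) x = wpd D b f x - wpd D b g x"
proof -
  have e: "(\<lambda>x. f x + (-1) *\<^sub>R g x) = (\<lambda>x. f x - g x)" by simp
  show h: "H1 D (\<lambda>x. f x - g x) < \<infinity>" using H1_lincomb_finite[OF f g, of "-1"] unfolding e .
  have "ennreal ((n1 (\<lambda>x. f x - g x))\<^sup>2) \<le> ennreal (2 * (n1 f)\<^sup>2 + 2 * (n1 g)\<^sup>2)"
    using H1_lincomb[OF f g, of "-1"] unfolding e H1_eq[OF h] H1_eq[OF f] H1_eq[OF g]
    by (simp add: ennreal_power ennreal_mult)
  then show "(n1 (\<lambda>x. f x - g x))\<^sup>2 \<le> 2 * (n1 f)\<^sup>2 + 2 * (n1 g)\<^sup>2"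
    by (subst (asm) ennreal_le_iff) auto
  assume "b \<in> Basis"
  then show "AE x in lebesgue_on D. wpd D b (\<lambda>x. f x - g x) x = wpd D b f x - wpd D b g x"
    using wpd_lincomb[OF f g, of b "-1"] unfolding e by simp
qed

lemma H1plus_diff:
  fixes f g :: "'a \<Rightarrow> 'b::euclidean_space"
  assumes f: "H1plus D \<alpha> f < \<infinity>" and g: "H1plus D \<alpha> g < \<infinity>"
  shows "H1plus D \<alpha> (\<lambda>x. f x - g x) < \<infinity>" "(N (\<lambda>x. f x - g x))\<^sup>2 \<le> 2 * (N f)\<^sup>2 + 2 * (N g)\<^sup>2"
proof -
  have e: "(\<lambda>x. f x + (-1) *\<^sub>R g x) = (\<lambda>x. f x - g x)" by simp
  show h: "H1plus D \<alpha> (\<lambda>x. f x - g x) < \<infinity>" using H1plus_lincomb(2)[OF f g, of "-1"] unfolding e .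
  have "ennreal ((N (\<lambda>x. f x - g x))\<^sup>2) \<le> ennreal (2 * (N f)\<^sup>2 + 2 * (N g)\<^sup>2)"
    using H1plus_lincomb(1)[OF f g, of "-1"] unfolding e H1plus_eq[OF h] H1plus_eq[OF f] H1plus_eq[OF g]
    by (simp add: ennreal_power ennreal_mult)
  then show "(N (\<lambda>x. f x - g x))\<^sup>2 \<le> 2 * (N f)\<^sup>2 + 2 * (N g)\<^sup>2"
    by (subst (asm) ennreal_le_iff) auto
qed

lemma Linf_N: "\<exists>C\<ge>0. \<forall>u :: 'a \<Rightarrow> 'b::euclidean_space. H1plus D \<alpha> u < \<infinity> \<longrightarrow> (AE x in lebesgue_on D. norm (u x) \<le> C * N u)"
proof -
  obtain \<E> where "convex_cover D \<E>" using cover by blast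
  from H1plus_Linf[OF open_D bounded_D this dim exponent, where 'b='b]
  obtain C where C: "C \<ge> 0" "\<And>u :: 'a \<Rightarrow> 'b. H1plus D \<alpha> u < \<infinity> \<Longrightarrow>
    AE x in lebesgue_on D. ennreal (norm (u x)) \<le> ennreal C * H1plus D \<alpha> u" by blast
  have "AE x in lebesgue_on D. norm (u x) \<le> C * N u" if u: "H1plus D \<alpha> u < \<infinity>" for u :: "'a \<Rightarrow> 'b"
    using C(2)[OF u] unfolding H1plus_eq[OF u] ennreal_mult'[OF C(1), symmetric]
    by eventually_elim (use C(1) in \<open>auto simp: ennreal_le_iff\<close>)
  then show ?thesis using C(1) by blast
qed

text \<open>Cauchy-Schwarz with both factors in L^4: w through its H1 norm, the derivative of u
  through the fractional norm. This serves the part of the cross product in which the difference is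
  not differentiated.\<close>

lemma product_N: "\<exists>C\<ge>0. \<forall>(w :: 'a \<Rightarrow> 'b::euclidean_space) (u :: 'a \<Rightarrow> 'b) b.
    H1 D w < \<infinity> \<longrightarrow> H1plus D \<alpha> u < \<infinity> \<longrightarrow> b \<in> Basis \<longrightarrow>
    (\<integral>\<^sup>+x. ennreal ((norm (w x) * norm (wpd D b u x))\<^sup>2) \<partial>lebesgue_on D) \<le> ennreal ((C * n1 w * N u)\<^sup>2)"
proof -
  obtain \<E> where cov: "convex_cover D \<E>" using cover by blast
  from Hfrac_L4[OF open_D bounded_D this dim exponent, where 'b='b]
  obtain C1 where C1: "C1 \<ge> 0" "\<And>g :: 'a \<Rightarrow> 'b. Hfrac D \<alpha> g < \<infinity> \<Longrightarrow>
    (\<integral>\<^sup>+x. ennreal (norm (g x) ^ 4) \<partial>lebesgue_on D) \<le> ennreal C1 * (Hfrac D \<alpha> g) ^ 4" by blast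
  from H1_L4[OF open_D bounded_D cov dim, where 'b='b]
  obtain C2 where C2: "C2 \<ge> 0" "\<And>f :: 'a \<Rightarrow> 'b. H1 D f < \<infinity> \<Longrightarrow>
    (\<integral>\<^sup>+x. ennreal (norm (f x) ^ 4) \<partial>lebesgue_on D) \<le> ennreal C2 * (H1 D f) ^ 4" by blast
  define C where "C = root 4 (C1 * C2)"
  have C: "C \<ge> 0" "C ^ 4 = C1 * C2" using C1(1) C2(1) by (auto simp: C_def)
  have "(\<integral>\<^sup>+x. ennreal ((norm (w x) * norm (wpd D b u x))\<^sup>2) \<partial>lebesgue_on D) \<le> ennreal ((C * n1 w * N u)\<^sup>2)"
    if w: "H1 D w < \<infinity>" and u: "H1plus D \<alpha> u < \<infinity>" and b: "b \<in> Basis" for w u :: "'a \<Rightarrow> 'b" and b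
  proof (rule ennreal_power_le_imp_le[of _ 2])
    have [measurable]: "w \<in> borel_measurable (lebesgue_on D)" by (rule L2_measurable[OF H1_L2[OF w]])
    note [measurable] = L2_wpd_measurable(2)[OF H1plus_power2(1)[OF u] b]
    let ?h = "wpd D b u"
    have hN: "Hfrac D \<alpha> ?h \<le> ennreal (N u)"
    proof (rule ennreal_power_le_imp_le[of _ 2])
      have "(Hfrac D \<alpha> ?h)\<^sup>2 \<le> (\<Sum>b\<in>Basis. (Hfrac D \<alpha> (wpd D b u))\<^sup>2)"
        using b by (intro member_le_sum) auto
      also have "\<dots> \<le> (H1plus D \<alpha> u)\<^sup>2" unfolding H1plus_power2(2)[OF u] by simp
      finally show "(Hfrac D \<alpha> ?h)\<^sup>2 \<le> (ennreal (N u))\<^sup>2" unfolding H1plus_eq[OF u] .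
    qed simp
    have "(\<integral>\<^sup>+x. ennreal ((norm (w x) * norm (?h x))\<^sup>2) \<partial>lebesgue_on D)\<^sup>2
        = (\<integral>\<^sup>+x. ennreal ((norm (w x))\<^sup>2) * ennreal ((norm (?h x))\<^sup>2) \<partial>lebesgue_on D)\<^sup>2"
      by (simp add: power_mult_distrib ennreal_mult)
    also have "\<dots> \<le> (\<integral>\<^sup>+x. (ennreal ((norm (w x))\<^sup>2))\<^sup>2 \<partial>lebesgue_on D) * (\<integral>\<^sup>+x. (ennreal ((norm (?h x))\<^sup>2))\<^sup>2 \<partial>lebesgue_on D)"
      by (rule Cauchy_Schwarz_nn_integral) measurable
    also have "\<dots> = (\<integral>\<^sup>+x. ennreal (norm (w x) ^ 4) \<partial>lebesgue_on D) * (\<integral>\<^sup>+x. ennreal (norm (?h x) ^ 4) \<partial>lebesgue_on D)"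
      by (simp add: ennreal_power flip: power_mult)
    also have "\<dots> \<le> (ennreal C2 * ennreal (n1 w) ^ 4) * (ennreal C1 * ennreal (N u) ^ 4)"
    proof (rule mult_mono)
      show "(\<integral>\<^sup>+x. ennreal (norm (?h x) ^ 4) \<partial>lebesgue_on D) \<le> ennreal C1 * ennreal (N u) ^ 4"
        by (rule order_trans[OF C1(2)[OF H1plus_power2(3)[OF u b]]]) (intro mult_left_mono power_mono hN, auto)
    qed (use C2(2)[OF w] in \<open>auto simp: H1_eq[OF w]\<close>)
    also have "\<dots> = ennreal ((C * n1 w * N u) ^ 4)"
      using C1(1) C2(1) by (simp add: ennreal_power ennreal_mult[symmetric] power_mult_distrib C mult_ac)
    also have "\<dots> = (ennreal ((C * n1 w * N u)\<^sup>2))\<^sup>2" by (simp add: ennreal_power flip: power_mult)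
    finally show "(\<integral>\<^sup>+x. ennreal ((norm (w x) * norm (?h x))\<^sup>2) \<partial>lebesgue_on D)\<^sup>2 \<le> (ennreal ((C * n1 w * N u)\<^sup>2))\<^sup>2" .
  qed simp
  then show ?thesis using C(1) by blast
qed

lemma scaled_L2:
  assumes [measurable]: "f \<in> borel_measurable (lebesgue_on D)"
    and "(\<integral>\<^sup>+x. ennreal ((norm (f x))\<^sup>2) \<partial>lebesgue_on D) \<le> ennreal (A\<^sup>2)" "0 \<le> K"
  shows "(\<integral>\<^sup>+x. ennreal ((K * norm (f x))\<^sup>2) \<partial>lebesgue_on D) \<le> ennreal ((K * A)\<^sup>2)"
proof -
  have "(\<integral>\<^sup>+x. ennreal ((K * norm (f x))\<^sup>2) \<partial>lebesgue_on D) = ennreal (K\<^sup>2) * (\<integral>\<^sup>+x. ennreal ((norm (f x))\<^sup>2) \<partial>lebesgue_on D)"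
    by (simp add: power_mult_distrib ennreal_mult nn_integral_cmult)
  also have "\<dots> \<le> ennreal (K\<^sup>2) * ennreal (A\<^sup>2)" by (intro mult_left_mono assms) auto
  finally show ?thesis by (simp add: power_mult_distrib ennreal_mult)
qed

lemma inner_L2_bound:
  fixes f g :: "'a \<Rightarrow> 'b::euclidean_space"
  assumes [measurable]: "f \<in> borel_measurable (lebesgue_on D)" "g \<in> borel_measurable (lebesgue_on D)"
    and f: "(\<integral>\<^sup>+x. ennreal ((norm (f x))\<^sup>2) \<partial>lebesgue_on D) \<le> ennreal (A\<^sup>2)"
    and g: "(\<integral>\<^sup>+x. ennreal ((norm (g x))\<^sup>2) \<partial>lebesgue_on D) \<le> ennreal (B\<^sup>2)" and AB: "0 \<le> A" "0 \<le> B"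
  shows "integrable (lebesgue_on D) (\<lambda>x. f x \<bullet> g x)" "\<bar>inner_L2 D f g\<bar> \<le> A * B"
  unfolding inner_L2_def
  by (rule L2_product_bound[where a="\<lambda>x. norm (f x)" and b="\<lambda>x. norm (g x)" and A=A and B=B];
      use f g AB in \<open>auto simp: Cauchy_Schwarz_ineq2\<close>)+

lemma H1_meas:
  assumes "H1 D f < \<infinity>"
  shows "f \<in> borel_measurable (lebesgue_on D)" "b \<in> Basis \<Longrightarrow> wpd D b f \<in> borel_measurable (lebesgue_on D)"
  using L2_measurable[OF H1_L2[OF assms]] L2_wpd_measurable(2)[OF assms] by blast+

lemma inner_L2_H1:
  fixes f g :: "'a \<Rightarrow> 'b::euclidean_space"
  assumes f: "H1 D f < \<infinity>" and g: "H1 D g < \<infinity>"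
  shows "integrable (lebesgue_on D) (\<lambda>x. f x \<bullet> g x)" "\<bar>inner_L2 D f g\<bar> \<le> n1 f * n1 g"
    and "b \<in> Basis \<Longrightarrow> integrable (lebesgue_on D) (\<lambda>x. wpd D b f x \<bullet> wpd D b g x)"
    and "b \<in> Basis \<Longrightarrow> \<bar>inner_L2 D (wpd D b f) (wpd D b g)\<bar> \<le> n1 f * n1 g"
  using inner_L2_bound[OF H1_meas(1)[OF f] H1_meas(1)[OF g] L2_le_n1(1)[OF f] L2_le_n1(1)[OF g]]
    inner_L2_bound[OF H1_meas(2)[OF f] H1_meas(2)[OF g] L2_le_n1(2)[OF f] L2_le_n1(2)[OF g], of b b] by simp_all

lemma inner_diff_H1:
  fixes f g \<phi> :: "'a \<Rightarrow> 'b::euclidean_space"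
  assumes f: "H1 D f < \<infinity>" and g: "H1 D g < \<infinity>" and \<phi>: "H1 D \<phi> < \<infinity>"
  shows "inner_L2 D (\<lambda>x. f x - g x) \<phi> = inner_L2 D f \<phi> - inner_L2 D g \<phi>"
    and "inner_grad D (\<lambda>x. f x - g x) \<phi> = inner_grad D f \<phi> - inner_grad D g \<phi>"
proof -
  show "inner_L2 D (\<lambda>x. f x - g x) \<phi> = inner_L2 D f \<phi> - inner_L2 D g \<phi>"
    unfolding inner_L2_def inner_diff_left
    by (rule Bochner_Integration.integral_diff[OF inner_L2_H1(1)[OF f \<phi>] inner_L2_H1(1)[OF g \<phi>]])
  have "inner_L2 D (wpd D b (\<lambda>x. f x - g x)) (wpd D b \<phi>) = inner_L2 D (wpd D b f) (wpd D b \<phi>) - inner_L2 D (wpd D b g) (wpd D b \<phi>)"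
    if b: "b \<in> Basis" for b
  proof -
    note [measurable] = H1_meas(2)[OF f b] H1_meas(2)[OF g b] H1_meas(2)[OF \<phi> b] H1_meas(2)[OF H1_diff(1)[OF f g] b]
    have "inner_L2 D (wpd D b (\<lambda>x. f x - g x)) (wpd D b \<phi>) = (\<integral>x. wpd D b f x \<bullet> wpd D b \<phi> x - wpd D b g x \<bullet> wpd D b \<phi> x \<partial>lebesgue_on D)"
      unfolding inner_L2_def using H1_diff(3)[OF f g b]
      by (intro integral_cong_AE) (auto elim!: eventually_mono simp: inner_diff_left)
    also have "\<dots> = inner_L2 D (wpd D b f) (wpd D b \<phi>) - inner_L2 D (wpd D b g) (wpd D b \<phi>)"
      unfolding inner_L2_def
      by (rule Bochner_Integration.integral_diff[OF inner_L2_H1(3)[OF f \<phi> b] inner_L2_H1(3)[OF g \<phi> b]])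
    finally show ?thesis .
  qed
  then show "inner_grad D (\<lambda>x. f x - g x) \<phi> = inner_grad D f \<phi> - inner_grad D g \<phi>"
    by (simp add: inner_grad_def sum_subtractf)
qed

text \<open>
  All three time integrands of the weak formulation are locally Lipschitz in this sense, with the
  difference measured in the weaker norm of \<open>H1\<close> only.
\<close>

definition lipschitz_form :: "(('a \<Rightarrow> real^3) \<Rightarrow> ('a \<Rightarrow> real^3) \<Rightarrow> real) \<Rightarrow> bool" where
  "lipschitz_form \<Phi> \<longleftrightarrow> (\<exists>C\<ge>0. \<forall>\<phi> f g. H1 D \<phi> < \<infinity> \<longrightarrow> H1plus D \<alpha> f < \<infinity> \<longrightarrow> H1plus D \<alpha> g < \<infinity> \<longrightarrow>
     \<bar>\<Phi> f \<phi> - \<Phi> g \<phi>\<bar> \<le> C * (1 + (N f)\<^sup>2 + (N g)\<^sup>2) * n1 (\<lambda>x. f x - g x) * n1 \<phi>)"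

lemma lipschitz_inner_grad: "lipschitz_form (inner_grad D)"
  unfolding lipschitz_form_def
proof (intro exI conjI allI impI)
  show "0 \<le> real DIM('a)" by simp
  fix \<phi> f g :: "'a \<Rightarrow> real^3"
  assume \<phi>: "H1 D \<phi> < \<infinity>" and f: "H1plus D \<alpha> f < \<infinity>" and g: "H1plus D \<alpha> g < \<infinity>"
  note f1 = H1plus_power2(1)[OF f] and g1 = H1plus_power2(1)[OF g]
  let ?w = "\<lambda>x. f x - g x"
  have "\<bar>inner_grad D f \<phi> - inner_grad D g \<phi>\<bar> = \<bar>inner_grad D ?w \<phi>\<bar>"
    by (simp add: inner_diff_H1(2)[OF f1 g1 \<phi>])
  also have "\<dots> \<le> (\<Sum>b\<in>Basis. \<bar>inner_L2 D (wpd D b ?w) (wpd D b \<phi>)\<bar>)"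
    unfolding inner_grad_def by (rule sum_abs)
  also have "\<dots> \<le> real DIM('a) * (n1 ?w * n1 \<phi>)"
    using inner_L2_H1(4)[OF H1_diff(1)[OF f1 g1] \<phi>] by (intro sum_bounded_above) auto
  also have "\<dots> \<le> real DIM('a) * (1 + (N f)\<^sup>2 + (N g)\<^sup>2) * n1 ?w * n1 \<phi>"
  proof -
    have "real DIM('a) * 1 * (n1 ?w * n1 \<phi>) \<le> real DIM('a) * (1 + (N f)\<^sup>2 + (N g)\<^sup>2) * (n1 ?w * n1 \<phi>)"
      by (intro mult_right_mono mult_left_mono) auto
    then show ?thesis by (simp add: mult.assoc)
  qed
  finally show "\<bar>inner_grad D f \<phi> - inner_grad D g \<phi>\<bar> \<le> real DIM('a) * (1 + (N f)\<^sup>2 + (N g)\<^sup>2) * n1 ?w * n1 \<phi>" .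
qed

text \<open>With w = f - g, bilinearity splits the difference into f x grad w + w x grad g. In the
  first summand f is bounded and grad w is in L2; in the second \<open>product_N\<close> places both
  factors in L^4. Thus w appears only through its H1 norm.\<close>

lemma lipschitz_inner_cross_grad: "lipschitz_form (\<lambda>f. inner_cross_grad D f f)"
proof -
  obtain c where c: "c \<ge> 0" "\<And>u :: 'a \<Rightarrow> real^3. H1plus D \<alpha> u < \<infinity> \<Longrightarrow> AE x in lebesgue_on D. norm (u x) \<le> c * N u"
    using Linf_N[where 'b="real^3"] by blast
  from product_N[where 'b="real^3"]
  obtain k where "0 \<le> k \<and> (\<forall>(w :: 'a \<Rightarrow> real^3) (u :: 'a \<Rightarrow> real^3) b.
    H1 D w < \<infinity> \<longrightarrow> H1plus D \<alpha> u < \<infinity> \<longrightarrow> b \<in> Basis \<longrightarrow>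
    (\<integral>\<^sup>+x. ennreal ((norm (w x) * norm (wpd D b u x))\<^sup>2) \<partial>lebesgue_on D) \<le> ennreal ((k * n1 w * N u)\<^sup>2))" ..
  note k = conjunct1[OF this] conjunct2[OF this, rule_format]
  have cm [measurable]: "(\<lambda>x. cross3 (p x) (q x)) \<in> borel_measurable (lebesgue_on D)"
    if "p \<in> borel_measurable (lebesgue_on D)" "q \<in> borel_measurable (lebesgue_on D)" for p q
  proof -
    have "continuous_on UNIV (\<lambda>z. cross3 (fst z) (snd z))"
      by (intro continuous_on_cross continuous_intros)
    then have "(\<lambda>z. cross3 (fst z) (snd z)) \<in> borel_measurable (borel \<Otimes>\<^sub>M borel)"
      by (simp add: borel_prod borel_measurable_continuous_onI)
    from measurable_compose[OF _ this, of "\<lambda>x. (p x, q x)" "lebesgue_on D"] that show ?thesis by simp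
  qed
  have bounded_cross: "integrable (lebesgue_on D) (\<lambda>x. cross3 (f x) (h x) \<bullet> \<psi> x)
      \<and> \<bar>\<integral>x. cross3 (f x) (h x) \<bullet> \<psi> x \<partial>lebesgue_on D\<bar> \<le> (c * N f * A) * B"
    if f: "H1plus D \<alpha> f < \<infinity>" and [measurable]: "h \<in> borel_measurable (lebesgue_on D)" "\<psi> \<in> borel_measurable (lebesgue_on D)"
      and h: "(\<integral>\<^sup>+x. ennreal ((norm (h x))\<^sup>2) \<partial>lebesgue_on D) \<le> ennreal (A\<^sup>2)" "0 \<le> A"
      and \<psi>: "(\<integral>\<^sup>+x. ennreal ((norm (\<psi> x))\<^sup>2) \<partial>lebesgue_on D) \<le> ennreal (B\<^sup>2)" "0 \<le> B"
    for f h \<psi> :: "'a \<Rightarrow> real^3" and A B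
  proof -
    note [measurable] = H1_meas(1)[OF H1plus_power2(1)[OF f]]
    have "AE x in lebesgue_on D. \<bar>cross3 (f x) (h x) \<bullet> \<psi> x\<bar> \<le> (c * N f * norm (h x)) * norm (\<psi> x)"
      using c(2)[OF f]
    proof eventually_elim
      case (elim x)
      have "\<bar>cross3 (f x) (h x) \<bullet> \<psi> x\<bar> \<le> norm (cross3 (f x) (h x)) * norm (\<psi> x)" by (rule Cauchy_Schwarz_ineq2)
      also have "\<dots> \<le> (norm (f x) * norm (h x)) * norm (\<psi> x)" by (intro mult_right_mono norm_cross3_le) auto
      also have "\<dots> \<le> (c * N f * norm (h x)) * norm (\<psi> x)" by (intro mult_right_mono elim) auto
      finally show ?case .
    qed
    then show ?thesis
      using L2_product_bound[of "\<lambda>x. cross3 (f x) (h x) \<bullet> \<psi> x" "lebesgue_on D" "\<lambda>x. c * N f * norm (h x)" "\<lambda>x. norm (\<psi> x)" "c * N f * A" B]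
        scaled_L2[OF _ h(1), of "c * N f"] h(2) \<psi> c(1) by auto
  qed
  have "\<bar>inner_cross_grad D f f \<phi> - inner_cross_grad D g g \<phi>\<bar>
      \<le> (real DIM('a) * (c + k)) * (1 + (N f)\<^sup>2 + (N g)\<^sup>2) * n1 (\<lambda>x. f x - g x) * n1 \<phi>"
    if \<phi>: "H1 D \<phi> < \<infinity>" and f: "H1plus D \<alpha> f < \<infinity>" and g: "H1plus D \<alpha> g < \<infinity>" for \<phi> f g
  proof -
    note f1 = H1plus_power2(1)[OF f] and g1 = H1plus_power2(1)[OF g]
    let ?w = "\<lambda>x. f x - g x"
    note w1 = H1_diff(1)[OF f1 g1]
    have each: "\<bar>inner_L2 D (\<lambda>x. cross3 (f x) (wpd D b f x)) (wpd D b \<phi>) - inner_L2 D (\<lambda>x. cross3 (g x) (wpd D b g x)) (wpd D b \<phi>)\<bar>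
        \<le> (c + k) * (1 + (N f)\<^sup>2 + (N g)\<^sup>2) * n1 ?w * n1 \<phi>" if b: "b \<in> Basis" for b
    proof -
      let ?\<psi> = "wpd D b \<phi>" and ?p = "wpd D b f" and ?q = "wpd D b g" and ?r = "wpd D b ?w"
      note [measurable] = H1_meas(1)[OF f1] H1_meas(1)[OF g1] H1_meas(1)[OF w1] H1_meas(2)[OF f1 b] H1_meas(2)[OF g1 b]
        H1_meas(2)[OF \<phi> b] H1_meas(2)[OF w1 b]
      note \<psi> = L2_le_n1(2)[OF \<phi> b]
      have I1: "integrable (lebesgue_on D) (\<lambda>x. cross3 (f x) (?p x) \<bullet> ?\<psi> x)"
        and I2: "integrable (lebesgue_on D) (\<lambda>x. cross3 (g x) (?q x) \<bullet> ?\<psi> x)"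
        and I3: "integrable (lebesgue_on D) (\<lambda>x. cross3 (f x) (?r x) \<bullet> ?\<psi> x)"
        and B3: "\<bar>\<integral>x. cross3 (f x) (?r x) \<bullet> ?\<psi> x \<partial>lebesgue_on D\<bar> \<le> (c * N f * n1 ?w) * n1 \<phi>"
        using bounded_cross[OF f _ _ L2_le_n1(2)[OF f1 b] _ \<psi>] bounded_cross[OF g _ _ L2_le_n1(2)[OF g1 b] _ \<psi>]
          bounded_cross[OF f _ _ L2_le_n1(2)[OF w1 b] _ \<psi>] by auto
      have le4: "AE x in lebesgue_on D. \<bar>cross3 (?w x) (?q x) \<bullet> ?\<psi> x\<bar> \<le> (norm (?w x) * norm (?q x)) * norm (?\<psi> x)"
      proof (rule AE_I2)
        fix x
        have "\<bar>cross3 (?w x) (?q x) \<bullet> ?\<psi> x\<bar> \<le> norm (cross3 (?w x) (?q x)) * norm (?\<psi> x)" by (rule Cauchy_Schwarz_ineq2)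
        also have "\<dots> \<le> (norm (?w x) * norm (?q x)) * norm (?\<psi> x)" by (intro mult_right_mono norm_cross3_le) auto
        finally show "\<bar>cross3 (?w x) (?q x) \<bullet> ?\<psi> x\<bar> \<le> (norm (?w x) * norm (?q x)) * norm (?\<psi> x)" .
      qed
      have I4: "integrable (lebesgue_on D) (\<lambda>x. cross3 (?w x) (?q x) \<bullet> ?\<psi> x)"
        and B4: "\<bar>\<integral>x. cross3 (?w x) (?q x) \<bullet> ?\<psi> x \<partial>lebesgue_on D\<bar> \<le> (k * n1 ?w * N g) * n1 \<phi>"
        using L2_product_bound[OF _ _ _ le4 k(2)[OF w1 g b] \<psi>] k(1) by auto
      have "inner_L2 D (\<lambda>x. cross3 (f x) (?p x)) ?\<psi> - inner_L2 D (\<lambda>x. cross3 (g x) (?q x)) ?\<psi>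
          = (\<integral>x. cross3 (f x) (?p x) \<bullet> ?\<psi> x - cross3 (g x) (?q x) \<bullet> ?\<psi> x \<partial>lebesgue_on D)"
        unfolding inner_L2_def by (rule Bochner_Integration.integral_diff[OF I1 I2, symmetric])
      also have "\<dots> = (\<integral>x. cross3 (f x) (?r x) \<bullet> ?\<psi> x + cross3 (?w x) (?q x) \<bullet> ?\<psi> x \<partial>lebesgue_on D)"
      proof (rule integral_cong_AE)
        show "AE x in lebesgue_on D. cross3 (f x) (?p x) \<bullet> ?\<psi> x - cross3 (g x) (?q x) \<bullet> ?\<psi> x
            = cross3 (f x) (?r x) \<bullet> ?\<psi> x + cross3 (?w x) (?q x) \<bullet> ?\<psi> x"
          using H1_diff(3)[OF f1 g1 b]
          by eventually_elim (simp add: right_diff_distrib left_diff_distrib inner_diff_left Cross3.right_diff_distrib Cross3.left_diff_distrib)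
      qed measurable
      also have "\<dots> = (\<integral>x. cross3 (f x) (?r x) \<bullet> ?\<psi> x \<partial>lebesgue_on D) + (\<integral>x. cross3 (?w x) (?q x) \<bullet> ?\<psi> x \<partial>lebesgue_on D)"
        by (rule Bochner_Integration.integral_add[OF I3 I4])
      finally have "\<bar>inner_L2 D (\<lambda>x. cross3 (f x) (?p x)) ?\<psi> - inner_L2 D (\<lambda>x. cross3 (g x) (?q x)) ?\<psi>\<bar>
          \<le> (c * N f * n1 ?w) * n1 \<phi> + (k * n1 ?w * N g) * n1 \<phi>"
        using B3 B4 by linarith
      also have "\<dots> = (c * N f + k * N g) * (n1 ?w * n1 \<phi>)" by (simp add: algebra_simps)
      also have "\<dots> \<le> ((c + k) * (1 + (N f)\<^sup>2 + (N g)\<^sup>2)) * (n1 ?w * n1 \<phi>)"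
      proof (rule mult_right_mono)
        have le: "t \<le> 1 + t\<^sup>2" for t :: real
          using sum_squares_ge_zero[of "t - 1" 0] by (simp add: power2_eq_square algebra_simps) (smt (verit) zero_le_square)
        have "c * N f + k * N g \<le> c * (1 + (N f)\<^sup>2 + (N g)\<^sup>2) + k * (1 + (N f)\<^sup>2 + (N g)\<^sup>2)"
          using c(1) k(1) le[of "N f"] le[of "N g"] by (intro add_mono mult_left_mono) (auto intro: order_trans)
        then show "c * N f + k * N g \<le> (c + k) * (1 + (N f)\<^sup>2 + (N g)\<^sup>2)" by (simp add: distrib_right)
      qed simp
      finally show ?thesis by (simp only: mult.assoc)
    qed
    have "\<bar>inner_cross_grad D f f \<phi> - inner_cross_grad D g g \<phi>\<bar>
        \<le> (\<Sum>b\<in>(Basis::'a set). (c + k) * (1 + (N f)\<^sup>2 + (N g)\<^sup>2) * n1 ?w * n1 \<phi>)"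
      unfolding inner_cross_grad_def sum_subtractf[symmetric]
      by (intro order_trans[OF sum_abs] sum_mono each)
    then show ?thesis by (simp add: mult.assoc)
  qed
  then show ?thesis
    unfolding lipschitz_form_def using c(1) k(1) by (intro exI[of _ "real DIM('a) * (c + k)"]) auto
qed

text \<open>f and g are bounded by multiples of N f and N g, so the pointwise factor in
  \<open>cubic_difference_le\<close> becomes a constant that grows quadratically in these norms, and
  only the L2 norms of f - g and of the test function remain.\<close>

lemma lipschitz_cubic:
  assumes \<mu>: "0 \<le> \<mu>"
  shows "lipschitz_form (\<lambda>f. inner_L2 D (\<lambda>x. (1 + \<mu> * (norm (f x))\<^sup>2) *\<^sub>R f x))"
proof -
  obtain c where c: "c \<ge> 0" "\<And>u :: 'a \<Rightarrow> real^3. H1plus D \<alpha> u < \<infinity> \<Longrightarrow> AE x in lebesgue_on D. norm (u x) \<le> c * N u"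
    using Linf_N[where 'b="real^3"] by blast
  define F where "F u x = (1 + \<mu> * (norm (u x))\<^sup>2) *\<^sub>R u x" for u :: "'a \<Rightarrow> real^3" and x
  have int: "integrable (lebesgue_on D) (\<lambda>x. F f x \<bullet> \<phi> x)" if f: "H1plus D \<alpha> f < \<infinity>" and \<phi>: "H1 D \<phi> < \<infinity>" for f \<phi>
  proof -
    note f1 = H1plus_power2(1)[OF f]
    note [measurable] = H1_meas(1)[OF f1] H1_meas(1)[OF \<phi>]
    have [measurable]: "F f \<in> borel_measurable (lebesgue_on D)" unfolding F_def by measurable
    define K where "K = 1 + \<mu> * (c * N f)\<^sup>2"
    have K: "0 \<le> K" using \<mu> by (simp add: K_def)
    have "AE x in lebesgue_on D. \<bar>F f x \<bullet> \<phi> x\<bar> \<le> (K * norm (f x)) * norm (\<phi> x)"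
      using c(2)[OF f]
    proof eventually_elim
      case (elim x)
      have "\<bar>F f x \<bullet> \<phi> x\<bar> \<le> norm (F f x) * norm (\<phi> x)" by (rule Cauchy_Schwarz_ineq2)
      also have "norm (F f x) = (1 + \<mu> * (norm (f x))\<^sup>2) * norm (f x)" using \<mu> by (simp add: F_def)
      also have "\<dots> \<le> K * norm (f x)"
        unfolding K_def using elim \<mu> by (intro mult_right_mono add_left_mono mult_left_mono power_mono) auto
      finally show ?case by (simp add: mult_right_mono)
    qed
    from L2_product_bound(1)[OF _ _ _ this scaled_L2[OF H1_meas(1)[OF f1] L2_le_n1(1)[OF f1] K] L2_le_n1(1)[OF \<phi>]]
    show ?thesis using K by simp
  qed
  have "\<bar>inner_L2 D (F f) \<phi> - inner_L2 D (F g) \<phi>\<bar> \<le> (1 + 2 * \<mu> * c\<^sup>2) * (1 + (N f)\<^sup>2 + (N g)\<^sup>2) * n1 (\<lambda>x. f x - g x) * n1 \<phi>"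
    if \<phi>: "H1 D \<phi> < \<infinity>" and f: "H1plus D \<alpha> f < \<infinity>" and g: "H1plus D \<alpha> g < \<infinity>" for \<phi> f g
  proof -
    note f1 = H1plus_power2(1)[OF f] and g1 = H1plus_power2(1)[OF g]
    let ?w = "\<lambda>x. f x - g x"
    note w1 = H1_diff(1)[OF f1 g1]
    note [measurable] = H1_meas(1)[OF f1] H1_meas(1)[OF g1] H1_meas(1)[OF w1] H1_meas(1)[OF \<phi>]
    have [measurable]: "F f \<in> borel_measurable (lebesgue_on D)" "F g \<in> borel_measurable (lebesgue_on D)"
      unfolding F_def by measurable
    define K where "K = (1 + 2 * \<mu> * c\<^sup>2) * (1 + (N f)\<^sup>2 + (N g)\<^sup>2)"
    have K: "0 \<le> K" using \<mu> by (simp add: K_def)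
    have "AE x in lebesgue_on D. \<bar>(F f x - F g x) \<bullet> \<phi> x\<bar> \<le> (K * norm (?w x)) * norm (\<phi> x)"
      using c(2)[OF f] c(2)[OF g]
    proof eventually_elim
      case (elim x)
      have "(norm (f x))\<^sup>2 + (norm (g x))\<^sup>2 \<le> (c * N f)\<^sup>2 + (c * N g)\<^sup>2"
        using elim by (intro add_mono power_mono) auto
      then have "1 + 2 * \<mu> * ((norm (f x))\<^sup>2 + (norm (g x))\<^sup>2) \<le> 1 + 2 * \<mu> * (c\<^sup>2 * ((N f)\<^sup>2 + (N g)\<^sup>2))"
        using \<mu> by (intro add_left_mono mult_left_mono) (auto simp: power_mult_distrib distrib_left)
      also have "\<dots> \<le> K"
        unfolding K_def using \<mu> by (simp add: algebra_simps)
      finally have K': "1 + 2 * \<mu> * ((norm (f x))\<^sup>2 + (norm (g x))\<^sup>2) \<le> K" .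
      have "\<bar>(F f x - F g x) \<bullet> \<phi> x\<bar> \<le> norm (F f x - F g x) * norm (\<phi> x)" by (rule Cauchy_Schwarz_ineq2)
      also have "norm (F f x - F g x) \<le> (1 + 2 * \<mu> * ((norm (f x))\<^sup>2 + (norm (g x))\<^sup>2)) * norm (?w x)"
        unfolding F_def by (rule cubic_difference_le[OF \<mu>])
      also have "\<dots> \<le> K * norm (?w x)" by (intro mult_right_mono K') auto
      finally show ?case by (simp add: mult_right_mono)
    qed
    from L2_product_bound(2)[OF _ _ _ this scaled_L2[OF H1_meas(1)[OF w1] L2_le_n1(1)[OF w1] K] L2_le_n1(1)[OF \<phi>]]
    have "\<bar>\<integral>x. (F f x - F g x) \<bullet> \<phi> x \<partial>lebesgue_on D\<bar> \<le> K * n1 ?w * n1 \<phi>" using K by simp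
    moreover have "(\<integral>x. (F f x - F g x) \<bullet> \<phi> x \<partial>lebesgue_on D) = inner_L2 D (F f) \<phi> - inner_L2 D (F g) \<phi>"
      unfolding inner_L2_def inner_diff_left by (rule Bochner_Integration.integral_diff[OF int[OF f \<phi>] int[OF g \<phi>]])
    ultimately show ?thesis by (simp add: K_def)
  qed
  then show ?thesis
    unfolding lipschitz_form_def F_def using \<mu> by (intro exI[of _ "1 + 2 * \<mu> * c\<^sup>2"]) auto
qed

end

section \<open>A Gronwall inequality with integrable kernel\<close>

lemma nn_integral_time:
  "(\<integral>\<^sup>+s. f s \<partial>time t) = (\<integral>\<^sup>+s. f s * indicator {0<..<t} s \<partial>lebesgue)"
  by (rule nn_integral_restrict_space) simp

lemma nn_integral_time_mono: "t \<le> T \<Longrightarrow> (\<integral>\<^sup>+s. f s \<partial>time t) \<le> (\<integral>\<^sup>+s. f s \<partial>time T)"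
  unfolding nn_integral_time by (intro nn_integral_mono mult_left_mono) (auto simp: indicator_def)

lemma AE_time_mono: "t \<le> T \<Longrightarrow> AE s in time T. P s \<Longrightarrow> AE s in time t. P s"
  by (auto simp: AE_restrict_space_iff elim!: eventually_mono)

text \<open>
  Between two consecutive levels \<open>n/2\<close> and \<open>(n+1)/2\<close> of the primitive of the kernel, the
  integral term absorbs at most half of the supremum of the unknown function.
\<close>

lemma level_set_measure:
  fixes K :: "real \<Rightarrow> ennreal"
  assumes K: "K \<in> borel_measurable (time T)" and t: "0 < t" "t < T"
    and up: "(\<integral>\<^sup>+s. K s \<partial>time t) \<le> ennreal (c + 1/2)" and c: "0 \<le> c"
    and \<tau>: "0 \<le> \<tau>" and above: "\<And>s. \<tau> < s \<Longrightarrow> s < t \<Longrightarrow> ennreal c < (\<integral>\<^sup>+r. K r \<partial>time s)"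
  shows "(\<integral>\<^sup>+s. K s * indicator {\<tau>..} s \<partial>time t) \<le> ennreal (1/2)"
proof -
  have [measurable]: "K \<in> borel_measurable (time t)"
    using K by (rule measurable_restrict_mono) (use t in auto)
  have ind [measurable]: "A \<in> sets borel \<Longrightarrow> (indicator A :: real \<Rightarrow> ennreal) \<in> borel_measurable (time t)" for A
    by (auto intro!: borel_measurable_indicator' measurable_restrict_space1)
  \<comment> \<open>At a time s > \<tau> the primitive has already exceeded c, so at most 1/2 of the
    total c + 1/2 is left on [s, t).\<close>
  have piece: "(\<integral>\<^sup>+r. K r * indicator {s..} r \<partial>time t) \<le> ennreal (1/2)" if s: "\<tau> < s" "s < t" for s
  proof -
    have "(\<integral>\<^sup>+r. K r \<partial>time t) = (\<integral>\<^sup>+r. K r * indicator {..<s} r + K r * indicator {s..} r \<partial>time t)"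
      by (intro nn_integral_cong) (auto simp: indicator_def)
    also have "\<dots> = (\<integral>\<^sup>+r. K r * indicator {..<s} r \<partial>time t) + (\<integral>\<^sup>+r. K r * indicator {s..} r \<partial>time t)"
      by (rule nn_integral_add) measurable
    also have "(\<integral>\<^sup>+r. K r * indicator {..<s} r \<partial>time t) = (\<integral>\<^sup>+r. K r \<partial>time s)"
      unfolding nn_integral_time using s by (intro nn_integral_cong) (auto simp: indicator_def)
    finally have sum: "(\<integral>\<^sup>+r. K r \<partial>time s) + (\<integral>\<^sup>+r. K r * indicator {s..} r \<partial>time t) \<le> ennreal (c + 1/2)" (is "?a + ?b \<le> _")
      using up by simp
    then have "?a + ?b < top" by (rule le_less_trans) simp
    then have "?a < \<infinity>" "?b < \<infinity>" by simp_all
    then obtain a b where ab: "?a = ennreal a" "?b = ennreal b" "0 \<le> a" "0 \<le> b"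
      by (cases ?a; cases ?b) auto
    then have "a + b \<le> c + 1/2" "c < a"
      using sum above[OF s] c by (simp_all add: ennreal_plus[symmetric] ennreal_less_iff del: ennreal_plus)
    then have "b \<le> 1/2" by linarith
    then show ?thesis unfolding ab by (rule ennreal_leI)
  qed
  \<comment> \<open>\<open>piece\<close> needs s strictly above \<tau>, so the half-line beyond
    \<tau> is exhausted by half-lines starting at \<tau> + 1/(i+1); the end point itself is a null
    set.\<close>
  define f where "f i r = K r * indicator {\<tau> + 1 / real (Suc i)..} r" for i r
  have "(\<integral>\<^sup>+s. K s * indicator {\<tau>..} s \<partial>time t) = (\<integral>\<^sup>+s. K s * indicator {\<tau><..} s \<partial>time t)"
    unfolding nn_integral_time
  proof (rule nn_integral_cong_AE)
    have "{\<tau>} \<in> null_sets lebesgue" by simp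
    then show "AE s in lebesgue. K s * indicator {\<tau>..} s * indicator {0<..<t} s = K s * indicator {\<tau><..} s * indicator {0<..<t} s"
      by (rule AE_I') (auto simp: indicator_def split: if_splits)
  qed
  also have "\<dots> \<le> ennreal (1/2)"
  proof (rule LIMSEQ_le_const2)
    show "(\<lambda>i. \<integral>\<^sup>+s. f i s \<partial>time t) \<longlonglongrightarrow> (\<integral>\<^sup>+s. K s * indicator {\<tau><..} s \<partial>time t)"
    proof (rule nn_integral_LIMSEQ)
      show "incseq f"
        unfolding incseq_def le_fun_def f_def
      proof (intro allI impI mult_left_mono)
        fix m n :: nat and x :: real assume mn: "m \<le> n"
        have "1 / real (Suc n) \<le> 1 / real (Suc m)" using mn by (intro divide_left_mono) auto
        then show "(indicator {\<tau> + 1 / real (Suc m)..} x :: ennreal) \<le> indicator {\<tau> + 1 / real (Suc n)..} x"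
          by (auto simp: indicator_def)
      qed simp
      show "f i \<in> borel_measurable (time t)" for i unfolding f_def by measurable
      show "(\<lambda>i. f i x) \<longlonglongrightarrow> K x * indicator {\<tau><..} x" for x
      proof (cases "\<tau> < x")
        case True
        then have "eventually (\<lambda>i. 1 / real (Suc i) < x - \<tau>) sequentially"
          using LIMSEQ_inverse_real_of_nat by (intro order_tendstoD(2)[of _ 0]) (auto simp: inverse_eq_divide)
        then have "eventually (\<lambda>i. f i x = K x * indicator {\<tau><..} x) sequentially"
          by eventually_elim (use True in \<open>auto simp: f_def indicator_def\<close>)
        then show ?thesis by (rule tendsto_eventually)
      next
        case False
        then have "f i x = 0" for i
        proof -
          have "0 < 1 / real (Suc i)" by simp
          then have "x \<notin> {\<tau> + 1 / real (Suc i)..}" using False unfolding atLeast_iff by linarith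
          then show ?thesis by (simp add: f_def)
        qed
        then show ?thesis using False by simp
      qed
    qed
    show "\<exists>N. \<forall>n\<ge>N. (\<integral>\<^sup>+s. f n s \<partial>time t) \<le> ennreal (1/2)"
    proof (intro exI allI impI)
      fix n :: nat
      show "(\<integral>\<^sup>+s. f n s \<partial>time t) \<le> ennreal (1/2)"
      proof (cases "\<tau> + 1 / real (Suc n) < t")
        case True
        then show ?thesis unfolding f_def by (intro piece) auto
      next
        case False
        then have "f n s * indicator {0<..<t} s = 0" for s
          by (auto simp: f_def indicator_def)
        then show ?thesis unfolding nn_integral_time by (simp only:) simp
      qed
    qed
  qed
  finally show ?thesis .
qed

text \<open>Growth over n levels of the primitive: if A x bounds the function up to one level,
  absorbing half of the supremum on the next leaves 2 (A + B A x).\<close>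

definition gronwall_factor :: "real \<Rightarrow> nat \<Rightarrow> real" where
  "gronwall_factor B n = ((\<lambda>x. 2 * (1 + B * x)) ^^ n) 1"

lemma gronwall_factor_nonneg: "0 \<le> B \<Longrightarrow> 0 \<le> gronwall_factor B n"
  by (induction n) (auto simp: gronwall_factor_def)

text \<open>Induction over the levels n/2 of the primitive of K, using boundedness of y in place of
  continuity. The index in the conclusion is the least n with n/2 >= B, so all levels up to time T
  are covered.\<close>

lemma gronwall:
  fixes K :: "real \<Rightarrow> ennreal" and y :: "real \<Rightarrow> real"
  assumes K: "K \<in> borel_measurable (time T)" and B: "(\<integral>\<^sup>+s. K s \<partial>time T) \<le> ennreal B" "0 \<le> B"
    and y0: "\<And>t. 0 \<le> y t" and bdd: "AE s in time T. y s \<le> L" and A: "0 \<le> A"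
    and le: "\<And>t. 0 < t \<Longrightarrow> t < T \<Longrightarrow> ennreal (y t) \<le> ennreal A + (\<integral>\<^sup>+s. K s * ennreal (y s) \<partial>time t)"
    and t: "0 < t" "t < T"
  shows "y t \<le> A * gronwall_factor B (nat \<lceil>2 * B\<rceil>)"
proof -
  define \<kappa> where "\<kappa> t = (\<integral>\<^sup>+s. K s \<partial>time t)" for t
  have \<kappa>B: "\<kappa> s \<le> ennreal B" if "s < T" for s
    unfolding \<kappa>_def using nn_integral_time_mono[of s T K] that B(1) by simp
  have \<kappa>_mono: "r \<le> s \<Longrightarrow> \<kappa> r \<le> \<kappa> s" for r s
    unfolding \<kappa>_def by (rule nn_integral_time_mono)
  define L' where "L' = max L 0"
  \<comment> \<open>The almost everywhere bound L, fed once into the integral inequality, bounds y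
    at every time below T; the supremum m below is taken over a bounded set for this reason.\<close>
  have yb: "y s \<le> A + L' * B" if s: "0 < s" "s < T" for s
  proof -
    have "(\<integral>\<^sup>+r. K r * ennreal (y r) \<partial>time s) \<le> (\<integral>\<^sup>+r. K r * ennreal L' \<partial>time s)"
      using AE_time_mono[OF _ bdd, of s] s
      by (intro nn_integral_mono_AE) (auto elim!: eventually_mono intro!: mult_left_mono ennreal_leI simp: L'_def)
    also have "\<dots> = \<kappa> s * ennreal L'"
      unfolding \<kappa>_def
    proof (rule nn_integral_multc)
      show "K \<in> borel_measurable (time s)"
        using K by (rule measurable_restrict_mono) (use s in auto)
    qed
    also have "\<dots> \<le> ennreal B * ennreal L'" by (intro mult_right_mono \<kappa>B s) auto
    finally have "ennreal (y s) \<le> ennreal A + ennreal B * ennreal L'"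
      using le[OF s] by (meson add_left_mono order_trans)
    also have "\<dots> = ennreal (A + L' * B)"
      using A B by (simp add: L'_def ennreal_mult[symmetric] ennreal_plus[symmetric] mult.commute del: ennreal_plus)
    finally show ?thesis using A B by (subst (asm) ennreal_le_iff) (auto simp: L'_def add_left_mono)
  qed
  have "y t \<le> A * gronwall_factor B n" if "0 < t" "t < T" "\<kappa> t \<le> ennreal (real n / 2)" for n t
    using that
  proof (induction n arbitrary: t)
    case 0
    have [measurable]: "K \<in> borel_measurable (time t)"
      using K by (rule measurable_restrict_mono) (use 0 in auto)
    have "AE s in time t. K s = 0"
      using 0 by (simp add: \<kappa>_def nn_integral_0_iff_AE)
    then have "(\<integral>\<^sup>+s. K s * ennreal (y s) \<partial>time t) = (\<integral>\<^sup>+s. 0 \<partial>time t)"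
      by (intro nn_integral_cong_AE) (auto elim!: eventually_mono)
    then have "ennreal (y t) \<le> ennreal A" using le[OF 0(1,2)] by simp
    then show ?case using A by (simp add: gronwall_factor_def)
  next
    case (Suc n)
    let ?a = "gronwall_factor B n"
    have a0: "0 \<le> ?a" by (rule gronwall_factor_nonneg[OF B(2)])
    define S where "S = {s. 0 < s \<and> s < t \<and> \<kappa> s \<le> ennreal (real n / 2)}"
    \<comment> \<open>Supremum of the times at which level n/2 is not exceeded; inserting 0 covers
      the case that there are none.\<close>
    define \<tau> where "\<tau> = Sup (insert 0 S)"
    have bS: "bdd_above (insert 0 S)" using Suc.prems by (intro bdd_aboveI[of _ t]) (auto simp: S_def)
    have \<tau>0: "0 \<le> \<tau>" unfolding \<tau>_def by (rule cSup_upper[OF _ bS]) simp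
    define m where "m = (SUP s\<in>{0<..t}. y s)"
    have bm: "bdd_above (y ` {0<..t})"
      using yb Suc.prems by (intro bdd_aboveI[of _ "A + L' * B"]) auto
    have ym: "y s \<le> m" if "0 < s" "s \<le> t" for s
      unfolding m_def using that bm by (intro cSUP_upper) auto
    have m0: "0 \<le> m" using ym[of t] y0[of t] Suc.prems by linarith
    \<comment> \<open>Before \<tau> the induction hypothesis applies because the primitive is
      monotone; from \<tau> on only the supremum m is at hand.\<close>
    have low: "y r \<le> A * ?a + m * indicator {\<tau>..} r" if r: "0 < r" "r < t" for r
    proof (cases "\<tau> \<le> r")
      case True
      moreover have "0 \<le> A * ?a" using A a0 by simp
      ultimately show ?thesis using ym[of r] r by (simp add: add_increasing)
    next
      case False
      then have "r < Sup (insert 0 S)" by (simp add: \<tau>_def)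
      then obtain s where s: "s \<in> insert 0 S" "r < s" using less_cSup_iff[OF _ bS] by auto
      then have "s \<in> S" using r by auto
      then have "\<kappa> r \<le> ennreal (real n / 2)"
        using \<kappa>_mono[of r s] s by (auto simp: S_def intro: order_trans)
      then show ?thesis using Suc.IH[of r] r Suc.prems False by simp
    qed
    have [measurable]: "K \<in> borel_measurable (time t)"
      using K by (rule measurable_restrict_mono) (use Suc.prems in auto)
    have ind [measurable]: "(indicator {\<tau>..} :: real \<Rightarrow> ennreal) \<in> borel_measurable (time t)"
      by (auto intro!: borel_measurable_indicator' measurable_restrict_space1)
    have half: "(\<integral>\<^sup>+s. K s * indicator {\<tau>..} s \<partial>time t) \<le> ennreal (1/2)"
    proof (rule level_set_measure[OF K Suc.prems(1,2)])
      show "(\<integral>\<^sup>+s. K s \<partial>time t) \<le> ennreal (real n / 2 + 1 / 2)"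
        using Suc.prems(3) by (simp add: \<kappa>_def add_divide_distrib add.commute)
      show "0 \<le> real n / 2" "0 \<le> \<tau>" using \<tau>0 by auto
      fix s assume s: "\<tau> < s" "s < t"
      have "s \<notin> S" using s cSup_upper[OF _ bS, of s] by (auto simp: \<tau>_def)
      then show "ennreal (real n / 2) < (\<integral>\<^sup>+r. K r \<partial>time s)"
        using s \<tau>0 by (auto simp: S_def \<kappa>_def not_le)
    qed
    have int: "(\<integral>\<^sup>+r. K r * ennreal (y r) \<partial>time t) \<le> ennreal (B * (A * ?a) + m / 2)"
    proof -
      have "(\<integral>\<^sup>+r. K r * ennreal (y r) \<partial>time t) \<le> (\<integral>\<^sup>+r. ennreal (A * ?a) * K r + ennreal m * (K r * indicator {\<tau>..} r) \<partial>time t)"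
      proof (rule nn_integral_mono)
        fix r assume "r \<in> space (time t)"
        then have r: "0 < r" "r < t" by auto
        have "ennreal (y r) \<le> ennreal (A * ?a + m * indicator {\<tau>..} r)" by (rule ennreal_leI[OF low[OF r]])
        also have "\<dots> = ennreal (A * ?a) + ennreal m * indicator {\<tau>..} r"
          using A a0 m0 by (auto simp: indicator_def)
        finally have "K r * ennreal (y r) \<le> K r * (ennreal (A * ?a) + ennreal m * indicator {\<tau>..} r)"
          by (rule mult_left_mono) simp
        then show "K r * ennreal (y r) \<le> ennreal (A * ?a) * K r + ennreal m * (K r * indicator {\<tau>..} r)"
          by (simp add: distrib_left ac_simps)
      qed
      also have "\<dots> = ennreal (A * ?a) * \<kappa> t + ennreal m * (\<integral>\<^sup>+r. K r * indicator {\<tau>..} r \<partial>time t)"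
        by (simp add: nn_integral_add nn_integral_cmult \<kappa>_def)
      also have "\<dots> \<le> ennreal (A * ?a) * ennreal B + ennreal m * ennreal (1/2)"
        using Suc.prems by (intro add_mono mult_left_mono half \<kappa>B) auto
      also have "\<dots> = ennreal (B * (A * ?a) + m / 2)"
      proof -
        have "ennreal (A * ?a) * ennreal B = ennreal (B * (A * ?a))"
          using A a0 B by (subst ennreal_mult[symmetric]) (auto simp: mult.commute)
        moreover have "ennreal m * ennreal (1/2) = ennreal (m * (1/2))"
          using m0 by (intro ennreal_mult[symmetric]) auto
        ultimately show ?thesis using A a0 B m0 by (simp only:) (subst ennreal_plus[symmetric], auto)
      qed
      finally show ?thesis .
    qed
    have "y s \<le> A + (B * (A * ?a) + m / 2)" if s: "s \<in> {0<..t}" for s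
    proof -
      have "ennreal (y s) \<le> ennreal A + (\<integral>\<^sup>+r. K r * ennreal (y r) \<partial>time s)"
        using s Suc.prems by (intro le) auto
      also have "\<dots> \<le> ennreal A + (\<integral>\<^sup>+r. K r * ennreal (y r) \<partial>time t)"
        using s by (intro add_left_mono nn_integral_time_mono) auto
      also have "\<dots> \<le> ennreal A + ennreal (B * (A * ?a) + m / 2)" by (intro add_left_mono int)
      also have "\<dots> = ennreal (A + (B * (A * ?a) + m / 2))"
        using A a0 B m0 by (subst ennreal_plus) auto
      finally show ?thesis using A a0 B m0 by (subst (asm) ennreal_le_iff) auto
    qed
    \<comment> \<open>Half of m is absorbed on the left, which yields the recursion of
      \<open>gronwall_factor\<close>.\<close>
    then have "m \<le> A + (B * (A * ?a) + m / 2)"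
      unfolding m_def using Suc.prems by (intro cSUP_least) auto
    then have "m \<le> 2 * (A + B * (A * ?a))" by simp
    also have "\<dots> = A * gronwall_factor B (Suc n)" by (simp add: gronwall_factor_def algebra_simps)
    finally show ?case using ym[of t] Suc.prems by linarith
  qed
  moreover have "\<kappa> t \<le> ennreal (real (nat \<lceil>2 * B\<rceil>) / 2)"
  proof -
    have "B \<le> real (nat \<lceil>2 * B\<rceil>) / 2" using B(2) by (simp add: of_nat_nat) linarith
    then show ?thesis using \<kappa>B[OF t(2)] by (meson ennreal_leI order_trans)
  qed
  ultimately show ?thesis using t by blast
qed

section \<open>Measurability in time\<close>

text \<open>The limit is known only off a null set; completeness of Lebesgue measure makes g
  measurable nevertheless.\<close>

lemma borel_measurable_time_AE_limit:
  fixes f :: "nat \<Rightarrow> real \<Rightarrow> real"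
  assumes f: "\<And>n. f n \<in> borel_measurable (time T)" and lim: "AE t in time T. (\<lambda>n. f n t) \<longlonglongrightarrow> g t"
  shows "g \<in> borel_measurable (time T)"
proof -
  have S: "{0<..<T} \<in> sets lebesgue" by simp
  define h where "h t = lim (\<lambda>n. f n t)" for t
  have "h \<in> borel_measurable (time T)"
    unfolding h_def using f by (rule borel_measurable_lim_metric)
  then have "(\<lambda>t. if t \<in> {0<..<T} then h t else 0) \<in> borel_measurable lebesgue"
    by (rule borel_measurable_if_I[OF _ S])
  moreover have "AE t in lebesgue. t \<in> {0<..<T} \<longrightarrow> (\<lambda>n. f n t) \<longlonglongrightarrow> g t"
    using lim by (subst (asm) AE_restrict_space_iff) auto
  then have "AE t in lebesgue. (if t \<in> {0<..<T} then h t else 0) = (if t \<in> {0<..<T} then g t else 0)"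
    by eventually_elim (auto simp: h_def limI)
  ultimately have "(\<lambda>t. if t \<in> {0<..<T} then g t else 0) \<in> borel_measurable lebesgue"
    by (rule borel_measurable_AE)
  then show ?thesis by (rule borel_measurable_if_D)
qed

section \<open>Norms and forms along approximating simple functions\<close>

context embedding_region
begin

text \<open>f is \<sigma> n minus the small difference and \<sigma> n is f plus it; both
  inequalities follow from the quadratic bounds for linear combinations once the difference has
  finite norm.\<close>

lemma H1plus_limit:
  fixes \<sigma> :: "nat \<Rightarrow> 'a \<Rightarrow> 'b::euclidean_space"
  assumes fin: "\<And>n. H1plus D \<alpha> (\<sigma> n) < \<infinity>" and lim: "(\<lambda>n. H1plus D \<alpha> (\<lambda>x. \<sigma> n x - f x)) \<longlonglongrightarrow> 0"
  shows "H1plus D \<alpha> f < \<infinity>" "(\<lambda>n. N (\<lambda>x. \<sigma> n x - f x)) \<longlonglongrightarrow> 0"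
    and "\<forall>\<^sub>F n in sequentially. H1plus D \<alpha> (\<lambda>x. \<sigma> n x - f x) < \<infinity> \<and>
      (N f)\<^sup>2 \<le> 2 * (N (\<sigma> n))\<^sup>2 + 2 * (N (\<lambda>x. \<sigma> n x - f x))\<^sup>2 \<and>
      (N (\<sigma> n))\<^sup>2 \<le> 2 * (N f)\<^sup>2 + 2 * (N (\<lambda>x. \<sigma> n x - f x))\<^sup>2"
proof -
  have ev: "\<forall>\<^sub>F n in sequentially. H1plus D \<alpha> (\<lambda>x. \<sigma> n x - f x) < \<infinity>"
    using order_tendstoD(2)[OF lim] by simp
  have e: "(\<lambda>x. \<sigma> n x - (\<sigma> n x - f x)) = f" for n by simp
  obtain n where "H1plus D \<alpha> (\<lambda>x. \<sigma> n x - f x) < \<infinity>"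
    using ev by (auto simp: eventually_sequentially)
  from H1plus_diff(1)[OF fin[of n] this] show f: "H1plus D \<alpha> f < \<infinity>" unfolding e .
  show "(\<lambda>n. N (\<lambda>x. \<sigma> n x - f x)) \<longlonglongrightarrow> 0"
    unfolding N_def using lim by (intro tendsto_enn2real) auto
  show "\<forall>\<^sub>F n in sequentially. H1plus D \<alpha> (\<lambda>x. \<sigma> n x - f x) < \<infinity> \<and>
      (N f)\<^sup>2 \<le> 2 * (N (\<sigma> n))\<^sup>2 + 2 * (N (\<lambda>x. \<sigma> n x - f x))\<^sup>2 \<and>
      (N (\<sigma> n))\<^sup>2 \<le> 2 * (N f)\<^sup>2 + 2 * (N (\<lambda>x. \<sigma> n x - f x))\<^sup>2"
    using ev
  proof eventually_elim
    case (elim n)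
    have "(N f)\<^sup>2 \<le> 2 * (N (\<sigma> n))\<^sup>2 + 2 * (N (\<lambda>x. \<sigma> n x - f x))\<^sup>2"
      using H1plus_diff(2)[OF fin[of n] elim] unfolding e .
    moreover have "(N (\<sigma> n))\<^sup>2 \<le> 2 * (N f)\<^sup>2 + 2 * (N (\<lambda>x. \<sigma> n x - f x))\<^sup>2"
    proof -
      have e': "(\<lambda>x. f x + 1 *\<^sub>R (\<sigma> n x - f x)) = \<sigma> n" by simp
      have "ennreal ((N (\<sigma> n))\<^sup>2) \<le> ennreal (2 * (N f)\<^sup>2 + 2 * (N (\<lambda>x. \<sigma> n x - f x))\<^sup>2)"
        using H1plus_lincomb(1)[OF f elim, of 1] unfolding e' H1plus_eq[OF fin] H1plus_eq[OF f] H1plus_eq[OF elim]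
        by (simp add: ennreal_power ennreal_mult)
      then show ?thesis by (subst (asm) ennreal_le_iff) auto
    qed
    ultimately show ?case using elim by blast
  qed
qed

text \<open>Sums are controlled only with a factor 2, so the norms of \<sigma> n are compared with
  that of f instead of being shown to converge to it; a limit inferior caught between two multiples
  of the squared norm is enough for a kernel.\<close>

lemma liminf_N_bounds:
  fixes \<sigma> :: "nat \<Rightarrow> 'a \<Rightarrow> 'b::euclidean_space"
  assumes fin: "\<And>n. H1plus D \<alpha> (\<sigma> n) < \<infinity>" and lim: "(\<lambda>n. H1plus D \<alpha> (\<lambda>x. \<sigma> n x - f x)) \<longlonglongrightarrow> 0"
  shows "ennreal ((N f)\<^sup>2) \<le> liminf (\<lambda>n. ennreal (2 * (N (\<sigma> n))\<^sup>2))"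
    and "liminf (\<lambda>n. ennreal (2 * (N (\<sigma> n))\<^sup>2)) \<le> ennreal (4 * (N f)\<^sup>2)"
proof -
  note L = H1plus_limit[OF fin lim]
  let ?\<delta> = "\<lambda>n. N (\<lambda>x. \<sigma> n x - f x)"
  have 1: "(\<lambda>n. ennreal ((N f)\<^sup>2 - 2 * (?\<delta> n)\<^sup>2)) \<longlonglongrightarrow> ennreal ((N f)\<^sup>2 - 2 * 0\<^sup>2)"
    by (intro tendsto_ennrealI tendsto_intros L(2))
  have "ennreal ((N f)\<^sup>2) = liminf (\<lambda>n. ennreal ((N f)\<^sup>2 - 2 * (?\<delta> n)\<^sup>2))"
    using lim_imp_Liminf[OF _ 1] by simp
  also have "\<dots> \<le> liminf (\<lambda>n. ennreal (2 * (N (\<sigma> n))\<^sup>2))"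
    using L(3) by (intro Liminf_mono) (auto elim!: eventually_mono intro!: ennreal_leI)
  finally show "ennreal ((N f)\<^sup>2) \<le> liminf (\<lambda>n. ennreal (2 * (N (\<sigma> n))\<^sup>2))" .
  have 2: "(\<lambda>n. ennreal (4 * (N f)\<^sup>2 + 4 * (?\<delta> n)\<^sup>2)) \<longlonglongrightarrow> ennreal (4 * (N f)\<^sup>2 + 4 * 0\<^sup>2)"
    by (intro tendsto_ennrealI tendsto_intros L(2))
  have "liminf (\<lambda>n. ennreal (2 * (N (\<sigma> n))\<^sup>2)) \<le> liminf (\<lambda>n. ennreal (4 * (N f)\<^sup>2 + 4 * (?\<delta> n)\<^sup>2))"
    using L(3)
  proof (intro Liminf_mono, eventually_elim)
    case (elim n)
    then show ?case by (intro ennreal_leI) linarith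
  qed
  also have "\<dots> = ennreal (4 * (N f)\<^sup>2)"
    using lim_imp_Liminf[OF _ 2] by simp
  finally show "liminf (\<lambda>n. ennreal (2 * (N (\<sigma> n))\<^sup>2)) \<le> ennreal (4 * (N f)\<^sup>2)" .
qed

text \<open>K is a measurable substitute for the square of \<open>N (u t)\<close>. It is a limit
  inferior of functions composed with simple functions, and such compositions are measurable without
  any regularity of \<open>N\<close>.\<close>

lemma strongly_measurable_kernel:
  fixes u :: "real \<Rightarrow> 'a \<Rightarrow> real^3"
  assumes "strongly_measurable T (H1plus D \<alpha>) u"
  shows "\<exists>K\<in>borel_measurable (time T). AE t in time T. H1plus D \<alpha> (u t) < \<infinity> \<and>
    ennreal ((N (u t))\<^sup>2) \<le> K t \<and> K t \<le> ennreal (4 * (N (u t))\<^sup>2)"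
proof -
  obtain s where s: "\<And>n. simple_in T (H1plus D \<alpha>) (s n)"
    and lim: "AE t in time T. (\<lambda>n::nat. H1plus D \<alpha> (\<lambda>x. s n t x - u t x)) \<longlonglongrightarrow> 0"
    using assms unfolding strongly_measurable_def by blast
  define K where "K t = liminf (\<lambda>n. ennreal (2 * (N (s n t))\<^sup>2))" for t
  have "(\<lambda>t. ennreal (2 * (N (s n t))\<^sup>2)) \<in> borel_measurable (time T)" for n
  proof -
    have "simple_function (time T) (s n)" using s[of n] by (simp add: simple_in_def)
    from borel_measurable_simple_function[OF simple_function_compose[OF this, of "\<lambda>f. ennreal (2 * (N f)\<^sup>2)"]]
    show ?thesis by (simp only: o_def)
  qed
  then have "K \<in> borel_measurable (time T)"
    unfolding K_def by (rule borel_measurable_liminf)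
  moreover have "AE t in time T. H1plus D \<alpha> (u t) < \<infinity> \<and> ennreal ((N (u t))\<^sup>2) \<le> K t \<and> K t \<le> ennreal (4 * (N (u t))\<^sup>2)"
  proof -
    have "AE t in time T. t \<in> {0<..<T}" using AE_space[of "time T"] by simp
    with lim show ?thesis
    proof eventually_elim
      case (elim t)
      have fin: "H1plus D \<alpha> (s n t) < \<infinity>" for n using s[of n] elim by (simp add: simple_in_def)
      show ?case
        unfolding K_def using H1plus_limit(1)[OF fin elim(1)] liminf_N_bounds[OF fin elim(1)] by blast
    qed
  qed
  ultimately show ?thesis by blast
qed

text \<open>\<Phi> composed with a simple function is simple, and the local Lipschitz bound makes
  the values converge along the approximating sequence.\<close>

lemma strongly_measurable_form:
  fixes u :: "real \<Rightarrow> 'a \<Rightarrow> real^3"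
  assumes u: "strongly_measurable T (H1plus D \<alpha>) u"
    and C: "0 \<le> C" "\<And>f g. H1plus D \<alpha> f < \<infinity> \<Longrightarrow> H1plus D \<alpha> g < \<infinity> \<Longrightarrow>
      \<bar>\<Phi> f - \<Phi> g\<bar> \<le> C * (1 + (N f)\<^sup>2 + (N g)\<^sup>2) * n1 (\<lambda>x. f x - g x)"
  shows "(\<lambda>t. \<Phi> (u t)) \<in> borel_measurable (time T)"
proof -
  obtain s where s: "\<And>n. simple_in T (H1plus D \<alpha>) (s n)"
    and lim: "AE t in time T. (\<lambda>n::nat. H1plus D \<alpha> (\<lambda>x. s n t x - u t x)) \<longlonglongrightarrow> 0"
    using u unfolding strongly_measurable_def by blast
  show ?thesis
  proof (rule borel_measurable_time_AE_limit)
    show "(\<lambda>t. \<Phi> (s n t)) \<in> borel_measurable (time T)" for n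
      using s[of n] simple_function_compose[of "time T" "s n" \<Phi>]
      by (auto simp: simple_in_def o_def intro!: borel_measurable_simple_function)
    have "AE t in time T. t \<in> {0<..<T}" using AE_space[of "time T"] by simp
    with lim show "AE t in time T. (\<lambda>n. \<Phi> (s n t)) \<longlonglongrightarrow> \<Phi> (u t)"
    proof eventually_elim
      case (elim t)
      have fin: "H1plus D \<alpha> (s n t) < \<infinity>" for n using s[of n] elim by (simp add: simple_in_def)
      note L = H1plus_limit[OF fin elim(1)]
      let ?\<delta> = "\<lambda>n. N (\<lambda>x. s n t x - u t x)"
      have "(\<lambda>n. \<Phi> (s n t) - \<Phi> (u t)) \<longlonglongrightarrow> 0"
      proof (rule Lim_null_comparison)
        show "\<forall>\<^sub>F n in sequentially. norm (\<Phi> (s n t) - \<Phi> (u t)) \<le> C * (1 + (2 * (N (u t))\<^sup>2 + 2 * (?\<delta> n)\<^sup>2) + (N (u t))\<^sup>2) * ?\<delta> n"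
          using L(3)
        proof eventually_elim
          case (elim n)
          have "norm (\<Phi> (s n t) - \<Phi> (u t)) \<le> C * (1 + (N (s n t))\<^sup>2 + (N (u t))\<^sup>2) * n1 (\<lambda>x. s n t x - u t x)"
            using C(2)[OF fin L(1)] by simp
          also have "\<dots> \<le> C * (1 + (2 * (N (u t))\<^sup>2 + 2 * (?\<delta> n)\<^sup>2) + (N (u t))\<^sup>2) * ?\<delta> n"
            using elim C(1) by (intro mult_mono mult_left_mono add_mono n1_le_N) auto
          finally show ?case .
        qed
        have "(\<lambda>n. C * (1 + (2 * (N (u t))\<^sup>2 + 2 * (?\<delta> n)\<^sup>2) + (N (u t))\<^sup>2) * ?\<delta> n)
          \<longlonglongrightarrow> C * (1 + (2 * (N (u t))\<^sup>2 + 2 * 0\<^sup>2) + (N (u t))\<^sup>2) * 0"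
          by (intro tendsto_intros L(2))
        then show "(\<lambda>n. C * (1 + (2 * (N (u t))\<^sup>2 + 2 * (?\<delta> n)\<^sup>2) + (N (u t))\<^sup>2) * ?\<delta> n) \<longlonglongrightarrow> 0" by simp
      qed
      then show ?case by (simp add: LIM_zero_iff)
    qed
  qed
qed

lemma n1_power2:
  fixes f :: "'a \<Rightarrow> 'b::euclidean_space"
  assumes f: "H1 D f < \<infinity>"
  shows "(n1 f)\<^sup>2 = inner_L2 D f f + inner_grad D f f"
proof -
  have sq: "(L2 D h)\<^sup>2 = ennreal (inner_L2 D h h)"
    if [measurable]: "h \<in> borel_measurable (lebesgue_on D)" and "integrable (lebesgue_on D) (\<lambda>x. h x \<bullet> h x)" for h :: "'a \<Rightarrow> 'b"
    using nn_integral_eq_integral[OF that(2)] by (simp add: L2_power2 inner_L2_def power2_norm_eq_inner)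
  have pos: "0 \<le> inner_L2 D h h" for h :: "'a \<Rightarrow> 'b"
    unfolding inner_L2_def by (rule Bochner_Integration.integral_nonneg) simp
  have "ennreal ((n1 f)\<^sup>2) = (L2 D f)\<^sup>2 + (\<Sum>b\<in>Basis. (L2 D (wpd D b f))\<^sup>2)"
    using H1_power2[OF f] H1_eq[OF f] by (simp add: ennreal_power)
  also have "\<dots> = ennreal (inner_L2 D f f) + (\<Sum>b\<in>Basis. ennreal (inner_L2 D (wpd D b f) (wpd D b f)))"
    using sq[OF H1_meas(1)[OF f] inner_L2_H1(1)[OF f f]] sq[OF H1_meas(2)[OF f] inner_L2_H1(3)[OF f f]] by simp
  also have "\<dots> = ennreal (inner_L2 D f f + inner_grad D f f)"
    unfolding inner_grad_def using pos by (simp add: sum_ennreal ennreal_plus sum_nonneg)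
  finally show ?thesis
    using pos by (subst (asm) ennreal_inj) (auto simp: inner_grad_def intro!: add_nonneg_nonneg sum_nonneg)
qed

lemma inner_L2_commute: "inner_L2 D f g = inner_L2 D g f"
  by (simp add: inner_L2_def inner_commute)

lemma inner_grad_commute: "inner_grad D f g = inner_grad D g f"
  unfolding inner_grad_def by (intro sum.cong refl inner_L2_commute)

lemma inner_grad_bound:
  fixes f g :: "'a \<Rightarrow> 'b::euclidean_space"
  assumes f: "H1 D f < \<infinity>" and g: "H1 D g < \<infinity>"
  shows "\<bar>inner_grad D f g\<bar> \<le> real DIM('a) * (n1 f * n1 g)"
proof -
  have "\<bar>inner_grad D f g\<bar> \<le> (\<Sum>b\<in>Basis. \<bar>inner_L2 D (wpd D b f) (wpd D b g)\<bar>)"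
    unfolding inner_grad_def by (rule sum_abs)
  also have "\<dots> \<le> real DIM('a) * (n1 f * n1 g)"
    using inner_L2_H1(4)[OF f g] by (intro sum_bounded_above) auto
  finally show ?thesis .
qed

text \<open>Polarisation: with w = f - g the difference of the squares is the H1 inner product of w
  with f plus that of w with g. It gives continuity of the squared norm without the triangle
  inequality.\<close>

lemma n1_power2_diff:
  fixes f g :: "'a \<Rightarrow> 'b::euclidean_space"
  assumes f: "H1 D f < \<infinity>" and g: "H1 D g < \<infinity>"
  shows "\<bar>(n1 f)\<^sup>2 - (n1 g)\<^sup>2\<bar> \<le> (1 + real DIM('a)) * (n1 (\<lambda>x. f x - g x) * (n1 f + n1 g))"
proof -
  let ?w = "\<lambda>x. f x - g x"
  note w = H1_diff(1)[OF f g]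
  have "(n1 f)\<^sup>2 - (n1 g)\<^sup>2 = (inner_L2 D ?w f + inner_grad D ?w f) + (inner_L2 D ?w g + inner_grad D ?w g)"
    unfolding n1_power2[OF f] n1_power2[OF g] inner_diff_H1[OF f g f] inner_diff_H1[OF f g g]
    by (simp add: inner_L2_commute[of g f] inner_grad_commute[of g f])
  moreover have "\<bar>inner_L2 D ?w f\<bar> \<le> n1 ?w * n1 f" "\<bar>inner_L2 D ?w g\<bar> \<le> n1 ?w * n1 g"
    "\<bar>inner_grad D ?w f\<bar> \<le> real DIM('a) * (n1 ?w * n1 f)" "\<bar>inner_grad D ?w g\<bar> \<le> real DIM('a) * (n1 ?w * n1 g)"
    using inner_L2_H1(2) inner_grad_bound w f g by blast+
  ultimately have "\<bar>(n1 f)\<^sup>2 - (n1 g)\<^sup>2\<bar> \<le> n1 ?w * n1 f + real DIM('a) * (n1 ?w * n1 f) + (n1 ?w * n1 g + real DIM('a) * (n1 ?w * n1 g))"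
    by linarith
  then show ?thesis by (simp add: algebra_simps)
qed

lemma H1_limit:
  fixes \<sigma> :: "nat \<Rightarrow> 'a \<Rightarrow> 'b::euclidean_space"
  assumes fin: "\<And>n. H1 D (\<sigma> n) < \<infinity>" and f: "H1 D f < \<infinity>" and lim: "(\<lambda>n. H1 D (\<lambda>x. \<sigma> n x - f x)) \<longlonglongrightarrow> 0"
  shows "(\<lambda>n. (n1 (\<sigma> n))\<^sup>2) \<longlonglongrightarrow> (n1 f)\<^sup>2"
proof -
  let ?\<delta> = "\<lambda>n. n1 (\<lambda>x. \<sigma> n x - f x)"
  have \<delta>: "?\<delta> \<longlonglongrightarrow> 0"
    unfolding n1_def using lim by (intro tendsto_enn2real) auto
  \<comment> \<open>The norm of \<sigma> n is bounded by 1 plus its square, because the available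
    estimate for sums concerns squares.\<close>
  let ?b = "\<lambda>n. (1 + real DIM('a)) * (?\<delta> n * ((1 + 2 * (n1 f)\<^sup>2 + 2 * (?\<delta> n)\<^sup>2) + n1 f))"
  have "(\<lambda>n. (n1 (\<sigma> n))\<^sup>2 - (n1 f)\<^sup>2) \<longlonglongrightarrow> 0"
  proof (rule Lim_null_comparison)
    show "\<forall>\<^sub>F n in sequentially. norm ((n1 (\<sigma> n))\<^sup>2 - (n1 f)\<^sup>2) \<le> ?b n"
    proof (intro always_eventually allI)
      fix n
      have e: "(\<lambda>x. f x + 1 *\<^sub>R (\<sigma> n x - f x)) = \<sigma> n" by simp
      note w = H1_diff(1)[OF fin[of n] f]
      have "ennreal ((n1 (\<sigma> n))\<^sup>2) \<le> ennreal (2 * (n1 f)\<^sup>2 + 2 * (?\<delta> n)\<^sup>2)"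
        using H1_lincomb[OF f w, of 1] unfolding e H1_eq[OF fin] H1_eq[OF f] H1_eq[OF w]
        by (simp add: ennreal_power ennreal_mult)
      then have "(n1 (\<sigma> n))\<^sup>2 \<le> 2 * (n1 f)\<^sup>2 + 2 * (?\<delta> n)\<^sup>2"
        by (subst (asm) ennreal_le_iff) auto
      moreover have "n1 (\<sigma> n) \<le> 1 + (n1 (\<sigma> n))\<^sup>2"
      proof -
        have "2 * n1 (\<sigma> n) \<le> 1 + (n1 (\<sigma> n))\<^sup>2"
          using zero_le_power2[of "n1 (\<sigma> n) - 1"] by (simp add: power2_diff)
        then show ?thesis using n1_nonneg[of "\<sigma> n"] by linarith
      qed
      ultimately have "(1 + real DIM('a)) * (?\<delta> n * (n1 (\<sigma> n) + n1 f)) \<le> ?b n"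
        by (intro mult_left_mono) auto
      then show "norm ((n1 (\<sigma> n))\<^sup>2 - (n1 f)\<^sup>2) \<le> ?b n"
        using n1_power2_diff[OF fin[of n] f] unfolding real_norm_def by (rule order_trans[rotated])
    qed
    have "?b \<longlonglongrightarrow> (1 + real DIM('a)) * (0 * ((1 + 2 * (n1 f)\<^sup>2 + 2 * 0\<^sup>2) + n1 f))"
      by (intro tendsto_intros \<delta>)
    then show "?b \<longlonglongrightarrow> 0" by simp
  qed
  then show ?thesis by (simp add: LIM_zero_iff)
qed

text \<open>\<open>LinfT\<close> is infinite unless its argument is strongly measurable, and the
  bound on the essential supremum asks for a measurable norm; both facts are needed before the
  difference of two solutions can be estimated.\<close>

lemma strongly_measurable_diff:
  fixes u v :: "real \<Rightarrow> 'a \<Rightarrow> 'b::euclidean_space"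
  assumes u: "strongly_measurable T (H1 D) u" and v: "strongly_measurable T (H1 D) v"
    and uv: "\<And>t. t \<in> {0<..<T} \<Longrightarrow> H1 D (u t) < \<infinity>" "\<And>t. t \<in> {0<..<T} \<Longrightarrow> H1 D (v t) < \<infinity>"
  shows "strongly_measurable T (H1 D) (\<lambda>t x. u t x - v t x)"
    and "(\<lambda>t. H1 D (\<lambda>x. u t x - v t x)) \<in> borel_measurable (time T)"
proof -
  obtain p where p: "\<And>n. simple_in T (H1 D) (p n)"
    and p_lim: "AE t in time T. (\<lambda>n::nat. H1 D (\<lambda>x. p n t x - u t x)) \<longlonglongrightarrow> 0"
    using u unfolding strongly_measurable_def by blast
  obtain q where q: "\<And>n. simple_in T (H1 D) (q n)"
    and q_lim: "AE t in time T. (\<lambda>n::nat. H1 D (\<lambda>x. q n t x - v t x)) \<longlonglongrightarrow> 0"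
    using v unfolding strongly_measurable_def by blast
  define s where "s n t x = p n t x - q n t x" for n t x
  have s: "simple_in T (H1 D) (s n)" for n
  proof -
    have "simple_function (time T) (p n)" "simple_function (time T) (q n)"
      using p[of n] q[of n] by (simp_all add: simple_in_def)
    from simple_function_compose2[OF this, of "\<lambda>f g x. f x - g x"]
    have "simple_function (time T) (\<lambda>t x. p n t x - q n t x)" .
    moreover have "H1 D (s n t) < \<infinity>" if "t \<in> {0<..<T}" for t
      unfolding s_def using p[of n] q[of n] that by (intro H1_diff(1)) (auto simp: simple_in_def)
    ultimately show ?thesis by (simp add: simple_in_def s_def[abs_def])
  qed
  have T: "AE t in time T. t \<in> {0<..<T}" using AE_space[of "time T"] by simp
  have lim: "AE t in time T. (\<lambda>n. H1 D (\<lambda>x. s n t x - (u t x - v t x))) \<longlonglongrightarrow> 0"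
    using p_lim q_lim T
  proof eventually_elim
    case (elim t)
    note fin = uv[OF elim(3)]
    have fp: "H1 D (p n t) < \<infinity>" and fq: "H1 D (q n t) < \<infinity>" for n
      using p[of n] q[of n] elim by (auto simp: simple_in_def)
    let ?a = "\<lambda>n. n1 (\<lambda>x. p n t x - u t x)" and ?b = "\<lambda>n. n1 (\<lambda>x. q n t x - v t x)"
    have ab: "?a \<longlonglongrightarrow> 0" "?b \<longlonglongrightarrow> 0"
      unfolding n1_def using elim by (auto intro!: tendsto_enn2real)
    have e: "(\<lambda>x. s n t x - (u t x - v t x)) = (\<lambda>x. (p n t x - u t x) - (q n t x - v t x))" for n
      by (auto simp: s_def)
    note d = H1_diff(1)[OF fp fin(1)] H1_diff(1)[OF fq fin(2)]
    have "(\<lambda>n. (n1 (\<lambda>x. s n t x - (u t x - v t x)))\<^sup>2) \<longlonglongrightarrow> 0"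
    proof (rule tendsto_sandwich[where f="\<lambda>_. 0" and h="\<lambda>n. 2 * (?a n)\<^sup>2 + 2 * (?b n)\<^sup>2"])
      show "(\<lambda>n. 2 * (?a n)\<^sup>2 + 2 * (?b n)\<^sup>2) \<longlonglongrightarrow> 0"
        using tendsto_add[OF tendsto_mult_left[OF tendsto_power[OF ab(1)], of 2 2] tendsto_mult_left[OF tendsto_power[OF ab(2)], of 2 2]] by simp
      show "\<forall>\<^sub>F n in sequentially. (n1 (\<lambda>x. s n t x - (u t x - v t x)))\<^sup>2 \<le> 2 * (?a n)\<^sup>2 + 2 * (?b n)\<^sup>2"
        unfolding e using H1_diff(2)[OF d] by simp
    qed auto
    then have "(\<lambda>n. sqrt ((n1 (\<lambda>x. s n t x - (u t x - v t x)))\<^sup>2)) \<longlonglongrightarrow> sqrt 0"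
      by (rule tendsto_real_sqrt)
    then have "(\<lambda>n. ennreal (n1 (\<lambda>x. s n t x - (u t x - v t x)))) \<longlonglongrightarrow> ennreal 0"
      by (intro tendsto_ennrealI) simp
    moreover have "H1 D (\<lambda>x. s n t x - (u t x - v t x)) = ennreal (n1 (\<lambda>x. s n t x - (u t x - v t x)))" for n
      unfolding e by (intro H1_eq H1_diff(1) d)
    ultimately show ?case by simp
  qed
  show "strongly_measurable T (H1 D) (\<lambda>t x. u t x - v t x)"
    unfolding strongly_measurable_def using s lim by blast
  have "(\<lambda>t. (n1 (\<lambda>x. u t x - v t x))\<^sup>2) \<in> borel_measurable (time T)"
  proof (rule borel_measurable_time_AE_limit)
    show "(\<lambda>t. (n1 (s n t))\<^sup>2) \<in> borel_measurable (time T)" for n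
      using s[of n] simple_function_compose[of "time T" "s n" "\<lambda>f. (n1 f)\<^sup>2"]
      by (auto simp: simple_in_def o_def intro!: borel_measurable_simple_function)
    show "AE t in time T. (\<lambda>n. (n1 (s n t))\<^sup>2) \<longlonglongrightarrow> (n1 (\<lambda>x. u t x - v t x))\<^sup>2"
      using lim T
    proof eventually_elim
      case (elim t)
      have "H1 D (s n t) < \<infinity>" for n using s[of n] elim by (simp add: simple_in_def)
      then show ?case by (rule H1_limit[OF _ H1_diff(1)[OF uv[OF elim(2)]] elim(1)])
    qed
  qed
  then have m: "(\<lambda>t. ennreal (sqrt ((n1 (\<lambda>x. u t x - v t x))\<^sup>2))) \<in> borel_measurable (time T)"
    by measurable
  show "(\<lambda>t. H1 D (\<lambda>x. u t x - v t x)) \<in> borel_measurable (time T)"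
  proof (subst measurable_cong)
    fix t assume "t \<in> space (time T)"
    then have "H1 D (\<lambda>x. u t x - v t x) < \<infinity>" using uv by (intro H1_diff(1)) auto
    then show "H1 D (\<lambda>x. u t x - v t x) = ennreal (sqrt ((n1 (\<lambda>x. u t x - v t x))\<^sup>2))"
      using H1_eq by simp
  qed (rule m)
qed

end

section \<open>The energy estimate\<close>

context embedding_region
begin

text \<open>The factor 4 comes from the upper comparison of K with the squared norm in
  \<open>strongly_measurable_kernel\<close>; K is the measurable kernel that enters the Gronwall
  inequality.\<close>

lemma L2T_N_bound:
  fixes u :: "real \<Rightarrow> 'a \<Rightarrow> real^3"
  assumes c: "L2T T (H1plus D \<alpha>) u \<le> ennreal c" "0 \<le> c"
  shows "strongly_measurable T (H1plus D \<alpha>) u"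
    and "\<exists>K\<in>borel_measurable (time T). (\<integral>\<^sup>+t. K t \<partial>time T) \<le> ennreal (4 * c\<^sup>2) \<and>
      (AE t in time T. H1plus D \<alpha> (u t) < \<infinity> \<and> ennreal ((N (u t))\<^sup>2) \<le> K t)"
proof -
  have "L2T T (H1plus D \<alpha>) u < top" using c(1) by (rule le_less_trans) simp
  then show sm: "strongly_measurable T (H1plus D \<alpha>) u" by (auto simp: L2T_def split: if_splits)
  then have "esqrt (\<integral>\<^sup>+t. (H1plus D \<alpha> (u t))\<^sup>2 \<partial>time T) \<le> ennreal c"
    using c(1) by (simp add: L2T_def)
  then have "(esqrt (\<integral>\<^sup>+t. (H1plus D \<alpha> (u t))\<^sup>2 \<partial>time T))\<^sup>2 \<le> (ennreal c)\<^sup>2"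
    by (rule power_mono) simp
  then have int: "(\<integral>\<^sup>+t. (H1plus D \<alpha> (u t))\<^sup>2 \<partial>time T) \<le> ennreal (c\<^sup>2)"
    using c(2) by (simp add: ennreal_power)
  obtain K where K: "K \<in> borel_measurable (time T)"
    and ae: "AE t in time T. H1plus D \<alpha> (u t) < \<infinity> \<and> ennreal ((N (u t))\<^sup>2) \<le> K t \<and> K t \<le> ennreal (4 * (N (u t))\<^sup>2)"
    using strongly_measurable_kernel[OF sm] by blast
  note [measurable] = K
  have "AE t in time T. ennreal (1/4) * K t \<le> (H1plus D \<alpha> (u t))\<^sup>2"
    using ae
  proof eventually_elim
    case (elim t)
    then have "ennreal (1/4) * K t \<le> ennreal (1/4) * ennreal (4 * (N (u t))\<^sup>2)"
      by (intro mult_left_mono) auto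
    also have "\<dots> = ennreal ((1/4) * (4 * (N (u t))\<^sup>2))" by (rule ennreal_mult[symmetric]) auto
    also have "\<dots> = (H1plus D \<alpha> (u t))\<^sup>2" using elim H1plus_eq[of "u t"] by (simp add: ennreal_power)
    finally show ?case .
  qed
  then have "ennreal (1/4) * (\<integral>\<^sup>+t. K t \<partial>time T) \<le> (\<integral>\<^sup>+t. (H1plus D \<alpha> (u t))\<^sup>2 \<partial>time T)"
    by (subst nn_integral_cmult[symmetric]) (auto intro!: nn_integral_mono_AE)
  also note int
  finally have "ennreal 4 * (ennreal (1/4) * (\<integral>\<^sup>+t. K t \<partial>time T)) \<le> ennreal 4 * ennreal (c\<^sup>2)"
    by (rule mult_left_mono) simp
  moreover have "ennreal 4 * (ennreal (1/4) * X) = X" for X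
    by (subst mult.assoc[symmetric], subst ennreal_mult[symmetric]) auto
  moreover have "ennreal 4 * ennreal (c\<^sup>2) = ennreal (4 * c\<^sup>2)"
    by (rule ennreal_mult[symmetric]) auto
  ultimately have "(\<integral>\<^sup>+t. K t \<partial>time T) \<le> ennreal (4 * c\<^sup>2)" by simp
  then show "\<exists>K\<in>borel_measurable (time T). (\<integral>\<^sup>+t. K t \<partial>time T) \<le> ennreal (4 * c\<^sup>2) \<and>
      (AE t in time T. H1plus D \<alpha> (u t) < \<infinity> \<and> ennreal ((N (u t))\<^sup>2) \<le> K t)"
    using K ae by (intro bexI[of _ K]) (auto elim!: eventually_mono)
qed

lemma LinfT_bound:
  assumes "LinfT T (H1 D) u < \<infinity>"
  shows "strongly_measurable T (H1 D) u" "\<exists>L\<ge>0. AE t in time T. n1 (u t) \<le> L"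
proof -
  show "strongly_measurable T (H1 D) u" using assms by (auto simp: LinfT_def split: if_splits)
  then have fin: "esssup (time T) (\<lambda>t. H1 D (u t)) < top" using assms by (simp add: LinfT_def)
  have "AE t in time T. n1 (u t) \<le> enn2real (esssup (time T) (\<lambda>t. H1 D (u t)))"
    using esssup_AE[of "\<lambda>t. H1 D (u t)" "time T"]
    by eventually_elim (use fin in \<open>auto simp: n1_def intro!: enn2real_mono\<close>)
  then show "\<exists>L\<ge>0. AE t in time T. n1 (u t) \<le> L" by (intro exI conjI) auto
qed

lemma emeasure_time: "0 \<le> T \<Longrightarrow> emeasure (time T) (space (time T)) = ennreal T"
  by (simp add: emeasure_restrict_space)

text \<open>\<Phi> is controlled only through differences, so a reference function is taken from u
  itself. Relative to it \<Phi> grows at most like a constant plus a multiple of K, which is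
  integrable.\<close>

lemma form_integrable:
  fixes u :: "real \<Rightarrow> 'a \<Rightarrow> real^3"
  assumes t: "0 < t" "t < T"
    and sm: "strongly_measurable T (H1plus D \<alpha>) u"
    and K: "K \<in> borel_measurable (time T)" "(\<integral>\<^sup>+t. K t \<partial>time T) < \<infinity>"
    and KN: "AE t in time T. H1plus D \<alpha> (u t) < \<infinity> \<and> ennreal ((N (u t))\<^sup>2) \<le> K t"
    and L: "AE t in time T. n1 (u t) \<le> L"
    and C: "0 \<le> C" "\<And>f g. H1plus D \<alpha> f < \<infinity> \<Longrightarrow> H1plus D \<alpha> g < \<infinity> \<Longrightarrow>
      \<bar>\<Phi> f - \<Phi> g\<bar> \<le> C * (1 + (N f)\<^sup>2 + (N g)\<^sup>2) * n1 (\<lambda>x. f x - g x)"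
  shows "integrable (time t) (\<lambda>s. \<Phi> (u s))"
proof -
  have sub: "{0<..<t} \<subseteq> {0<..<T}" using t by auto
  have [measurable]: "K \<in> borel_measurable (time t)" by (rule measurable_restrict_mono[OF K(1) sub])
  have [measurable]: "(\<lambda>s. \<Phi> (u s)) \<in> borel_measurable (time t)"
    by (rule measurable_restrict_mono[OF strongly_measurable_form[OF sm C] sub])
  \<comment> \<open>The interval has positive length, so a property that holds almost everywhere on
    it holds somewhere; this supplies the reference function.\<close>
  have "\<not> (AE s in time t. False)"
  proof
    assume "AE s in time t. False"
    then have "emeasure (time t) (space (time t)) = 0"
      unfolding eventually_False ae_filter_eq_bot_iff .
    then show False using emeasure_time[of t] t by simp
  qed
  moreover have "AE s in time t. False" if none: "\<And>s. \<not> H1plus D \<alpha> (u s) < \<infinity>"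
    using AE_time_mono[OF less_imp_le[OF t(2)] KN] by eventually_elim (use none in blast)
  ultimately obtain s0 where f0: "H1plus D \<alpha> (u s0) < \<infinity>" by blast
  define f0' where "f0' = u s0"
  \<comment> \<open>A bound for the H1 distance from u s to the reference function; the maximum with
    0 permits squaring without knowing the sign of L.\<close>
  define m where "m = sqrt (2 * (max L 0)\<^sup>2 + 2 * (n1 f0')\<^sup>2)"
  define a where "a = \<bar>\<Phi> f0'\<bar> + C * (1 + (N f0')\<^sup>2) * m"
  have m0: "0 \<le> m" by (simp add: m_def)
  have a0: "0 \<le> a" using C(1) m0 by (simp add: a_def)
  have "AE s in time t. ennreal \<bar>\<Phi> (u s)\<bar> \<le> ennreal a + ennreal (C * m) * K s"
    using AE_time_mono[OF less_imp_le[OF t(2)] KN] AE_time_mono[OF less_imp_le[OF t(2)] L]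
  proof eventually_elim
    case (elim s)
    then have n: "n1 (u s) \<le> L" and s: "H1plus D \<alpha> (u s) < \<infinity> \<and> ennreal ((N (u s))\<^sup>2) \<le> K s" by auto
    have fin: "H1plus D \<alpha> (u s) < \<infinity>" "H1plus D \<alpha> f0' < \<infinity>" using s f0 by (auto simp: f0'_def)
    have "(n1 (\<lambda>x. u s x - f0' x))\<^sup>2 \<le> 2 * (n1 (u s))\<^sup>2 + 2 * (n1 f0')\<^sup>2"
      using H1_diff(2)[OF fin[THEN H1plus_power2(1)]] .
    also have "\<dots> \<le> 2 * (max L 0)\<^sup>2 + 2 * (n1 f0')\<^sup>2"
      using n by (intro add_mono mult_left_mono power_mono) auto
    finally have d: "n1 (\<lambda>x. u s x - f0' x) \<le> m" unfolding m_def by (rule real_le_rsqrt)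
    have "\<bar>\<Phi> (u s) - \<Phi> f0'\<bar> \<le> C * (1 + (N (u s))\<^sup>2 + (N f0')\<^sup>2) * n1 (\<lambda>x. u s x - f0' x)"
      by (rule C(2)[OF fin])
    also have "\<dots> \<le> C * (1 + (N (u s))\<^sup>2 + (N f0')\<^sup>2) * m"
      using C(1) d by (intro mult_left_mono) auto
    finally have "\<bar>\<Phi> (u s)\<bar> \<le> a + (C * m) * (N (u s))\<^sup>2"
      unfolding a_def by (simp add: algebra_simps)
    then have "ennreal \<bar>\<Phi> (u s)\<bar> \<le> ennreal (a + (C * m) * (N (u s))\<^sup>2)" by (rule ennreal_leI)
    also have "\<dots> = ennreal a + ennreal (C * m) * ennreal ((N (u s))\<^sup>2)"
      using a0 C(1) m0 by (simp add: ennreal_mult)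
    also have "\<dots> \<le> ennreal a + ennreal (C * m) * K s"
      using s by (intro add_left_mono mult_left_mono) auto
    finally show ?case .
  qed
  then have "(\<integral>\<^sup>+s. ennreal \<bar>\<Phi> (u s)\<bar> \<partial>time t) \<le> (\<integral>\<^sup>+s. ennreal a + ennreal (C * m) * K s \<partial>time t)"
    by (rule nn_integral_mono_AE)
  also have "\<dots> = ennreal a * ennreal t + ennreal (C * m) * (\<integral>\<^sup>+s. K s \<partial>time t)"
    using emeasure_time[of t] t by (simp add: nn_integral_add nn_integral_cmult)
  also have "\<dots> < \<infinity>"
    using le_less_trans[OF nn_integral_time_mono K(2), of t] t by (simp add: ennreal_mult_less_top)
  finally show ?thesis by (intro integrableI_bounded) auto
qed

text \<open>p stands for the norm of the fixed test function. J is a finite number here; the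
  infinite case is trivial and is separated in \<open>energy_estimate\<close>.\<close>

lemma form_integral_difference:
  fixes u v :: "real \<Rightarrow> 'a \<Rightarrow> real^3"
  assumes t: "0 < t" "t < T"
    and Ku: "AE t in time T. H1plus D \<alpha> (u t) < \<infinity> \<and> ennreal ((N (u t))\<^sup>2) \<le> Ku t"
    and Kv: "AE t in time T. H1plus D \<alpha> (v t) < \<infinity> \<and> ennreal ((N (v t))\<^sup>2) \<le> Kv t"
    and K: "Ku \<in> borel_measurable (time T)" "Kv \<in> borel_measurable (time T)"
    and int: "integrable (time t) (\<lambda>s. \<Phi> (u s))" "integrable (time t) (\<lambda>s. \<Phi> (v s))"
    and C: "0 \<le> C" "0 \<le> p" "\<And>f g. H1plus D \<alpha> f < \<infinity> \<Longrightarrow> H1plus D \<alpha> g < \<infinity> \<Longrightarrow>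
      \<bar>\<Phi> f - \<Phi> g\<bar> \<le> C * (1 + (N f)\<^sup>2 + (N g)\<^sup>2) * n1 (\<lambda>x. f x - g x) * p"
    and n: "(\<lambda>s. ennreal (n1 (\<lambda>x. u s x - v s x))) \<in> borel_measurable (time T)"
    and J: "(\<integral>\<^sup>+s. (1 + Ku s + Kv s) * ennreal (n1 (\<lambda>x. u s x - v s x)) \<partial>time t) = ennreal J" "0 \<le> J"
  shows "\<bar>(\<integral>s. \<Phi> (u s) \<partial>time t) - (\<integral>s. \<Phi> (v s) \<partial>time t)\<bar> \<le> C * p * J"
proof -
  have "ennreal \<bar>(\<integral>s. \<Phi> (u s) \<partial>time t) - (\<integral>s. \<Phi> (v s) \<partial>time t)\<bar> = ennreal (norm (\<integral>s. \<Phi> (u s) - \<Phi> (v s) \<partial>time t))"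
    using int by simp
  also have "\<dots> \<le> (\<integral>\<^sup>+s. ennreal (norm (\<Phi> (u s) - \<Phi> (v s))) \<partial>time t)"
    using int by (intro integral_norm_bound_ennreal) auto
  also have "\<dots> \<le> (\<integral>\<^sup>+s. ennreal (C * p) * ((1 + Ku s + Kv s) * ennreal (n1 (\<lambda>x. u s x - v s x))) \<partial>time t)"
  proof (rule nn_integral_mono_AE)
    show "AE s in time t. ennreal (norm (\<Phi> (u s) - \<Phi> (v s)))
        \<le> ennreal (C * p) * ((1 + Ku s + Kv s) * ennreal (n1 (\<lambda>x. u s x - v s x)))"
    using AE_time_mono[OF less_imp_le[OF t(2)] Ku] AE_time_mono[OF less_imp_le[OF t(2)] Kv]
  proof eventually_elim
    case (elim s)
    then have u: "H1plus D \<alpha> (u s) < \<infinity> \<and> ennreal ((N (u s))\<^sup>2) \<le> Ku s"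
      and v: "H1plus D \<alpha> (v s) < \<infinity> \<and> ennreal ((N (v s))\<^sup>2) \<le> Kv s" by auto
    let ?n = "n1 (\<lambda>x. u s x - v s x)"
    have "\<bar>\<Phi> (u s) - \<Phi> (v s)\<bar> \<le> C * (1 + (N (u s))\<^sup>2 + (N (v s))\<^sup>2) * ?n * p"
      using u v by (intro C(3)) auto
    also have "\<dots> = (C * p) * ((1 + (N (u s))\<^sup>2 + (N (v s))\<^sup>2) * ?n)" by simp
    finally have "ennreal \<bar>\<Phi> (u s) - \<Phi> (v s)\<bar> \<le> ennreal ((C * p) * ((1 + (N (u s))\<^sup>2 + (N (v s))\<^sup>2) * ?n))"
      by (rule ennreal_leI)
    also have "\<dots> = ennreal (C * p) * ((1 + ennreal ((N (u s))\<^sup>2) + ennreal ((N (v s))\<^sup>2)) * ennreal ?n)"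
      using C(1,2) by (simp add: ennreal_mult add_nonneg_nonneg)
    also have "\<dots> \<le> ennreal (C * p) * ((1 + Ku s + Kv s) * ennreal ?n)"
      using u v by (intro mult_left_mono mult_right_mono add_mono) auto
    finally show ?case by simp
  qed
  qed
  also have "\<dots> = ennreal (C * p) * ennreal J"
    unfolding J(1)[symmetric]
  proof (rule nn_integral_cmult)
    have sub: "{0<..<t} \<subseteq> {0<..<T}" using t by auto
    note [measurable] = measurable_restrict_mono[OF K(1) sub] measurable_restrict_mono[OF K(2) sub]
      measurable_restrict_mono[OF n sub]
    show "(\<lambda>s. (1 + Ku s + Kv s) * ennreal (n1 (\<lambda>x. u s x - v s x))) \<in> borel_measurable (time t)"
      by measurable
  qed
  finally have "ennreal \<bar>(\<integral>s. \<Phi> (u s) \<partial>time t) - (\<integral>s. \<Phi> (v s) \<partial>time t)\<bar> \<le> ennreal (C * p * J)"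
    using C(1,2) J(2) by (simp add: ennreal_mult)
  then show ?thesis using C(1,2) J(2) by (subst (asm) ennreal_le_iff) auto
qed

end

section \<open>The stability estimate for weak solutions\<close>

context embedding_region
begin

text \<open>G is fixed before the solutions and sees them only through the bound c, as the order of
  quantifiers in the theorem requires.\<close>

lemma energy_estimate:
  fixes \<kappa>\<^sub>1 \<kappa>\<^sub>2 \<mu> \<gamma> \<epsilon> T c :: real
  assumes \<mu>: "0 \<le> \<mu>" and \<epsilon>: "0 < \<epsilon>" and T: "0 < T" and c: "0 \<le> c"
  shows "\<exists>G\<ge>0. \<forall>u0 v0 u v. H1 D u0 < \<infinity> \<longrightarrow> H1 D v0 < \<infinity> \<longrightarrow>
    weak_solution D \<alpha> \<kappa>\<^sub>1 \<kappa>\<^sub>2 \<mu> \<gamma> \<epsilon> T u0 u \<longrightarrow> weak_solution D \<alpha> \<kappa>\<^sub>1 \<kappa>\<^sub>2 \<mu> \<gamma> \<epsilon> T v0 v \<longrightarrow>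
    LinfT T (H1 D) u < \<infinity> \<longrightarrow> LinfT T (H1 D) v < \<infinity> \<longrightarrow>
    L2T T (H1plus D \<alpha>) u \<le> ennreal c \<longrightarrow> L2T T (H1plus D \<alpha>) v \<le> ennreal c \<longrightarrow>
    (\<forall>t\<in>{0<..<T}. n1 (\<lambda>x. u t x - v t x) \<le> G * n1 (\<lambda>x. u0 x - v0 x))"
proof -
  let ?\<Phi>1 = "inner_grad D :: ('a \<Rightarrow> real^3) \<Rightarrow> _ \<Rightarrow> real"
  let ?\<Phi>2 = "\<lambda>f. inner_cross_grad D f f"
  let ?\<Phi>3 = "\<lambda>f. inner_L2 D (\<lambda>x. (1 + \<mu> * (norm (f x))\<^sup>2) *\<^sub>R f x) :: ('a \<Rightarrow> real^3) \<Rightarrow> real"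
  obtain C1 where C1: "0 \<le> C1" "\<And>\<phi> f g. H1 D \<phi> < \<infinity> \<Longrightarrow> H1plus D \<alpha> f < \<infinity> \<Longrightarrow> H1plus D \<alpha> g < \<infinity> \<Longrightarrow>
      \<bar>?\<Phi>1 f \<phi> - ?\<Phi>1 g \<phi>\<bar> \<le> C1 * (1 + (N f)\<^sup>2 + (N g)\<^sup>2) * n1 (\<lambda>x. f x - g x) * n1 \<phi>"
    using lipschitz_inner_grad unfolding lipschitz_form_def by blast
  obtain C2 where C2: "0 \<le> C2" "\<And>\<phi> f g. H1 D \<phi> < \<infinity> \<Longrightarrow> H1plus D \<alpha> f < \<infinity> \<Longrightarrow> H1plus D \<alpha> g < \<infinity> \<Longrightarrow>
      \<bar>?\<Phi>2 f \<phi> - ?\<Phi>2 g \<phi>\<bar> \<le> C2 * (1 + (N f)\<^sup>2 + (N g)\<^sup>2) * n1 (\<lambda>x. f x - g x) * n1 \<phi>"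
    using lipschitz_inner_cross_grad unfolding lipschitz_form_def by blast
  obtain C3 where C3: "0 \<le> C3" "\<And>\<phi> f g. H1 D \<phi> < \<infinity> \<Longrightarrow> H1plus D \<alpha> f < \<infinity> \<Longrightarrow> H1plus D \<alpha> g < \<infinity> \<Longrightarrow>
      \<bar>?\<Phi>3 f \<phi> - ?\<Phi>3 g \<phi>\<bar> \<le> C3 * (1 + (N f)\<^sup>2 + (N g)\<^sup>2) * n1 (\<lambda>x. f x - g x) * n1 \<phi>"
    using lipschitz_cubic[OF \<mu>] unfolding lipschitz_form_def by blast
  \<comment> \<open>Absolute values because \<gamma> may have either sign; the summand 1 makes
    \<theta> positive.\<close>
  define \<theta> where "\<theta> = \<bar>\<kappa>\<^sub>1\<bar> * C1 + \<bar>\<gamma>\<bar> * C2 + \<bar>\<kappa>\<^sub>2\<bar> * C3 + 1"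
  have \<theta>: "\<theta> > 0" using C1(1) C2(1) C3(1) by (simp add: \<theta>_def add_nonneg_pos)
  \<comment> \<open>Coercivity constant: the quadratic form on the left of the energy identity is at
    least m times the squared H1 norm.\<close>
  define m where "m = min 1 \<epsilon>"
  have m: "0 < m" "m \<le> 1" "m \<le> \<epsilon>" using \<epsilon> by (auto simp: m_def)
  \<comment> \<open>The initial difference enters with 1 for its L2 part and \<epsilon> for each of
    the d partial derivatives.\<close>
  define a where "a = (1 + \<epsilon> * real DIM('a)) / m"
  have a: "0 \<le> a" using m \<epsilon> by (simp add: a_def)
  \<comment> \<open>Bound for the integral of the kernel
    \<open>\<theta> / m * (1 + Ku s + Kv s)\<close> over (0, T): T from the constant 1, and
    \<open>4 * c\<^sup>2\<close> from each of the two solutions.\<close>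
  define B where "B = \<theta> / m * (T + 4 * c\<^sup>2 + 4 * c\<^sup>2)"
  have B: "0 \<le> B" using \<theta> m T by (simp add: B_def)
  have main: "n1 (\<lambda>x. u t x - v t x) \<le> a * gronwall_factor B (nat \<lceil>2 * B\<rceil>) * n1 (\<lambda>x. u0 x - v0 x)"
    if u0: "H1 D u0 < \<infinity>" and v0: "H1 D v0 < \<infinity>"
      and wu: "weak_solution D \<alpha> \<kappa>\<^sub>1 \<kappa>\<^sub>2 \<mu> \<gamma> \<epsilon> T u0 u" and wv: "weak_solution D \<alpha> \<kappa>\<^sub>1 \<kappa>\<^sub>2 \<mu> \<gamma> \<epsilon> T v0 v"
      and Lu: "LinfT T (H1 D) u < \<infinity>" and Lv: "LinfT T (H1 D) v < \<infinity>"
      and cu: "L2T T (H1plus D \<alpha>) u \<le> ennreal c" and cv: "L2T T (H1plus D \<alpha>) v \<le> ennreal c"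
      and t0: "t \<in> {0<..<T}"
    for u0 v0 u v t
  proof -
    define w where "w t x = u t x - v t x" for t x
    define w0 where "w0 x = u0 x - v0 x" for x
    define y where "y t = n1 (w t)" for t
    have y0: "0 \<le> y t" for t by (simp add: y_def)
    have uH: "H1 D (u t) < \<infinity>" and vH: "H1 D (v t) < \<infinity>" if "t \<in> {0<..<T}" for t
      using wu wv that unfolding weak_solution_def by blast+
    have wH: "H1 D (w t) < \<infinity>" if "t \<in> {0<..<T}" for t
      unfolding w_def by (rule H1_diff(1)[OF uH[OF that] vH[OF that]])
    have w0H: "H1 D w0 < \<infinity>" unfolding w0_def by (rule H1_diff(1)[OF u0 v0])
    obtain Ku where Ku: "Ku \<in> borel_measurable (time T)" "(\<integral>\<^sup>+t. Ku t \<partial>time T) \<le> ennreal (4 * c\<^sup>2)"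
      "AE t in time T. H1plus D \<alpha> (u t) < \<infinity> \<and> ennreal ((N (u t))\<^sup>2) \<le> Ku t"
      using L2T_N_bound(2)[OF cu c] by blast
    obtain Kv where Kv: "Kv \<in> borel_measurable (time T)" "(\<integral>\<^sup>+t. Kv t \<partial>time T) \<le> ennreal (4 * c\<^sup>2)"
      "AE t in time T. H1plus D \<alpha> (v t) < \<infinity> \<and> ennreal ((N (v t))\<^sup>2) \<le> Kv t"
      using L2T_N_bound(2)[OF cv c] by blast
    have Kfin: "(\<integral>\<^sup>+t. Ku t \<partial>time T) < \<infinity>" "(\<integral>\<^sup>+t. Kv t \<partial>time T) < \<infinity>"
      using Ku(2) Kv(2) by (auto intro: le_less_trans)
    obtain l where l: "AE t in time T. n1 (u t) \<le> l" using LinfT_bound(2)[OF Lu] by blast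
    obtain l' where l': "AE t in time T. n1 (v t) \<le> l'" using LinfT_bound(2)[OF Lv] by blast
    have ym: "(\<lambda>s. ennreal (y s)) \<in> borel_measurable (time T)"
    proof (subst measurable_cong)
      show "(\<lambda>s. H1 D (\<lambda>x. u s x - v s x)) \<in> borel_measurable (time T)"
        by (rule strongly_measurable_diff(2)[OF LinfT_bound(1)[OF Lu] LinfT_bound(1)[OF Lv] uH vH])
      fix s assume "s \<in> space (time T)"
      then have "H1 D (w s) < \<infinity>" by (intro wH) simp
      from H1_eq[OF this, symmetric] show "ennreal (y s) = H1 D (\<lambda>x. u s x - v s x)"
        unfolding y_def w_def[abs_def] .
    qed
    define K where "K s = ennreal (\<theta> / m) * (1 + Ku s + Kv s)" for s
    have Km: "K \<in> borel_measurable (time T)" unfolding K_def using Ku(1) Kv(1) by measurable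
    have KB: "(\<integral>\<^sup>+s. K s \<partial>time T) \<le> ennreal B"
    proof -
      note [measurable] = Ku(1) Kv(1)
      have "(\<integral>\<^sup>+s. K s \<partial>time T) = ennreal (\<theta> / m) * (ennreal T + (\<integral>\<^sup>+s. Ku s \<partial>time T) + (\<integral>\<^sup>+s. Kv s \<partial>time T))"
        unfolding K_def using emeasure_time[of T] T by (simp add: nn_integral_cmult nn_integral_add)
      also have "\<dots> \<le> ennreal (\<theta> / m) * (ennreal T + ennreal (4 * c\<^sup>2) + ennreal (4 * c\<^sup>2))"
        by (intro mult_left_mono add_mono Ku(2) Kv(2)) auto
      also have "ennreal T + ennreal (4 * c\<^sup>2) + ennreal (4 * c\<^sup>2) = ennreal (T + 4 * c\<^sup>2 + 4 * c\<^sup>2)"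
      proof -
        have "ennreal p + ennreal q + ennreal q = ennreal (p + q + q)" if "0 \<le> p" "0 \<le> q" for p q
          using that by (simp add: ennreal_plus[symmetric] del: ennreal_plus)
        then show ?thesis using T by (meson less_imp_le mult_nonneg_nonneg zero_le_numeral zero_le_power2)
      qed
      also have "ennreal (\<theta> / m) * ennreal (T + 4 * c\<^sup>2 + 4 * c\<^sup>2) = ennreal B" unfolding B_def using \<theta> m T by (intro ennreal_mult[symmetric]) auto
      finally show ?thesis .
    qed
    have ybdd: "AE s in time T. y s \<le> sqrt (2 * l\<^sup>2 + 2 * l'\<^sup>2)"
    proof -
      have "AE s in time T. s \<in> {0<..<T}" using AE_space[of "time T"] by simp
      with l l' show ?thesis
      proof eventually_elim
        case (elim s)
        have "(y s)\<^sup>2 \<le> 2 * (n1 (u s))\<^sup>2 + 2 * (n1 (v s))\<^sup>2"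
          unfolding y_def w_def by (rule H1_diff(2)[OF uH[OF elim(3)] vH[OF elim(3)]])
        also have "\<dots> \<le> 2 * l\<^sup>2 + 2 * l'\<^sup>2"
          using elim by (intro add_mono mult_left_mono power_mono) auto
        finally show ?case by (rule real_le_rsqrt)
      qed
    qed
    have step: "ennreal (y t) \<le> ennreal (a * n1 w0) + (\<integral>\<^sup>+s. K s * ennreal (y s) \<partial>time t)" if t: "0 < t" "t < T" for t
    proof -
      have tT: "t \<in> {0<..<T}" using t by simp
      have sub: "{0<..<t} \<subseteq> {0<..<T}" using t by auto
      define J where "J = (\<integral>\<^sup>+s. (1 + Ku s + Kv s) * ennreal (y s) \<partial>time t)"
      have KJ: "(\<integral>\<^sup>+s. K s * ennreal (y s) \<partial>time t) = ennreal (\<theta> / m) * J"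
      proof -
        note [measurable] = measurable_restrict_mono[OF Ku(1) sub] measurable_restrict_mono[OF Kv(1) sub]
          measurable_restrict_mono[OF ym sub]
        show ?thesis unfolding J_def K_def mult.assoc by (rule nn_integral_cmult) measurable
      qed
      show ?thesis
      \<comment> \<open>An infinite J makes the right side infinite, because \<theta> / m is
        positive.\<close>
      proof (cases "J = \<infinity>")
        case True
        then show ?thesis unfolding KJ using \<theta> m by (simp add: ennreal_mult_top)
      next
        case False
        then obtain j where j: "J = ennreal j" "0 \<le> j" by (cases J) auto
        let ?w = "w t"
        note wt = wH[OF tT]
        have p0: "0 \<le> n1 ?w" by simp
        have integrals: "integrable (time t) (\<lambda>s. \<Phi> (u s) ?w)" "integrable (time t) (\<lambda>s. \<Phi> (v s) ?w)"
          "\<bar>(\<integral>s. \<Phi> (u s) ?w \<partial>time t) - (\<integral>s. \<Phi> (v s) ?w \<partial>time t)\<bar> \<le> C * n1 ?w * j"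
          if C: "0 \<le> C" "\<And>\<phi> f g. H1 D \<phi> < \<infinity> \<Longrightarrow> H1plus D \<alpha> f < \<infinity> \<Longrightarrow> H1plus D \<alpha> g < \<infinity> \<Longrightarrow>
            \<bar>\<Phi> f \<phi> - \<Phi> g \<phi>\<bar> \<le> C * (1 + (N f)\<^sup>2 + (N g)\<^sup>2) * n1 (\<lambda>x. f x - g x) * n1 \<phi>"
          for C and \<Phi> :: "('a \<Rightarrow> real^3) \<Rightarrow> ('a \<Rightarrow> real^3) \<Rightarrow> real"
        proof -
          have C': "\<bar>\<Phi> f ?w - \<Phi> g ?w\<bar> \<le> (C * n1 ?w) * (1 + (N f)\<^sup>2 + (N g)\<^sup>2) * n1 (\<lambda>x. f x - g x)"
            if "H1plus D \<alpha> f < \<infinity>" "H1plus D \<alpha> g < \<infinity>" for f g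
            using C(2)[OF wt that] by (simp add: mult_ac)
          have Cp: "0 \<le> C * n1 ?w" using C(1) by simp
          show i1: "integrable (time t) (\<lambda>s. \<Phi> (u s) ?w)"
            by (rule form_integrable[OF t L2T_N_bound(1)[OF cu c] Ku(1) Kfin(1) Ku(3) l Cp C'])
          show i2: "integrable (time t) (\<lambda>s. \<Phi> (v s) ?w)"
            by (rule form_integrable[OF t L2T_N_bound(1)[OF cv c] Kv(1) Kfin(2) Kv(3) l' Cp C'])
          show "\<bar>(\<integral>s. \<Phi> (u s) ?w \<partial>time t) - (\<integral>s. \<Phi> (v s) ?w \<partial>time t)\<bar> \<le> C * n1 ?w * j"
            by (rule form_integral_difference[OF t Ku(3) Kv(3) Ku(1) Kv(1) i1 i2 C(1) p0 C(2)[OF wt]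
                  ym[unfolded y_def w_def[abs_def]] j[unfolded J_def y_def w_def[abs_def]]])
        qed
        define d1 where "d1 = (\<integral>s. ?\<Phi>1 (u s) ?w \<partial>time t) - (\<integral>s. ?\<Phi>1 (v s) ?w \<partial>time t)"
        define d2 where "d2 = (\<integral>s. ?\<Phi>2 (u s) ?w \<partial>time t) - (\<integral>s. ?\<Phi>2 (v s) ?w \<partial>time t)"
        define d3 where "d3 = (\<integral>s. ?\<Phi>3 (u s) ?w \<partial>time t) - (\<integral>s. ?\<Phi>3 (v s) ?w \<partial>time t)"
        have d: "\<bar>d1\<bar> \<le> C1 * n1 ?w * j" "\<bar>d2\<bar> \<le> C2 * n1 ?w * j" "\<bar>d3\<bar> \<le> C3 * n1 ?w * j"
          unfolding d1_def d2_def d3_def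
          using integrals(3)[of C1 ?\<Phi>1, OF C1] integrals(3)[of C2 ?\<Phi>2, OF C2] integrals(3)[of C3 ?\<Phi>3, OF C3] by blast+
        have Eu: "inner_L2 D (u t) ?w + \<epsilon> * inner_grad D (u t) ?w + \<kappa>\<^sub>1 * (\<integral>s. ?\<Phi>1 (u s) ?w \<partial>time t)
            + \<gamma> * (\<integral>s. ?\<Phi>2 (u s) ?w \<partial>time t) + \<kappa>\<^sub>2 * (\<integral>s. ?\<Phi>3 (u s) ?w \<partial>time t)
            = inner_L2 D u0 ?w + \<epsilon> * inner_grad D u0 ?w"
          using wu tT wt unfolding weak_solution_def by blast
        have Ev: "inner_L2 D (v t) ?w + \<epsilon> * inner_grad D (v t) ?w + \<kappa>\<^sub>1 * (\<integral>s. ?\<Phi>1 (v s) ?w \<partial>time t)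
            + \<gamma> * (\<integral>s. ?\<Phi>2 (v s) ?w \<partial>time t) + \<kappa>\<^sub>2 * (\<integral>s. ?\<Phi>3 (v s) ?w \<partial>time t)
            = inner_L2 D v0 ?w + \<epsilon> * inner_grad D v0 ?w"
          using wv tT wt unfolding weak_solution_def by blast
        have wd: "inner_L2 D ?w ?w = inner_L2 D (u t) ?w - inner_L2 D (v t) ?w"
          "inner_grad D ?w ?w = inner_grad D (u t) ?w - inner_grad D (v t) ?w"
          using inner_diff_H1[OF uH[OF tT] vH[OF tT] wt] by (simp_all add: w_def[abs_def])
        have w0d: "inner_L2 D w0 ?w = inner_L2 D u0 ?w - inner_L2 D v0 ?w"
          "inner_grad D w0 ?w = inner_grad D u0 ?w - inner_grad D v0 ?w"
          using inner_diff_H1[OF u0 v0 wt] by (simp_all add: w0_def[abs_def])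
        have E: "inner_L2 D ?w ?w + \<epsilon> * inner_grad D ?w ?w
            = inner_L2 D w0 ?w + \<epsilon> * inner_grad D w0 ?w - \<kappa>\<^sub>1 * d1 - \<gamma> * d2 - \<kappa>\<^sub>2 * d3"
          unfolding wd w0d d1_def d2_def d3_def right_diff_distrib using Eu Ev by linarith
        have pos: "0 \<le> inner_L2 D h h" for h :: "'a \<Rightarrow> real^3"
          unfolding inner_L2_def by (rule Bochner_Integration.integral_nonneg) simp
        have gpos: "0 \<le> inner_grad D ?w ?w" unfolding inner_grad_def by (intro sum_nonneg pos)
        have "m * (y t)\<^sup>2 = m * inner_L2 D ?w ?w + m * inner_grad D ?w ?w"
          unfolding y_def n1_power2[OF wt] by (simp add: distrib_left)
        also have "\<dots> \<le> 1 * inner_L2 D ?w ?w + \<epsilon> * inner_grad D ?w ?w"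
          using m pos gpos by (intro add_mono mult_right_mono) auto
        also have "\<dots> \<le> \<bar>inner_L2 D w0 ?w\<bar> + \<epsilon> * \<bar>inner_grad D w0 ?w\<bar> + \<bar>\<kappa>\<^sub>1\<bar> * \<bar>d1\<bar> + \<bar>\<gamma>\<bar> * \<bar>d2\<bar> + \<bar>\<kappa>\<^sub>2\<bar> * \<bar>d3\<bar>"
        proof -
          have "- (\<kappa>\<^sub>1 * d1) \<le> \<bar>\<kappa>\<^sub>1\<bar> * \<bar>d1\<bar>" "- (\<gamma> * d2) \<le> \<bar>\<gamma>\<bar> * \<bar>d2\<bar>" "- (\<kappa>\<^sub>2 * d3) \<le> \<bar>\<kappa>\<^sub>2\<bar> * \<bar>d3\<bar>"
            by (metis abs_ge_minus_self abs_mult)+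
          moreover have "\<epsilon> * inner_grad D w0 ?w \<le> \<epsilon> * \<bar>inner_grad D w0 ?w\<bar>" using \<epsilon> by (intro mult_left_mono) auto
          ultimately show ?thesis using E abs_ge_self[of "inner_L2 D w0 ?w"] by linarith
        qed
        also have "\<dots> \<le> n1 w0 * y t + \<epsilon> * (real DIM('a) * (n1 w0 * y t))
            + \<bar>\<kappa>\<^sub>1\<bar> * (C1 * y t * j) + \<bar>\<gamma>\<bar> * (C2 * y t * j) + \<bar>\<kappa>\<^sub>2\<bar> * (C3 * y t * j)"
          using d inner_L2_H1(2)[OF w0H wt] inner_grad_bound[OF w0H wt] \<epsilon> unfolding y_def
          by (intro add_mono mult_left_mono) auto
        also have "\<dots> = y t * ((1 + \<epsilon> * real DIM('a)) * n1 w0 + (\<theta> - 1) * j)"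
          by (simp add: \<theta>_def algebra_simps)
        also have "\<dots> \<le> y t * ((1 + \<epsilon> * real DIM('a)) * n1 w0 + \<theta> * j)"
          using y0 j(2) by (intro mult_left_mono add_left_mono mult_right_mono) auto
        finally have sq: "m * (y t)\<^sup>2 \<le> y t * ((1 + \<epsilon> * real DIM('a)) * n1 w0 + \<theta> * j)" .
        have "y t \<le> a * n1 w0 + \<theta> / m * j"
        proof (cases "y t = 0")
          case True
          then show ?thesis using a \<theta> m j by simp
        next
          case False
          then have "0 < y t" using y0[of t] by linarith
          moreover have "y t * (m * y t) \<le> y t * ((1 + \<epsilon> * real DIM('a)) * n1 w0 + \<theta> * j)"
            using sq by (simp add: power2_eq_square mult_ac)
          ultimately have "m * y t \<le> (1 + \<epsilon> * real DIM('a)) * n1 w0 + \<theta> * j"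
            by (rule mult_left_le_imp_le[rotated])
          then have "y t \<le> ((1 + \<epsilon> * real DIM('a)) * n1 w0 + \<theta> * j) / m"
            using m by (simp add: pos_le_divide_eq mult.commute)
          also have "\<dots> = a * n1 w0 + \<theta> / m * j" using m by (simp add: a_def field_simps)
          finally show ?thesis .
        qed
        then have "ennreal (y t) \<le> ennreal (a * n1 w0 + \<theta> / m * j)" by (rule ennreal_leI)
        also have "\<dots> = ennreal (a * n1 w0) + ennreal (\<theta> / m) * J"
          unfolding j(1) using a \<theta> m j(2)
          by (subst ennreal_mult[symmetric]; (subst ennreal_plus[symmetric])?) auto
        finally show ?thesis unfolding KJ .
      qed
    qed
    have "y t \<le> (a * n1 w0) * gronwall_factor B (nat \<lceil>2 * B\<rceil>)"
      by (rule gronwall[OF Km KB B y0 ybdd _ step]) (use a t0 in auto)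
    then show ?thesis by (simp add: y_def w_def[abs_def] w0_def[abs_def] mult_ac)
  qed
  show ?thesis
    using main a gronwall_factor_nonneg[OF B]
    by (intro exI[of _ "a * gronwall_factor B (nat \<lceil>2 * B\<rceil>)"]) simp
qed

end

section \<open>Stability and uniqueness of strong solutions\<close>

lemma H1_le_H1Lap: "H1 D f \<le> H1Lap D f"
  by (auto simp: H1Lap_def)

theorem theorem5p6:
  fixes D :: "'a::euclidean_space set"
    and \<alpha> \<kappa>\<^sub>1 \<kappa>\<^sub>2 \<mu> \<gamma> \<epsilon> T :: real
  assumes "polytopal_domain D" and "admissible D \<alpha>"
    and "\<kappa>\<^sub>1 > 0" and "\<kappa>\<^sub>2 > 0" and "\<mu> > 0"
    and "0 < \<epsilon>" and "\<epsilon> < 1" and "T > 0"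
  shows "(\<forall>c::real. \<exists>C::real. \<forall>u0 v0 u v.
            H1Lap D u0 < \<infinity> \<and> H1Lap D v0 < \<infinity> \<and>
            strong_solution D \<alpha> \<kappa>\<^sub>1 \<kappa>\<^sub>2 \<mu> \<gamma> \<epsilon> T u0 u \<and> solution_bounds D \<alpha> \<epsilon> T c u \<and>
            strong_solution D \<alpha> \<kappa>\<^sub>1 \<kappa>\<^sub>2 \<mu> \<gamma> \<epsilon> T v0 v \<and> solution_bounds D \<alpha> \<epsilon> T c v \<longrightarrow>
            LinfT T (H1 D) (\<lambda>t x. u t x - v t x)
              \<le> ennreal C * H1Lap D (\<lambda>x. u0 x - v0 x))
       \<and> (\<forall>u0 u v. H1Lap D u0 < \<infinity> \<and>
            strong_solution D \<alpha> \<kappa>\<^sub>1 \<kappa>\<^sub>2 \<mu> \<gamma> \<epsilon> T u0 u \<and>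
            strong_solution D \<alpha> \<kappa>\<^sub>1 \<kappa>\<^sub>2 \<mu> \<gamma> \<epsilon> T u0 v \<longrightarrow>
            (\<forall>t\<in>{0<..<T}. AE x in lebesgue_on D. u t x = v t x))"
proof -
  interpret embedding_region D \<alpha>
    using polytopal_domain_cover[OF assms(1)] admissible_exponent[OF assms(1,2)]
    by unfold_locales auto
  have H1: "H1 D f < \<infinity>" if "H1Lap D f < \<infinity>" for f :: "'a \<Rightarrow> real^3"
    using H1_le_H1Lap that by (rule le_less_trans)
  have strong: "weak_solution D \<alpha> \<kappa>\<^sub>1 \<kappa>\<^sub>2 \<mu> \<gamma> \<epsilon> T u0 u" "LinfT T (H1 D) u < \<infinity>" "L2T T (H1plus D \<alpha>) u < \<infinity>"
    "\<And>t. t \<in> {0<..<T} \<Longrightarrow> H1 D (u t) < \<infinity>"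
    if "strong_solution D \<alpha> \<kappa>\<^sub>1 \<kappa>\<^sub>2 \<mu> \<gamma> \<epsilon> T u0 u" for u0 u
    using that unfolding strong_solution_def in_W1infT_def weak_solution_def by blast+
  have \<mu>0: "0 \<le> \<mu>" using assms(5) by simp
  show ?thesis
  proof (intro conjI allI impI ballI)
    fix c :: real
    \<comment> \<open>c may be negative, whereas \<open>energy_estimate\<close> asks for a
      non-negative bound.\<close>
    let ?c = "max c 0"
    obtain G where G: "G \<ge> 0" "\<And>u0 v0 u v. H1 D u0 < \<infinity> \<Longrightarrow> H1 D v0 < \<infinity> \<Longrightarrow>
      weak_solution D \<alpha> \<kappa>\<^sub>1 \<kappa>\<^sub>2 \<mu> \<gamma> \<epsilon> T u0 u \<Longrightarrow> weak_solution D \<alpha> \<kappa>\<^sub>1 \<kappa>\<^sub>2 \<mu> \<gamma> \<epsilon> T v0 v \<Longrightarrow>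
      LinfT T (H1 D) u < \<infinity> \<Longrightarrow> LinfT T (H1 D) v < \<infinity> \<Longrightarrow>
      L2T T (H1plus D \<alpha>) u \<le> ennreal ?c \<Longrightarrow> L2T T (H1plus D \<alpha>) v \<le> ennreal ?c \<Longrightarrow>
      \<forall>t\<in>{0<..<T}. n1 (\<lambda>x. u t x - v t x) \<le> G * n1 (\<lambda>x. u0 x - v0 x)"
      using energy_estimate[OF \<mu>0 assms(6,8), of ?c \<kappa>\<^sub>1 \<kappa>\<^sub>2 \<gamma>] by auto
    show "\<exists>C. \<forall>u0 v0 u v. H1Lap D u0 < \<infinity> \<and> H1Lap D v0 < \<infinity> \<and>
            strong_solution D \<alpha> \<kappa>\<^sub>1 \<kappa>\<^sub>2 \<mu> \<gamma> \<epsilon> T u0 u \<and> solution_bounds D \<alpha> \<epsilon> T c u \<and>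
            strong_solution D \<alpha> \<kappa>\<^sub>1 \<kappa>\<^sub>2 \<mu> \<gamma> \<epsilon> T v0 v \<and> solution_bounds D \<alpha> \<epsilon> T c v \<longrightarrow>
            LinfT T (H1 D) (\<lambda>t x. u t x - v t x) \<le> ennreal C * H1Lap D (\<lambda>x. u0 x - v0 x)"
    proof (intro exI[of _ G] allI impI, elim conjE)
      fix u0 v0 u v
      assume h: "H1Lap D u0 < \<infinity>" "H1Lap D v0 < \<infinity>"
        and u: "strong_solution D \<alpha> \<kappa>\<^sub>1 \<kappa>\<^sub>2 \<mu> \<gamma> \<epsilon> T u0 u" and bu: "solution_bounds D \<alpha> \<epsilon> T c u"
        and v: "strong_solution D \<alpha> \<kappa>\<^sub>1 \<kappa>\<^sub>2 \<mu> \<gamma> \<epsilon> T v0 v" and bv: "solution_bounds D \<alpha> \<epsilon> T c v"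
      have le: "L2T T (H1plus D \<alpha>) u \<le> ennreal ?c" "L2T T (H1plus D \<alpha>) v \<le> ennreal ?c"
        using bu bv order_trans[OF _ ennreal_leI[of c ?c]] by (auto simp: solution_bounds_def Let_def)
      note H = H1[OF h(1)] H1[OF h(2)]
      have y: "n1 (\<lambda>x. u t x - v t x) \<le> G * n1 (\<lambda>x. u0 x - v0 x)" if "t \<in> {0<..<T}" for t
        using G(2)[OF H strong(1)[OF u] strong(1)[OF v] strong(2)[OF u] strong(2)[OF v] le] that by blast
      note sm = strongly_measurable_diff[OF LinfT_bound(1)[OF strong(2)[OF u]] LinfT_bound(1)[OF strong(2)[OF v]]
          strong(4)[OF u] strong(4)[OF v]]
      have "LinfT T (H1 D) (\<lambda>t x. u t x - v t x) = esssup (time T) (\<lambda>t. H1 D (\<lambda>x. u t x - v t x))"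
        unfolding LinfT_def using sm(1) by simp
      also have "\<dots> \<le> ennreal G * H1 D (\<lambda>x. u0 x - v0 x)"
      proof (rule esssup_I[OF sm(2)])
        have "AE t in time T. t \<in> {0<..<T}" using AE_space[of "time T"] by simp
        then show "AE t in time T. H1 D (\<lambda>x. u t x - v t x) \<le> ennreal G * H1 D (\<lambda>x. u0 x - v0 x)"
        proof eventually_elim
          case (elim t)
          have "ennreal (n1 (\<lambda>x. u t x - v t x)) \<le> ennreal (G * n1 (\<lambda>x. u0 x - v0 x))"
            by (rule ennreal_leI[OF y[OF elim]])
          then show ?case
            unfolding H1_eq[OF H1_diff(1)[OF strong(4)[OF u elim] strong(4)[OF v elim]]] H1_eq[OF H1_diff(1)[OF H]]
            using G(1) by (simp add: ennreal_mult)
        qed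
      qed
      also have "\<dots> \<le> ennreal G * H1Lap D (\<lambda>x. u0 x - v0 x)"
        by (intro mult_left_mono H1_le_H1Lap) simp
      finally show "LinfT T (H1 D) (\<lambda>t x. u t x - v t x) \<le> ennreal G * H1Lap D (\<lambda>x. u0 x - v0 x)" .
    qed
  next
    fix u0 u v t
    assume "H1Lap D u0 < \<infinity> \<and> strong_solution D \<alpha> \<kappa>\<^sub>1 \<kappa>\<^sub>2 \<mu> \<gamma> \<epsilon> T u0 u \<and> strong_solution D \<alpha> \<kappa>\<^sub>1 \<kappa>\<^sub>2 \<mu> \<gamma> \<epsilon> T u0 v"
    then have h: "H1Lap D u0 < \<infinity>" and u: "strong_solution D \<alpha> \<kappa>\<^sub>1 \<kappa>\<^sub>2 \<mu> \<gamma> \<epsilon> T u0 u"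
      and v: "strong_solution D \<alpha> \<kappa>\<^sub>1 \<kappa>\<^sub>2 \<mu> \<gamma> \<epsilon> T u0 v" by auto
    assume t: "t \<in> {0<..<T}"
    \<comment> \<open>Uniqueness comes without a common a priori constant; the finite norms of the
      two solutions supply one.\<close>
    define c where "c = max (enn2real (L2T T (H1plus D \<alpha>) u)) (enn2real (L2T T (H1plus D \<alpha>) v))"
    have c: "0 \<le> c" by (simp add: c_def le_max_iff_disj)
    have "L2T T (H1plus D \<alpha>) u = ennreal (enn2real (L2T T (H1plus D \<alpha>) u))"
      "L2T T (H1plus D \<alpha>) v = ennreal (enn2real (L2T T (H1plus D \<alpha>) v))"
      using strong(3)[OF u] strong(3)[OF v] by (simp_all add: less_top)
    then have le: "L2T T (H1plus D \<alpha>) u \<le> ennreal c" "L2T T (H1plus D \<alpha>) v \<le> ennreal c"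
      by (metis c_def ennreal_leI max.cobounded1, metis c_def ennreal_leI max.cobounded2)
    let ?z = "\<lambda>x. u0 x - u0 x"
    note z = H1_diff(1)[OF H1[OF h] H1[OF h]]
    \<comment> \<open>The norm of the zero function is computed through inner products, since its
      weak derivatives are only selected by choice in \<open>wpd\<close>.\<close>
    have "(n1 ?z)\<^sup>2 = 0"
      unfolding n1_power2[OF z] inner_diff_H1[OF H1[OF h] H1[OF h] z] by simp
    then have "n1 ?z = 0" by simp
    then have "n1 (\<lambda>x. u t x - v t x) \<le> 0"
      using energy_estimate[OF \<mu>0 assms(6,8) c, of \<kappa>\<^sub>1 \<kappa>\<^sub>2 \<gamma>] H1[OF h] strong(1,2)[OF u] strong(1,2)[OF v] le t
      by fastforce
    then have n0: "n1 (\<lambda>x. u t x - v t x) = 0" by (simp add: order_antisym)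
    note w = H1_diff(1)[OF strong(4)[OF u t] strong(4)[OF v t]]
    note [measurable] = H1_meas(1)[OF w]
    \<comment> \<open>The L2 part of the vanishing H1 norm already forces equality almost
      everywhere.\<close>
    have "(\<integral>\<^sup>+x. ennreal ((norm (u t x - v t x))\<^sup>2) \<partial>lebesgue_on D) = 0"
      using L2_le_n1(1)[OF w] n0 by simp
    then have "AE x in lebesgue_on D. ennreal ((norm (u t x - v t x))\<^sup>2) = 0"
      by (subst (asm) nn_integral_0_iff_AE) measurable
    then show "AE x in lebesgue_on D. u t x = v t x"
      by eventually_elim simp
  qed
qed

end
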